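(* All linear algebraic groups below are connected and over $\mathbb{C}$. (1) One has the equalities of sets $$\{p(G) : G \text{ reductive}\} = \{p(G) : G \text{ nilpotent}\} = \{p(G) : G \text{ solvable}\} = \{p(G) : G \text{ a linear algebraic group}\} = \mathbb{Q} \cap (1/2, 1].$$ (2) Every real number $\alpha \in [1/2, 1]$ is a limit point of each of the four sets $\{p(G) : G \text{ reductive}\}$, $\{p(G) : G \text{ nilpotent}\}$, $\{p(G) : G \text{ solvable}\}$, $\{p(G) : G \text{ a linear algebraic group}\}$.
   Context: For a linear algebraic group $G$ over $\mathbb{C}$, let $C(G) := \{(a,b) \in G \times G : ab = ba\}$, a Zariski closed subset of $G \times G$. The commuting probability of $G$ is defined as $p(G) := \dfrac{\dim C(G)}{\dim (G\times G)} = \dfrac{\dim C(G)}{2\dim G}$ if $\dim G > 0$, and $p(G) := 1$ if $G$ is finite. *)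

theory Defs
  imports
    "HOL-Analysis.Abstract_Topology"
    "HOL-Analysis.Elementary_Topology"
    "HOL-Library.Extended_Nat"
    "HOL-Algebra.Solvable_Groups"
    "Jordan_Normal_Form.Matrix"
begin

section \<open>Zariski topologies and Krull dimension\<close>

text \<open>The polynomial functions on a space \<open>'a\<close> with respect to a set of coordinate functions: the
  \<open>\<complex>\<close>-algebra of functions generated by the coordinates.\<close>

inductive_set polyfuns :: "('a \<Rightarrow> complex) set \<Rightarrow> ('a \<Rightarrow> complex) set"
  for X :: "('a \<Rightarrow> complex) set" where
  polyfuns_const: "(\<lambda>_. c) \<in> polyfuns X"
| polyfuns_coord: "f \<in> X \<Longrightarrow> f \<in> polyfuns X"
| polyfuns_add: "f \<in> polyfuns X \<Longrightarrow> g \<in> polyfuns X \<Longrightarrow> (\<lambda>x. f x + g x) \<in> polyfuns X"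
| polyfuns_mult: "f \<in> polyfuns X \<Longrightarrow> g \<in> polyfuns X \<Longrightarrow> (\<lambda>x. f x * g x) \<in> polyfuns X"

definition zariski :: "('a \<Rightarrow> complex) set \<Rightarrow> 'a set \<Rightarrow> 'a topology" where
  "zariski X V = topology (\<lambda>U. \<exists>F \<subseteq> polyfuns X. U = {x \<in> V. \<exists>f\<in>F. f x \<noteq> 0})"

lemma istopology_zariski:
  "istopology (\<lambda>U. \<exists>F \<subseteq> polyfuns X. U = {x \<in> V. \<exists>f\<in>F. f x \<noteq> 0})"
  unfolding istopology_def
proof (intro conjI allI impI)
  fix S T
  assume "\<exists>F \<subseteq> polyfuns X. S = {x \<in> V. \<exists>f\<in>F. f x \<noteq> 0}"
    and "\<exists>F \<subseteq> polyfuns X. T = {x \<in> V. \<exists>f\<in>F. f x \<noteq> 0}"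
  then obtain F G where F: "F \<subseteq> polyfuns X" "S = {x \<in> V. \<exists>f\<in>F. f x \<noteq> 0}"
    and G: "G \<subseteq> polyfuns X" "T = {x \<in> V. \<exists>f\<in>G. f x \<noteq> 0}" by auto
  let ?H = "(\<lambda>(f, g) x. f x * g x) ` (F \<times> G)"
  have "?H \<subseteq> polyfuns X"
  proof
    fix h assume "h \<in> ?H"
    then obtain f g where "f \<in> F" "g \<in> G" "h = (\<lambda>x. f x * g x)" by auto
    then show "h \<in> polyfuns X" using polyfuns_mult F(1) G(1) by blast
  qed
  moreover have "S \<inter> T = {x \<in> V. \<exists>h\<in>?H. h x \<noteq> 0}" unfolding F(2) G(2) by auto
  ultimately show "\<exists>H \<subseteq> polyfuns X. S \<inter> T = {x \<in> V. \<exists>h\<in>H. h x \<noteq> 0}" by blast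
next
  fix \<K>
  assume "\<forall>K\<in>\<K>. \<exists>F \<subseteq> polyfuns X. K = {x \<in> V. \<exists>f\<in>F. f x \<noteq> 0}"
  then have "\<exists>F. \<forall>K\<in>\<K>. F K \<subseteq> polyfuns X \<and> K = {x \<in> V. \<exists>f\<in>F K. f x \<noteq> 0}"
    by (rule bchoice)
  then obtain F where F: "\<forall>K\<in>\<K>. F K \<subseteq> polyfuns X \<and> K = {x \<in> V. \<exists>f\<in>F K. f x \<noteq> 0}" ..
  have sub: "F K \<subseteq> polyfuns X" if "K \<in> \<K>" for K
    using bspec[OF F that] by (rule conjunct1)
  have mem: "x \<in> K \<longleftrightarrow> x \<in> V \<and> (\<exists>f\<in>F K. f x \<noteq> 0)" if "K \<in> \<K>" for K x
    using eqset_imp_iff[OF conjunct2[OF bspec[OF F that]], of x] by (simp only: mem_Collect_eq)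
  have "\<Union>(F ` \<K>) \<subseteq> polyfuns X"
    using sub by (rule UN_least)
  moreover have "\<Union>\<K> = {x \<in> V. \<exists>f\<in>\<Union>(F ` \<K>). f x \<noteq> 0}"
  proof (rule Set.set_eqI)
    fix x
    have "x \<in> \<Union>\<K> \<longleftrightarrow> (\<exists>K\<in>\<K>. x \<in> V \<and> (\<exists>f\<in>F K. f x \<noteq> 0))"
      unfolding Union_iff by (intro bex_cong refl mem)
    also have "\<dots> \<longleftrightarrow> x \<in> {x \<in> V. \<exists>f\<in>\<Union>(F ` \<K>). f x \<noteq> 0}"
      unfolding mem_Collect_eq by fast
    finally show "x \<in> \<Union>\<K> \<longleftrightarrow> x \<in> {x \<in> V. \<exists>f\<in>\<Union>(F ` \<K>). f x \<noteq> 0}" .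
  qed
  ultimately show "\<exists>H \<subseteq> polyfuns X. \<Union>\<K> = {x \<in> V. \<exists>f\<in>H. f x \<noteq> 0}"
    by (intro exI[of _ "\<Union>(F ` \<K>)"] conjI)
qed

lemma openin_zariski:
  "openin (zariski X V) U \<longleftrightarrow> (\<exists>F \<subseteq> polyfuns X. U = {x \<in> V. \<exists>f\<in>F. f x \<noteq> 0})"
  unfolding zariski_def by (simp add: topology_inverse'[OF istopology_zariski])

lemma topspace_zariski [simp]: "topspace (zariski X V) = V"
proof -
  have "openin (zariski X V) V"
    unfolding openin_zariski by (rule exI[of _ "{\<lambda>_. 1}"]) (auto intro: polyfuns_const)
  moreover have "U \<subseteq> V" if "openin (zariski X V) U" for U
    using that unfolding openin_zariski by auto
  ultimately show ?thesis by (meson openin_subset openin_topspace subset_antisym)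
qed

lemma closedin_zariski:
  "closedin (zariski X V) S \<longleftrightarrow> (\<exists>F \<subseteq> polyfuns X. S = {x \<in> V. \<forall>f\<in>F. f x = 0})"
proof -
  have key: "S \<subseteq> V \<and> V - S = {x \<in> V. \<exists>f\<in>F. f x \<noteq> 0} \<longleftrightarrow> S = {x \<in> V. \<forall>f\<in>F. f x = 0}" for F
    by (simp only: set_eq_iff subset_iff) auto
  have "closedin (zariski X V) S \<longleftrightarrow>
      (\<exists>F \<subseteq> polyfuns X. S \<subseteq> V \<and> V - S = {x \<in> V. \<exists>f\<in>F. f x \<noteq> 0})"
    unfolding closedin_def openin_zariski topspace_zariski by blast
  then show ?thesis by (simp only: key)
qed

definition irreducible_space :: "'a topology \<Rightarrow> bool" where
  "irreducible_space T \<longleftrightarrow> topspace T \<noteq> {} \<and>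
    (\<forall>A B. closedin T A \<longrightarrow> closedin T B \<longrightarrow> topspace T = A \<union> B \<longrightarrow>
       A = topspace T \<or> B = topspace T)"

text \<open>The supremum of the lengths \<open>d\<close> of strict chains \<open>Z 0 \<subset> \<dots> \<subset> Z d\<close> of irreducible closed
  subsets. The empty space gets dimension 0.\<close>

definition krull_dim :: "'a topology \<Rightarrow> enat" where
  "krull_dim T = Sup {enat d | d. \<exists>Z :: nat \<Rightarrow> 'a set.
     (\<forall>i\<le>d. closedin T (Z i) \<and> irreducible_space (subtopology T (Z i))) \<and>
     (\<forall>i<d. Z i \<subset> Z (Suc i))}"

section \<open>Linear algebraic groups over the complex numbers\<close>

definition mat_coords :: "nat \<Rightarrow> (complex mat \<Rightarrow> complex) set" where
  "mat_coords n = {(\<lambda>A. A $$ (i, j)) | i j. i < n \<and> j < n}"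

definition zariski_mat :: "nat \<Rightarrow> complex mat topology" where
  "zariski_mat n = zariski (mat_coords n) (carrier_mat n n)"

text \<open>The Zariski topology on the affine space \<open>M\<^sub>n(\<complex>) \<times> M\<^sub>n(\<complex>)\<close> is given by polynomials in all
  \<open>2n\<^sup>2\<close> entries; it is not the product of the two Zariski topologies.\<close>

definition zariski_mat2 :: "nat \<Rightarrow> (complex mat \<times> complex mat) topology" where
  "zariski_mat2 n = zariski ((\<lambda>f. f \<circ> fst) ` mat_coords n \<union> (\<lambda>f. f \<circ> snd) ` mat_coords n)
     (carrier_mat n n \<times> carrier_mat n n)"

definition GL :: "nat \<Rightarrow> complex mat monoid" where
  "GL n = units_of (ring_mat TYPE(complex) n ())"

text \<open>Closedness is relative to \<open>GL n\<close>. The inverse determinant gives no further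
  closed sets, so polynomials in the matrix entries suffice.\<close>

definition linear_algebraic_group :: "nat \<Rightarrow> complex mat set \<Rightarrow> bool" where
  "linear_algebraic_group n G \<longleftrightarrow> subgroup G (GL n) \<and>
     closedin (subtopology (zariski_mat n) (carrier (GL n))) G"

abbreviation zariski_connected :: "nat \<Rightarrow> complex mat set \<Rightarrow> bool" where
  "zariski_connected n G \<equiv> connectedin (zariski_mat n) G"

abbreviation as_group :: "nat \<Rightarrow> complex mat set \<Rightarrow> complex mat monoid" where
  "as_group n G \<equiv> (GL n)\<lparr>carrier := G\<rparr>"

definition unipotent_mat :: "nat \<Rightarrow> complex mat \<Rightarrow> bool" where
  "unipotent_mat n A \<longleftrightarrow> (\<exists>k. (A - 1\<^sub>m n) ^\<^sub>m k = 0\<^sub>m n n)"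

text \<open>Trivial unipotent radical, the latter being the largest connected normal unipotent closed
  subgroup.\<close>

definition reductive :: "nat \<Rightarrow> complex mat set \<Rightarrow> bool" where
  "reductive n G \<longleftrightarrow>
     (\<forall>N. linear_algebraic_group n N \<and> zariski_connected n N \<and> N \<lhd> as_group n G \<and>
          (\<forall>A\<in>N. unipotent_mat n A) \<longrightarrow> N = {1\<^sub>m n})"

fun lower_central_series :: "('a, 'b) monoid_scheme \<Rightarrow> nat \<Rightarrow> 'a set" where
  "lower_central_series G 0 = carrier G"
| "lower_central_series G (Suc i) = generate G
     (\<Union>x\<in>carrier G. \<Union>y\<in>lower_central_series G i. {x \<otimes>\<^bsub>G\<^esub> y \<otimes>\<^bsub>G\<^esub> inv\<^bsub>G\<^esub> x \<otimes>\<^bsub>G\<^esub> inv\<^bsub>G\<^esub> y})"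

definition nilpotent_group :: "('a, 'b) monoid_scheme \<Rightarrow> bool" where
  "nilpotent_group G \<longleftrightarrow> (\<exists>c. lower_central_series G c = {\<one>\<^bsub>G\<^esub>})"

section \<open>The commuting probability\<close>

definition commuting_variety :: "complex mat set \<Rightarrow> (complex mat \<times> complex mat) set" where
  "commuting_variety G = {(a, b) \<in> G \<times> G. a * b = b * a}"

text \<open>Both dimensions are at most \<open>2n\<^sup>2\<close>, hence finite, so \<open>the_enat\<close> loses nothing.\<close>

definition commuting_prob :: "nat \<Rightarrow> complex mat set \<Rightarrow> real" where
  "commuting_prob n G = (if finite G then 1 else
     real (the_enat (krull_dim (subtopology (zariski_mat2 n) (commuting_variety G)))) /
     real (the_enat (krull_dim (subtopology (zariski_mat2 n) (G \<times> G)))))"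

definition commuting_probs :: "(nat \<Rightarrow> complex mat set \<Rightarrow> bool) \<Rightarrow> real set" where
  "commuting_probs P = {commuting_prob n G | n G.
     linear_algebraic_group n G \<and> zariski_connected n G \<and> P n G}"

end

theory Submission
  imports
    Defs
    "HOL-Computational_Algebra.Fundamental_Theorem_Algebra"
    "HOL-Computational_Algebra.Formal_Power_Series"
    "Jordan_Normal_Form.Jordan_Normal_Form_Existence"
begin

text \<open>Dimensions are squeezed between algebraically independent functions, which yield chains of
  irreducible closed sets, and the growth of the Hilbert function on a dense subset, which bounds
  such chains.

  Lower bound: for an irreducible closed set \<open>Z\<close> of dimension \<open>dim G\<close> through \<open>1\<close>, the sets
  \<open>{(a, a\<^sup>k) | a \<in> Z}\<close> are infinitely many irreducible subsets of \<open>C(G)\<close> of that dimension. Two of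
  them lie in the same irreducible component of \<open>C(G)\<close>, so \<open>dim C(G) > dim G\<close>.

  Nilpotent groups: the substitutions \<open>x + a\<^sub>k\<^sub>+\<^sub>1 x\<^sup>k\<^sup>+\<^sup>1 + \<dots>\<close> modulo \<open>x\<^sup>m\<^sup>+\<^sup>2\<close> form a unipotent group of
  dimension \<open>m - k + 1\<close> whose commuting variety has dimension \<open>m + 2\<close> for \<open>2k \<le> m\<close>: an element of
  depth \<open>k\<close> commutes only with its complex powers, up to terms of high order.

  Reductive groups: \<open>GL n \<times> (\<complex>\<^sup>\<times>)\<^sup>b\<close> has dimension \<open>n\<^sup>2 + b\<close>, and by Motzkin--Taussky its commuting
  variety has dimension \<open>n\<^sup>2 + n + 2b\<close>. Both families realise all rationals in \<open>(1/2, 1]\<close>.\<close>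

section \<open>Polynomial functions and irreducible sets\<close>

text \<open>Most varieties here are known only through a parametrisation whose image is at best
  dense, so fibre dimensions have to be avoided. The growth bound suits this: a span of size
  O((s+1)^D) for the functions of degree at most \<open>s\<close> passes to polynomial images,
  products, finite unions and closures. Conversely, independent functions become a chain by
  repeatedly cutting with a fibre; for this a dominant map must hit a nonempty open set of values,
  and characters supply the points.

  The number \<open>m + 2\<close> arises on every stratum: a first entry of depth \<open>i\<close>
  has \<open>m + 1 - i\<close> coefficients, its complex powers add one parameter, and the remaining
  factor, of depth \<open>m + 1 - i\<close>, has \<open>i\<close> coefficients. So no stratum is too
  large, and \<open>2 * k \<le> m\<close> lets depth \<open>k\<close> attain the number inside the
  group. For \<open>GL n\<close>, a generic matrix is cyclic, so its commutant consists of the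
  polynomials in it and has dimension \<open>n\<close>.

  With \<open>2 * r - 1 = s / t\<close>, both families reduce to an integer equation for the excess
  of dim C(G) over dim G, divided by dim G.\<close>

definition pf :: "('a \<Rightarrow> complex) set \<Rightarrow> 'a set \<Rightarrow> ('a \<Rightarrow> complex) \<Rightarrow> bool" where
  "pf X S g \<longleftrightarrow> (\<exists>h\<in>polyfuns X. \<forall>x\<in>S. g x = h x)"

lemma pf_polyfuns: "g \<in> polyfuns X \<Longrightarrow> pf X S g"
  by (auto simp: pf_def)

lemma pf_UNIV: "pf X UNIV g \<longleftrightarrow> g \<in> polyfuns X"
proof
  assume "pf X UNIV g"
  then obtain h where "h \<in> polyfuns X" "\<forall>x. g x = h x" by (auto simp: pf_def)
  moreover from this have "g = h" by auto
  ultimately show "g \<in> polyfuns X" by simp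
qed (auto simp: pf_def)

lemma pf_const: "pf X S (\<lambda>_. c)"
  by (auto intro: pf_polyfuns polyfuns_const)

lemma pf_coord: "f \<in> X \<Longrightarrow> pf X S f"
  by (auto intro: pf_polyfuns polyfuns_coord)

lemma pf_add: "pf X S f \<Longrightarrow> pf X S g \<Longrightarrow> pf X S (\<lambda>x. f x + g x)"
  unfolding pf_def by (metis (no_types, lifting) polyfuns_add)

lemma pf_mult: "pf X S f \<Longrightarrow> pf X S g \<Longrightarrow> pf X S (\<lambda>x. f x * g x)"
  unfolding pf_def by (metis (no_types, lifting) polyfuns_mult)

lemma pf_uminus: "pf X S f \<Longrightarrow> pf X S (\<lambda>x. - f x)"
  using pf_mult[OF pf_const[of X S "-1"], of f] by simp

lemma pf_diff: "pf X S f \<Longrightarrow> pf X S g \<Longrightarrow> pf X S (\<lambda>x. f x - g x)"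
  using pf_add[of X S f "\<lambda>x. - g x"] pf_uminus[of X S g] by simp

lemma pf_sum: "(\<And>i. i \<in> I \<Longrightarrow> pf X S (f i)) \<Longrightarrow> pf X S (\<lambda>x. \<Sum>i\<in>I. f i x)"
  by (induction I rule: infinite_finite_induct) (auto intro: pf_const pf_add)

lemma pf_prod: "(\<And>i. i \<in> I \<Longrightarrow> pf X S (f i)) \<Longrightarrow> pf X S (\<lambda>x. \<Prod>i\<in>I. f i x)"
  by (induction I rule: infinite_finite_induct) (auto intro: pf_const pf_mult)

lemma pf_power: "pf X S f \<Longrightarrow> pf X S (\<lambda>x. f x ^ k)"
  by (induction k) (auto intro: pf_const pf_mult)

lemma pf_cong: "pf X S f \<Longrightarrow> (\<And>x. x \<in> S \<Longrightarrow> f x = g x) \<Longrightarrow> pf X S g"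
  by (auto simp: pf_def)

lemma pf_subset: "pf X S f \<Longrightarrow> T \<subseteq> S \<Longrightarrow> pf X T f"
  by (auto simp: pf_def)

lemma pf_divide_const: "pf X S f \<Longrightarrow> pf X S (\<lambda>x. f x / c)"
  using pf_mult[OF pf_const[of X S "1/c"], of f] by simp

lemmas pf_intros = pf_const pf_add pf_mult pf_uminus pf_diff pf_sum pf_prod pf_power

lemma pf_comp:
  assumes g: "pf X S g" and \<phi>: "\<phi> ` T \<subseteq> S"
    and co: "\<And>f. f \<in> X \<Longrightarrow> pf Y T (\<lambda>t. f (\<phi> t))"
  shows "pf Y T (\<lambda>t. g (\<phi> t))"
proof -
  obtain h where h: "h \<in> polyfuns X" "\<forall>x\<in>S. g x = h x" using g by (auto simp: pf_def)
  from h(1) have "pf Y T (\<lambda>t. h (\<phi> t))"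
    by induction (auto intro: pf_intros co)
  then show ?thesis by (rule pf_cong) (use h(2) \<phi> in auto)
qed

text \<open>Closedness in \<open>S\<close> is expressed by equations, so that no ambient space
  occurs; \<open>closedin_zariski_sub\<close> identifies it with closedness in the subspace
  topology.\<close>

definition zclosed :: "('a \<Rightarrow> complex) set \<Rightarrow> 'a set \<Rightarrow> 'a set \<Rightarrow> bool" where
  "zclosed X S Z \<longleftrightarrow> (\<exists>F\<subseteq>polyfuns X. Z = {x\<in>S. \<forall>f\<in>F. f x = 0})"

text \<open>Primality of the vanishing ideal of \<open>Z\<close>. By
  \<open>irreducible_zariski_sub\<close> this is irreducibility, and it refers to \<open>Z\<close>
  alone.\<close>

definition zprime :: "('a \<Rightarrow> complex) set \<Rightarrow> 'a set \<Rightarrow> bool" where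
  "zprime X Z \<longleftrightarrow> Z \<noteq> {} \<and> (\<forall>g\<in>polyfuns X. \<forall>h\<in>polyfuns X.
     (\<forall>x\<in>Z. g x * h x = 0) \<longrightarrow> (\<forall>x\<in>Z. g x = 0) \<or> (\<forall>x\<in>Z. h x = 0))"

lemma zprimeD:
  assumes "zprime X Z" "pf X Z g" "pf X Z h" "\<And>x. x \<in> Z \<Longrightarrow> g x = 0 \<or> h x = 0"
  shows "(\<forall>x\<in>Z. g x = 0) \<or> (\<forall>x\<in>Z. h x = 0)"
proof -
  obtain g' h' where gh: "g' \<in> polyfuns X" "\<forall>x\<in>Z. g x = g' x" "h' \<in> polyfuns X" "\<forall>x\<in>Z. h x = h' x"
    using assms(2,3) by (auto simp: pf_def)
  then have "\<forall>x\<in>Z. g' x * h' x = 0" using assms(4) by auto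
  then have "(\<forall>x\<in>Z. g' x = 0) \<or> (\<forall>x\<in>Z. h' x = 0)"
    using assms(1) gh(1,3) unfolding zprime_def by blast
  then show ?thesis using gh(2,4) by auto
qed

lemma zclosed_subset: "zclosed X S Z \<Longrightarrow> Z \<subseteq> S"
  by (auto simp: zclosed_def)

lemma zclosed_self: "zclosed X S S"
  unfolding zclosed_def by (rule exI[of _ "{}"]) auto

lemma zclosed_pf:
  assumes "\<And>f. f \<in> F \<Longrightarrow> pf X S f"
  shows "zclosed X S {x\<in>S. \<forall>f\<in>F. f x = 0}"
proof -
  have "\<forall>f\<in>F. \<exists>h\<in>polyfuns X. \<forall>x\<in>S. f x = h x" using assms by (auto simp: pf_def)
  then obtain h where h: "\<forall>f\<in>F. h f \<in> polyfuns X \<and> (\<forall>x\<in>S. f x = h f x)" by metis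
  show ?thesis unfolding zclosed_def
    by (rule exI[of _ "h ` F"]) (use h in auto)
qed

lemma zclosed_pf1: "pf X S f \<Longrightarrow> zclosed X S {x\<in>S. f x = 0}"
  using zclosed_pf[of "{f}" X S] by simp

lemma zclosed_Inter2:
  assumes "zclosed X S A" "zclosed X S B" shows "zclosed X S (A \<inter> B)"
proof -
  obtain F G where "F \<subseteq> polyfuns X" "A = {x\<in>S. \<forall>f\<in>F. f x = 0}" "G \<subseteq> polyfuns X" "B = {x\<in>S. \<forall>f\<in>G. f x = 0}"
    using assms by (auto simp: zclosed_def)
  then show ?thesis unfolding zclosed_def by (intro exI[of _ "F \<union> G"]) auto
qed

lemma zclosed_trans:
  assumes "zclosed X S A" "zclosed X A B" shows "zclosed X S B"
proof -
  obtain F G where "F \<subseteq> polyfuns X" "A = {x\<in>S. \<forall>f\<in>F. f x = 0}" "G \<subseteq> polyfuns X" "B = {x\<in>A. \<forall>f\<in>G. f x = 0}"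
    using assms by (auto simp: zclosed_def)
  then show ?thesis unfolding zclosed_def by (intro exI[of _ "F \<union> G"]) auto
qed

lemma zclosed_mono:
  assumes "zclosed X S A" "A \<subseteq> T" "T \<subseteq> S" shows "zclosed X T A"
proof -
  obtain F where "F \<subseteq> polyfuns X" "A = {x\<in>S. \<forall>f\<in>F. f x = 0}"
    using assms by (auto simp: zclosed_def)
  then show ?thesis unfolding zclosed_def using assms by (intro exI[of _ "F"]) auto
qed

lemma closedin_zariski_sub:
  assumes "S \<subseteq> V"
  shows "closedin (subtopology (zariski X V) S) Z \<longleftrightarrow> zclosed X S Z"
proof
  assume "closedin (subtopology (zariski X V) S) Z"
  then obtain T where T: "closedin (zariski X V) T" "Z = T \<inter> S" by (auto simp: closedin_subtopology)
  then obtain F where "F \<subseteq> polyfuns X" "T = {x \<in> V. \<forall>f\<in>F. f x = 0}" by (auto simp: closedin_zariski)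
  then show "zclosed X S Z" unfolding zclosed_def using T assms by (intro exI[of _ F]) auto
next
  assume "zclosed X S Z"
  then obtain F where "F \<subseteq> polyfuns X" "Z = {x \<in> S. \<forall>f\<in>F. f x = 0}" by (auto simp: zclosed_def)
  then show "closedin (subtopology (zariski X V) S) Z"
    unfolding closedin_subtopology closedin_zariski
    by (intro exI[of _ "{x \<in> V. \<forall>f\<in>F. f x = 0}"]) (use assms in auto)
qed

lemma irreducible_zariski_sub:
  assumes "Z \<subseteq> V"
  shows "irreducible_space (subtopology (zariski X V) Z) \<longleftrightarrow> zprime X Z"
proof -
  have ts: "topspace (subtopology (zariski X V) Z) = Z" using assms by auto
  show ?thesis
  proof
    assume L: "irreducible_space (subtopology (zariski X V) Z)"
    then have ne: "Z \<noteq> {}" unfolding irreducible_space_def ts by simp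
    have "(\<forall>x\<in>Z. g x = 0) \<or> (\<forall>x\<in>Z. h x = 0)"
      if gh: "g \<in> polyfuns X" "h \<in> polyfuns X" "\<forall>x\<in>Z. g x * h x = 0" for g h
    proof -
      have "zclosed X Z {x\<in>Z. g x = 0}" "zclosed X Z {x\<in>Z. h x = 0}"
        using gh by (auto intro: zclosed_pf1 pf_polyfuns)
      moreover have "Z = {x\<in>Z. g x = 0} \<union> {x\<in>Z. h x = 0}" using gh(3) by auto
      ultimately have "{x\<in>Z. g x = 0} = Z \<or> {x\<in>Z. h x = 0} = Z"
        using L unfolding irreducible_space_def ts closedin_zariski_sub[OF assms] by blast
      then show ?thesis by auto
    qed
    then show "zprime X Z" using ne by (auto simp: zprime_def)
  next
    assume P: "zprime X Z"
    show "irreducible_space (subtopology (zariski X V) Z)"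
      unfolding irreducible_space_def ts closedin_zariski_sub[OF assms]
    proof (intro conjI allI impI)
      show "Z \<noteq> {}" using P by (auto simp: zprime_def)
      fix A B assume A: "zclosed X Z A" and B: "zclosed X Z B" and AB: "Z = A \<union> B"
      obtain F where F: "F \<subseteq> polyfuns X" "A = {x\<in>Z. \<forall>f\<in>F. f x = 0}" using A by (auto simp: zclosed_def)
      obtain G where G: "G \<subseteq> polyfuns X" "B = {x\<in>Z. \<forall>f\<in>G. f x = 0}" using B by (auto simp: zclosed_def)
      show "A = Z \<or> B = Z"
      proof (rule ccontr)
        assume "\<not> (A = Z \<or> B = Z)"
        then obtain f g where fg: "f \<in> F" "\<not> (\<forall>x\<in>Z. f x = 0)" "g \<in> G" "\<not> (\<forall>x\<in>Z. g x = 0)"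
          using F G by auto
        have "\<forall>x\<in>Z. f x * g x = 0" using AB F G fg by auto
        then show False using P fg F(1) G(1) unfolding zprime_def by blast
      qed
    qed
  qed
qed

definition zchain :: "('a \<Rightarrow> complex) set \<Rightarrow> 'a set \<Rightarrow> nat \<Rightarrow> (nat \<Rightarrow> 'a set) \<Rightarrow> bool" where
  "zchain X S d Z \<longleftrightarrow> (\<forall>i\<le>d. zclosed X S (Z i) \<and> zprime X (Z i)) \<and> (\<forall>i<d. Z i \<subset> Z (Suc i))"

lemma krull_dim_zariski:
  assumes "S \<subseteq> V"
  shows "krull_dim (subtopology (zariski X V) S) = Sup {enat d | d. \<exists>Z. zchain X S d Z}"
proof -
  have "subtopology (subtopology (zariski X V) S) Z = subtopology (zariski X V) Z" if "Z \<subseteq> S" for Z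
    using that by (simp add: subtopology_subtopology Int_absorb1)
  then have *: "zclosed X S Z \<and> irreducible_space (subtopology (subtopology (zariski X V) S) Z)
       \<longleftrightarrow> zclosed X S Z \<and> zprime X Z" for Z
    using zclosed_subset[of X S Z] irreducible_zariski_sub[of Z V X] assms by auto
  show ?thesis unfolding krull_dim_def closedin_zariski_sub[OF assms] * zchain_def ..
qed

lemma krull_dim_eqI:
  assumes "S \<subseteq> V" "zchain X S d Z" "\<And>e Z. zchain X S e Z \<Longrightarrow> e \<le> d"
  shows "krull_dim (subtopology (zariski X V) S) = enat d"
  unfolding krull_dim_zariski[OF assms(1)]
proof (rule antisym)
  show "Sup {enat d | d. \<exists>Z. zchain X S d Z} \<le> enat d"
    by (rule Sup_least) (use assms(3) in auto)
  show "enat d \<le> Sup {enat d | d. \<exists>Z. zchain X S d Z}"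
    by (rule Sup_upper) (use assms(2) in auto)
qed

lemma zprime_image:
  assumes "zprime Y T" and co: "\<And>f. f \<in> X \<Longrightarrow> pf Y T (\<lambda>t. f (\<phi> t))"
  shows "zprime X (\<phi> ` T)"
  unfolding zprime_def
proof (intro conjI ballI impI)
  show "\<phi> ` T \<noteq> {}" using assms(1) by (auto simp: zprime_def)
  fix g h assume gh: "g \<in> polyfuns X" "h \<in> polyfuns X" "\<forall>x\<in>\<phi> ` T. g x * h x = 0"
  have "pf Y T (\<lambda>t. g (\<phi> t))" "pf Y T (\<lambda>t. h (\<phi> t))"
    by (rule pf_comp[of X UNIV]; use gh co in \<open>auto simp: pf_UNIV\<close>)+
  from zprimeD[OF assms(1) this]
  show "(\<forall>x\<in>\<phi> ` T. g x = 0) \<or> (\<forall>x\<in>\<phi> ` T. h x = 0)" using gh(3) by auto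
qed

text \<open>A nonempty principal open subset is dense: if \<open>g\<close> vanishes wherever
  \<open>u\<close> does not, then \<open>u * g\<close> vanishes on \<open>Z\<close> and primality
  removes \<open>u\<close>. Irreducibility of the open subset follows from this density.\<close>

lemma zprime_open:
  assumes "zprime X Z" "pf X Z u" "x0 \<in> Z" "u x0 \<noteq> 0"
  shows "zprime X {x\<in>Z. u x \<noteq> 0}"
    and "pf X Z g \<Longrightarrow> (\<And>x. x \<in> Z \<Longrightarrow> u x \<noteq> 0 \<Longrightarrow> g x = 0) \<Longrightarrow> \<forall>x\<in>Z. g x = 0"
proof -
  show 1: "\<forall>x\<in>Z. g x = 0" if "pf X Z g" "\<And>x. x \<in> Z \<Longrightarrow> u x \<noteq> 0 \<Longrightarrow> g x = 0" for g
    using zprimeD[OF assms(1,2), of g] that assms(3,4) by blast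
  show "zprime X {x\<in>Z. u x \<noteq> 0}"
    unfolding zprime_def
  proof (intro conjI ballI impI)
    show "{x\<in>Z. u x \<noteq> 0} \<noteq> {}" using assms by auto
    fix g h assume gh: "g \<in> polyfuns X" "h \<in> polyfuns X" "\<forall>x\<in>{x\<in>Z. u x \<noteq> 0}. g x * h x = 0"
    have "\<forall>x\<in>Z. g x * h x = 0"
      by (rule 1) (use gh in \<open>auto intro: pf_mult pf_polyfuns\<close>)
    then show "(\<forall>x\<in>{x\<in>Z. u x \<noteq> 0}. g x = 0) \<or> (\<forall>x\<in>{x\<in>Z. u x \<noteq> 0}. h x = 0)"
      using assms(1) gh(1,2) unfolding zprime_def by blast
  qed
qed

lemma connectedin_zprime:
  assumes "zprime X Z" "Z \<subseteq> V"
  shows "connectedin (zariski X V) Z"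
proof -
  have ts: "topspace (subtopology (zariski X V) Z) = Z" using assms by auto
  have "irreducible_space (subtopology (zariski X V) Z)"
    using irreducible_zariski_sub[OF assms(2)] assms(1) by blast
  then have "connected_space (subtopology (zariski X V) Z)"
    unfolding connected_space_closedin_eq irreducible_space_def ts by blast
  then show ?thesis using assms(2) by (simp add: connectedin_def)
qed

text \<open>Affine \<open>d\<close>-space is modelled on all sequences; only the first
  \<open>d\<close> entries are coordinates, and polynomials ignore the others, see
  \<open>cds_cong\<close>. Adding or specialising variables then needs no change of type.\<close>

definition cds :: "nat \<Rightarrow> ((nat \<Rightarrow> complex) \<Rightarrow> complex) set" where
  "cds d = (\<lambda>i p. p i) ` {..<d}"

lemma cds_Suc: "cds (Suc d) = insert (\<lambda>p. p d) (cds d)"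
  by (auto simp: cds_def lessThan_Suc)

lemma cds_coord: "i < d \<Longrightarrow> (\<lambda>p. p i) \<in> cds d"
  by (auto simp: cds_def)

lemma polyfuns_mono: "X \<subseteq> Y \<Longrightarrow> polyfuns X \<subseteq> polyfuns Y"
proof
  fix f assume "X \<subseteq> Y" "f \<in> polyfuns X"
  from this(2,1) show "f \<in> polyfuns Y"
    by induction (auto intro: polyfuns.intros)
qed

lemma polyfuns_sum: "(\<And>i. i \<in> I \<Longrightarrow> f i \<in> polyfuns X) \<Longrightarrow> (\<lambda>x. \<Sum>i\<in>I. f i x) \<in> polyfuns X"
  using pf_sum[of I X UNIV f] by (auto simp: pf_UNIV)

lemma polyfuns_prod: "(\<And>i. i \<in> I \<Longrightarrow> f i \<in> polyfuns X) \<Longrightarrow> (\<lambda>x. \<Prod>i\<in>I. f i x) \<in> polyfuns X"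
  using pf_prod[of I X UNIV f] by (auto simp: pf_UNIV)

lemma polyfuns_power: "f \<in> polyfuns X \<Longrightarrow> (\<lambda>x. f x ^ k) \<in> polyfuns X"
  using pf_power[of X UNIV f] by (auto simp: pf_UNIV)

lemma polyfuns_diff: "f \<in> polyfuns X \<Longrightarrow> g \<in> polyfuns X \<Longrightarrow> (\<lambda>x. f x - g x) \<in> polyfuns X"
  using pf_diff[of X UNIV f g] by (auto simp: pf_UNIV)

lemma polyfuns_uminus: "f \<in> polyfuns X \<Longrightarrow> (\<lambda>x. - f x) \<in> polyfuns X"
  using pf_uminus[of X UNIV f] by (auto simp: pf_UNIV)

lemma polyfuns_comp:
  assumes "g \<in> polyfuns X" "\<And>f. f \<in> X \<Longrightarrow> (\<lambda>t. f (\<phi> t)) \<in> polyfuns Y"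
  shows "(\<lambda>t. g (\<phi> t)) \<in> polyfuns Y"
  using pf_comp[of X UNIV g \<phi> UNIV Y] assms by (auto simp: pf_UNIV)

lemma polyfuns_cds_comp:
  assumes "P \<in> polyfuns (cds d)" "\<And>i. i < d \<Longrightarrow> f i \<in> polyfuns X"
  shows "(\<lambda>x. P (\<lambda>i. f i x)) \<in> polyfuns X"
  by (rule polyfuns_comp[OF assms(1)]) (auto simp: cds_def intro: assms(2))

lemma pf_cds_comp:
  assumes "P \<in> polyfuns (cds d)" "\<And>i. i < d \<Longrightarrow> pf X S (f i)"
  shows "pf X S (\<lambda>x. P (\<lambda>i. f i x))"
  by (rule pf_comp[of "cds d" UNIV]) (use assms in \<open>auto simp: cds_def pf_UNIV\<close>)

lemma cds_cong: "P \<in> polyfuns (cds d) \<Longrightarrow> (\<And>i. i < d \<Longrightarrow> p i = q i) \<Longrightarrow> P p = P q"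
  by (induction rule: polyfuns.induct) (auto simp: cds_def)

text \<open>Multiplicativity is reduced to the stability of the set of represented functions under
  multiplication by \<open>x\<close> and by the elements of \<open>polyfuns X\<close>; this avoids convolutions.\<close>

lemma polyfuns_insert:
  assumes "g \<in> polyfuns (insert x X)"
  shows "\<exists>m a. (\<forall>j. a j \<in> polyfuns X) \<and> (\<forall>j>m. a j = (\<lambda>_. 0)) \<and> (\<forall>p. g p = (\<Sum>j\<le>m. a j p * x p ^ j))"
proof -
  define R where "R = {g. \<exists>m a. (\<forall>j. a j \<in> polyfuns X) \<and> (\<forall>j>m. a j = (\<lambda>_. 0)) \<and>
    (\<forall>p. g p = (\<Sum>j\<le>m. a j p * x p ^ j))}"
  have RI: "g \<in> R" if "\<And>j. a j \<in> polyfuns X" "\<And>j. j > m \<Longrightarrow> a j = (\<lambda>_. 0)" "\<And>p. g p = (\<Sum>j\<le>m. a j p * x p ^ j)" for g m a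
    using that unfolding R_def by blast
  have Rc: "f \<in> R" if "f \<in> polyfuns X" for f
    by (rule RI[of "\<lambda>j. if j = 0 then f else (\<lambda>_. 0)" 0]) (auto intro: that polyfuns_const)
  have pad: "(\<Sum>j\<le>m. a j p * x p ^ j) = (\<Sum>j\<le>M. a j p * x p ^ j)" if "\<forall>j>m. a j = (\<lambda>_. 0)" "m \<le> M"
    for m M p and a :: "nat \<Rightarrow> 'a \<Rightarrow> complex"
    by (rule sum.mono_neutral_left) (use that in auto)
  have Radd: "(\<lambda>p. f p + g p) \<in> R" if fg: "f \<in> R" "g \<in> R" for f g
  proof -
    obtain m a where a: "\<forall>j. a j \<in> polyfuns X" "\<forall>j>m. a j = (\<lambda>_. 0)" "\<forall>p. f p = (\<Sum>j\<le>m. a j p * x p ^ j)"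
      using fg(1) unfolding R_def by blast
    obtain n b where b: "\<forall>j. b j \<in> polyfuns X" "\<forall>j>n. b j = (\<lambda>_. 0)" "\<forall>p. g p = (\<Sum>j\<le>n. b j p * x p ^ j)"
      using fg(2) unfolding R_def by blast
    show ?thesis
    proof (rule RI[of "\<lambda>j p. a j p + b j p" "max m n"])
      fix p
      have "f p = (\<Sum>j\<le>max m n. a j p * x p ^ j)" using a pad[OF a(2), of "max m n" p] by simp
      moreover have "g p = (\<Sum>j\<le>max m n. b j p * x p ^ j)" using b pad[OF b(2), of "max m n" p] by simp
      ultimately show "f p + g p = (\<Sum>j\<le>max m n. (a j p + b j p) * x p ^ j)"
        by (simp add: sum.distrib algebra_simps)
    qed (use a b in \<open>auto intro: polyfuns_add\<close>)
  qed
  have Rmul: "(\<lambda>p. f p * g p) \<in> R" if fg: "f \<in> polyfuns X" "g \<in> R" for f g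
  proof -
    obtain n b where b: "\<forall>j. b j \<in> polyfuns X" "\<forall>j>n. b j = (\<lambda>_. 0)" "\<forall>p. g p = (\<Sum>j\<le>n. b j p * x p ^ j)"
      using fg(2) unfolding R_def by blast
    show ?thesis
      by (rule RI[of "\<lambda>j p. f p * b j p" n]) (use b fg in \<open>auto intro: polyfuns_mult simp: sum_distrib_left mult.assoc\<close>)
  qed
  have Rx: "(\<lambda>p. x p * g p) \<in> R" if g: "g \<in> R" for g
  proof -
    obtain n b where b: "\<forall>j. b j \<in> polyfuns X" "\<forall>j>n. b j = (\<lambda>_. 0)" "\<forall>p. g p = (\<Sum>j\<le>n. b j p * x p ^ j)"
      using g unfolding R_def by blast
    show ?thesis
    proof (rule RI[of "\<lambda>j. case j of 0 \<Rightarrow> (\<lambda>_. 0) | Suc i \<Rightarrow> b i" "Suc n"])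
      fix p
      show "x p * g p = (\<Sum>j\<le>Suc n. (case j of 0 \<Rightarrow> (\<lambda>_. 0) | Suc i \<Rightarrow> b i) p * x p ^ j)"
        unfolding sum.atMost_Suc_shift using b(3) by (simp add: sum_distrib_left algebra_simps)
    qed (use b in \<open>auto intro: polyfuns_const split: nat.splits\<close>)
  qed
  have main: "\<forall>h\<in>R. (\<lambda>p. f p * h p) \<in> R" if "f \<in> polyfuns (insert x X)" for f
    using that
  proof induction
    case (polyfuns_const c)
    then show ?case using Rmul[OF polyfuns.polyfuns_const] by blast
  next
    case (polyfuns_coord f)
    then show ?case using Rx Rmul[OF polyfuns.polyfuns_coord] by blast
  next
    case (polyfuns_add f g)
    then show ?case using Radd by (auto simp: distrib_right)
  next
    case (polyfuns_mult f g)
    show ?case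
    proof
      fix h assume "h \<in> R"
      then have "(\<lambda>p. g p * h p) \<in> R" using polyfuns_mult.IH(2) by blast
      then have "(\<lambda>p. f p * (g p * h p)) \<in> R" using bspec[OF polyfuns_mult.IH(1)] by fastforce
      then show "(\<lambda>p. f p * g p * h p) \<in> R" by (simp add: mult.assoc)
    qed
  qed
  have "(\<lambda>_. 1) \<in> R" by (rule Rc) (rule polyfuns_const)
  with main[OF assms] have "(\<lambda>p. g p * 1) \<in> R" by (rule bspec)
  then show ?thesis by (simp add: R_def)
qed

lemma poly_path:
  assumes "g \<in> polyfuns X" "\<And>f. f \<in> X \<Longrightarrow> \<exists>q. \<forall>t. f (\<gamma> t) = poly q t"
  shows "\<exists>q. \<forall>t::complex. g (\<gamma> t) = poly q t"
  using assms(1)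
proof induction
  case (polyfuns_const c)
  then show ?case by (intro exI[of _ "[:c:]"]) auto
next
  case (polyfuns_coord f)
  then show ?case using assms(2) by auto
next
  case (polyfuns_add f g)
  then show ?case by (metis poly_add)
next
  case (polyfuns_mult f g)
  then show ?case by (metis poly_mult)
qed

text \<open>On a curve with polynomial coordinates, \<open>g\<close> and \<open>h\<close> become
  polynomials in one variable. A curve from a point with \<open>g \<noteq> 0\<close> to a point with
  \<open>h \<noteq> 0\<close> makes both polynomials nonzero, while their product is zero.\<close>

lemma zprime_paths:
  assumes ne: "S \<noteq> {}" and
    path: "\<And>x y. x \<in> S \<Longrightarrow> y \<in> S \<Longrightarrow> \<exists>\<gamma>. \<gamma> 0 = x \<and> \<gamma> 1 = y \<and> range \<gamma> \<subseteq> S \<and>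
      (\<forall>f\<in>X. \<exists>q. \<forall>t::complex. f (\<gamma> t) = poly q t)"
  shows "zprime X S"
  unfolding zprime_def
proof (intro conjI ballI impI)
  fix g h assume gh: "g \<in> polyfuns X" "h \<in> polyfuns X" "\<forall>x\<in>S. g x * h x = 0"
  show "(\<forall>x\<in>S. g x = 0) \<or> (\<forall>x\<in>S. h x = 0)"
  proof (rule ccontr)
    assume "\<not> ((\<forall>x\<in>S. g x = 0) \<or> (\<forall>x\<in>S. h x = 0))"
    then obtain x y where xy: "x \<in> S" "y \<in> S" "g x \<noteq> 0" "h y \<noteq> 0" by auto
    obtain \<gamma> where \<gamma>: "\<gamma> 0 = x" "\<gamma> 1 = y" "range \<gamma> \<subseteq> S" "\<forall>f\<in>X. \<exists>q. \<forall>t::complex. f (\<gamma> t) = poly q t"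
      using path[OF xy(1,2)] by auto
    obtain p q where p: "\<forall>t. g (\<gamma> t) = poly p t" and q: "\<forall>t. h (\<gamma> t) = poly q t"
      using poly_path[OF gh(1), of \<gamma>] poly_path[OF gh(2), of \<gamma>] \<gamma>(4) by blast
    have "poly (p * q) t = 0" for t using gh(3) \<gamma>(3) p q by (metis poly_mult rangeI subset_iff)
    then have "p * q = 0" using poly_all_0_iff_0 by blast
    then have "p = 0 \<or> q = 0" by simp
    then show False using p q xy \<gamma> by (metis poly_0)
  qed
qed (use ne in auto)

lemma zprime_affine: "zprime (cds d) UNIV"
proof (rule zprime_paths)
  fix x y :: "nat \<Rightarrow> complex"
  show "\<exists>\<gamma>. \<gamma> 0 = x \<and> \<gamma> 1 = y \<and> range \<gamma> \<subseteq> UNIV \<and> (\<forall>f\<in>cds d. \<exists>q. \<forall>t. f (\<gamma> t) = poly q t)"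
  proof (intro exI conjI)
    show "\<forall>f\<in>cds d. \<exists>q. \<forall>t. f ((\<lambda>t i. poly [:x i, y i - x i:] t) t) = poly q t"
      by (auto simp: cds_def simp del: poly_pCons)
  qed auto
qed auto

text \<open>The form in which density of open sets is used: an identity \<open>Q = 0\<close> may be
  checked only where a nonzero polynomial \<open>P\<close> does not vanish.\<close>

lemma cds_mult_zero:
  assumes "P \<in> polyfuns (cds d)" "Q \<in> polyfuns (cds d)" "\<And>p. P p \<noteq> 0 \<Longrightarrow> Q p = 0"
  shows "(\<forall>p. P p = 0) \<or> (\<forall>p. Q p = 0)"
  using zprimeD[OF zprime_affine, of d P Q] assms by (auto simp: pf_UNIV)

lemma cds_prod_nonzero:
  assumes "finite I" "\<And>i. i \<in> I \<Longrightarrow> P i \<in> polyfuns (cds d)" "\<And>i. i \<in> I \<Longrightarrow> \<exists>p. P i p \<noteq> 0"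
  shows "\<exists>p. (\<Prod>i\<in>I. P i p) \<noteq> 0"
  using assms
proof (induction I rule: finite_induct)
  case (insert i I)
  have "\<exists>p. (\<Prod>i\<in>I. P i p) \<noteq> 0" using insert by auto
  moreover have "(\<lambda>p. \<Prod>i\<in>I. P i p) \<in> polyfuns (cds d)" using insert by (intro polyfuns_prod) auto
  ultimately have "\<not> ((\<forall>p. P i p = 0) \<or> (\<forall>p. (\<Prod>i\<in>I. P i p) = 0))" using insert.prems(2) by auto
  then have "\<not> (\<forall>p. P i p \<noteq> 0 \<longrightarrow> (\<Prod>i\<in>I. P i p) = 0)"
    using cds_mult_zero[of "P i" d "\<lambda>p. \<Prod>i\<in>I. P i p"] insert.prems(1) \<open>(\<lambda>p. \<Prod>i\<in>I. P i p) \<in> polyfuns (cds d)\<close> by blast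
  then show ?case using insert.hyps by auto
qed auto

lemma cds_coeffs_zero:
  assumes "\<And>j. Q j \<in> polyfuns (cds d)" "\<And>p. (\<Sum>j\<le>m. Q j p * p d ^ j) = 0" "j \<le> m"
  shows "Q j p = 0"
proof -
  have "(\<Sum>j\<le>m. Q j p * t ^ j) = 0" for t
  proof -
    have "Q j (p(d := t)) = Q j p" for j by (rule cds_cong[OF assms(1)]) auto
    then show ?thesis using assms(2)[of "p(d := t)"] by simp
  qed
  then show ?thesis using polyfun_eq_0[of "\<lambda>j. Q j p" m] assms(3) by auto
qed

text \<open>Elimination, with unknowns indexed by \<open>I\<close> and equations by
  \<open>J\<close>. If \<open>c k j \<noteq> 0\<close>, equation \<open>j\<close> expresses the
  unknown \<open>k\<close> by the others; substitution leaves one unknown and one equation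
  less.\<close>

lemma homogeneous_system:
  fixes c :: "'i \<Rightarrow> 'j \<Rightarrow> complex"
  assumes "finite J" "finite I" "card J < card I"
  shows "\<exists>l. (\<exists>i\<in>I. l i \<noteq> 0) \<and> (\<forall>j\<in>J. (\<Sum>i\<in>I. l i * c i j) = 0)"
  using assms
proof (induction J arbitrary: I c rule: finite_induct)
  case empty
  then obtain i where "i \<in> I" by fastforce
  then show ?case by (intro exI[of _ "\<lambda>_. 1"]) auto
next
  case (insert j J)
  show ?case
  proof (cases "\<forall>i\<in>I. c i j = 0")
    case True
    have "card J < card I" using insert by auto
    from insert.IH[OF insert.prems(1) this, of c] show ?thesis using True by auto
  next
    case False
    then obtain k where k: "k \<in> I" "c k j \<noteq> 0" by auto
    let ?I = "I - {k}"
    have "card J < card ?I" using insert k by (simp add: card_Diff_singleton)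
    from insert.IH[OF _ this, of "\<lambda>i s. c i s - c i j / c k j * c k s"] insert.prems
    obtain l where l: "\<exists>i\<in>?I. l i \<noteq> 0" "\<forall>s\<in>J. (\<Sum>i\<in>?I. l i * (c i s - c i j / c k j * c k s)) = 0" by auto
    define m where "m i = (if i = k then - (\<Sum>i\<in>?I. l i * c i j / c k j) else l i)" for i
    have sm: "(\<Sum>i\<in>I. m i * c i s) = (\<Sum>i\<in>?I. l i * (c i s - c i j / c k j * c k s))" for s
    proof -
      have "(\<Sum>i\<in>I. m i * c i s) = m k * c k s + (\<Sum>i\<in>?I. m i * c i s)"
        using insert.prems k by (simp add: sum.remove)
      also have "(\<Sum>i\<in>?I. m i * c i s) = (\<Sum>i\<in>?I. l i * c i s)" by (rule sum.cong) (auto simp: m_def)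
      finally have 1: "(\<Sum>i\<in>I. m i * c i s) = m k * c k s + (\<Sum>i\<in>?I. l i * c i s)" .
      have "m k * c k s = - (\<Sum>i\<in>?I. l i * (c i j / c k j * c k s))"
        by (simp add: m_def sum_distrib_right mult.assoc)
      then show ?thesis unfolding 1 by (simp add: right_diff_distrib sum_subtractf)
    qed
    show ?thesis
    proof (intro exI[of _ m] conjI ballI)
      show "\<exists>i\<in>I. m i \<noteq> 0" using l(1) by (auto simp: m_def)
      fix s assume "s \<in> insert j J"
      then show "(\<Sum>i\<in>I. m i * c i s) = 0" unfolding sm using l(2) k by auto
    qed
  qed
qed

section \<open>Algebraic independence and growth\<close>

definition indep :: "(nat \<Rightarrow> 'a \<Rightarrow> complex) \<Rightarrow> nat \<Rightarrow> 'a set \<Rightarrow> bool" where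
  "indep f d S \<longleftrightarrow> (\<forall>P\<in>polyfuns (cds d). (\<forall>x\<in>S. P (\<lambda>i. f i x) = 0) \<longrightarrow> (\<forall>p. P p = 0))"

lemma indepD:
  "indep f d S \<Longrightarrow> P \<in> polyfuns (cds d) \<Longrightarrow> (\<And>x. x \<in> S \<Longrightarrow> P (\<lambda>i. f i x) = 0) \<Longrightarrow> P p = 0"
  by (auto simp: indep_def)

lemma not_indepE:
  assumes "\<not> indep f d S"
  obtains P p where "P \<in> polyfuns (cds d)" "P p \<noteq> 0" "\<And>x. x \<in> S \<Longrightarrow> P (\<lambda>i. f i x) = 0"
  using assms by (auto simp: indep_def)

text \<open>\<open>T\<close> lies in the Zariski closure of \<open>S\<close>. Neither set has to
  contain the other; this matters for parametrisations that leave the group, as in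
  \<open>cv_param_zdense\<close>.\<close>

definition zdense :: "('a \<Rightarrow> complex) set \<Rightarrow> 'a set \<Rightarrow> 'a set \<Rightarrow> bool" where
  "zdense X S T \<longleftrightarrow> (\<forall>g\<in>polyfuns X. (\<forall>x\<in>S. g x = 0) \<longrightarrow> (\<forall>x\<in>T. g x = 0))"

text \<open>The coordinates may satisfy relations as functions, so a function has no well-defined
  degree; \<open>pdeg X s f\<close> asserts only that some polynomial expression for
  \<open>f\<close> has degree at most \<open>s\<close>.\<close>

inductive pdeg :: "('a \<Rightarrow> complex) set \<Rightarrow> nat \<Rightarrow> ('a \<Rightarrow> complex) \<Rightarrow> bool" for X where
  pdeg_const: "pdeg X s (\<lambda>_. c)"
| pdeg_coord: "f \<in> X \<Longrightarrow> pdeg X s g \<Longrightarrow> pdeg X (Suc s) (\<lambda>x. f x * g x)"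
| pdeg_add: "pdeg X s f \<Longrightarrow> pdeg X s g \<Longrightarrow> pdeg X s (\<lambda>x. f x + g x)"
| pdeg_Suc: "pdeg X s f \<Longrightarrow> pdeg X (Suc s) f"

lemma pdeg_mono:
  assumes "pdeg X s f" "s \<le> t" shows "pdeg X t f"
  using assms(2,1) by (induction t rule: dec_induct) (auto intro: pdeg_Suc)

lemma pdeg_scale: "pdeg X s f \<Longrightarrow> pdeg X s (\<lambda>x. c * f x)"
proof (induction rule: pdeg.induct)
  case (pdeg_coord f s g)
  then have "pdeg X (Suc s) (\<lambda>x. f x * (c * g x))" by (intro pdeg.pdeg_coord)
  then show ?case by (simp add: mult.left_commute)
qed (auto intro: pdeg.intros simp: distrib_left)

lemma pdeg_mult:
  assumes "pdeg X s f" "pdeg X t g" shows "pdeg X (s + t) (\<lambda>x. f x * g x)"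
  using assms(1)
proof induction
  case (pdeg_const s c)
  then show ?case using pdeg_mono[OF pdeg_scale[OF assms(2)]] by simp
next
  case (pdeg_coord f s h)
  then show ?case using pdeg.pdeg_coord[OF pdeg_coord(1,3)] by (simp add: mult.assoc)
qed (auto intro: pdeg.intros simp: distrib_right)

lemma polyfuns_pdeg: "g \<in> polyfuns X \<Longrightarrow> \<exists>s. pdeg X s g"
proof (induction rule: polyfuns.induct)
  case (polyfuns_coord f)
  from pdeg_coord[OF this pdeg_const[of X 0 1]] show ?case by auto
next
  case (polyfuns_add f g)
  then obtain s t where "pdeg X s f" "pdeg X t g" by auto
  then show ?case by (intro exI[of _ "max s t"] pdeg_add) (auto elim: pdeg_mono)
qed (auto intro: pdeg_const pdeg_mult)

lemma polyfuns_pdeg_finite: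
  assumes "finite I" "\<And>i. i \<in> I \<Longrightarrow> f i \<in> polyfuns X"
  shows "\<exists>e. \<forall>i\<in>I. pdeg X e (f i)"
proof -
  have "\<forall>i\<in>I. \<exists>s. pdeg X s (f i)" using assms(2) polyfuns_pdeg by blast
  then obtain s where s: "\<forall>i\<in>I. pdeg X (s i) (f i)" by metis
  show ?thesis
    by (rule exI[of _ "Max (s ` I)"]) (use s assms(1) in \<open>auto intro: pdeg_mono[OF _ Max_ge]\<close>)
qed

lemma pdeg_power: "pdeg X s f \<Longrightarrow> pdeg X (k * s) (\<lambda>x. f x ^ k)"
  by (induction k) (auto intro: pdeg_const dest: pdeg_mult)

lemma pdeg_prod:
  "(\<And>i. i < (d::nat) \<Longrightarrow> pdeg X s (f i)) \<Longrightarrow> pdeg X (d * s) (\<lambda>x. \<Prod>i<d. f i x)"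
proof (induction d)
  case (Suc d)
  then have "pdeg X (d * s + s) (\<lambda>x. (\<Prod>i<d. f i x) * f d x)" by (intro pdeg_mult) auto
  then show ?case by (simp add: add.commute)
qed (auto intro: pdeg_const)

section \<open>Spans of functions and the growth of the Hilbert function\<close>

definition spn :: "('a \<Rightarrow> complex) set \<Rightarrow> 'a set \<Rightarrow> ('a \<Rightarrow> complex) \<Rightarrow> bool" where
  "spn B S g \<longleftrightarrow> (\<exists>c. \<forall>x\<in>S. g x = (\<Sum>b\<in>B. c b * b x))"

lemma spn_base:
  assumes "finite B" "b \<in> B" shows "spn B S b"
  unfolding spn_def
proof (intro exI ballI)
  fix x
  have "(\<Sum>a\<in>B. (if a = b then 1 else 0) * a x) = (\<Sum>a\<in>B. if a = b then a x else 0)"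
    by (rule sum.cong) auto
  also have "\<dots> = b x" using assms by simp
  finally show "b x = (\<Sum>a\<in>B. (if a = b then 1 else 0) * a x)" ..
qed

lemma spn_add: "spn B S f \<Longrightarrow> spn B S g \<Longrightarrow> spn B S (\<lambda>x. f x + g x)"
proof -
  assume "spn B S f" "spn B S g"
  then obtain c d where "\<forall>x\<in>S. f x = (\<Sum>b\<in>B. c b * b x)" "\<forall>x\<in>S. g x = (\<Sum>b\<in>B. d b * b x)"
    by (auto simp: spn_def)
  then show ?thesis unfolding spn_def
    by (intro exI[of _ "\<lambda>b. c b + d b"]) (auto simp: sum.distrib distrib_right)
qed

lemma spn_scale: "spn B S f \<Longrightarrow> spn B S (\<lambda>x. c * f x)"
proof -
  assume "spn B S f"
  then obtain d where "\<forall>x\<in>S. f x = (\<Sum>b\<in>B. d b * b x)" by (auto simp: spn_def)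
  then show ?thesis unfolding spn_def
    by (intro exI[of _ "\<lambda>b. c * d b"]) (auto simp: sum_distrib_left mult.assoc)
qed

lemma spn_zero: "spn B S (\<lambda>_. 0)"
  unfolding spn_def by (rule exI[of _ "\<lambda>_. 0"]) auto

lemma spn_sum: "(\<And>i. i \<in> I \<Longrightarrow> spn B S (f i)) \<Longrightarrow> spn B S (\<lambda>x. \<Sum>i\<in>I. f i x)"
  by (induction I rule: infinite_finite_induct) (auto intro: spn_zero spn_add)

lemma spn_cong: "spn B S f \<Longrightarrow> (\<And>x. x \<in> S \<Longrightarrow> f x = g x) \<Longrightarrow> spn B S g"
  by (auto simp: spn_def)

lemma spn_lin:
  assumes "spn B S g" "\<And>b. b \<in> B \<Longrightarrow> spn B' S (\<lambda>x. h x * b x)"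
  shows "spn B' S (\<lambda>x. h x * g x)"
proof -
  obtain c where c: "\<forall>x\<in>S. g x = (\<Sum>b\<in>B. c b * b x)" using assms(1) by (auto simp: spn_def)
  have "spn B' S (\<lambda>x. \<Sum>b\<in>B. c b * (h x * b x))"
    using assms(2) by (intro spn_sum spn_scale) auto
  then show ?thesis
    by (rule spn_cong) (use c in \<open>auto simp: sum_distrib_left mult.left_commute\<close>)
qed

lemma spn_mono:
  assumes "spn B S g" "B \<subseteq> B'" "finite B'" shows "spn B' S g"
  using spn_lin[OF assms(1), of B' "\<lambda>_. 1"] assms(2,3) by (auto intro: spn_base)

definition growth0 :: "('a \<Rightarrow> complex) set \<Rightarrow> 'a set \<Rightarrow> nat \<Rightarrow> bool" where
  "growth0 X S D \<longleftrightarrow> (\<exists>C. \<forall>s. \<exists>B. finite B \<and> card B \<le> C * (s + 1) ^ D \<and> (\<forall>g. pdeg X s g \<longrightarrow> spn B S g))"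

text \<open>Passing to a set \<open>S\<close> whose closure contains \<open>T\<close> allows
  denominators, as in \<open>maxind_growth\<close>, and parametrisations that are not onto.\<close>

definition growth :: "('a \<Rightarrow> complex) set \<Rightarrow> 'a set \<Rightarrow> nat \<Rightarrow> bool" where
  "growth X T D \<longleftrightarrow> (\<exists>S. zdense X S T \<and> growth0 X S D)"

abbreviation expos :: "nat \<Rightarrow> nat \<Rightarrow> (nat \<Rightarrow> nat) set" where
  "expos d s \<equiv> PiE {..<d} (\<lambda>_. {..s})"

lemma card_expos: "card (expos d s) = (s + 1) ^ d"
  by (simp add: card_PiE)

lemma finite_expos: "finite (expos d s)"
  by (simp add: finite_PiE)

lemma monomial_polyfuns: "(\<lambda>p. \<Prod>k<d. p k ^ b k) \<in> polyfuns (cds d)"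
  by (rule polyfuns_prod, rule polyfuns_power, rule polyfuns_coord) (auto intro: cds_coord)

text \<open>Splitting off the exponent of the last variable writes the sum as a polynomial in that
  variable whose coefficients \<open>Q j\<close> involve only the earlier ones.\<close>

lemma monomials_independent:
  assumes "\<And>p. (\<Sum>b\<in>expos d s. l b * (\<Prod>k<d. p k ^ b k)) = (0::complex)" "b \<in> expos d s"
  shows "l b = 0"
  using assms
proof (induction d arbitrary: l b)
  case 0
  then show ?case by auto
next
  case (Suc d)
  let ?h = "\<lambda>(j, b). b(d := j)"
  have inj: "inj_on ?h ({..s} \<times> expos d s)"
    using inj_combinator[of d "{..<d}" "\<lambda>_. {..s}"] by simp
  have im: "expos (Suc d) s = ?h ` ({..s} \<times> expos d s)"
    unfolding lessThan_Suc PiE_insert_eq ..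
  define Q where "Q j p = (\<Sum>b\<in>expos d s. l (b(d := j)) * (\<Prod>k<d. p k ^ b k))" for j and p :: "nat \<Rightarrow> complex"
  have "(\<Sum>j\<le>s. Q j p * p d ^ j) = 0" for p
  proof -
    have "0 = (\<Sum>b\<in>?h ` ({..s} \<times> expos d s). l b * (\<Prod>k<Suc d. p k ^ b k))"
      using Suc.prems(1)[of p] unfolding im by (rule sym)
    also have "\<dots> = (\<Sum>(j, b)\<in>{..s} \<times> expos d s. l (b(d := j)) * (\<Prod>k<Suc d. p k ^ (b(d := j)) k))"
      unfolding sum.reindex[OF inj] by (rule sum.cong[OF refl]) (simp only: comp_def split_beta)
    also have "\<dots> = (\<Sum>(j, b)\<in>{..s} \<times> expos d s. l (b(d := j)) * (\<Prod>k<d. p k ^ b k) * p d ^ j)"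
    proof (rule sum.cong[OF refl], clarify)
      fix j b
      have "(\<Prod>k<d. p k ^ (b(d := j)) k) = (\<Prod>k<d. p k ^ b k)" by (rule prod.cong) auto
      then show "l (b(d := j)) * (\<Prod>k<Suc d. p k ^ (b(d := j)) k) = l (b(d := j)) * (\<Prod>k<d. p k ^ b k) * p d ^ j"
        by (simp only: prod.lessThan_Suc fun_upd_same mult.assoc)
    qed
    also have "\<dots> = (\<Sum>j\<le>s. Q j p * p d ^ j)"
      unfolding Q_def sum_distrib_right by (simp only: sum.cartesian_product)
    finally show ?thesis ..
  qed
  moreover have "Q j \<in> polyfuns (cds d)" for j
    unfolding Q_def by (intro polyfuns_sum polyfuns_mult polyfuns_const monomial_polyfuns)
  ultimately have Q0: "Q j p = 0" if "j \<le> s" for j p using cds_coeffs_zero[of Q d s j p] that by blast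
  obtain j b' where b': "j \<le> s" "b' \<in> expos d s" "b = b'(d := j)"
    using Suc.prems(2) unfolding im by (elim imageE) (simp only: split_beta mem_Times_iff, blast)
  have "l (b'(d := j)) = 0"
    by (rule Suc.IH[OF _ b'(2)]) (use Q0[OF b'(1)] in \<open>simp only: Q_def\<close>)
  then show ?case using b'(3) by (simp only:)
qed

lemma indep_zdense:
  assumes "indep f d T" "zdense X S T" "\<And>i. i < d \<Longrightarrow> f i \<in> polyfuns X"
  shows "indep f d S"
  unfolding indep_def
proof (intro ballI impI)
  fix P assume P: "P \<in> polyfuns (cds d)" "\<forall>x\<in>S. P (\<lambda>i. f i x) = 0"
  have "(\<lambda>x. P (\<lambda>i. f i x)) \<in> polyfuns X" by (rule polyfuns_cds_comp[OF P(1) assms(3)])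
  then have "\<forall>x\<in>T. P (\<lambda>i. f i x) = 0" using assms(2) P(2) by (auto simp: zdense_def)
  then show "\<forall>p. P p = 0" using assms(1) P(1) by (auto simp: indep_def)
qed

lemma indep_mono: "indep f d S \<Longrightarrow> S \<subseteq> T \<Longrightarrow> indep f d T"
  unfolding indep_def by blast

text \<open>Counting: the \<open>(s + 1) ^ d\<close> monomials in \<open>f\<close> with exponents at
  most \<open>s\<close> have degree at most \<open>d * s * e\<close>, so they lie in a span of size
  O((s+1)^D). If \<open>D < d\<close>, a suitable \<open>s\<close> forces a linear relation between
  them.\<close>

lemma indep_le_growth:
  assumes "growth X T D" and f: "\<And>i. i < d \<Longrightarrow> f i \<in> polyfuns X" and ind: "indep f d T"
  shows "d \<le> D"
proof (rule ccontr)
  assume "\<not> d \<le> D"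
  then have dD: "Suc D \<le> d" by simp
  obtain S where S: "zdense X S T" "growth0 X S D" using assms(1) by (auto simp: growth_def)
  obtain C where C: "\<And>s. \<exists>B. finite B \<and> card B \<le> C * (s + 1) ^ D \<and> (\<forall>g. pdeg X s g \<longrightarrow> spn B S g)"
    using S(2) unfolding growth0_def by blast
  obtain e where e: "\<forall>i\<in>{..<d}. pdeg X e (f i)"
    using polyfuns_pdeg_finite[of "{..<d}" f X] f by auto
  \<comment> \<open>With this \<open>s\<close> the constant in the bound for the span is
    \<open>s\<close> itself, and \<open>s * (s + 1) ^ D < (s + 1) ^ Suc D\<close>.\<close>
  define s where "s = C * (e * d + 1) ^ D"
  obtain B where B: "finite B" "card B \<le> C * (d * (s * e) + 1) ^ D" "\<And>g. pdeg X (d * (s * e)) g \<Longrightarrow> spn B S g"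
    using C[of "d * (s * e)"] by blast
  have "d * (s * e) + 1 \<le> (e * d + 1) * (s + 1)" by (simp add: algebra_simps)
  then have "C * (d * (s * e) + 1) ^ D \<le> C * ((e * d + 1) * (s + 1)) ^ D"
    by (intro mult_left_mono power_mono) auto
  also have "\<dots> = (C * (e * d + 1) ^ D) * (s + 1) ^ D" by (simp only: power_mult_distrib mult.assoc)
  also have "\<dots> = s * (s + 1) ^ D" by (simp only: s_def[symmetric])
  also have "\<dots> < (s + 1) ^ Suc D" by simp
  also have "\<dots> \<le> (s + 1) ^ d" using dD by (intro power_increasing) auto
  finally have card: "card B < card (expos d s)" using B(2) by (simp add: card_expos)
  have "spn B S (\<lambda>x. \<Prod>k<d. f k x ^ b k)" if "b \<in> expos d s" for b
  proof (rule B(3), rule pdeg_prod)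
    fix k assume "k < d"
    then have "b k \<le> s" "pdeg X e (f k)" using that e by (auto dest: PiE_mem)
    then show "pdeg X (s * e) (\<lambda>x. f k x ^ b k)"
      by (intro pdeg_mono[OF pdeg_power]) auto
  qed
  then have "\<forall>b\<in>expos d s. \<exists>c. \<forall>x\<in>S. (\<Prod>k<d. f k x ^ b k) = (\<Sum>w\<in>B. c w * w x)"
    unfolding spn_def by blast
  from bchoice[OF this] obtain c where
    c: "\<And>b x. b \<in> expos d s \<Longrightarrow> x \<in> S \<Longrightarrow> (\<Prod>k<d. f k x ^ b k) = (\<Sum>w\<in>B. c b w * w x)"
    by blast
  obtain l where l: "\<exists>b\<in>expos d s. l b \<noteq> 0" "\<forall>w\<in>B. (\<Sum>b\<in>expos d s. l b * c b w) = 0"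
    using homogeneous_system[OF B(1) finite_expos card, of c] by auto
  define P where "P p = (\<Sum>b\<in>expos d s. l b * (\<Prod>k<d. p k ^ b k))" for p :: "nat \<Rightarrow> complex"
  have "P \<in> polyfuns (cds d)"
    unfolding P_def by (intro polyfuns_sum polyfuns_mult polyfuns_const monomial_polyfuns)
  moreover have "P (\<lambda>i. f i x) = 0" if "x \<in> S" for x
  proof -
    have "P (\<lambda>i. f i x) = (\<Sum>b\<in>expos d s. l b * (\<Sum>w\<in>B. c b w * w x))"
      unfolding P_def by (rule sum.cong[OF refl]) (simp only: c that)
    also have "\<dots> = (\<Sum>b\<in>expos d s. \<Sum>w\<in>B. l b * c b w * w x)"
      by (simp only: sum_distrib_left mult.assoc)
    also have "\<dots> = (\<Sum>w\<in>B. \<Sum>b\<in>expos d s. l b * c b w * w x)" by (rule sum.swap)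
    also have "\<dots> = (\<Sum>w\<in>B. (\<Sum>b\<in>expos d s. l b * c b w) * w x)"
      by (simp only: sum_distrib_right)
    also have "\<dots> = 0" by (rule sum.neutral) (simp add: l(2))
    finally show ?thesis .
  qed
  moreover have "indep f d S" by (rule indep_zdense[OF ind S(1) f])
  ultimately have P0: "P p = 0" for p unfolding indep_def by blast
  have "l b = 0" if "b \<in> expos d s" for b
    by (rule monomials_independent[where l = l and d = d and s = s, OF _ that]) (rule P0[unfolded P_def])
  then show False using l(1) by blast
qed

text \<open>\<open>f i\<close> vanishes on \<open>Z i\<close> but not on \<open>Z (Suc i)\<close>.
  In a relation on \<open>Z (Suc e)\<close>, a power of \<open>f e\<close> can be cancelled by
  primality; restriction to \<open>Z e\<close>, where \<open>f e = 0\<close>, leaves the lowest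
  coefficient as a relation between fewer functions.\<close>

lemma zchain_indep:
  assumes "zchain X S d Z"
  shows "\<exists>f. (\<forall>i<d. f i \<in> polyfuns X) \<and> indep f d (Z d)"
proof -
  have "\<exists>g\<in>polyfuns X. (\<forall>x\<in>Z i. g x = 0) \<and> (\<exists>x\<in>Z (Suc i). g x \<noteq> 0)" if "i < d" for i
  proof -
    have "zclosed X S (Z i)" "zclosed X S (Z (Suc i))" "Z i \<subset> Z (Suc i)"
      using assms that by (auto simp: zchain_def)
    then obtain F where F: "F \<subseteq> polyfuns X" "Z i = {x\<in>S. \<forall>f\<in>F. f x = 0}" by (auto simp: zclosed_def)
    obtain x where "x \<in> Z (Suc i)" "x \<notin> Z i" using \<open>Z i \<subset> Z (Suc i)\<close> by auto
    moreover have "x \<in> S" using calculation(1) \<open>zclosed X S (Z (Suc i))\<close> zclosed_subset by blast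
    ultimately obtain f where "f \<in> F" "f x \<noteq> 0" using F by auto
    then show ?thesis using F \<open>x \<in> Z (Suc i)\<close> by auto
  qed
  then obtain f where f: "\<And>i. i < d \<Longrightarrow> f i \<in> polyfuns X" "\<And>i x. i < d \<Longrightarrow> x \<in> Z i \<Longrightarrow> f i x = 0"
    "\<And>i. i < d \<Longrightarrow> \<exists>x\<in>Z (Suc i). f i x \<noteq> 0" by metis
  have "indep f e (Z e)" if "e \<le> d" for e
    using that
  proof (induction e)
    case 0
    have "Z 0 \<noteq> {}" using assms by (auto simp: zchain_def zprime_def)
    then obtain x where x: "x \<in> Z 0" by auto
    show ?case unfolding indep_def
    proof (intro ballI impI allI)
      fix P p assume "P \<in> polyfuns (cds 0)" "\<forall>x\<in>Z 0. P (\<lambda>i. f i x) = 0"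
      then show "P p = 0" using cds_cong[of P 0 p "\<lambda>i. f i x"] x by auto
    qed
  next
    case (Suc e)
    then have IH: "indep f e (Z e)" and e: "e < d" by auto
    have Zs: "Z e \<subset> Z (Suc e)" and pr: "zprime X (Z (Suc e))" using assms e by (auto simp: zchain_def)
    show ?case unfolding indep_def
    proof (intro ballI impI)
      fix P assume P: "P \<in> polyfuns (cds (Suc e))" "\<forall>x\<in>Z (Suc e). P (\<lambda>i. f i x) = 0"
      obtain m Q where Q: "\<forall>j. Q j \<in> polyfuns (cds e)" "\<forall>p. P p = (\<Sum>j\<le>m. Q j p * p e ^ j)"
        using polyfuns_insert[of P "\<lambda>p. p e" "cds e"] P(1) unfolding cds_Suc by blast
      have Q0: "\<forall>p. Q j p = 0" if "j \<le> m" for j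
        using that
      proof (induction j rule: less_induct)
        case (less j)
        \<comment> \<open>The relation divided by \<open>f e x ^ j\<close>; its terms below
          \<open>j\<close> vanish by induction.\<close>
        define R where "R x = (\<Sum>i\<in>{j..m}. Q i (\<lambda>i. f i x) * f e x ^ (i - j))" for x
        have "pf X (Z (Suc e)) (\<lambda>x. Q i (\<lambda>i. f i x))" for i
          by (rule pf_cds_comp[of "Q i" e]) (use Q(1) f(1) e in \<open>auto intro: pf_polyfuns\<close>)
        then have pfR: "pf X (Z (Suc e)) R"
          unfolding R_def by (intro pf_sum pf_mult pf_power pf_polyfuns[OF f(1)[OF e]])
        have "f e x ^ j * R x = 0" if "x \<in> Z (Suc e)" for x
        proof -
          have "0 = (\<Sum>i\<le>m. Q i (\<lambda>i. f i x) * f e x ^ i)" using P(2) Q(2) that by auto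
          also have "\<dots> = (\<Sum>i\<in>{j..m}. Q i (\<lambda>i. f i x) * f e x ^ i)"
            by (rule sum.mono_neutral_right) (use less in auto)
          also have "\<dots> = f e x ^ j * R x"
            unfolding R_def sum_distrib_left
          proof (rule sum.cong[OF refl])
            fix i assume "i \<in> {j..m}"
            then have "f e x ^ i = f e x ^ j * f e x ^ (i - j)" by (simp flip: power_add)
            then show "Q i (\<lambda>i. f i x) * f e x ^ i = f e x ^ j * (Q i (\<lambda>i. f i x) * f e x ^ (i - j))"
              by (simp only: mult.left_commute)
          qed
          finally show ?thesis ..
        qed
        then have "(\<forall>x\<in>Z (Suc e). f e x ^ j = 0) \<or> (\<forall>x\<in>Z (Suc e). R x = 0)"
          using zprimeD[OF pr _ pfR, of "\<lambda>x. f e x ^ j"] f(1)[OF e] by (auto intro: pf_power pf_polyfuns)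
        then have R0: "\<forall>x\<in>Z (Suc e). R x = 0" using f(3)[OF e] by auto
        have "Q j (\<lambda>i. f i x) = 0" if x: "x \<in> Z e" for x
        proof -
          have "R x = (\<Sum>i\<in>{j}. Q i (\<lambda>i. f i x) * f e x ^ (i - j))"
            unfolding R_def
            by (rule sum.mono_neutral_right) (use less f(2)[OF e x] in auto)
          then show ?thesis using R0 x Zs by auto
        qed
        then show ?case using IH Q(1) by (auto simp: indep_def)
      qed
      show "\<forall>p. P p = 0" using Q(2) Q0 by simp
    qed
  qed
  then show ?thesis using f(1) by auto
qed

lemma zchain_le_growth:
  assumes "zchain X S d Z" "growth X S D"
  shows "d \<le> D"
proof -
  obtain f where f: "\<forall>i<d. f i \<in> polyfuns X" "indep f d (Z d)" using zchain_indep[OF assms(1)] by auto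
  have "Z d \<subseteq> S" using assms(1) zclosed_subset unfolding zchain_def by blast
  then have "indep f d S" using f(2) indep_mono by blast
  then show ?thesis using indep_le_growth[OF assms(2)] f(1) by blast
qed

inductive_set idl :: "('a \<Rightarrow> complex) set \<Rightarrow> ('a \<Rightarrow> complex) set \<Rightarrow> ('a \<Rightarrow> complex) set" for X B where
  idl_zero: "(\<lambda>_. 0) \<in> idl X B"
| idl_comb: "b \<in> B \<Longrightarrow> r \<in> polyfuns X \<Longrightarrow> g \<in> idl X B \<Longrightarrow> (\<lambda>x. r x * b x + g x) \<in> idl X B"

section \<open>Noetherian decomposition\<close>

lemma idl_base: "b \<in> B \<Longrightarrow> b \<in> idl X B"
  using idl_comb[OF _ polyfuns_const[of 1] idl_zero, of b B X] by simp

lemma idl_add: "f \<in> idl X B \<Longrightarrow> g \<in> idl X B \<Longrightarrow> (\<lambda>x. f x + g x) \<in> idl X B"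
proof (induction rule: idl.induct)
  case (idl_comb b r h)
  then have "(\<lambda>x. r x * b x + (h x + g x)) \<in> idl X B" by (intro idl.idl_comb) auto
  then show ?case by (simp add: add.assoc)
qed auto

lemma idl_mult: "g \<in> idl X B \<Longrightarrow> r \<in> polyfuns X \<Longrightarrow> (\<lambda>x. r x * g x) \<in> idl X B"
proof (induction rule: idl.induct)
  case (idl_comb b s h)
  then have "(\<lambda>x. (r x * s x) * b x + r x * h x) \<in> idl X B" by (intro idl.idl_comb polyfuns_mult) auto
  then show ?case by (simp add: algebra_simps)
qed (auto intro: idl_zero)

lemma idl_trans: "g \<in> idl X B \<Longrightarrow> B \<subseteq> idl X C \<Longrightarrow> g \<in> idl X C"
proof (induction rule: idl.induct)
  case (idl_comb b r g)
  then have "b \<in> idl X C" "g \<in> idl X C" by auto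
  from idl_add[OF idl_mult[OF this(1) idl_comb.hyps(2)] this(2)] show ?case .
qed (rule idl_zero)

lemma idl_mono: "g \<in> idl X B \<Longrightarrow> B \<subseteq> C \<Longrightarrow> g \<in> idl X C"
  by (rule idl_trans) (auto intro: idl_base)

lemma idl_finite: "g \<in> idl X B \<Longrightarrow> \<exists>F\<subseteq>B. finite F \<and> g \<in> idl X F"
proof (induction rule: idl.induct)
  case idl_zero
  then show ?case by (intro exI[of _ "{}"]) (auto intro: idl.idl_zero)
next
  case (idl_comb b r g)
  then obtain F where F: "F \<subseteq> B" "finite F" "g \<in> idl X F" by auto
  then show ?case using idl_comb
    by (intro exI[of _ "insert b F"]) (auto intro!: idl.idl_comb intro: idl_mono)
qed

lemma idl_finite_set:
  assumes "finite G" "G \<subseteq> idl X B" shows "\<exists>F\<subseteq>B. finite F \<and> G \<subseteq> idl X F"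
  using assms
proof (induction G rule: finite_induct)
  case (insert g G)
  obtain F where F: "F \<subseteq> B" "finite F" "G \<subseteq> idl X F" using insert by auto
  obtain F' where F': "F' \<subseteq> B" "finite F'" "g \<in> idl X F'" using idl_finite[of g X B] insert by auto
  show ?case using F F' idl_mono[of _ X F "F \<union> F'"] idl_mono[of _ X F' "F \<union> F'"]
    by (intro exI[of _ "F \<union> F'"]) auto
qed auto

definition noeth :: "('a \<Rightarrow> complex) set \<Rightarrow> bool" where
  "noeth X \<longleftrightarrow> (\<forall>A\<subseteq>polyfuns X. \<exists>F\<subseteq>A. finite F \<and> A \<subseteq> idl X F)"

text \<open>\<open>c\<close> is the coefficient of \<open>x ^ m\<close> in some representation of
  \<open>g\<close> of degree at most \<open>m\<close> in \<open>x\<close>. It may be zero and need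
  not be determined by \<open>g\<close>.\<close>

definition lead :: "('a \<Rightarrow> complex) set \<Rightarrow> ('a \<Rightarrow> complex) \<Rightarrow> ('a \<Rightarrow> complex) \<Rightarrow> nat \<Rightarrow> ('a \<Rightarrow> complex) \<Rightarrow> bool" where
  "lead X x g m c \<longleftrightarrow> (\<exists>a. (\<forall>j. a j \<in> polyfuns X) \<and> (\<forall>p. g p = (\<Sum>j\<le>m. a j p * x p ^ j)) \<and> a m = c)"

lemma lead_polyfuns: "lead X x g m c \<Longrightarrow> c \<in> polyfuns X"
  by (auto simp: lead_def)

lemma lead_zero: "lead X x (\<lambda>_. 0) m (\<lambda>_. 0)"
  unfolding lead_def by (rule exI[of _ "\<lambda>_ _. 0"]) (auto intro: polyfuns_const)

lemma lead_comb:
  assumes "lead X x g m c" "lead X x h m d" "r \<in> polyfuns X"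
  shows "lead X x (\<lambda>p. r p * g p + h p) m (\<lambda>p. r p * c p + d p)"
proof -
  obtain a where a: "\<forall>j. a j \<in> polyfuns X" "\<forall>p. g p = (\<Sum>j\<le>m. a j p * x p ^ j)" "a m = c"
    using assms(1) by (auto simp: lead_def)
  obtain b where b: "\<forall>j. b j \<in> polyfuns X" "\<forall>p. h p = (\<Sum>j\<le>m. b j p * x p ^ j)" "b m = d"
    using assms(2) by (auto simp: lead_def)
  show ?thesis unfolding lead_def
    by (rule exI[of _ "\<lambda>j p. r p * a j p + b j p"])
      (use a b assms(3) in \<open>auto intro!: polyfuns_add polyfuns_mult simp: sum.distrib sum_distrib_left distrib_right mult.assoc\<close>)
qed

lemma lead_shift:
  assumes "lead X x g m c"
  shows "lead X x (\<lambda>p. x p ^ k * g p) (m + k) c"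
proof -
  obtain a where a: "\<forall>j. a j \<in> polyfuns X" "\<forall>p. g p = (\<Sum>j\<le>m. a j p * x p ^ j)" "a m = c"
    using assms(1) by (auto simp: lead_def)
  let ?a = "\<lambda>j. if j < k then (\<lambda>_. 0) else a (j - k)"
  have "x p ^ k * g p = (\<Sum>j\<le>m + k. ?a j p * x p ^ j)" for p
  proof -
    have "(\<Sum>j\<le>m + k. ?a j p * x p ^ j) = (\<Sum>j\<in>{k..m + k}. ?a j p * x p ^ j)"
      by (rule sum.mono_neutral_right) auto
    also have "\<dots> = (\<Sum>j\<in>{0..m}. ?a (j + k) p * x p ^ (j + k))"
      using sum.shift_bounds_cl_nat_ivl[of "\<lambda>j. ?a j p * x p ^ j" 0 k m] by simp
    also have "\<dots> = x p ^ k * g p"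
      using a(2) by (simp add: sum_distrib_left power_add mult_ac atLeast0AtMost)
    finally show ?thesis ..
  qed
  then show ?thesis unfolding lead_def
    by (intro exI[of _ ?a]) (use a in \<open>auto intro: polyfuns_const\<close>)
qed

lemma lead_cancel:
  assumes "lead X x g m c" "lead X x h m c"
  shows "(\<forall>p. g p - h p = 0) \<or> (\<exists>k<m. \<exists>d. lead X x (\<lambda>p. g p - h p) k d)"
proof -
  obtain a where a: "\<forall>j. a j \<in> polyfuns X" "\<forall>p. g p = (\<Sum>j\<le>m. a j p * x p ^ j)" "a m = c"
    using assms(1) by (auto simp: lead_def)
  obtain b where b: "\<forall>j. b j \<in> polyfuns X" "\<forall>p. h p = (\<Sum>j\<le>m. b j p * x p ^ j)" "b m = c"
    using assms(2) by (auto simp: lead_def)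
  have d: "g p - h p = (\<Sum>j\<le>m. (a j p - b j p) * x p ^ j)" for p
    using a b by (simp add: sum_subtractf left_diff_distrib)
  show ?thesis
  proof (cases m)
    case 0
    then show ?thesis using d a(3) b(3) by auto
  next
    case (Suc k)
    have "lead X x (\<lambda>p. g p - h p) k (\<lambda>p. a k p - b k p)"
      unfolding lead_def
      by (rule exI[of _ "\<lambda>j p. a j p - b j p"])
        (use a(1,3) b(1,3) d Suc in \<open>auto intro: polyfuns_diff\<close>)
    then show ?thesis using Suc by blast
  qed
qed

text \<open>Hilbert's basis theorem. Up to degree \<open>e\<close> the sets \<open>J m\<close> of
  leading coefficients have their own finite generating sets \<open>F m\<close>. Above
  \<open>e\<close> the single set \<open>F0\<close>, which generates the union of all
  \<open>J m\<close>, suffices, since an element of degree \<open>M c \<le> e\<close> can be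
  multiplied by a power of \<open>x\<close>. Subtracting an element with the same leading
  coefficient lowers the degree.\<close>

lemma noeth_insert:
  assumes "noeth X" shows "noeth (insert x X)"
  unfolding noeth_def
proof (intro allI impI)
  let ?Y = "insert x X"
  fix A assume A: "A \<subseteq> polyfuns ?Y"
  define I where "I = idl ?Y A"
  have IR: "g \<in> polyfuns ?Y" if "g \<in> I" for g
    using that unfolding I_def
  proof (induction rule: idl.induct)
    case (idl_comb b r g)
    then show ?case using A by (intro polyfuns_add polyfuns_mult) auto
  qed (rule polyfuns_const)
  have XY: "polyfuns X \<subseteq> polyfuns ?Y" by (rule polyfuns_mono) auto
  define J where "J m = {c. \<exists>g\<in>I. lead X x g m c}" for m
  have JX: "J m \<subseteq> polyfuns X" for m unfolding J_def by (auto dest: lead_polyfuns)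
  have "\<exists>F\<subseteq>J m. finite F \<and> J m \<subseteq> idl X F" for m
    using assms JX[of m] by (auto simp: noeth_def)
  then obtain F where F: "\<And>m. F m \<subseteq> J m" "\<And>m. finite (F m)" "\<And>m. J m \<subseteq> idl X (F m)" by metis
  have "(\<Union>m. J m) \<subseteq> polyfuns X" using JX by auto
  from assms[unfolded noeth_def, rule_format, OF this]
  obtain F0 where F0: "F0 \<subseteq> (\<Union>m. J m)" "finite F0" "(\<Union>m. J m) \<subseteq> idl X F0"
    by (elim exE conjE)
  have "\<forall>c\<in>F0. \<exists>m. c \<in> J m" using F0(1) by auto
  then obtain M where M: "\<And>c. c \<in> F0 \<Longrightarrow> c \<in> J (M c)" by metis
  obtain e where e: "\<And>c. c \<in> F0 \<Longrightarrow> M c \<le> e"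
    using finite_nat_set_iff_bounded_le[of "M ` F0"] F0(2) by auto
  have "\<forall>m. \<forall>c\<in>J m. \<exists>g. g \<in> I \<and> lead X x g m c" by (auto simp: J_def)
  then obtain G where G: "\<And>m c. c \<in> J m \<Longrightarrow> G m c \<in> I" "\<And>m c. c \<in> J m \<Longrightarrow> lead X x (G m c) m c" by metis
  define GG where "GG = (\<Union>m\<le>e. G m ` F m) \<union> (\<lambda>c. G (M c) c) ` F0"
  have GGf: "finite GG" unfolding GG_def using F(2) F0(2) by auto
  have GGI: "GG \<subseteq> I" unfolding GG_def using G F(1) M by blast
  define L where "L m = {c. \<exists>h\<in>idl ?Y GG. lead X x h m c}" for m
  have Lid: "c \<in> L m" if "c \<in> idl X B" "B \<subseteq> L m" for c B m
    using that
  proof (induction rule: idl.induct)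
    case idl_zero
    then show ?case unfolding L_def by (auto intro: lead_zero idl.idl_zero)
  next
    case (idl_comb b r g)
    then obtain h h' where h: "h \<in> idl ?Y GG" "lead X x h m b" "h' \<in> idl ?Y GG" "lead X x h' m g"
      unfolding L_def by auto
    then have "lead X x (\<lambda>p. r p * h p + h' p) m (\<lambda>p. r p * b p + g p)"
      by (intro lead_comb) (use idl_comb in auto)
    moreover have "(\<lambda>p. r p * h p + h' p) \<in> idl ?Y GG"
      by (rule idl_add[OF idl_mult]) (use h idl_comb XY in auto)
    ultimately show ?case unfolding L_def by blast
  qed
  have JL: "J m \<subseteq> L m" for m
  proof (cases "m \<le> e")
    case True
    have "F m \<subseteq> L m"
    proof
      fix c assume c: "c \<in> F m"
      then have "G m c \<in> GG" using True by (auto simp: GG_def)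
      then show "c \<in> L m" using G(2)[of c m] F(1) c idl_base unfolding L_def by blast
    qed
    then show ?thesis using F(3) Lid by blast
  next
    case False
    have "F0 \<subseteq> L m"
    proof
      fix c assume c: "c \<in> F0"
      then have "G (M c) c \<in> idl ?Y GG" by (auto simp: GG_def intro: idl_base)
      then have "(\<lambda>p. x p ^ (m - M c) * G (M c) c p) \<in> idl ?Y GG"
        by (rule idl_mult) (auto intro: polyfuns_power polyfuns_coord)
      moreover have "lead X x (\<lambda>p. x p ^ (m - M c) * G (M c) c p) (M c + (m - M c)) c"
        by (rule lead_shift) (rule G(2)[OF M[OF c]])
      moreover have "M c + (m - M c) = m" using e[OF c] False by auto
      ultimately show "c \<in> L m" unfolding L_def by auto
    qed
    moreover have "J m \<subseteq> idl X F0" using F0(3) by auto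
    ultimately show ?thesis using Lid by blast
  qed
  have main: "g \<in> idl ?Y GG" if "g \<in> I" "lead X x g m c" for g m c
    using that
  proof (induction m arbitrary: g c rule: less_induct)
    case (less m)
    have "c \<in> L m" using less.prems JL unfolding J_def by blast
    then obtain h where h: "h \<in> idl ?Y GG" "lead X x h m c" by (auto simp: L_def)
    have hI: "h \<in> I" unfolding I_def by (rule idl_trans[OF h(1)]) (use GGI in \<open>simp add: I_def\<close>)
    have "(\<lambda>p. (-1) * h p) \<in> I" unfolding I_def by (rule idl_mult) (use hI in \<open>auto simp: I_def intro: polyfuns_const\<close>)
    then have dI: "(\<lambda>p. g p - h p) \<in> I" using idl_add[of g ?Y A "\<lambda>p. (-1) * h p"] less.prems(1) by (simp add: I_def)
    have "(\<lambda>p. g p - h p) \<in> idl ?Y GG"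
      using lead_cancel[OF less.prems(2) h(2)]
    proof
      assume "\<forall>p. g p - h p = 0"
      then show ?thesis using idl_zero[of ?Y GG] by simp
    qed (use less.IH dI in blast)
    from idl_add[OF this h(1)] show ?case by simp
  qed
  have "I \<subseteq> idl ?Y GG"
  proof
    fix g assume g: "g \<in> I"
    obtain m a where "\<forall>j. a j \<in> polyfuns X" "\<forall>p. g p = (\<Sum>j\<le>m. a j p * x p ^ j)"
      using polyfuns_insert[OF IR[OF g]] by blast
    then have "lead X x g m (a m)" unfolding lead_def by blast
    then show "g \<in> idl ?Y GG" using main g by blast
  qed
  moreover obtain F' where F': "F' \<subseteq> A" "finite F'" "GG \<subseteq> idl ?Y F'"
    using idl_finite_set[OF GGf, of ?Y A] GGI unfolding I_def by auto
  ultimately have "A \<subseteq> idl ?Y F'" using idl_base[of _ A ?Y] idl_trans[of _ ?Y GG F'] unfolding I_def by blast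
  then show "\<exists>F\<subseteq>A. finite F \<and> A \<subseteq> idl ?Y F" using F' by blast
qed

lemma noeth_empty: "noeth {}"
  unfolding noeth_def
proof (intro allI impI)
  fix A :: "('a \<Rightarrow> complex) set" assume A: "A \<subseteq> polyfuns {}"
  have c: "\<exists>c. f = (\<lambda>_. c)" if "f \<in> polyfuns {}" for f :: "'a \<Rightarrow> complex"
    using that by induction auto
  show "\<exists>F\<subseteq>A. finite F \<and> A \<subseteq> idl {} F"
  proof (cases "A \<subseteq> {\<lambda>_. 0}")
    case True
    then show ?thesis by (intro exI[of _ "{}"]) (auto intro: idl_zero)
  next
    case False
    then obtain f where f: "f \<in> A" "f \<noteq> (\<lambda>_. 0)" by auto
    then obtain d where d: "f = (\<lambda>_. d)" using c A by blast
    have "g \<in> idl {} {f}" if "g \<in> A" for g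
    proof -
      have "g \<in> polyfuns {}" using A that by blast
      from c[OF this] obtain e where e: "g = (\<lambda>_. e)" by blast
      have "(\<lambda>x. (\<lambda>_. e / d) x * f x) \<in> idl {} {f}"
        by (rule idl_mult) (auto intro: idl_base polyfuns_const)
      moreover have "(\<lambda>x. (\<lambda>_. e / d) x * f x) = g" using e d f(2) by auto
      ultimately show ?thesis by simp
    qed
    then show ?thesis using f by (intro exI[of _ "{f}"]) auto
  qed
qed

lemma noeth_finite: "finite X \<Longrightarrow> noeth X"
  by (induction X rule: finite_induct) (auto intro: noeth_empty noeth_insert)

text \<open>In an infinite descent choose \<open>g i\<close> vanishing on \<open>Z (Suc i)\<close>
  but not on \<open>Z i\<close>. Finitely many of them generate the ideal of all; for
  \<open>N\<close> beyond their indices they vanish on \<open>Z N\<close>, hence so does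
  \<open>g N\<close>.\<close>

lemma wf_zclosed:
  assumes "finite X"
  shows "wf {(A, B). zclosed X S A \<and> zclosed X S B \<and> A \<subset> B}"
  unfolding wf_iff_no_infinite_down_chain
proof
  assume "\<exists>Z. \<forall>i. (Z (Suc i), Z i) \<in> {(A, B). zclosed X S A \<and> zclosed X S B \<and> A \<subset> B}"
  then obtain Z where "\<forall>i. zclosed X S (Z (Suc i)) \<and> zclosed X S (Z i) \<and> Z (Suc i) \<subset> Z i" by auto
  then have Z: "\<And>i. zclosed X S (Z i)" "\<And>i. Z (Suc i) \<subset> Z i" by blast+
  have "\<exists>g\<in>polyfuns X. (\<forall>x\<in>Z (Suc i). g x = 0) \<and> (\<exists>x\<in>Z i. g x \<noteq> 0)" for i
  proof -
    obtain F where F: "F \<subseteq> polyfuns X" "Z (Suc i) = {x\<in>S. \<forall>f\<in>F. f x = 0}"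
      using Z(1)[of "Suc i"] by (auto simp: zclosed_def)
    obtain x where "x \<in> Z i" "x \<notin> Z (Suc i)" using Z(2)[of i] by auto
    moreover have "x \<in> S" using calculation(1) Z(1) zclosed_subset by blast
    ultimately show ?thesis using F by blast
  qed
  then obtain g where g: "\<And>i. g i \<in> polyfuns X" "\<And>i x. x \<in> Z (Suc i) \<Longrightarrow> g i x = 0"
    "\<And>i. \<exists>x\<in>Z i. g i x \<noteq> 0" by metis
  have "range g \<subseteq> polyfuns X" using g(1) by auto
  from noeth_finite[OF assms, unfolded noeth_def, rule_format, OF this]
  obtain F where F: "F \<subseteq> range g" "finite F" "range g \<subseteq> idl X F"
    by (elim exE conjE)
  obtain I where I: "finite I" "F = g ` I" using finite_subset_image[OF F(2,1)] by blast
  obtain N where N: "\<forall>i\<in>I. i < N" using I(1) finite_nat_set_iff_bounded by auto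
  have dec: "i \<le> j \<Longrightarrow> Z j \<subseteq> Z i" for i j
    by (rule lift_Suc_antimono_le[of Z]) (use Z(2) in auto)
  have "\<forall>x\<in>Z N. h x = 0" if "h \<in> idl X F" for h
    using that
  proof induction
    case (idl_comb b r h)
    obtain i where i: "i \<in> I" "b = g i" using idl_comb(1) I by auto
    have "Z N \<subseteq> Z (Suc i)" using N i by (intro dec) auto
    then show ?case using idl_comb i g(2) by auto
  qed auto
  then have "\<forall>x\<in>Z N. g N x = 0" using F(3) by blast
  then show False using g(3)[of N] by auto
qed

text \<open>A minimal closed set on which \<open>f\<close> stays independent is irreducible: if
  \<open>g * h = 0\<close> with neither factor zero, both zero sets are smaller and carry relations
  \<open>P\<close> and \<open>Q\<close>, so \<open>P * Q\<close> would be a relation on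
  \<open>Z\<close>.\<close>

lemma zprime_component:
  assumes X: "finite X" and Y: "zclosed X S Y" "indep f d Y" "\<And>i. i < d \<Longrightarrow> f i \<in> polyfuns X"
  shows "\<exists>Z\<subseteq>Y. zclosed X S Z \<and> zprime X Z \<and> indep f d Z"
proof -
  let ?Q = "{Z. Z \<subseteq> Y \<and> zclosed X S Z \<and> indep f d Z}"
  have YQ: "Y \<in> ?Q" using Y by auto
  obtain Z where
    "Z \<in> ?Q" "\<forall>W. (W, Z) \<in> {(A, B). zclosed X S A \<and> zclosed X S B \<and> A \<subset> B} \<longrightarrow> W \<notin> ?Q"
    by (rule wfE_min[OF wf_zclosed[OF X, of S] YQ], rule that, assumption, iprover)
  then have ZY: "Z \<subseteq> Y" and Zc: "zclosed X S Z" and Zi: "indep f d Z"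
    and min: "\<And>W. zclosed X S W \<Longrightarrow> W \<subset> Z \<Longrightarrow> \<not> indep f d W" by auto
  have "zprime X Z" unfolding zprime_def
  proof (intro conjI ballI impI)
    show "Z \<noteq> {}"
    proof
      assume "Z = {}"
      then show False using indepD[OF Zi polyfuns_const[of 1 "cds d"]] by simp
    qed
    fix g h assume gh: "g \<in> polyfuns X" "h \<in> polyfuns X" "\<forall>x\<in>Z. g x * h x = 0"
    have *: "\<exists>P p. P \<in> polyfuns (cds d) \<and> P p \<noteq> 0 \<and> (\<forall>x\<in>Z. g x = 0 \<longrightarrow> P (\<lambda>i. f i x) = 0)"
      if g: "g \<in> polyfuns X" "\<not> (\<forall>x\<in>Z. g x = 0)" for g
    proof -
      have "zclosed X Z {x\<in>Z. g x = 0}" using g by (intro zclosed_pf1 pf_polyfuns)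
      then have "zclosed X S {x\<in>Z. g x = 0}" by (rule zclosed_trans[OF Zc])
      then have "\<not> indep f d {x\<in>Z. g x = 0}" by (rule min) (use g in auto)
      then obtain P p where "P \<in> polyfuns (cds d)" "P p \<noteq> 0" "\<And>x. x \<in> {x\<in>Z. g x = 0} \<Longrightarrow> P (\<lambda>i. f i x) = 0"
        by (rule not_indepE) blast
      then show ?thesis by (intro exI[of _ P] exI[of _ p]) auto
    qed
    show "(\<forall>x\<in>Z. g x = 0) \<or> (\<forall>x\<in>Z. h x = 0)"
    proof (rule ccontr)
      assume "\<not> ((\<forall>x\<in>Z. g x = 0) \<or> (\<forall>x\<in>Z. h x = 0))"
      then have n: "\<not> (\<forall>x\<in>Z. g x = 0)" "\<not> (\<forall>x\<in>Z. h x = 0)" by auto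
      obtain P p where P: "P \<in> polyfuns (cds d)" "P p \<noteq> 0" "\<forall>x\<in>Z. g x = 0 \<longrightarrow> P (\<lambda>i. f i x) = 0"
        using *[OF gh(1) n(1)] by (elim exE conjE)
      obtain Q q where Q: "Q \<in> polyfuns (cds d)" "Q q \<noteq> 0" "\<forall>x\<in>Z. h x = 0 \<longrightarrow> Q (\<lambda>i. f i x) = 0"
        using *[OF gh(2) n(2)] by (elim exE conjE)
      have "P (\<lambda>i. f i x) * Q (\<lambda>i. f i x) = 0" if "x \<in> Z" for x using P(3) Q(3) gh(3) that by auto
      then have "P p * Q p = 0" for p by (rule indepD[OF Zi polyfuns_mult[OF P(1) Q(1)]])
      then show False using cds_mult_zero[OF P(1) Q(1)] P(2) Q(2) by auto
    qed
  qed
  then show ?thesis using ZY Zc Zi by blast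
qed

lemma zclosed_decomposition:
  assumes X: "finite X" and Y: "zclosed X S Y"
  shows "\<exists>F. finite F \<and> (\<forall>Z\<in>F. zclosed X S Z \<and> zprime X Z) \<and> Y = \<Union>F"
  using Y
proof (induction Y rule: wf_induct_rule[OF wf_zclosed[OF X, of S]])
  case (1 Y)
  consider "Y = {}" | "zprime X Y" | g h where "g \<in> polyfuns X" "h \<in> polyfuns X" "\<forall>x\<in>Y. g x * h x = 0"
     "\<not> (\<forall>x\<in>Y. g x = 0)" "\<not> (\<forall>x\<in>Y. h x = 0)"
    unfolding zprime_def by blast
  then show ?case
  proof cases
    case 1
    then show ?thesis by (intro exI[of _ "{}"]) auto
  next
    case 2
    then show ?thesis using 1(2) by (intro exI[of _ "{Y}"]) auto
  next
    case (3 g h)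
    let ?A = "{x\<in>Y. g x = 0}" and ?B = "{x\<in>Y. h x = 0}"
    have cl: "zclosed X S ?A" "zclosed X S ?B"
      using zclosed_trans[OF 1(2)] zclosed_pf1[OF pf_polyfuns] 3(1,2) by metis+
    have "\<exists>F. finite F \<and> (\<forall>Z\<in>F. zclosed X S Z \<and> zprime X Z) \<and> ?A = \<Union>F"
      by (rule 1(1)) (use 1(2) cl 3 in auto)
    moreover have "\<exists>F. finite F \<and> (\<forall>Z\<in>F. zclosed X S Z \<and> zprime X Z) \<and> ?B = \<Union>F"
      by (rule 1(1)) (use 1(2) cl 3 in auto)
    ultimately obtain F G where "finite F" "\<forall>Z\<in>F. zclosed X S Z \<and> zprime X Z" "?A = \<Union>F"
      "finite G" "\<forall>Z\<in>G. zclosed X S Z \<and> zprime X Z" "?B = \<Union>G" by auto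
    moreover have "Y = ?A \<union> ?B" using 3(3) by auto
    ultimately have "finite (F \<union> G) \<and> (\<forall>Z\<in>F \<union> G. zclosed X S Z \<and> zprime X Z) \<and> Y = \<Union>(F \<union> G)"
      by (metis Un_iff Union_Un_distrib finite_UnI)
    then show ?thesis by blast
  qed
qed

section \<open>Permanence of growth bounds under closures, unions, images and products\<close>

lemma zdense_mono: "zdense X S T \<Longrightarrow> S \<subseteq> S' \<Longrightarrow> T' \<subseteq> T \<Longrightarrow> zdense X S' T'"
  unfolding zdense_def by blast

lemma zdense_subset: "T \<subseteq> S \<Longrightarrow> zdense X S T"
  unfolding zdense_def by blast

lemma growth_mono:
  assumes "growth X T D" "T' \<subseteq> T" "D \<le> D'"
  shows "growth X T' D'"
proof -
  obtain S C where S: "zdense X S T"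
    and C: "\<And>s. \<exists>B. finite B \<and> card B \<le> C * (s + 1) ^ D \<and> (\<forall>g. pdeg X s g \<longrightarrow> spn B S g)"
    using assms(1) unfolding growth_def growth0_def by blast
  have le: "C * (s + 1) ^ D \<le> C * (s + 1) ^ D'" for s
    using assms(3) by (intro mult_left_mono power_increasing) auto
  have "growth0 X S D'"
    unfolding growth0_def by (rule exI[of _ C]) (metis C le le_trans)
  moreover have "zdense X S T'" using S by (rule zdense_mono) (use assms(2) in auto)
  ultimately show ?thesis unfolding growth_def by blast
qed

lemma growth0_growth: "growth0 X S D \<Longrightarrow> growth X S D"
  unfolding growth_def using zdense_subset[of S S] by blast

lemma spn_restrict_image:
  assumes "spn B S g" shows "spn ((\<lambda>b x. if x \<in> S then b x else 0) ` B) UNIV (\<lambda>x. if x \<in> S then g x else 0)"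
proof (cases "finite B")
  \<comment> \<open>The sum over an infinite set is \<open>0\<close>, so \<open>g\<close> vanishes
    on \<open>S\<close>.\<close>
  case False
  then have "\<forall>x\<in>S. g x = 0" using assms by (auto simp: spn_def)
  then show ?thesis by (intro spn_cong[OF spn_zero]) auto
next
  case True
  let ?r = "\<lambda>b x. if x \<in> S then b x else (0::complex)"
  obtain c where c: "\<forall>x\<in>S. g x = (\<Sum>b\<in>B. c b * b x)" using assms by (auto simp: spn_def)
  have "spn (?r ` B) UNIV (\<lambda>x. \<Sum>b\<in>B. c b * ?r b x)"
    by (intro spn_sum spn_scale spn_base) (use True in auto)
  then show ?thesis by (rule spn_cong) (use c in auto)
qed

text \<open>The two spanning sets are made compatible by extending functions by \<open>0\<close>
  from the disjoint pieces \<open>S\<close> and \<open>T - S\<close>.\<close>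

lemma growth0_Un:
  assumes "growth0 X S D" "growth0 X T D" shows "growth0 X (S \<union> T) D"
proof -
  obtain C where C: "\<And>s. \<exists>B. finite B \<and> card B \<le> C * (s + 1) ^ D \<and> (\<forall>g. pdeg X s g \<longrightarrow> spn B S g)"
    using assms(1) unfolding growth0_def by blast
  obtain C' where C': "\<And>s. \<exists>B. finite B \<and> card B \<le> C' * (s + 1) ^ D \<and> (\<forall>g. pdeg X s g \<longrightarrow> spn B T g)"
    using assms(2) unfolding growth0_def by blast
  have "\<exists>B. finite B \<and> card B \<le> (C + C') * (s + 1) ^ D \<and> (\<forall>g. pdeg X s g \<longrightarrow> spn B (S \<union> T) g)" for s
  proof -
    obtain B where B: "finite B" "card B \<le> C * (s + 1) ^ D" "\<forall>g. pdeg X s g \<longrightarrow> spn B S g" using C by blast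
    obtain B' where B': "finite B'" "card B' \<le> C' * (s + 1) ^ D" "\<forall>g. pdeg X s g \<longrightarrow> spn B' T g" using C' by blast
    let ?T = "T - S"
    let ?B = "(\<lambda>b x. if x \<in> S then b x else 0) ` B" and ?B' = "(\<lambda>b x. if x \<in> ?T then b x else 0) ` B'"
    have "card (?B \<union> ?B') \<le> card B + card B'"
      by (rule order.trans[OF card_Un_le add_mono[OF card_image_le card_image_le]]) (use B B' in auto)
    then have 1: "card (?B \<union> ?B') \<le> (C + C') * (s + 1) ^ D" using B(2) B'(2) by (simp add: distrib_right)
    have "spn (?B \<union> ?B') (S \<union> T) g" if g: "pdeg X s g" for g
    proof -
      have "spn B S g" "spn B' T g" using B(3) B'(3) g by auto
      then have "spn B' ?T g" by (auto simp: spn_def)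
      have "spn (?B \<union> ?B') UNIV (\<lambda>x. (if x \<in> S then g x else 0) + (if x \<in> ?T then g x else 0))"
        by (rule spn_add; rule spn_mono, rule spn_restrict_image)
          (use \<open>spn B S g\<close> \<open>spn B' ?T g\<close> B B' in auto)
      then have "spn (?B \<union> ?B') (S \<union> T) (\<lambda>x. (if x \<in> S then g x else 0) + (if x \<in> ?T then g x else 0))"
        unfolding spn_def by blast
      then show ?thesis by (rule spn_cong) auto
    qed
    then show ?thesis using 1 B(1) B'(1) by (intro exI[of _ "?B \<union> ?B'"]) auto
  qed
  then show ?thesis unfolding growth0_def by blast
qed

lemma growth_Un:
  assumes "growth X S D" "growth X T D" shows "growth X (S \<union> T) D"
proof -
  obtain S' T' where "zdense X S' S" "growth0 X S' D" "zdense X T' T" "growth0 X T' D"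
    using assms unfolding growth_def by blast
  moreover from this have "zdense X (S' \<union> T') (S \<union> T)" unfolding zdense_def by blast
  ultimately show ?thesis unfolding growth_def using growth0_Un by blast
qed

lemma growth_empty: "growth X {} D"
  by (rule growth0_growth, unfold growth0_def, rule exI[of _ 0]) (auto intro!: exI[of _ "{}"] simp: spn_def)

lemma growth_Union:
  assumes "finite F" "\<And>Z. Z \<in> F \<Longrightarrow> growth X Z D" shows "growth X (\<Union>F) D"
  using assms by (induction F rule: finite_induct) (auto intro: growth_empty growth_Un)

lemma growth0_affine: "growth0 (cds D) UNIV D"
  unfolding growth0_def
proof (intro exI allI conjI)
  fix s
  define M :: "nat \<Rightarrow> ((nat \<Rightarrow> complex) \<Rightarrow> complex) set"
    where "M s = (\<lambda>b p. \<Prod>k<D. p k ^ b k) ` expos D s" for s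
  have fM: "finite (M s)" for s unfolding M_def using finite_expos by auto
  show "finite (M s)" by (rule fM)
  show "card (M s) \<le> 1 * (s + 1) ^ D"
    using card_image_le[OF finite_expos, of "\<lambda>b p. \<Prod>k<D. (p k :: complex) ^ b k" D s] unfolding M_def card_expos by simp
  fix g :: "(nat \<Rightarrow> complex) \<Rightarrow> complex"
  show "pdeg (cds D) s g \<longrightarrow> spn (M s) UNIV g"
  proof
    assume "pdeg (cds D) s g"
    then show "spn (M s) UNIV g"
    proof induction
      case (pdeg_const s c)
      have "(\<lambda>p. \<Prod>k<D. p k ^ (restrict (\<lambda>_. 0) {..<D}) k) \<in> M s" unfolding M_def by (intro imageI PiE_I) auto
      then have "spn (M s) UNIV (\<lambda>p. c * (\<Prod>k<D. p k ^ (restrict (\<lambda>_. 0) {..<D}) k))"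
        by (intro spn_scale spn_base fM)
      then show ?case by (rule spn_cong) simp
    next
      case (pdeg_coord f s g)
      obtain i where i: "i < D" "f = (\<lambda>p. p i)" using pdeg_coord(1) by (auto simp: cds_def)
      show ?case
      proof (rule spn_lin[OF pdeg_coord(3)])
        fix m assume "m \<in> M s"
        then obtain b where b: "b \<in> expos D s" "m = (\<lambda>p. \<Prod>k<D. p k ^ b k)" by (auto simp: M_def)
        let ?b = "b(i := Suc (b i))"
        have "?b \<in> expos D (Suc s)"
          using b(1) i(1) by (fastforce simp: PiE_iff extensional_def)
        moreover have "f p * m p = (\<Prod>k<D. p k ^ ?b k)" for p
        proof -
          have "(\<Prod>k<D. p k ^ ?b k) = p i ^ ?b i * (\<Prod>k\<in>{..<D} - {i}. p k ^ ?b k)"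
            using i by (intro prod.remove) auto
          also have "(\<Prod>k\<in>{..<D} - {i}. p k ^ ?b k) = (\<Prod>k\<in>{..<D} - {i}. p k ^ b k)"
            by (rule prod.cong) auto
          also have "p i ^ ?b i * \<dots> = p i * (p i ^ b i * \<dots>)" by simp
          also have "p i ^ b i * (\<Prod>k\<in>{..<D} - {i}. p k ^ b k) = (\<Prod>k<D. p k ^ b k)"
            using i by (intro prod.remove[symmetric]) auto
          finally show ?thesis using i b by simp
        qed
        ultimately have "(\<lambda>p. f p * m p) \<in> M (Suc s)" unfolding M_def by (intro image_eqI[of _ _ ?b]) auto
        then show "spn (M (Suc s)) UNIV (\<lambda>p. f p * m p)" by (intro spn_base fM)
      qed
    next
      case (pdeg_Suc s f)
      have "expos D s \<subseteq> expos D (Suc s)" by (rule PiE_mono) auto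
      then have "M s \<subseteq> M (Suc s)" unfolding M_def by (rule image_mono)
      then show ?case using spn_mono[OF pdeg_Suc(2)] fM by blast
    qed (rule spn_add)
  qed
qed

lemma pdeg_comp:
  assumes "finite X" "\<And>f. f \<in> X \<Longrightarrow> pf Y T (\<lambda>t. f (\<phi> t))"
  shows "\<exists>e. \<forall>s g. pdeg X s g \<longrightarrow> (\<exists>h. pdeg Y (e * s) h \<and> (\<forall>t\<in>T. g (\<phi> t) = h t))"
proof -
  have "\<forall>f\<in>X. \<exists>h. h \<in> polyfuns Y \<and> (\<forall>t\<in>T. f (\<phi> t) = h t)" using assms(2) unfolding pf_def by blast
  from bchoice[OF this] obtain h where h: "\<And>f. f \<in> X \<Longrightarrow> h f \<in> polyfuns Y" "\<And>f t. f \<in> X \<Longrightarrow> t \<in> T \<Longrightarrow> f (\<phi> t) = h f t"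
    by blast
  obtain e where e: "\<forall>f\<in>X. pdeg Y e (h f)" using polyfuns_pdeg_finite[OF assms(1), of h Y] h(1) by auto
  have "\<exists>h. pdeg Y (e * s) h \<and> (\<forall>t\<in>T. g (\<phi> t) = h t)" if "pdeg X s g" for s g
    using that
  proof induction
    case (pdeg_const s c)
    then show ?case by (intro exI[of _ "\<lambda>_. c"]) (auto intro: pdeg.pdeg_const)
  next
    case (pdeg_coord f s g)
    then obtain k where k: "pdeg Y (e * s) k" "\<forall>t\<in>T. g (\<phi> t) = k t" by auto
    show ?case
      by (rule exI[of _ "\<lambda>t. h f t * k t"]) (use pdeg_mult[OF e[rule_format, OF pdeg_coord(1)] k(1)] k(2) h(2)[OF pdeg_coord(1)] in auto)
  next
    case (pdeg_add s f g)
    then obtain k l where k: "pdeg Y (e * s) k" "\<forall>t\<in>T. f (\<phi> t) = k t" "pdeg Y (e * s) l" "\<forall>t\<in>T. g (\<phi> t) = l t" by auto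
    show ?case
      by (rule exI[of _ "\<lambda>t. k t + l t"]) (use k pdeg.pdeg_add in auto)
  next
    case (pdeg_Suc s f)
    then obtain k where k: "pdeg Y (e * s) k" "\<forall>t\<in>T. f (\<phi> t) = k t" by auto
    show ?case
      by (rule exI[of _ k]) (use k pdeg_mono[OF k(1)] in auto)
  qed
  then show ?thesis by blast
qed

text \<open>Spanning functions on \<open>T\<close> are transported to the image along an arbitrary
  section \<open>\<psi>\<close> of \<open>\<phi>\<close>. They need not remain polynomial, but a
  span may consist of any functions.\<close>

lemma growth0_image:
  assumes X: "finite X" and co: "\<And>f. f \<in> X \<Longrightarrow> pf Y T (\<lambda>t. f (\<phi> t))" and g: "growth0 Y T D"
  shows "growth0 X (\<phi> ` T) D"
proof -
  obtain e where e: "\<And>s g. pdeg X s g \<Longrightarrow> \<exists>h. pdeg Y (e * s) h \<and> (\<forall>t\<in>T. g (\<phi> t) = h t)"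
    using pdeg_comp[of X Y T \<phi>, OF X co] by blast
  obtain C where C: "\<And>s. \<exists>B. finite B \<and> card B \<le> C * (s + 1) ^ D \<and> (\<forall>g. pdeg Y s g \<longrightarrow> spn B T g)"
    using g unfolding growth0_def by blast
  have "\<exists>B. finite B \<and> card B \<le> (C * (e + 1) ^ D) * (s + 1) ^ D \<and> (\<forall>g. pdeg X s g \<longrightarrow> spn B (\<phi> ` T) g)" for s
  proof -
    obtain B where B: "finite B" "card B \<le> C * (e * s + 1) ^ D" "\<forall>g. pdeg Y (e * s) g \<longrightarrow> spn B T g" using C by blast
    define \<psi> where "\<psi> = inv_into T \<phi>"
    have \<psi>: "\<psi> x \<in> T" "\<phi> (\<psi> x) = x" if "x \<in> \<phi> ` T" for x
      unfolding \<psi>_def using that by (auto intro: inv_into_into f_inv_into_f)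
    let ?B = "(\<lambda>b x. b (\<psi> x)) ` B"
    have "card ?B \<le> card B" using B(1) by (rule card_image_le)
    also have "\<dots> \<le> C * (e * s + 1) ^ D" by (rule B)
    also have "\<dots> \<le> C * ((e + 1) * (s + 1)) ^ D" by (intro mult_left_mono power_mono) auto
    finally have 1: "card ?B \<le> (C * (e + 1) ^ D) * (s + 1) ^ D" by (simp only: power_mult_distrib mult.assoc)
    have "spn ?B (\<phi> ` T) g" if g: "pdeg X s g" for g
    proof -
      obtain h where h: "pdeg Y (e * s) h" "\<forall>t\<in>T. g (\<phi> t) = h t" using e[OF g] by blast
      then have "spn B T h" using B(3) by blast
      then obtain c where c: "\<forall>t\<in>T. h t = (\<Sum>b\<in>B. c b * b t)" by (auto simp: spn_def)
      have "spn ?B (\<phi> ` T) (\<lambda>x. \<Sum>b\<in>B. c b * b (\<psi> x))"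
        by (intro spn_sum spn_scale spn_base) (use B(1) in auto)
      moreover have "(\<Sum>b\<in>B. c b * b (\<psi> x)) = g x" if "x \<in> \<phi> ` T" for x
        using c h(2) \<psi>[OF that] by metis
      ultimately show ?thesis by (rule spn_cong)
    qed
    then show ?thesis using 1 B(1) by (intro exI[of _ ?B]) auto
  qed
  then show ?thesis unfolding growth0_def by blast
qed

lemma growth_affine_image:
  assumes "finite X" "\<And>f. f \<in> X \<Longrightarrow> pf (cds D) UNIV (\<lambda>t. f (\<phi> t))"
  shows "growth X (range \<phi>) D"
  by (intro growth0_growth growth0_image[OF assms growth0_affine])

definition pair_coords :: "('a \<Rightarrow> complex) set \<Rightarrow> ('b \<Rightarrow> complex) set \<Rightarrow> ('a \<times> 'b \<Rightarrow> complex) set" where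
  "pair_coords X Y = (\<lambda>f. f \<circ> fst) ` X \<union> (\<lambda>f. f \<circ> snd) ` Y"

lemma pf_pair_fst: "pf X S g \<Longrightarrow> pf (pair_coords X Y) (S \<times> T) (\<lambda>z. g (fst z))"
  by (rule pf_comp[of X S]) (auto simp: pair_coords_def comp_def intro!: pf_coord)

lemma pf_pair_snd: "pf Y T g \<Longrightarrow> pf (pair_coords X Y) (S \<times> T) (\<lambda>z. g (snd z))"
  by (rule pf_comp[of Y T]) (auto simp: pair_coords_def comp_def intro!: pf_coord)

lemma pf_slice_fst: "pf (pair_coords X Y) (S \<times> T) g \<Longrightarrow> y \<in> T \<Longrightarrow> pf X S (\<lambda>x. g (x, y))"
  by (rule pf_comp[of "pair_coords X Y" "S \<times> T"]) (auto simp: pair_coords_def intro: pf_coord pf_const)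

lemma pf_slice_snd: "pf (pair_coords X Y) (S \<times> T) g \<Longrightarrow> x \<in> S \<Longrightarrow> pf Y T (\<lambda>y. g (x, y))"
  by (rule pf_comp[of "pair_coords X Y" "S \<times> T"]) (auto simp: pair_coords_def intro: pf_coord pf_const)

lemma pdeg_pair:
  assumes "pdeg (pair_coords X Y) s g"
  shows "\<exists>L. (\<forall>(p, q)\<in>set L. pdeg X s p \<and> pdeg Y s q) \<and> (\<forall>x y. g (x, y) = (\<Sum>(p, q)\<leftarrow>L. p x * q y))"
  using assms
proof induction
  case (pdeg_const s c)
  show ?case by (rule exI[of _ "[(\<lambda>_. c, \<lambda>_. 1)]"]) (auto intro: pdeg.pdeg_const)
next
  case (pdeg_coord f s g)
  obtain L where L: "\<forall>(p, q)\<in>set L. pdeg X s p \<and> pdeg Y s q" "\<forall>x y. g (x, y) = (\<Sum>(p, q)\<leftarrow>L. p x * q y)"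
    using pdeg_coord(3) by blast
  from pdeg_coord(1) consider u where "u \<in> X" "f = u \<circ> fst" | v where "v \<in> Y" "f = v \<circ> snd"
    by (auto simp: pair_coords_def)
  then show ?case
  proof cases
    case 1
    show ?thesis
      by (rule exI[of _ "map (\<lambda>(p, q). (\<lambda>x. u x * p x, q)) L"])
        (use L 1 in \<open>auto simp: sum_list_const_mult[symmetric] comp_def split_def mult.assoc intro: pdeg.pdeg_coord pdeg_Suc\<close>)
  next
    case 2
    show ?thesis
      by (rule exI[of _ "map (\<lambda>(p, q). (p, \<lambda>y. v y * q y)) L"])
        (use L 2 in \<open>auto simp: sum_list_const_mult[symmetric] comp_def split_def mult.left_commute intro: pdeg.pdeg_coord pdeg_Suc\<close>)
  qed
next
  case (pdeg_add s f g)
  obtain L where L: "\<forall>(p, q)\<in>set L. pdeg X s p \<and> pdeg Y s q" "\<forall>x y. f (x, y) = (\<Sum>(p, q)\<leftarrow>L. p x * q y)"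
    using pdeg_add(3) by blast
  obtain M where M: "\<forall>(p, q)\<in>set M. pdeg X s p \<and> pdeg Y s q" "\<forall>x y. g (x, y) = (\<Sum>(p, q)\<leftarrow>M. p x * q y)"
    using pdeg_add(4) by blast
  show ?case by (rule exI[of _ "L @ M"]) (use L M in auto)
next
  case (pdeg_Suc s f)
  obtain L where L: "\<forall>(p, q)\<in>set L. pdeg X s p \<and> pdeg Y s q" "\<forall>x y. f (x, y) = (\<Sum>(p, q)\<leftarrow>L. p x * q y)"
    using pdeg_Suc(2) by blast
  show ?case by (rule exI[of _ L]) (use L in \<open>auto intro: pdeg.pdeg_Suc\<close>)
qed

lemma growth_Times:
  assumes "growth X S D" "growth Y T E"
  shows "growth (pair_coords X Y) (S \<times> T) (D + E)"
proof -
  obtain S' C where S: "zdense X S' S"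
    and C: "\<And>s. \<exists>B. finite B \<and> card B \<le> C * (s + 1) ^ D \<and> (\<forall>g. pdeg X s g \<longrightarrow> spn B S' g)"
    using assms(1) unfolding growth_def growth0_def by blast
  obtain T' C' where T: "zdense Y T' T"
    and C': "\<And>s. \<exists>B. finite B \<and> card B \<le> C' * (s + 1) ^ E \<and> (\<forall>g. pdeg Y s g \<longrightarrow> spn B T' g)"
    using assms(2) unfolding growth_def growth0_def by blast
  \<comment> \<open>Density passes from \<open>S'\<close> to \<open>S\<close> with the second
    variable fixed in \<open>T'\<close>, then from \<open>T'\<close> to \<open>T\<close> with the
    first variable fixed in \<open>S\<close>.\<close>
  have "zdense (pair_coords X Y) (S' \<times> T') (S \<times> T)"
    unfolding zdense_def
  proof (intro ballI impI)
    fix g z assume g: "g \<in> polyfuns (pair_coords X Y)" "\<forall>z\<in>S' \<times> T'. g z = 0" "z \<in> S \<times> T"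
    have sl: "(\<lambda>x. g (x, y)) \<in> polyfuns X" "(\<lambda>y. g (x, y)) \<in> polyfuns Y" for x y
      using pf_slice_fst[of X Y UNIV UNIV g y] pf_slice_snd[of X Y UNIV UNIV g x] g(1) by (auto simp: pf_UNIV)
    have "g (x, y) = 0" if "x \<in> S" "y \<in> T'" for x y
      using S sl(1)[of y] g(2) that unfolding zdense_def by auto
    then have "g (x, y) = 0" if "x \<in> S" "y \<in> T" for x y
      using T sl(2)[of x] that unfolding zdense_def by auto
    then show "g z = 0" using g(3) by auto
  qed
  moreover have "\<exists>B. finite B \<and> card B \<le> (C * C') * (s + 1) ^ (D + E) \<and>
      (\<forall>g. pdeg (pair_coords X Y) s g \<longrightarrow> spn B (S' \<times> T') g)" for s
  proof -
    obtain B where B: "finite B" "card B \<le> C * (s + 1) ^ D" "\<forall>g. pdeg X s g \<longrightarrow> spn B S' g" using C by blast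
    obtain B' where B': "finite B'" "card B' \<le> C' * (s + 1) ^ E" "\<forall>g. pdeg Y s g \<longrightarrow> spn B' T' g" using C' by blast
    let ?B = "(\<lambda>(a, b) z. a (fst z) * b (snd z)) ` (B \<times> B')"
    have "card ?B \<le> card B * card B'"
      using card_image_le[of "B \<times> B'" "\<lambda>(a, b) z. a (fst z) * b (snd z)"] B(1) B'(1) by (simp add: card_cartesian_product)
    also have "\<dots> \<le> (C * (s + 1) ^ D) * (C' * (s + 1) ^ E)" using B(2) B'(2) by (rule mult_mono) auto
    finally have 1: "card ?B \<le> (C * C') * (s + 1) ^ (D + E)" by (simp add: power_add mult_ac)
    have pq: "spn ?B (S' \<times> T') (\<lambda>z. p (fst z) * q (snd z))" if pq: "pdeg X s p" "pdeg Y s q" for p q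
    proof -
      obtain c where c: "\<forall>x\<in>S'. p x = (\<Sum>b\<in>B. c b * b x)" using B(3)[rule_format, OF pq(1)] unfolding spn_def by blast
      obtain d where d: "\<forall>y\<in>T'. q y = (\<Sum>b\<in>B'. d b * b y)" using B'(3)[rule_format, OF pq(2)] unfolding spn_def by blast
      have "spn ?B (S' \<times> T') (\<lambda>z. \<Sum>a\<in>B. \<Sum>b\<in>B'. (c a * d b) * (a (fst z) * b (snd z)))"
        by (intro spn_sum spn_scale spn_base) (use B(1) B'(1) in auto)
      then show ?thesis
        by (rule spn_cong) (use c d in \<open>auto simp: sum_product mult_ac\<close>)
    qed
    have "spn ?B (S' \<times> T') g" if g: "pdeg (pair_coords X Y) s g" for g
    proof -
      obtain L where L: "\<forall>(p, q)\<in>set L. pdeg X s p \<and> pdeg Y s q" "\<forall>x y. g (x, y) = (\<Sum>(p, q)\<leftarrow>L. p x * q y)"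
        using pdeg_pair[OF g] by blast
      have "spn ?B (S' \<times> T') (\<lambda>z. \<Sum>(p, q)\<leftarrow>L. p (fst z) * q (snd z))"
        using L(1) by (induction L) (auto intro!: spn_zero spn_add pq)
      then show ?thesis by (rule spn_cong) (use L(2) in auto)
    qed
    then show ?thesis using 1 B(1) B'(1) by (intro exI[of _ ?B]) auto
  qed
  then have "growth0 (pair_coords X Y) (S' \<times> T') (D + E)" unfolding growth0_def by blast
  ultimately show ?thesis unfolding growth_def by blast
qed

text \<open>The two groups of variables are freed one after the other: for fixed \<open>y\<close>
  the polynomial vanishes identically in the first \<open>d\<close> variables, and then also in the
  last \<open>e\<close>.\<close>

lemma indep_Times:
  assumes "indep f d S" "indep g e T"
  shows "indep (\<lambda>i z. if i < d then f i (fst z) else g (i - d) (snd z)) (d + e) (S \<times> T)"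
  unfolding indep_def
proof (intro ballI impI allI)
  fix P p assume P: "P \<in> polyfuns (cds (d + e))"
    "\<forall>z\<in>S \<times> T. P (\<lambda>i. if i < d then f i (fst z) else g (i - d) (snd z)) = 0"
  have 1: "P (\<lambda>i. if i < d then a i else g (i - d) y) = 0" if "y \<in> T" for a y
  proof (rule indepD[OF assms(1), of "\<lambda>a. P (\<lambda>i. if i < d then a i else g (i - d) y)"])
    have "(\<lambda>a. if i < d then a i else g (i - d) y) \<in> polyfuns (cds d)" for i
      by (cases "i < d") (auto intro: polyfuns_const polyfuns_coord cds_coord)
    then show "(\<lambda>a. P (\<lambda>i. if i < d then a i else g (i - d) y)) \<in> polyfuns (cds d)"
      by (rule polyfuns_cds_comp[OF P(1)])
    fix x assume "x \<in> S"
    then show "P (\<lambda>i. if i < d then f i x else g (i - d) y) = 0" using P(2)[rule_format, of "(x, y)"] that by (simp cong: if_cong)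
  qed
  have "P (\<lambda>i. if i < d then p i else b (i - d)) = 0" for b
  proof (rule indepD[OF assms(2), of "\<lambda>b. P (\<lambda>i. if i < d then p i else b (i - d))"])
    have "(\<lambda>b. if i < d then p i else b (i - d)) \<in> polyfuns (cds e)" if "i < d + e" for i
      using that by (cases "i < d") (auto intro!: polyfuns_const polyfuns_coord cds_coord)
    then show "(\<lambda>b. P (\<lambda>i. if i < d then p i else b (i - d))) \<in> polyfuns (cds e)"
      by (rule polyfuns_cds_comp[OF P(1)])
  qed (use 1 in auto)
  from this[of "\<lambda>i. p (i + d)"] show "P p = 0"
    using cds_cong[OF P(1), where p = "\<lambda>i. if i < d then p i else p (i - d + d)" and q = p] by auto
qed

section \<open>Maximal independent families\<close>

lemma indep_le: assumes "indep f e S" "d \<le> e" shows "indep f d S"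
  unfolding indep_def
proof (intro ballI impI allI)
  fix P p assume P: "P \<in> polyfuns (cds d)" "\<forall>x\<in>S. P (\<lambda>i. f i x) = 0"
  have "cds d \<subseteq> cds e" using assms(2) by (auto simp: cds_def)
  then have "P \<in> polyfuns (cds e)" using P(1) polyfuns_mono by blast
  then show "P p = 0" by (rule indepD[OF assms(1)]) (use P(2) in auto)
qed

text \<open>For irreducible \<open>Z\<close> this is a transcendence basis of the function field
  that consists of polynomial functions. The relations it yields take the place of algebraic field
  extensions.\<close>

definition maxind :: "('a \<Rightarrow> complex) set \<Rightarrow> (nat \<Rightarrow> 'a \<Rightarrow> complex) \<Rightarrow> nat \<Rightarrow> 'a set \<Rightarrow> bool" where
  "maxind X f d Z \<longleftrightarrow> (\<forall>i<d. f i \<in> polyfuns X) \<and> indep f d Z \<and>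
     (\<forall>g\<in>polyfuns X. \<not> indep (f(d := g)) (Suc d) Z)"

lemma maxind_extend:
  assumes "growth X Z D" "indep f d Z" "\<And>i. i < d \<Longrightarrow> f i \<in> polyfuns X"
  shows "\<exists>e g. d \<le> e \<and> (\<forall>i<d. g i = f i) \<and> maxind X g e Z"
proof -
  let ?E = "{e. d \<le> e \<and> (\<exists>g. (\<forall>i<d. g i = f i) \<and> (\<forall>i<e. g i \<in> polyfuns X) \<and> indep g e Z)}"
  have "?E \<subseteq> {..D}" using indep_le_growth[OF assms(1)] by auto
  then have fin: "finite ?E" by (rule finite_subset) auto
  have "d \<in> ?E" using assms(2,3) by auto
  then have "Max ?E \<in> ?E" using fin by (intro Max_in) auto
  then obtain g where g: "d \<le> Max ?E" "\<forall>i<d. g i = f i" "\<forall>i<Max ?E. g i \<in> polyfuns X" "indep g (Max ?E) Z" by auto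
  have "\<not> indep (g(Max ?E := h)) (Suc (Max ?E)) Z" if "h \<in> polyfuns X" for h
  proof
    assume "indep (g(Max ?E := h)) (Suc (Max ?E)) Z"
    then have "Suc (Max ?E) \<in> ?E" using g that
      by (intro CollectI conjI exI[of _ "g(Max ?E := h)"]) (auto simp: less_Suc_eq)
    then have "Suc (Max ?E) \<le> Max ?E" using fin by (intro Max_ge)
    then show False by simp
  qed
  then have "maxind X g (Max ?E) Z" using g unfolding maxind_def by blast
  then show ?thesis using g by blast
qed

lemma maxind_relation:
  assumes "maxind X f d Z" "g \<in> polyfuns X"
  obtains m Q where "\<And>j. Q j \<in> polyfuns (cds d)" "\<exists>j\<le>m. \<exists>p. Q j p \<noteq> 0"
    "\<And>x. x \<in> Z \<Longrightarrow> (\<Sum>j\<le>m. Q j (\<lambda>i. f i x) * g x ^ j) = 0"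
proof -
  have "\<not> indep (f(d := g)) (Suc d) Z" using assms unfolding maxind_def by blast
  then obtain P p where P: "P \<in> polyfuns (cds (Suc d))" "P p \<noteq> 0" "\<And>x. x \<in> Z \<Longrightarrow> P (\<lambda>i. (f(d := g)) i x) = 0"
    by (rule not_indepE) blast
  obtain m Q where Q: "\<forall>j. Q j \<in> polyfuns (cds d)" "\<forall>p. P p = (\<Sum>j\<le>m. Q j p * p d ^ j)"
    using polyfuns_insert[of P "\<lambda>p. p d" "cds d"] P(1) unfolding cds_Suc by blast
  show ?thesis
  proof (rule that[of Q m])
    show "Q j \<in> polyfuns (cds d)" for j using Q(1) by blast
    show "\<exists>j\<le>m. \<exists>p. Q j p \<noteq> 0"
    proof (rule ccontr)
      assume "\<not> (\<exists>j\<le>m. \<exists>p. Q j p \<noteq> 0)"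
      then have "P p = 0" using Q(2) by simp
      then show False using P(2) by simp
    qed
    fix x assume x: "x \<in> Z"
    have "Q j (\<lambda>i. (f(d := g)) i x) = Q j (\<lambda>i. f i x)" for j
      by (rule cds_cong[OF Q(1)[rule_format]]) auto
    then show "(\<Sum>j\<le>m. Q j (\<lambda>i. f i x) * g x ^ j) = 0" using P(3)[OF x] Q(2) by simp
  qed
qed

lemma maxind_relation_top:
  assumes "maxind X f d Z" "g \<in> polyfuns X"
  obtains m Q where "\<And>j. Q j \<in> polyfuns (cds d)" "\<exists>p. Q m p \<noteq> 0" "m > 0"
    "\<And>x. x \<in> Z \<Longrightarrow> (\<Sum>j\<le>m. Q j (\<lambda>i. f i x) * g x ^ j) = 0"
proof -
  obtain m Q where Q: "\<And>j. Q j \<in> polyfuns (cds d)" "\<exists>j\<le>m. \<exists>p. Q j p \<noteq> 0"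
    "\<And>x. x \<in> Z \<Longrightarrow> (\<Sum>j\<le>m. Q j (\<lambda>i. f i x) * g x ^ j) = 0"
    by (rule maxind_relation[OF assms], rule that)
  let ?J = "{j. j \<le> m \<and> (\<exists>p. Q j p \<noteq> 0)}"
  define e where "e = Max ?J"
  have "e \<in> ?J" unfolding e_def by (rule Max_in) (use Q(2) in auto)
  then have e: "e \<le> m" "\<exists>p. Q e p \<noteq> 0" by auto
  have gt: "Q j p = 0" if "j \<le> m" "j > e" for j p
  proof (rule ccontr)
    assume "Q j p \<noteq> 0"
    then have "j \<in> ?J" using that by blast
    then have "j \<le> e" unfolding e_def by (intro Max_ge) auto
    then show False using that by simp
  qed
  have rel: "(\<Sum>j\<le>e. Q j (\<lambda>i. f i x) * g x ^ j) = 0" if "x \<in> Z" for x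
  proof -
    have "(\<Sum>j\<le>m. Q j (\<lambda>i. f i x) * g x ^ j) = (\<Sum>j\<le>e. Q j (\<lambda>i. f i x) * g x ^ j)"
      by (rule sum.mono_neutral_right) (use e gt in auto)
    then show ?thesis using Q(3)[OF that] by simp
  qed
  have "e > 0"
  proof (rule ccontr)
    assume "\<not> e > 0"
    then have "Q e (\<lambda>i. f i x) = 0" if "x \<in> Z" for x using rel[OF that] by simp
    moreover have "indep f d Z" using assms(1) by (auto simp: maxind_def)
    ultimately have "Q e p = 0" for p using indepD[of f d Z "Q e" p] Q(1) by auto
    then show False using e by auto
  qed
  show ?thesis by (rule that[of Q e, OF Q(1) e(2) \<open>e > 0\<close> rel])
qed

text \<open>Each coordinate \<open>y\<close> satisfies a relation of degree \<open>e y\<close> over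
  \<open>f\<close> with leading coefficient \<open>a y (e y)\<close>. Where the product
  \<open>u\<close> of all leading coefficients is nonzero, the coordinates are integral over
  \<open>f\<close>: a function of degree \<open>s\<close>, multiplied by \<open>u ^ s\<close>, is a
  combination of the finitely many monomials \<open>mon c\<close> with \<open>c y < e y\<close>,
  with coefficients of degree O(s) in \<open>f\<close>. On this dense open set only \<open>d\<close>
  variables count.\<close>

lemma maxind_growth:
  assumes X: "finite X" and Z: "zprime X Z" and mx: "maxind X f d Z"
  shows "growth X Z d"
proof -
  let ?f = "\<lambda>x i. f i x"
  have f: "\<And>i. i < d \<Longrightarrow> f i \<in> polyfuns X" and ind: "indep f d Z" using mx by (auto simp: maxind_def)
  define rel where "rel y m Q \<longleftrightarrow> (\<forall>j. Q j \<in> polyfuns (cds d)) \<and> (\<exists>p. Q m p \<noteq> 0) \<and> m > 0 \<and>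
      (\<forall>x\<in>Z. (\<Sum>j\<le>m. Q j (?f x) * y x ^ j) = 0)" for y m Q
  have "\<exists>mQ. rel y (fst mQ) (snd mQ)" if y: "y \<in> X" for y
  proof -
    obtain m Q where "\<And>j. Q j \<in> polyfuns (cds d)" "\<exists>p. Q m p \<noteq> 0" "m > 0"
      "\<And>x. x \<in> Z \<Longrightarrow> (\<Sum>j\<le>m. Q j (\<lambda>i. f i x) * y x ^ j) = 0"
      by (rule maxind_relation_top[OF mx polyfuns_coord[OF y]], rule that)
    then have "rel y m Q" unfolding rel_def by blast
    then show ?thesis by (intro exI[of _ "(m, Q)"]) simp
  qed
  then have "\<forall>y\<in>X. \<exists>mQ. rel y (fst mQ) (snd mQ)" by blast
  from bchoice[OF this] obtain ea where ea: "\<forall>y\<in>X. rel y (fst (ea y)) (snd (ea y))" by blast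
  define e a where "e y = fst (ea y)" and "a y = snd (ea y)" for y
  have r: "rel y (e y) (a y)" if "y \<in> X" for y using ea that by (simp add: e_def a_def)
  have a: "a y j \<in> polyfuns (cds d)" "\<exists>p. a y (e y) p \<noteq> 0" "e y > 0" if "y \<in> X" for y j
    using r[OF that] unfolding rel_def by auto
  have a4: "(\<Sum>j\<le>e y. a y j (?f x) * y x ^ j) = 0" if "y \<in> X" "x \<in> Z" for y x
    using r[OF that(1)] that(2) unfolding rel_def by auto
  define u where "u p = (\<Prod>y\<in>X. a y (e y) p)" for p
  define w where "w y p = (\<Prod>y'\<in>X - {y}. a y' (e y') p)" for y p
  have u: "u \<in> polyfuns (cds d)" unfolding u_def by (rule polyfuns_prod) (use a in auto)
  have w: "w y \<in> polyfuns (cds d)" for y unfolding w_def by (rule polyfuns_prod) (use a in auto)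
  have uw: "u p = w y p * a y (e y) p" if "y \<in> X" for y p
    unfolding u_def w_def using X that by (subst prod.remove) auto
  have un: "\<exists>p. u p \<noteq> 0" unfolding u_def by (rule cds_prod_nonzero[OF X]) (use a in auto)
  have "\<exists>K. \<forall>i\<in>(SIGMA y:X. {..e y}). pdeg (cds d) K ((\<lambda>(y, j) p. - (w y p * a y j p)) i)"
    by (rule polyfuns_pdeg_finite)
      (use X a(1) w in \<open>auto simp: split_beta intro!: polyfuns_uminus[OF polyfuns_mult]\<close>)
  then obtain K1 where K1: "\<forall>i\<in>(SIGMA y:X. {..e y}). pdeg (cds d) K1 ((\<lambda>(y, j) p. - (w y p * a y j p)) i)"
    by (elim exE)
  obtain K2 where K2: "pdeg (cds d) K2 u" using polyfuns_pdeg[OF u] by blast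
  \<comment> \<open>One bound for the degree of \<open>u\<close> and of all coefficients that a
    single reduction introduces.\<close>
  define K where "K = max K1 K2"
  have Ku: "pdeg (cds d) K u" using pdeg_mono[OF K2] by (simp add: K_def)
  have Kw: "pdeg (cds d) K (\<lambda>p. - (w y p * a y j p))" if "y \<in> X" "j \<le> e y" for y j
    using pdeg_mono[of "cds d" K1 _ K] K1 that by (auto simp: K_def)
  define CC where "CC = PiE X (\<lambda>y. {..<e y})"
  have fCC: "finite CC" unfolding CC_def using X by (intro finite_PiE) auto
  define mon where "mon c x = (\<Prod>y\<in>X. y x ^ c y)" for c x
  define W where "W s h \<longleftrightarrow> (\<exists>q. (\<forall>c\<in>CC. pdeg (cds d) (K * s) (q c)) \<and> (\<forall>x\<in>Z. h x = (\<Sum>c\<in>CC. q c (?f x) * mon c x)))" for s h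
  have W_single: "W s (\<lambda>x. q (?f x) * mon c x)" if "pdeg (cds d) (K * s) q" "c \<in> CC" for s q c
    unfolding W_def
  proof (rule exI[of _ "\<lambda>c'. if c' = c then q else (\<lambda>_. 0)"], rule conjI; rule ballI)
    show "pdeg (cds d) (K * s) (if c' = c then q else (\<lambda>_. 0))" for c'
      by (cases "c' = c") (simp_all add: that pdeg_const)
    fix x
    have "(\<Sum>c'\<in>CC. (if c' = c then q else (\<lambda>_. 0)) (?f x) * mon c' x) = (\<Sum>c'\<in>CC. if c' = c then q (?f x) * mon c' x else 0)"
      by (rule sum.cong) auto
    also have "\<dots> = q (?f x) * mon c x" using that fCC by simp
    finally show "q (?f x) * mon c x = (\<Sum>c'\<in>CC. (if c' = c then q else (\<lambda>_. 0)) (?f x) * mon c' x)" ..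
  qed
  have W_add: "W s (\<lambda>x. g x + h x)" if gh: "W s g" "W s h" for s g h
  proof -
    obtain q where q: "\<forall>c\<in>CC. pdeg (cds d) (K * s) (q c)" "\<forall>x\<in>Z. g x = (\<Sum>c\<in>CC. q c (?f x) * mon c x)"
      using gh(1) unfolding W_def by blast
    obtain r where r: "\<forall>c\<in>CC. pdeg (cds d) (K * s) (r c)" "\<forall>x\<in>Z. h x = (\<Sum>c\<in>CC. r c (?f x) * mon c x)"
      using gh(2) unfolding W_def by blast
    show ?thesis unfolding W_def
      by (rule exI[of _ "\<lambda>c p. q c p + r c p"]) (use q r in \<open>auto intro: pdeg_add simp: sum.distrib distrib_right\<close>)
  qed
  have W_zero: "W s (\<lambda>_. 0)" for s
    unfolding W_def by (rule exI[of _ "\<lambda>_ _. 0"]) (auto intro: pdeg_const)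
  have W_sum: "W s (\<lambda>x. \<Sum>i\<in>I. g i x)" if "\<And>i. i \<in> I \<Longrightarrow> W s (g i)" for I s and g :: "'i \<Rightarrow> 'a \<Rightarrow> complex"
    using that by (induction I rule: infinite_finite_induct) (auto intro: W_zero W_add)
  have W_cong: "W s h" if "W s g" "\<And>x. x \<in> Z \<Longrightarrow> g x = h x" for s g h
    using that unfolding W_def by auto
  have W_u: "W (Suc s) (\<lambda>x. u (?f x) * h x)" if h: "W s h" for s h
  proof -
    obtain q where q: "\<forall>c\<in>CC. pdeg (cds d) (K * s) (q c)" "\<forall>x\<in>Z. h x = (\<Sum>c\<in>CC. q c (?f x) * mon c x)"
      using h unfolding W_def by blast
    show ?thesis unfolding W_def
      by (rule exI[of _ "\<lambda>c p. u p * q c p"])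
        (use q pdeg_mult[OF Ku] in \<open>auto simp: sum_distrib_left mult.assoc\<close>)
  qed
  \<comment> \<open>Multiplication by \<open>y\<close> raises one exponent. If it reaches
    \<open>e y\<close>, the relation replaces \<open>y ^ e y\<close> by lower powers; the extra
    factor \<open>u = w y * a y (e y)\<close> supplies the leading coefficient, so that no division
    occurs.\<close>
  have W_y: "W (Suc s) (\<lambda>x. u (?f x) * (y x * h x))" if h: "W s h" and y: "y \<in> X" for s h y
  proof -
    obtain q where q: "\<forall>c\<in>CC. pdeg (cds d) (K * s) (q c)" "\<forall>x\<in>Z. h x = (\<Sum>c\<in>CC. q c (?f x) * mon c x)"
      using h unfolding W_def by blast
    have mon_upd: "mon (c(y := j)) x * y x ^ c y = mon c x * y x ^ j" for c j x
    proof -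
      have "mon c' x = y x ^ c' y * (\<Prod>y'\<in>X - {y}. y' x ^ c' y')" for c'
        unfolding mon_def using X y by (rule prod.remove)
      moreover have "(\<Prod>y'\<in>X - {y}. y' x ^ (c(y := j)) y') = (\<Prod>y'\<in>X - {y}. y' x ^ c y')"
        by (rule prod.cong) auto
      ultimately show ?thesis by simp
    qed
    have mon_split: "mon c x = y x ^ c y * mon (c(y := 0)) x" for c x
      using mon_upd[of c 0 x] by (simp add: mult.commute)
    have mon_upd': "mon (c(y := j)) x = y x ^ j * mon (c(y := 0)) x" for c j x
      using mon_split[of "c(y := j)" x] by simp
    have CC_upd: "c(y := j) \<in> CC" if "c \<in> CC" "j < e y" for c j
      using that y unfolding CC_def by (auto simp: PiE_iff extensional_def)
    have "W (Suc s) (\<lambda>x. \<Sum>c\<in>CC. u (?f x) * (y x * (q c (?f x) * mon c x)))"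
    proof (rule W_sum)
      fix c assume c: "c \<in> CC"
      have qc: "pdeg (cds d) (K * s) (q c)" using q(1) c by blast
      show "W (Suc s) (\<lambda>x. u (?f x) * (y x * (q c (?f x) * mon c x)))"
      proof (cases "Suc (c y) < e y")
        case True
        have "pdeg (cds d) (K * Suc s) (\<lambda>p. u p * q c p)" using pdeg_mult[OF Ku qc] by simp
        from W_single[OF this CC_upd[OF c True]]
        show ?thesis by (rule W_cong) (simp add: mon_upd'[of c "Suc (c y)"] mon_split[of c] del: fun_upd_apply)
      next
        case False
        have "c y < e y" using c y unfolding CC_def by auto
        then have cy: "Suc (c y) = e y" using False by simp
        have "W (Suc s) (\<lambda>x. \<Sum>j<e y. (- (w y (?f x) * a y j (?f x)) * q c (?f x)) * mon (c(y := j)) x)"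
        proof (rule W_sum)
          fix j assume j: "j \<in> {..<e y}"
          have "pdeg (cds d) (K * Suc s) (\<lambda>p. - (w y p * a y j p) * q c p)"
            using pdeg_mult[OF Kw[OF y, of j] qc] j by simp
          from W_single[OF this CC_upd[OF c]] j
          show "W (Suc s) (\<lambda>x. (- (w y (?f x) * a y j (?f x)) * q c (?f x)) * mon (c(y := j)) x)" by simp
        qed
        then show ?thesis
        proof (rule W_cong)
          fix x assume x: "x \<in> Z"
          have "(\<Sum>j<e y. a y j (?f x) * y x ^ j) + a y (e y) (?f x) * y x ^ e y = 0"
            using a4[OF y x] by (simp add: lessThan_Suc_atMost[symmetric])
          then have top: "a y (e y) (?f x) * y x ^ e y = - (\<Sum>j<e y. a y j (?f x) * y x ^ j)"
            by (simp add: eq_neg_iff_add_eq_0 add.commute)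
          have "u (?f x) * (y x * (q c (?f x) * mon c x))
              = (a y (e y) (?f x) * y x ^ e y) * (w y (?f x) * q c (?f x) * mon (c(y := 0)) x)"
            unfolding uw[OF y] mon_split[of c] cy[symmetric] by (simp add: mult_ac)
          also have "\<dots> = (\<Sum>j<e y. (- (w y (?f x) * a y j (?f x)) * q c (?f x)) * mon (c(y := j)) x)"
            unfolding top sum_negf[symmetric] sum_distrib_right
          proof (rule sum.cong[OF refl])
            fix j
            show "- (a y j (?f x) * y x ^ j) * (w y (?f x) * q c (?f x) * mon (c(y := 0)) x)
              = (- (w y (?f x) * a y j (?f x)) * q c (?f x)) * mon (c(y := j)) x"
              unfolding mon_upd'[of c j x] by (simp add: mult_ac)
          qed
          finally show "(\<Sum>j<e y. (- (w y (?f x) * a y j (?f x)) * q c (?f x)) * mon (c(y := j)) x)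
            = u (?f x) * (y x * (q c (?f x) * mon c x))" ..
        qed
      qed
    qed
    then show ?thesis
      by (rule W_cong) (use q(2) in \<open>simp add: sum_distrib_left\<close>)
  qed
  have W_main: "W s (\<lambda>x. u (?f x) ^ s * g x)" if "pdeg X s g" for s g
    using that
  proof induction
    case (pdeg_const s c)
    define c0 where "c0 = restrict (\<lambda>_. 0::nat) X"
    have "c0 \<in> CC" unfolding CC_def c0_def using a(3) by (intro PiE_I) auto
    moreover have "pdeg (cds d) (K * s) (\<lambda>p. c * u p ^ s)"
      using pdeg_scale[OF pdeg_power[OF Ku, of s]] by (simp add: mult.commute)
    ultimately have "W s (\<lambda>x. (c * u (?f x) ^ s) * mon c0 x)" by (intro W_single)
    moreover have "mon c0 x = 1" for x unfolding mon_def c0_def by simp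
    ultimately show ?case by (simp add: mult.commute)
  next
    case (pdeg_coord y s g)
    from W_y[OF pdeg_coord(3,1)] show ?case by (simp add: mult_ac)
  next
    case (pdeg_add s g h)
    from W_add[OF pdeg_add(3,4)] show ?case by (simp add: distrib_left)
  next
    case (pdeg_Suc s g)
    from W_u[OF pdeg_Suc(2)] show ?case by (simp add: mult.assoc)
  qed
  define S where "S = {x\<in>Z. u (?f x) \<noteq> 0}"
  have pu: "pf X Z (\<lambda>x. u (?f x))" by (rule pf_polyfuns[OF polyfuns_cds_comp[OF u f]])
  have "\<exists>x\<in>Z. u (?f x) \<noteq> 0" using indepD[OF ind u] un by metis
  then obtain x0 where x0: "x0 \<in> Z" "u (?f x0) \<noteq> 0" by blast
  have "zdense X S Z"
    unfolding zdense_def S_def using zprime_open(2)[OF Z pu x0] by (auto intro: pf_polyfuns)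
  moreover have "growth0 X S d"
  proof -
    obtain C where C: "\<And>s. \<exists>B. finite B \<and> card B \<le> C * (s + 1) ^ d \<and> (\<forall>g. pdeg (cds d) s g \<longrightarrow> spn B UNIV g)"
      using growth0_affine[of d] unfolding growth0_def by blast
    have "\<exists>B. finite B \<and> card B \<le> (card CC * C * (K + 1) ^ d) * (s + 1) ^ d \<and> (\<forall>g. pdeg X s g \<longrightarrow> spn B S g)" for s
    proof -
      obtain B where B: "finite B" "card B \<le> C * (K * s + 1) ^ d" "\<forall>g. pdeg (cds d) (K * s) g \<longrightarrow> spn B UNIV g" using C by blast
      let ?b = "\<lambda>(c, b) x. b (?f x) * mon c x / u (?f x) ^ s"
      let ?B = "?b ` (CC \<times> B)"
      have "card ?B \<le> card CC * card B"
        using card_image_le[of "CC \<times> B" ?b] fCC B(1) by (simp add: card_cartesian_product)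
      also have "\<dots> \<le> card CC * (C * (K * s + 1) ^ d)" using B(2) by (rule mult_le_mono2)
      also have "\<dots> \<le> card CC * (C * ((K + 1) * (s + 1)) ^ d)" by (intro mult_le_mono2 power_mono) auto
      finally have 1: "card ?B \<le> (card CC * C * (K + 1) ^ d) * (s + 1) ^ d"
        by (simp only: power_mult_distrib mult.assoc)
      have "spn ?B S g" if g: "pdeg X s g" for g
      proof -
        obtain q where q: "\<forall>c\<in>CC. pdeg (cds d) (K * s) (q c)" "\<forall>x\<in>Z. u (?f x) ^ s * g x = (\<Sum>c\<in>CC. q c (?f x) * mon c x)"
          using W_main[OF g] unfolding W_def by blast
        have "\<forall>c\<in>CC. \<exists>k. \<forall>p. q c p = (\<Sum>b\<in>B. k b * b p)"
        proof
          fix c assume "c \<in> CC"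
          then have "spn B UNIV (q c)" using q(1) B(3) by auto
          then show "\<exists>k. \<forall>p. q c p = (\<Sum>b\<in>B. k b * b p)" by (simp add: spn_def)
        qed
        from bchoice[OF this] obtain k where k: "\<forall>c\<in>CC. \<forall>p. q c p = (\<Sum>b\<in>B. k c b * b p)" ..
        have "spn ?B S (\<lambda>x. \<Sum>c\<in>CC. \<Sum>b\<in>B. k c b * ?b (c, b) x)"
          by (intro spn_sum spn_scale spn_base) (use B(1) fCC in auto)
        then show ?thesis
        proof (rule spn_cong)
          fix x assume x: "x \<in> S"
          have "(\<Sum>c\<in>CC. \<Sum>b\<in>B. k c b * ?b (c, b) x) = (\<Sum>c\<in>CC. q c (?f x) * mon c x) / u (?f x) ^ s"
            unfolding sum_divide_distrib
          proof (rule sum.cong[OF refl])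
            fix c assume c: "c \<in> CC"
            have "q c (?f x) = (\<Sum>b\<in>B. k c b * b (?f x))" by (rule k[rule_format, OF c])
            then show "(\<Sum>b\<in>B. k c b * ?b (c, b) x) = q c (?f x) * mon c x / u (?f x) ^ s"
              by (simp add: sum_distrib_right sum_divide_distrib mult.assoc)
          qed
          also have "\<dots> = g x" using q(2) x unfolding S_def by (auto simp: field_simps)
          finally show "(\<Sum>c\<in>CC. \<Sum>b\<in>B. k c b * ?b (c, b) x) = g x" .
        qed
      qed
      then show ?thesis using 1 B(1) fCC by (intro exI[of _ ?B]) auto
    qed
    then show ?thesis unfolding growth0_def by blast
  qed
  ultimately show ?thesis unfolding growth_def by blast
qed

section \<open>Extension of characters and chains\<close>

text \<open>An algebra homomorphism to the complex numbers from the restrictions of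
  \<open>polyfuns Y\<close> to \<open>Z\<close>. It stands for a point of the closure of the image
  of \<open>Z\<close> under the functions in \<open>Y\<close>.\<close>

definition character :: "('a \<Rightarrow> complex) set \<Rightarrow> 'a set \<Rightarrow> (('a \<Rightarrow> complex) \<Rightarrow> complex) \<Rightarrow> bool" where
  "character Y Z \<phi> \<longleftrightarrow> (\<forall>c. \<phi> (\<lambda>_. c) = c) \<and>
     (\<forall>g\<in>polyfuns Y. \<forall>h\<in>polyfuns Y. \<phi> (\<lambda>x. g x + h x) = \<phi> g + \<phi> h \<and> \<phi> (\<lambda>x. g x * h x) = \<phi> g * \<phi> h) \<and>
     (\<forall>g\<in>polyfuns Y. (\<forall>x\<in>Z. g x = 0) \<longrightarrow> \<phi> g = 0)"

lemma character_const: "character Y Z \<phi> \<Longrightarrow> \<phi> (\<lambda>_. c) = c"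
  by (auto simp: character_def)

lemma character_add: "character Y Z \<phi> \<Longrightarrow> g \<in> polyfuns Y \<Longrightarrow> h \<in> polyfuns Y \<Longrightarrow> \<phi> (\<lambda>x. g x + h x) = \<phi> g + \<phi> h"
  by (auto simp: character_def)

lemma character_mult: "character Y Z \<phi> \<Longrightarrow> g \<in> polyfuns Y \<Longrightarrow> h \<in> polyfuns Y \<Longrightarrow> \<phi> (\<lambda>x. g x * h x) = \<phi> g * \<phi> h"
  by (auto simp: character_def)

lemma character_zero: "character Y Z \<phi> \<Longrightarrow> g \<in> polyfuns Y \<Longrightarrow> (\<And>x. x \<in> Z \<Longrightarrow> g x = 0) \<Longrightarrow> \<phi> g = 0"
  by (auto simp: character_def)

lemma character_diff:
  assumes "character Y Z \<phi>" "g \<in> polyfuns Y" "h \<in> polyfuns Y"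
  shows "\<phi> (\<lambda>x. g x - h x) = \<phi> g - \<phi> h"
proof -
  have "\<phi> (\<lambda>x. (g x - h x) + h x) = \<phi> (\<lambda>x. g x - h x) + \<phi> h"
    by (rule character_add[OF assms(1) polyfuns_diff[OF assms(2,3)] assms(3)])
  then show ?thesis by simp
qed

lemma character_cong:
  assumes "character Y Z \<phi>" "g \<in> polyfuns Y" "h \<in> polyfuns Y" "\<And>x. x \<in> Z \<Longrightarrow> g x = h x"
  shows "\<phi> g = \<phi> h"
proof -
  have "\<phi> (\<lambda>x. g x - h x) = 0"
    by (rule character_zero[OF assms(1) polyfuns_diff[OF assms(2,3)]]) (simp add: assms(4))
  then show ?thesis using character_diff[OF assms(1-3)] by simp
qed

lemma character_mono: "character Y Z \<phi> \<Longrightarrow> polyfuns Y' \<subseteq> polyfuns Y \<Longrightarrow> character Y' Z \<phi>"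
  unfolding character_def by blast

lemma character_comp:
  assumes "character Y Z \<phi>" "P \<in> polyfuns (cds d)" and f: "\<And>i. i < d \<Longrightarrow> f i \<in> polyfuns Y"
  shows "\<phi> (\<lambda>x. P (\<lambda>i. f i x)) = P (\<lambda>i. \<phi> (f i))"
  using assms(2)
proof induction
  case (polyfuns_const c)
  then show ?case by (rule character_const[OF assms(1)])
next
  case (polyfuns_coord g)
  then show ?case by (auto simp: cds_def)
next
  case (polyfuns_add g h)
  then show ?case
    using character_add[OF assms(1) polyfuns_cds_comp[OF polyfuns_add(1) f] polyfuns_cds_comp[OF polyfuns_add(2) f]] by simp
next
  case (polyfuns_mult g h)
  then show ?case
    using character_mult[OF assms(1) polyfuns_cds_comp[OF polyfuns_mult(1) f] polyfuns_cds_comp[OF polyfuns_mult(2) f]] by simp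
qed

text \<open>An element of the extended algebra has many representations, so a value is first
  attached to representations. The relation \<open>R\<close> becomes a function once the value is
  seen to depend only on the restriction to \<open>Z\<close>.\<close>

lemma character_of_relation:
  assumes const: "\<And>c. R (\<lambda>_. c) c"
    and add: "\<And>g h v w. R g v \<Longrightarrow> R h w \<Longrightarrow> R (\<lambda>x. g x + h x) (v + w)"
    and mult: "\<And>g h v w. g \<in> polyfuns Y \<Longrightarrow> h \<in> polyfuns Y \<Longrightarrow> R g v \<Longrightarrow> R h w \<Longrightarrow> R (\<lambda>x. g x * h x) (v * w)"
    and ex: "\<And>g. g \<in> polyfuns Y \<Longrightarrow> \<exists>v. R g v"
    and fn: "\<And>g h v w. R g v \<Longrightarrow> R h w \<Longrightarrow> (\<And>x. x \<in> Z \<Longrightarrow> g x = h x) \<Longrightarrow> v = w"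
  shows "\<exists>\<psi>. character Y Z \<psi> \<and> (\<forall>g v. R g v \<longrightarrow> \<psi> g = v)"
proof -
  define \<psi> where "\<psi> g = (THE v. R g v)" for g
  have \<psi>: "\<psi> g = v" if "R g v" for g v
    unfolding \<psi>_def by (rule the_equality, rule that, rule fn[OF _ that refl])
  have R: "R g (\<psi> g)" if g: "g \<in> polyfuns Y" for g
  proof -
    obtain v where "R g v" using ex[OF g] by blast
    then show ?thesis using \<psi> by simp
  qed
  have "character Y Z \<psi>"
    unfolding character_def
  proof (intro conjI allI ballI impI)
    show "\<psi> (\<lambda>_. c) = c" for c by (rule \<psi>[OF const])
    fix g assume g: "g \<in> polyfuns Y"
    { assume "\<forall>x\<in>Z. g x = 0"
      then show "\<psi> g = 0" by (intro fn[OF R[OF g] const]) auto }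
    fix h assume h: "h \<in> polyfuns Y"
    show "\<psi> (\<lambda>x. g x + h x) = \<psi> g + \<psi> h" by (rule \<psi>[OF add[OF R[OF g] R[OF h]]])
    show "\<psi> (\<lambda>x. g x * h x) = \<psi> g * \<psi> h" by (rule \<psi>[OF mult[OF g h R[OF g] R[OF h]]])
  qed
  then show ?thesis using \<psi> by blast
qed

lemma sum_pad:
  fixes b :: "nat \<Rightarrow> complex" assumes "m \<le> M"
  shows "(\<Sum>j\<le>m. b j) = (\<Sum>j\<le>M. if j \<le> m then b j else 0)"
proof -
  have "(\<Sum>j\<le>M. if j \<le> m then b j else 0) = (\<Sum>j\<le>m. if j \<le> m then b j else 0)"
    by (rule sum.mono_neutral_right) (use assms in auto)
  then show ?thesis by simp
qed

lemma sum_shift: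
  fixes A :: "nat \<Rightarrow> complex"
  shows "(\<Sum>j\<le>e + k. if k \<le> j then A (j - k) * z ^ j else 0) = z ^ k * (\<Sum>j\<le>e. A j * z ^ j)"
proof -
  have "(\<Sum>j\<le>e + k. if k \<le> j then A (j - k) * z ^ j else 0) = (\<Sum>j\<in>{k..e + k}. A (j - k) * z ^ j)"
    by (subst sum.mono_neutral_right[of "{..e + k}" "{k..e + k}"]) auto
  also have "\<dots> = (\<Sum>j\<in>{0..e}. A j * z ^ (j + k))"
    using sum.shift_bounds_cl_nat_ivl[of "\<lambda>j. A (j - k) * z ^ j" 0 k e] by simp
  also have "\<dots> = z ^ k * (\<Sum>j\<le>e. A j * z ^ j)"
    by (simp add: sum_distrib_left power_add mult_ac atLeast0AtMost)
  finally show ?thesis .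
qed

lemma poly_root_exists:
  fixes a :: "nat \<Rightarrow> complex"
  assumes "a e \<noteq> 0" "e > 0" shows "\<exists>t. (\<Sum>j\<le>e. a j * t ^ j) = 0"
proof -
  define p where "p = (\<Sum>j\<le>e. monom (a j) j)"
  have pz: "poly p t = (\<Sum>j\<le>e. a j * t ^ j)" for t by (simp add: p_def poly_sum poly_monom)
  have "coeff p e = (\<Sum>j\<le>e. if j = e then a j else 0)"
    unfolding p_def coeff_sum by (rule sum.cong) auto
  then have "coeff p e = a e" by simp
  then have "degree p \<noteq> 0" using assms le_degree[of p e] by auto
  then have "\<not> constant (poly p)" by (simp add: constant_degree)
  then show ?thesis using fundamental_theorem_of_algebra[of p] pz by auto
qed

text \<open>Adjoining \<open>y\<close> to \<open>polyfuns Y\<close>: for a relation of minimal degree with leading coefficient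
  \<open>w\<close>, pseudo-division shows that every relation of \<open>y\<close> is, up to powers of \<open>w\<close>, a multiple of
  the minimal one. So a character with \<open>\<phi> w \<noteq> 0\<close> extends, sending \<open>y\<close> to a root.\<close>

lemma character_extend_step:
  assumes Z: "zprime X Z" and YX: "Y \<subseteq> polyfuns X" and yX: "y \<in> polyfuns X"
    and rel: "\<And>j. q j \<in> polyfuns Y" "\<exists>j\<le>m. \<exists>x\<in>Z. q j x \<noteq> 0" "\<And>x. x \<in> Z \<Longrightarrow> (\<Sum>j\<le>m. q j x * y x ^ j) = 0"
  shows "\<exists>w\<in>polyfuns Y. (\<exists>x\<in>Z. w x \<noteq> 0) \<and> (\<forall>\<phi>. character Y Z \<phi> \<and> \<phi> w \<noteq> 0 \<longrightarrow>
     (\<exists>\<psi>. character (insert y Y) Z \<psi> \<and> (\<forall>g\<in>polyfuns Y. \<psi> g = \<phi> g)))"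
proof -
  define Q where "Q m \<longleftrightarrow> (\<exists>a. (\<forall>j. a j \<in> polyfuns Y) \<and> (\<exists>j\<le>m. \<exists>x\<in>Z. a j x \<noteq> 0) \<and>
     (\<forall>x\<in>Z. (\<Sum>j\<le>m. a j x * y x ^ j) = 0))" for m
  have "Q m" unfolding Q_def using rel by (intro exI[of _ q]) auto
  define e where "e = (LEAST m. Q m)"
  have "Q e" unfolding e_def by (rule LeastI[of Q, OF \<open>Q m\<close>])
  have min: "\<not> Q k" if "k < e" for k using not_less_Least[of k Q] that by (simp add: e_def)
  obtain a where a: "\<And>j. a j \<in> polyfuns Y" "\<exists>j\<le>e. \<exists>x\<in>Z. a j x \<noteq> 0"
    "\<And>x. x \<in> Z \<Longrightarrow> (\<Sum>j\<le>e. a j x * y x ^ j) = 0" using \<open>Q e\<close> unfolding Q_def by auto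
  have e0: "e > 0"
  proof (rule ccontr)
    assume "\<not> e > 0"
    then have "e = 0" by simp
    then show False using a(2) a(3) by auto
  qed
  have low: "b j x = 0" if "\<And>j. b j \<in> polyfuns Y" "k < e" "\<And>x. x \<in> Z \<Longrightarrow> (\<Sum>j\<le>k. b j x * y x ^ j) = 0" "j \<le> k" "x \<in> Z"
    for b k j x
  proof (rule ccontr)
    assume "b j x \<noteq> 0"
    then have "Q k" unfolding Q_def using that by (intro exI[of _ b]) auto
    then show False using min that by auto
  qed
  have ae: "\<exists>x\<in>Z. a e x \<noteq> 0"
  proof (rule ccontr)
    assume n: "\<not> (\<exists>x\<in>Z. a e x \<noteq> 0)"
    obtain k where k: "e = Suc k" using e0 gr0_implies_Suc by blast
    have "(\<Sum>j\<le>k. a j x * y x ^ j) = 0" if "x \<in> Z" for x using a(3)[OF that] n that k by auto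
    then have "a j x = 0" if "j \<le> k" "x \<in> Z" for j x
      using low[of a k j x] a(1) that k by auto
    then show False using a(2) n k by (metis le_Suc_eq)
  qed
  have ext: "\<exists>\<psi>. character (insert y Y) Z \<psi> \<and> (\<forall>g\<in>polyfuns Y. \<psi> g = \<phi> g)"
    if ch: "character Y Z \<phi>" and w: "\<phi> (a e) \<noteq> 0" for \<phi>
  proof -
    obtain t where t: "(\<Sum>j\<le>e. \<phi> (a j) * t ^ j) = 0"
      using poly_root_exists[of "\<lambda>j. \<phi> (a j)" e] w e0 by auto
    \<comment> \<open>The root \<open>t\<close> of the image of the minimal relation satisfies the
      image of every relation; this makes the value independent of the representation.\<close>
    have zero: "(\<Sum>j\<le>m. \<phi> (b j) * t ^ j) = 0"
      if "\<And>j. b j \<in> polyfuns Y" "\<And>x. x \<in> Z \<Longrightarrow> (\<Sum>j\<le>m. b j x * y x ^ j) = 0" for m b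
      using that
    proof (induction m arbitrary: b rule: less_induct)
      case (less m)
      show ?case
      proof (cases "m < e")
        case True
        have "\<phi> (b j) = 0" if "j \<le> m" for j
          by (rule character_zero[OF ch less.prems(1)]) (rule low[OF less.prems(1) True less.prems(2) that])
        then show ?thesis by simp
      next
        case False
        define k where "k = m - e"
        have m: "m = e + k" using False by (simp add: k_def)
        obtain l where l: "m = Suc l" using m e0 not0_implies_Suc[of m] by auto
        \<comment> \<open>\<open>a e\<close> times the given relation minus
          \<open>b m * y ^ k\<close> times the minimal one: the coefficient of degree
          \<open>m\<close> cancels.\<close>
        define c where "c j = (\<lambda>x. a e x * b j x - b m x * (if k \<le> j then a (j - k) x else 0))" for j
        have ak: "(\<lambda>x. if k \<le> j then a (j - k) x else 0) \<in> polyfuns Y" for j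
          by (cases "k \<le> j") (simp_all add: a(1) polyfuns_const)
        have cY: "c j \<in> polyfuns Y" for j
          unfolding c_def by (rule polyfuns_diff[OF polyfuns_mult[OF a(1) less.prems(1)] polyfuns_mult[OF less.prems(1) ak]])
        have cm: "c m x = 0" for x by (simp add: c_def m)
        have gen: "(\<Sum>j\<le>m. (u * B j - v * (if k \<le> j then A (j - k) else 0)) * z ^ j)
          = u * (\<Sum>j\<le>m. B j * z ^ j) - v * (z ^ k * (\<Sum>j\<le>e. A j * z ^ j))"
          for u v z :: complex and A B :: "nat \<Rightarrow> complex"
        proof -
          have "(\<Sum>j\<le>m. (u * B j - v * (if k \<le> j then A (j - k) else 0)) * z ^ j)
            = (\<Sum>j\<le>m. u * (B j * z ^ j) - v * (if k \<le> j then A (j - k) * z ^ j else 0))"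
            by (rule sum.cong) (auto simp: algebra_simps)
          then show ?thesis unfolding sum_shift[symmetric] m
            by (simp only: sum_subtractf sum_distrib_left)
        qed
        have "(\<Sum>j\<le>l. c j x * y x ^ j) = 0" if "x \<in> Z" for x
        proof -
          have "(\<Sum>j\<le>m. c j x * y x ^ j) = 0"
            unfolding c_def gen[of "a e x" "\<lambda>j. b j x" "b m x" "\<lambda>j. a j x" "y x"] less.prems(2)[OF that] a(3)[OF that] by simp
          then show ?thesis using cm l by simp
        qed
        then have "(\<Sum>j\<le>l. \<phi> (c j) * t ^ j) = 0" by (intro less.IH cY) (use l in auto)
        moreover have "\<phi> (c m) = 0" by (rule character_zero[OF ch cY cm])
        ultimately have c0: "(\<Sum>j\<le>m. \<phi> (c j) * t ^ j) = 0" using l by simp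
        have "\<phi> (c j) = \<phi> (a e) * \<phi> (b j) - \<phi> (b m) * (if k \<le> j then \<phi> (a (j - k)) else 0)" for j
        proof -
          have "\<phi> (\<lambda>x. if k \<le> j then a (j - k) x else 0) = (if k \<le> j then \<phi> (a (j - k)) else 0)"
            using character_const[OF ch, of 0] by simp
          then show ?thesis unfolding c_def
            by (simp only: character_diff[OF ch polyfuns_mult[OF a(1) less.prems(1)] polyfuns_mult[OF less.prems(1) ak]]
               character_mult[OF ch a(1) less.prems(1)] character_mult[OF ch less.prems(1) ak])
        qed
        then have "\<phi> (a e) * (\<Sum>j\<le>m. \<phi> (b j) * t ^ j) = 0"
          using c0 gen[of "\<phi> (a e)" "\<lambda>j. \<phi> (b j)" "\<phi> (b m)" "\<lambda>j. \<phi> (a j)" t] t by simp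
        then show ?thesis using w by simp
      qed
    qed
    define R where "R g v \<longleftrightarrow> (\<exists>m b. (\<forall>j. b j \<in> polyfuns Y) \<and> (\<forall>x\<in>Z. g x = (\<Sum>j\<le>m. b j x * y x ^ j)) \<and>
       v = (\<Sum>j\<le>m. \<phi> (b j) * t ^ j))" for g v
    have pad: "\<exists>b. (\<forall>j. b j \<in> polyfuns Y) \<and> (\<forall>x\<in>Z. g x = (\<Sum>j\<le>M. b j x * y x ^ j)) \<and> v = (\<Sum>j\<le>M. \<phi> (b j) * t ^ j)"
      if b: "\<forall>j. b j \<in> polyfuns Y" "\<forall>x\<in>Z. g x = (\<Sum>j\<le>m. b j x * y x ^ j)" "v = (\<Sum>j\<le>m. \<phi> (b j) * t ^ j)" and M: "m \<le> M"
      for g v m M b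
    proof (rule exI[of _ "\<lambda>j. if j \<le> m then b j else (\<lambda>_. 0)"], intro conjI allI ballI)
      show "(if j \<le> m then b j else (\<lambda>_. 0)) \<in> polyfuns Y" for j using b(1) polyfuns_const[of 0 Y] by simp
      have 1: "(\<Sum>j\<le>M. (if j \<le> m then b j else (\<lambda>_. 0)) x * y x ^ j) = (\<Sum>j\<le>M. if j \<le> m then b j x * y x ^ j else 0)" for x
        by (rule sum.cong) auto
      show "g x = (\<Sum>j\<le>M. (if j \<le> m then b j else (\<lambda>_. 0)) x * y x ^ j)" if "x \<in> Z" for x
        unfolding 1 sum_pad[OF M, symmetric] using b(2) that by blast
      have 2: "(\<Sum>j\<le>M. \<phi> (if j \<le> m then b j else (\<lambda>_. 0)) * t ^ j) = (\<Sum>j\<le>M. if j \<le> m then \<phi> (b j) * t ^ j else 0)"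
        by (rule sum.cong) (auto simp: character_const[OF ch])
      show "v = (\<Sum>j\<le>M. \<phi> (if j \<le> m then b j else (\<lambda>_. 0)) * t ^ j)"
        unfolding 2 sum_pad[OF M, symmetric] by (rule b(3))
    qed
    have common: "\<exists>M b c. (\<forall>j. b j \<in> polyfuns Y) \<and> (\<forall>j. c j \<in> polyfuns Y) \<and> (\<forall>x\<in>Z. g x = (\<Sum>j\<le>M. b j x * y x ^ j)) \<and>
       (\<forall>x\<in>Z. h x = (\<Sum>j\<le>M. c j x * y x ^ j)) \<and> v = (\<Sum>j\<le>M. \<phi> (b j) * t ^ j) \<and> u = (\<Sum>j\<le>M. \<phi> (c j) * t ^ j)"
      if gh: "R g v" "R h u" for g h v u
    proof -
      obtain m b where b: "\<forall>j. b j \<in> polyfuns Y" "\<forall>x\<in>Z. g x = (\<Sum>j\<le>m. b j x * y x ^ j)" "v = (\<Sum>j\<le>m. \<phi> (b j) * t ^ j)"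
        using gh(1) unfolding R_def by (elim exE conjE)
      obtain n c where c: "\<forall>j. c j \<in> polyfuns Y" "\<forall>x\<in>Z. h x = (\<Sum>j\<le>n. c j x * y x ^ j)" "u = (\<Sum>j\<le>n. \<phi> (c j) * t ^ j)"
        using gh(2) unfolding R_def by (elim exE conjE)
      show ?thesis using pad[OF b, of "max m n"] pad[OF c, of "max m n"] by (auto 0 4)
    qed
    have R_fn: "v = u" if gh: "R g v" "R h u" "\<And>x. x \<in> Z \<Longrightarrow> g x = h x" for g h v u
    proof -
      obtain M b c where b: "\<forall>j. b j \<in> polyfuns Y" "\<forall>j. c j \<in> polyfuns Y" "\<forall>x\<in>Z. g x = (\<Sum>j\<le>M. b j x * y x ^ j)"
        "\<forall>x\<in>Z. h x = (\<Sum>j\<le>M. c j x * y x ^ j)" "v = (\<Sum>j\<le>M. \<phi> (b j) * t ^ j)" "u = (\<Sum>j\<le>M. \<phi> (c j) * t ^ j)"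
        using common[OF gh(1,2)] by (elim exE conjE)
      have "(\<Sum>j\<le>M. \<phi> (\<lambda>x. b j x - c j x) * t ^ j) = 0"
      proof (rule zero)
        show "(\<lambda>x. b j x - c j x) \<in> polyfuns Y" for j using b(1,2) by (intro polyfuns_diff) auto
        fix x assume "x \<in> Z"
        then show "(\<Sum>j\<le>M. (b j x - c j x) * y x ^ j) = 0"
          using b(3,4) gh(3) by (simp add: left_diff_distrib sum_subtractf)
      qed
      then show ?thesis unfolding b(5,6)
        using character_diff[OF ch] b(1,2) by (simp add: left_diff_distrib sum_subtractf)
    qed
    have R_add: "R (\<lambda>x. g x + h x) (v + u)" if gh: "R g v" "R h u" for g h v u
    proof -
      obtain M b c where b: "\<forall>j. b j \<in> polyfuns Y" "\<forall>j. c j \<in> polyfuns Y" "\<forall>x\<in>Z. g x = (\<Sum>j\<le>M. b j x * y x ^ j)"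
        "\<forall>x\<in>Z. h x = (\<Sum>j\<le>M. c j x * y x ^ j)" "v = (\<Sum>j\<le>M. \<phi> (b j) * t ^ j)" "u = (\<Sum>j\<le>M. \<phi> (c j) * t ^ j)"
        using common[OF gh] by (elim exE conjE)
      show ?thesis unfolding R_def
      proof (rule exI[of _ M], rule exI[of _ "\<lambda>j x. b j x + c j x"], intro conjI allI ballI)
        show "(\<lambda>x. b j x + c j x) \<in> polyfuns Y" for j using b(1,2) by (intro polyfuns_add) auto
        show "g x + h x = (\<Sum>j\<le>M. (b j x + c j x) * y x ^ j)" if "x \<in> Z" for x
          using b(3,4) that by (simp add: distrib_right sum.distrib)
        show "v + u = (\<Sum>j\<le>M. \<phi> (\<lambda>x. b j x + c j x) * t ^ j)"
          unfolding b(5,6) using character_add[OF ch] b(1,2) by (simp add: distrib_right sum.distrib)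
      qed
    qed
    have R_scale: "R (\<lambda>x. b x * g x) (\<phi> b * v)" if bg: "b \<in> polyfuns Y" "R g v" for b g v
    proof -
      obtain m c where c: "\<forall>j. c j \<in> polyfuns Y" "\<forall>x\<in>Z. g x = (\<Sum>j\<le>m. c j x * y x ^ j)" "v = (\<Sum>j\<le>m. \<phi> (c j) * t ^ j)"
        using bg(2) unfolding R_def by (elim exE conjE)
      show ?thesis unfolding R_def
      proof (rule exI[of _ m], rule exI[of _ "\<lambda>j x. b x * c j x"], intro conjI allI ballI)
        show "(\<lambda>x. b x * c j x) \<in> polyfuns Y" for j using c(1) bg(1) by (intro polyfuns_mult) auto
        show "b x * g x = (\<Sum>j\<le>m. b x * c j x * y x ^ j)" if "x \<in> Z" for x
          using c(2) that by (simp add: sum_distrib_left mult.assoc)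
        show "\<phi> b * v = (\<Sum>j\<le>m. \<phi> (\<lambda>x. b x * c j x) * t ^ j)"
          unfolding c(3) using character_mult[OF ch bg(1)] c(1) by (simp add: sum_distrib_left mult.assoc)
      qed
    qed
    have R_Y: "R g (\<phi> g)" if "g \<in> polyfuns Y" for g
      unfolding R_def by (rule exI[of _ 0], rule exI[of _ "\<lambda>_. g"]) (use that in auto)
    have R_shift: "R (\<lambda>x. y x * g x) (t * v)" if g: "R g v" for g v
    proof -
      obtain m c where c: "\<forall>j. c j \<in> polyfuns Y" "\<forall>x\<in>Z. g x = (\<Sum>j\<le>m. c j x * y x ^ j)" "v = (\<Sum>j\<le>m. \<phi> (c j) * t ^ j)"
        using g unfolding R_def by (elim exE conjE)
      show ?thesis unfolding R_def
      proof (rule exI[of _ "Suc m"], rule exI[of _ "\<lambda>j. case j of 0 \<Rightarrow> (\<lambda>_. 0) | Suc i \<Rightarrow> c i"], intro conjI allI ballI)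
        show "(case j of 0 \<Rightarrow> (\<lambda>_. 0) | Suc i \<Rightarrow> c i) \<in> polyfuns Y" for j
          using c(1) polyfuns_const[of 0 Y] by (cases j) auto
        show "y x * g x = (\<Sum>j\<le>Suc m. (case j of 0 \<Rightarrow> (\<lambda>_. 0) | Suc i \<Rightarrow> c i) x * y x ^ j)" if "x \<in> Z" for x
          unfolding sum.atMost_Suc_shift using c(2) that by (simp add: sum_distrib_left mult_ac)
        show "t * v = (\<Sum>j\<le>Suc m. \<phi> (case j of 0 \<Rightarrow> (\<lambda>_. 0) | Suc i \<Rightarrow> c i) * t ^ j)"
          unfolding sum.atMost_Suc_shift c(3) by (simp add: sum_distrib_left mult_ac character_const[OF ch])
      qed
    qed
    have R_mult': "\<exists>v. R g v \<and> (\<forall>h u. R h u \<longrightarrow> R (\<lambda>x. g x * h x) (v * u))" if "g \<in> polyfuns (insert y Y)" for g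
      using that
    proof induction
      case (polyfuns_const c)
      show ?case
        using R_Y[OF polyfuns.polyfuns_const] R_scale[OF polyfuns.polyfuns_const] character_const[OF ch]
        by (intro exI[of _ c]) simp
    next
      case (polyfuns_coord f)
      then consider "f = y" | "f \<in> Y" by blast
      then show ?case
      proof cases
        case 1
        have "R (\<lambda>x. y x * 1) (t * 1)"
          using R_shift[OF R_Y[OF polyfuns.polyfuns_const[of 1 Y]]] character_const[OF ch] by simp
        then show ?thesis using R_shift 1 by (intro exI[of _ t]) simp
      next
        case 2
        then show ?thesis using R_Y R_scale polyfuns.polyfuns_coord[OF 2]
          by (intro exI[of _ "\<phi> f"]) simp
      qed
    next
      case (polyfuns_add f g)
      then obtain v u where v: "R f v" "\<forall>h w. R h w \<longrightarrow> R (\<lambda>x. f x * h x) (v * w)"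
        and u: "R g u" "\<forall>h w. R h w \<longrightarrow> R (\<lambda>x. g x * h x) (u * w)" by (elim exE conjE)
      show ?case
        by (rule exI[of _ "v + u"]) (use R_add v u in \<open>simp add: distrib_right\<close>)
    next
      case (polyfuns_mult f g)
      then obtain v u where v: "R f v" "\<forall>h w. R h w \<longrightarrow> R (\<lambda>x. f x * h x) (v * w)"
        and u: "R g u" "\<forall>h w. R h w \<longrightarrow> R (\<lambda>x. g x * h x) (u * w)" by (elim exE conjE)
      show ?case
        by (rule exI[of _ "v * u"]) (use v u in \<open>simp add: mult.assoc\<close>)
    qed
    have "\<exists>\<psi>. character (insert y Y) Z \<psi> \<and> (\<forall>g v. R g v \<longrightarrow> \<psi> g = v)"
    proof (rule character_of_relation[of R])
      show "R (\<lambda>_. c) c" for c using R_Y[OF polyfuns_const, of c] character_const[OF ch] by simp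
      show "R (\<lambda>x. g x + h x) (v + w)" if "R g v" "R h w" for g h v w by (rule R_add[OF that])
      show "R (\<lambda>x. g x * h x) (v * w)" if g: "g \<in> polyfuns (insert y Y)" "R g v" "R h w" for g h v w
      proof -
        obtain v' where v': "R g v'" "\<forall>h u. R h u \<longrightarrow> R (\<lambda>x. g x * h x) (v' * u)" using R_mult'[OF g(1)] by (elim exE conjE)
        have "v' = v" by (rule R_fn[OF v'(1) g(2) refl])
        then show ?thesis using v'(2) g(3) by simp
      qed
      show "\<exists>v. R g v" if "g \<in> polyfuns (insert y Y)" for g using R_mult'[OF that] by blast
      show "v = w" if "R g v" "R h w" "\<And>x. x \<in> Z \<Longrightarrow> g x = h x" for g h v w by (rule R_fn[OF that])
    qed
    then obtain \<psi> where \<psi>: "character (insert y Y) Z \<psi>" "\<forall>g v. R g v \<longrightarrow> \<psi> g = v" by (elim exE conjE)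
    then show ?thesis using R_Y by (intro exI[of _ \<psi>]) simp
  qed
  show ?thesis by (rule bexI[of _ "a e"]) (use ae ext a(1) in auto)
qed

lemma polyfuns_family:
  assumes "g \<in> polyfuns (f ` {..<d})"
  shows "\<exists>P\<in>polyfuns (cds d). \<forall>x. g x = P (\<lambda>i. f i x)"
  using assms
proof induction
  case (polyfuns_const c)
  show ?case by (rule bexI[of _ "\<lambda>_. c"]) (simp_all add: polyfuns.polyfuns_const)
next
  case (polyfuns_coord h)
  then obtain i where "i < d" "h = f i" by auto
  then show ?case by (intro bexI[of _ "\<lambda>p. p i"]) (auto intro: polyfuns.polyfuns_coord cds_coord)
next
  case (polyfuns_add g h)
  then obtain P Q where "P \<in> polyfuns (cds d)" "\<forall>x. g x = P (\<lambda>i. f i x)" "Q \<in> polyfuns (cds d)" "\<forall>x. h x = Q (\<lambda>i. f i x)" by auto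
  then show ?case by (intro bexI[of _ "\<lambda>p. P p + Q p"]) (auto intro: polyfuns.polyfuns_add)
next
  case (polyfuns_mult g h)
  then obtain P Q where "P \<in> polyfuns (cds d)" "\<forall>x. g x = P (\<lambda>i. f i x)" "Q \<in> polyfuns (cds d)" "\<forall>x. h x = Q (\<lambda>i. f i x)" by auto
  then show ?case by (intro bexI[of _ "\<lambda>p. P p * Q p"]) (auto intro: polyfuns.polyfuns_mult)
qed

lemma polyfuns_trans:
  assumes "g \<in> polyfuns Y" "Y \<subseteq> polyfuns X" shows "g \<in> polyfuns X"
  using assms(1) by induction (use assms(2) in \<open>auto intro: polyfuns.intros\<close>)

text \<open>After cancelling a power of \<open>w\<close>, the lowest nonzero coefficient of a
  relation of \<open>w\<close> is a multiple of \<open>w\<close>. So a nonzero value of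
  \<open>P\<close> at a parameter point guarantees that \<open>w\<close> does not vanish above
  it.\<close>

lemma maxind_relation_bottom:
  assumes Z: "zprime X Z" and mx: "maxind X f d Z" and w: "w \<in> polyfuns X" "\<exists>x\<in>Z. w x \<noteq> 0"
  shows "\<exists>P\<in>polyfuns (cds d). (\<exists>p. P p \<noteq> 0) \<and>
    (\<exists>s\<in>polyfuns (insert w (f ` {..<d})). \<forall>x\<in>Z. P (\<lambda>i. f i x) = w x * s x)"
proof -
  let ?f = "\<lambda>x i. f i x"
  have f: "f i \<in> polyfuns X" if "i < d" for i using mx that by (auto simp: maxind_def)
  obtain m Q where Q: "\<And>j. Q j \<in> polyfuns (cds d)" "\<exists>j\<le>m. \<exists>p. Q j p \<noteq> 0"
    "\<And>x. x \<in> Z \<Longrightarrow> (\<Sum>j\<le>m. Q j (\<lambda>i. f i x) * w x ^ j) = 0"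
    by (rule maxind_relation[OF mx w(1)], rule that)
  define k where "k = (LEAST j. j \<le> m \<and> (\<exists>p. Q j p \<noteq> 0))"
  have "k \<le> m \<and> (\<exists>p. Q k p \<noteq> 0)" unfolding k_def using Q(2) by (rule LeastI_ex)
  then have k: "k \<le> m" "\<exists>p. Q k p \<noteq> 0" by auto
  have lt: "Q j p = 0" if "j < k" for j p
    using not_less_Least[of j "\<lambda>j. j \<le> m \<and> (\<exists>p. Q j p \<noteq> 0)"] that k(1) unfolding k_def[symmetric] by auto
  define s where "s x = - (\<Sum>j\<in>{Suc k..m}. Q j (?f x) * w x ^ (j - Suc k))" for x
  have Qf: "(\<lambda>x. Q j (?f x)) \<in> polyfuns (f ` {..<d})" for j
    by (rule polyfuns_cds_comp[OF Q(1)]) (auto intro: polyfuns_coord)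
  then have Qf': "(\<lambda>x. Q j (?f x)) \<in> polyfuns (insert w (f ` {..<d}))" for j
    using polyfuns_mono[of "f ` {..<d}" "insert w (f ` {..<d})"] by blast
  have sp: "s \<in> polyfuns (insert w (f ` {..<d}))"
    unfolding s_def
    by (rule polyfuns_uminus, rule polyfuns_sum, rule polyfuns_mult[OF Qf'], rule polyfuns_power, rule polyfuns_coord) simp
  have sX: "s \<in> polyfuns X" by (rule polyfuns_trans[OF sp]) (use w f in auto)
  have QX: "(\<lambda>x. Q k (?f x)) \<in> polyfuns X" by (rule polyfuns_trans[OF Qf]) (use f in auto)
  have eq: "w x ^ k * (Q k (?f x) - w x * s x) = 0" if "x \<in> Z" for x
  proof -
    have "(\<Sum>j\<le>m. Q j (?f x) * w x ^ j) = (\<Sum>j\<in>{k..m}. Q j (?f x) * w x ^ j)"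
      by (rule sum.mono_neutral_right) (use lt in auto)
    also have "\<dots> = Q k (?f x) * w x ^ k + (\<Sum>j\<in>{Suc k..m}. Q j (?f x) * w x ^ j)"
      using k(1) by (simp add: sum.atLeast_Suc_atMost)
    also have "(\<Sum>j\<in>{Suc k..m}. Q j (?f x) * w x ^ j) = w x ^ k * (w x * - s x)"
      unfolding s_def minus_minus sum_distrib_left
    proof (rule sum.cong[OF refl])
      fix j assume "j \<in> {Suc k..m}"
      then obtain l where "j = Suc k + l" using le_Suc_ex[of "Suc k" j] by auto
      then show "Q j (?f x) * w x ^ j = w x ^ k * (w x * (Q j (?f x) * w x ^ (j - Suc k)))"
        by (simp add: power_add mult_ac)
    qed
    finally have "Q k (?f x) * w x ^ k + w x ^ k * (w x * - s x) = 0" using Q(3)[OF that] by simp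
    moreover have "w x ^ k * (Q k (?f x) - w x * s x) = Q k (?f x) * w x ^ k + w x ^ k * (w x * - s x)"
      by (simp add: right_diff_distrib mult.commute[of "Q k (?f x)"])
    ultimately show ?thesis by simp
  qed
  have pd: "pf X Z (\<lambda>x. Q k (?f x) - w x * s x)"
    by (rule pf_polyfuns[OF polyfuns_diff[OF QX polyfuns_mult[OF w(1) sX]]])
  have "(\<forall>x\<in>Z. w x ^ k = 0) \<or> (\<forall>x\<in>Z. Q k (?f x) - w x * s x = 0)"
    by (rule zprimeD[OF Z pf_polyfuns[OF polyfuns_power[OF w(1)]] pd]) (use eq in auto)
  then have "\<forall>x\<in>Z. Q k (?f x) = w x * s x" using w(2) by auto
  then show ?thesis using sp k(2) Q(1) by blast
qed

text \<open>The generators are adjoined one at a time. Each extension is possible for characters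
  with \<open>\<phi> w \<noteq> 0\<close>; multiplying \<open>u\<close> by the polynomial
  \<open>P\<close> from \<open>maxind_relation_bottom\<close> turns this into a condition on the
  parameter \<open>p\<close>.\<close>

lemma character_extend:
  assumes Z: "zprime X Z" and mx: "maxind X f d Z" and C: "finite C" "C \<subseteq> polyfuns X"
  shows "\<exists>u\<in>polyfuns (cds d). (\<exists>p. u p \<noteq> 0) \<and>
    (\<forall>p. u p \<noteq> 0 \<longrightarrow> (\<exists>\<psi>. character (f ` {..<d} \<union> C) Z \<psi> \<and> (\<forall>i<d. \<psi> (f i) = p i)))"
  using C
proof (induction C rule: finite_induct)
  case empty
  have ind: "indep f d Z" using mx by (auto simp: maxind_def)
  have "\<exists>\<psi>. character (f ` {..<d}) Z \<psi> \<and> (\<forall>i<d. \<psi> (f i) = p i)" for p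
  proof -
    define R where "R g v \<longleftrightarrow> (\<exists>P\<in>polyfuns (cds d). (\<forall>x\<in>Z. g x = P (\<lambda>i. f i x)) \<and> v = P p)" for g v
    have "\<exists>\<psi>. character (f ` {..<d}) Z \<psi> \<and> (\<forall>g v. R g v \<longrightarrow> \<psi> g = v)"
    proof (rule character_of_relation[of R])
      show "R (\<lambda>_. c) c" for c unfolding R_def by (rule bexI[of _ "\<lambda>_. c"]) (simp_all add: polyfuns_const)
      show "R (\<lambda>x. g x + h x) (v + w)" if gh: "R g v" "R h w" for g h v w
      proof -
        obtain P Q where "P \<in> polyfuns (cds d)" "\<forall>x\<in>Z. g x = P (\<lambda>i. f i x)" "v = P p"
          "Q \<in> polyfuns (cds d)" "\<forall>x\<in>Z. h x = Q (\<lambda>i. f i x)" "w = Q p" using gh unfolding R_def by (elim bexE conjE)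
        then show ?thesis unfolding R_def by (intro bexI[of _ "\<lambda>q. P q + Q q"]) (simp_all add: polyfuns_add)
      qed
      show "R (\<lambda>x. g x * h x) (v * w)" if gh: "R g v" "R h w" for g h v w
      proof -
        obtain P Q where "P \<in> polyfuns (cds d)" "\<forall>x\<in>Z. g x = P (\<lambda>i. f i x)" "v = P p"
          "Q \<in> polyfuns (cds d)" "\<forall>x\<in>Z. h x = Q (\<lambda>i. f i x)" "w = Q p" using gh unfolding R_def by (elim bexE conjE)
        then show ?thesis unfolding R_def by (intro bexI[of _ "\<lambda>q. P q * Q q"]) (simp_all add: polyfuns_mult)
      qed
      show "\<exists>v. R g v" if g: "g \<in> polyfuns (f ` {..<d})" for g
      proof -
        obtain P where "P \<in> polyfuns (cds d)" "\<forall>x. g x = P (\<lambda>i. f i x)"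
          using polyfuns_family[OF g] by (elim bexE)
        then show ?thesis unfolding R_def by (intro exI[of _ "P p"] bexI[of _ P]) simp_all
      qed
      show "v = w" if gh: "R g v" "R h w" "\<And>x. x \<in> Z \<Longrightarrow> g x = h x" for g h v w
      proof -
        obtain P Q where P: "P \<in> polyfuns (cds d)" "\<forall>x\<in>Z. g x = P (\<lambda>i. f i x)" "v = P p"
          and Q: "Q \<in> polyfuns (cds d)" "\<forall>x\<in>Z. h x = Q (\<lambda>i. f i x)" "w = Q p" using gh(1,2) unfolding R_def by (elim bexE conjE)
        have "P p - Q p = 0"
          by (rule indepD[OF ind polyfuns_diff[OF P(1) Q(1)]]) (use P(2) Q(2) gh(3) in auto)
        then show ?thesis using P(3) Q(3) by simp
      qed
    qed
    then obtain \<psi> where \<psi>: "character (f ` {..<d}) Z \<psi>" "\<forall>g v. R g v \<longrightarrow> \<psi> g = v" by (elim exE conjE)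
    have "R (f i) (p i)" if "i < d" for i
      unfolding R_def by (rule bexI[of _ "\<lambda>q. q i"]) (simp_all add: polyfuns_coord cds_coord that)
    then show ?thesis using \<psi> by (intro exI[of _ \<psi>]) simp
  qed
  then show ?case by (intro bexI[of _ "\<lambda>_. 1"]) (simp_all add: polyfuns_const)
next
  case (insert y C)
  let ?Y = "f ` {..<d} \<union> C"
  have f: "f i \<in> polyfuns X" if "i < d" for i using mx that by (auto simp: maxind_def)
  have YX: "?Y \<subseteq> polyfuns X" and yX: "y \<in> polyfuns X" using insert.prems f by auto
  obtain u where u: "u \<in> polyfuns (cds d)" "\<exists>p. u p \<noteq> 0"
    "\<And>p. u p \<noteq> 0 \<Longrightarrow> \<exists>\<psi>. character ?Y Z \<psi> \<and> (\<forall>i<d. \<psi> (f i) = p i)"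
    using insert.IH insert.prems by auto
  obtain m Q where Q: "\<And>j. Q j \<in> polyfuns (cds d)" "\<exists>p. Q m p \<noteq> 0" "m > 0"
    "\<And>x. x \<in> Z \<Longrightarrow> (\<Sum>j\<le>m. Q j (\<lambda>i. f i x) * y x ^ j) = 0"
    by (rule maxind_relation_top[OF mx yX], rule that)
  have ind: "indep f d Z" using mx by (auto simp: maxind_def)
  have QY: "(\<lambda>x. Q j (\<lambda>i. f i x)) \<in> polyfuns ?Y" for j
    by (rule polyfuns_cds_comp[OF Q(1)]) (auto intro: polyfuns_coord)
  have "\<exists>x\<in>Z. Q m (\<lambda>i. f i x) \<noteq> 0"
  proof (rule ccontr)
    assume "\<not> (\<exists>x\<in>Z. Q m (\<lambda>i. f i x) \<noteq> 0)"
    then have "Q m p = 0" for p using indepD[OF ind Q(1), of m p] by simp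
    then show False using Q(2) by simp
  qed
  then have "\<exists>j\<le>m. \<exists>x\<in>Z. Q j (\<lambda>i. f i x) \<noteq> 0" by blast
  from character_extend_step[OF Z YX yX, of "\<lambda>j x. Q j (\<lambda>i. f i x)", OF QY this Q(4)]
  obtain w where w: "w \<in> polyfuns ?Y" "\<exists>x\<in>Z. w x \<noteq> 0" "\<And>\<phi>. character ?Y Z \<phi> \<Longrightarrow> \<phi> w \<noteq> 0 \<Longrightarrow>
     \<exists>\<psi>. character (insert y ?Y) Z \<psi> \<and> (\<forall>g\<in>polyfuns ?Y. \<psi> g = \<phi> g)" by auto
  have wX: "w \<in> polyfuns X" by (rule polyfuns_trans[OF w(1) YX])
  obtain P s where P: "P \<in> polyfuns (cds d)" "\<exists>p. P p \<noteq> 0" "s \<in> polyfuns (insert w (f ` {..<d}))"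
    "\<forall>x\<in>Z. P (\<lambda>i. f i x) = w x * s x" using maxind_relation_bottom[OF Z mx wX w(2)] by (elim bexE conjE)
  have sY: "s \<in> polyfuns ?Y" by (rule polyfuns_trans[OF P(3)]) (use w(1) in \<open>auto intro: polyfuns_coord\<close>)
  have fY: "f i \<in> polyfuns ?Y" if "i < d" for i using that by (auto intro: polyfuns_coord)
  show ?case
  proof (rule bexI[of _ "\<lambda>p. u p * P p"], intro conjI allI impI)
    show "(\<lambda>p. u p * P p) \<in> polyfuns (cds d)" by (rule polyfuns_mult[OF u(1) P(1)])
    show "\<exists>p. u p * P p \<noteq> 0" using cds_mult_zero[OF u(1) P(1)] u(2) P(2) by auto
    fix p assume "u p * P p \<noteq> 0"
    then have up: "u p \<noteq> 0" and Pp: "P p \<noteq> 0" by auto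
    obtain \<phi> where \<phi>: "character ?Y Z \<phi>" "\<forall>i<d. \<phi> (f i) = p i" using u(3)[OF up] by auto
    have "P p = P (\<lambda>i. \<phi> (f i))" by (rule cds_cong[OF P(1)]) (use \<phi>(2) in auto)
    also have "\<dots> = \<phi> (\<lambda>x. P (\<lambda>i. f i x))" by (rule character_comp[OF \<phi>(1) P(1) fY, symmetric])
    also have "\<dots> = \<phi> (\<lambda>x. w x * s x)"
      by (rule character_cong[OF \<phi>(1) polyfuns_cds_comp[OF P(1) fY] polyfuns_mult[OF w(1) sY]]) (use P(4) in auto)
    also have "\<dots> = \<phi> w * \<phi> s" by (rule character_mult[OF \<phi>(1) w(1) sY])
    finally have "\<phi> w \<noteq> 0" using Pp by auto
    then obtain \<psi> where \<psi>: "character (insert y ?Y) Z \<psi>" "\<forall>g\<in>polyfuns ?Y. \<psi> g = \<phi> g"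
      using w(3)[OF \<phi>(1)] by auto
    have "insert y ?Y = f ` {..<d} \<union> insert y C" by auto
    then show "\<exists>\<psi>. character (f ` {..<d} \<union> insert y C) Z \<psi> \<and> (\<forall>i<d. \<psi> (f i) = p i)"
      using \<psi> \<phi>(2) fY by (intro exI[of _ \<psi>]) auto
  qed
qed

text \<open>Closed subsets of a principal open subset of the affine space \<open>V\<close> with coordinates \<open>X\<close>.\<close>

definition qaffine :: "('a \<Rightarrow> complex) set \<Rightarrow> 'a set \<Rightarrow> 'a set \<Rightarrow> bool" where
  "qaffine X V Z \<longleftrightarrow> finite X \<and> (\<forall>c. \<exists>x\<in>V. \<forall>y\<in>X. y x = c y) \<and>
     (\<exists>v\<in>polyfuns X. zclosed X {x\<in>V. v x \<noteq> 0} Z)"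

lemma qaffine_zclosed: "qaffine X V S \<Longrightarrow> zclosed X S Z \<Longrightarrow> qaffine X V Z"
  unfolding qaffine_def using zclosed_trans by blast

text \<open>A character of all coordinates is evaluation at a point of \<open>V\<close>, since
  \<open>V\<close> realises every choice of values. The equations of \<open>Z\<close> hold there
  because characters respect them, and the factor \<open>P\<close> makes \<open>v\<close> nonzero,
  so the point lies in the principal open set.\<close>

lemma dominant_image:
  assumes q: "qaffine X V Z" and Z: "zprime X Z" and mx: "maxind X f d Z"
  shows "\<exists>u\<in>polyfuns (cds d). (\<exists>p. u p \<noteq> 0) \<and> (\<forall>p. u p \<noteq> 0 \<longrightarrow> (\<exists>x\<in>Z. \<forall>i<d. f i x = p i))"
proof -
  obtain v F where X: "finite X" and V: "\<And>c. \<exists>x\<in>V. \<forall>y\<in>X. y x = c y" and v: "v \<in> polyfuns X"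
    and F: "F \<subseteq> polyfuns X" "Z = {x\<in>{x\<in>V. v x \<noteq> 0}. \<forall>g\<in>F. g x = 0}"
    using q unfolding qaffine_def zclosed_def by blast
  have f: "f i \<in> polyfuns X" if "i < d" for i using mx that by (auto simp: maxind_def)
  have "X \<subseteq> polyfuns X" by (auto intro: polyfuns_coord)
  from character_extend[OF Z mx X this] obtain u where u: "u \<in> polyfuns (cds d)" "\<exists>p. u p \<noteq> 0"
    "\<And>p. u p \<noteq> 0 \<Longrightarrow> \<exists>\<psi>. character (f ` {..<d} \<union> X) Z \<psi> \<and> (\<forall>i<d. \<psi> (f i) = p i)" by auto
  have "Z \<noteq> {}" using Z by (auto simp: zprime_def)
  then have vZ: "\<exists>x\<in>Z. v x \<noteq> 0" using F(2) by auto
  obtain P s where P: "P \<in> polyfuns (cds d)" "\<exists>p. P p \<noteq> 0" "s \<in> polyfuns (insert v (f ` {..<d}))"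
    "\<forall>x\<in>Z. P (\<lambda>i. f i x) = v x * s x" using maxind_relation_bottom[OF Z mx v vZ] by (elim bexE conjE)
  have sX: "s \<in> polyfuns X" by (rule polyfuns_trans[OF P(3)]) (use v f in auto)
  show ?thesis
  proof (rule bexI[of _ "\<lambda>p. u p * P p"], intro conjI allI impI)
    show "(\<lambda>p. u p * P p) \<in> polyfuns (cds d)" by (rule polyfuns_mult[OF u(1) P(1)])
    show "\<exists>p. u p * P p \<noteq> 0" using cds_mult_zero[OF u(1) P(1)] u(2) P(2) by auto
    fix p assume "u p * P p \<noteq> 0"
    then have up: "u p \<noteq> 0" and Pp: "P p \<noteq> 0" by auto
    obtain \<psi> where \<psi>': "character (f ` {..<d} \<union> X) Z \<psi>" "\<forall>i<d. \<psi> (f i) = p i" using u(3)[OF up] by auto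
    have \<psi>: "character X Z \<psi>" by (rule character_mono[OF \<psi>'(1)]) (rule polyfuns_mono, simp)
    obtain z where z: "z \<in> V" "\<forall>y\<in>X. y z = \<psi> y" using V by blast
    have ev: "\<psi> g = g z" if "g \<in> polyfuns X" for g
      using that
    proof induction
      case (polyfuns_const c)
      then show ?case by (rule character_const[OF \<psi>])
    next
      case (polyfuns_coord y)
      then show ?case using z(2) by simp
    next
      case (polyfuns_add g h)
      then show ?case using character_add[OF \<psi>] by simp
    next
      case (polyfuns_mult g h)
      then show ?case using character_mult[OF \<psi>] by simp
    qed
    have "P p = P (\<lambda>i. \<psi> (f i))" by (rule cds_cong[OF P(1)]) (use \<psi>'(2) in auto)
    also have "\<dots> = \<psi> (\<lambda>x. P (\<lambda>i. f i x))" by (rule character_comp[OF \<psi> P(1) f, symmetric])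
    also have "\<dots> = \<psi> (\<lambda>x. v x * s x)"
      by (rule character_cong[OF \<psi> polyfuns_cds_comp[OF P(1) f] polyfuns_mult[OF v sX]]) (use P(4) in auto)
    also have "\<dots> = \<psi> v * \<psi> s" by (rule character_mult[OF \<psi> v sX])
    finally have "v z \<noteq> 0" using Pp ev[OF v] by auto
    moreover have "g z = 0" if "g \<in> F" for g
    proof -
      have "g \<in> polyfuns X" using that F(1) by blast
      then have "\<psi> g = 0" by (rule character_zero[OF \<psi>]) (use that F(2) in auto)
      then show ?thesis using ev[OF \<open>g \<in> polyfuns X\<close>] by simp
    qed
    ultimately have "z \<in> Z" using z(1) F(2) by auto
    moreover have "f i z = p i" if "i < d" for i using ev[OF f[OF that]] \<psi>'(2) that by simp
    ultimately show "\<exists>x\<in>Z. \<forall>i<d. f i x = p i" by blast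
  qed
qed

text \<open>A crude bound, which serves to limit the length of independent families. The coordinates
  need not separate the points of \<open>S\<close>, so representatives of their common values are
  used; these are dense in \<open>S\<close>.\<close>

lemma growth_coords: assumes "finite X" shows "growth X S (card X)"
proof -
  obtain e where e: "bij_betw e {..<card X} X" using assms ex_bij_betw_nat_finite lessThan_atLeast0 by metis
  define \<phi> where "\<phi> x = (\<lambda>i. e i x)" for x
  define T where "T = \<phi> ` S"
  have "growth0 (cds (card X)) T (card X)"
    using growth0_affine[of "card X"] unfolding growth0_def spn_def by (meson UNIV_I)
  define \<psi> where "\<psi> = inv_into S \<phi>"
  have \<psi>: "\<psi> t \<in> S" "\<phi> (\<psi> t) = t" if "t \<in> T" for t
    unfolding \<psi>_def using that by (auto simp: T_def intro: inv_into_into f_inv_into_f)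
  have "pf (cds (card X)) T (\<lambda>t. f (\<psi> t))" if f: "f \<in> X" for f
  proof -
    obtain i where i: "i < card X" "f = e i" using e f by (auto simp: bij_betw_def)
    have "pf (cds (card X)) T (\<lambda>t. t i)" by (rule pf_coord[OF cds_coord[OF i(1)]])
    then show ?thesis by (rule pf_cong) (use \<psi>(2) i in \<open>auto simp: \<phi>_def fun_eq_iff\<close>)
  qed
  from growth0_image[of X "cds (card X)" T \<psi>, OF assms this \<open>growth0 (cds (card X)) T (card X)\<close>]
  have "growth0 X (\<psi> ` T) (card X)" .
  moreover have "zdense X (\<psi> ` T) S"
    unfolding zdense_def
  proof (intro ballI impI)
    fix g x assume g: "g \<in> polyfuns X" "\<forall>x\<in>\<psi> ` T. g x = 0" and x: "x \<in> S"
    have same: "f (\<psi> (\<phi> x)) = f x" if "f \<in> X" for f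
    proof -
      obtain i where i: "i < card X" "f = e i" using e \<open>f \<in> X\<close> by (auto simp: bij_betw_def)
      have "\<phi> (\<psi> (\<phi> x)) = \<phi> x" using \<psi>(2) x by (auto simp: T_def)
      then have "\<phi> (\<psi> (\<phi> x)) i = \<phi> x i" by simp
      then show ?thesis using i by (simp add: \<phi>_def)
    qed
    have "g (\<psi> (\<phi> x)) = g x" using g(1) by induction (use same in auto)
    then show "g x = 0" using g(2) x by (auto simp: T_def)
  qed
  ultimately show ?thesis unfolding growth_def by blast
qed

text \<open>Extend \<open>f\<close> on an irreducible \<open>Z\<close> to a maximal family
  \<open>g\<close> and cut \<open>Z\<close> by \<open>g l = p0 l\<close> with its last member, where
  \<open>p0\<close> lies in the open set of values from \<open>dominant_image\<close>. Generic
  values of the other members still occur on the section \<open>T\<close>, so these stay independent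
  there, and \<open>T\<close> is smaller than \<open>Z\<close>.\<close>

lemma indep_zchain:
  assumes "qaffine X V S" "indep f d S" "\<And>i. i < d \<Longrightarrow> f i \<in> polyfuns X"
  shows "\<exists>Z. zchain X S d Z"
  using assms
proof (induction d arbitrary: S f)
  case 0
  have X: "finite X" using 0 by (auto simp: qaffine_def)
  obtain Z where "zclosed X S Z" "zprime X Z"
    using zprime_component[OF X zclosed_self 0(2)] 0(3) by auto
  then show ?case by (intro exI[of _ "\<lambda>_. Z"]) (auto simp: zchain_def)
next
  case (Suc d)
  have X: "finite X" using Suc by (auto simp: qaffine_def)
  obtain Z where Z: "zclosed X S Z" "zprime X Z" "indep f (Suc d) Z"
    using zprime_component[OF X zclosed_self Suc.prems(2,3)] by auto
  have qZ: "qaffine X V Z" by (rule qaffine_zclosed[OF Suc.prems(1) Z(1)])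
  obtain e g where g: "Suc d \<le> e" "maxind X g e Z"
    using maxind_extend[OF growth_coords[OF X] Z(3) Suc.prems(3)] by auto
  obtain l where l: "e = Suc l" using g(1) by (cases e) auto
  have gX: "\<And>i. i < e \<Longrightarrow> g i \<in> polyfuns X" and gi: "indep g e Z" using g(2) by (auto simp: maxind_def)
  obtain u p0 where u: "u \<in> polyfuns (cds e)" "u p0 \<noteq> 0" "\<forall>p. u p \<noteq> 0 \<longrightarrow> (\<exists>x\<in>Z. \<forall>i<e. g i x = p i)"
    using dominant_image[OF qZ Z(2) g(2)] by auto
  define T where "T = {x\<in>Z. g l x - p0 l = 0}"
  have "zclosed X Z T" unfolding T_def
    by (rule zclosed_pf1[OF pf_polyfuns[OF polyfuns_diff[OF gX polyfuns_const]]]) (simp add: l)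
  then have T: "zclosed X S T" by (rule zclosed_trans[OF Z(1)])
  have "indep g l T"
    unfolding indep_def
  proof (intro ballI impI)
    fix P assume P: "P \<in> polyfuns (cds l)" "\<forall>x\<in>T. P (\<lambda>i. g i x) = 0"
    define u' where "u' p = u (p(l := p0 l))" for p
    have co: "(\<lambda>p. (p(l := p0 l)) i) \<in> polyfuns (cds l)" if "i < e" for i
    proof (cases "i = l")
      case False
      then have "i < l" using that l by simp
      then show ?thesis using False by (simp add: polyfuns_coord cds_coord)
    qed (simp add: polyfuns_const)
    have "(\<lambda>p. u (\<lambda>i. (p(l := p0 l)) i)) \<in> polyfuns (cds l)" by (rule polyfuns_cds_comp[OF u(1) co])
    moreover have "u' = (\<lambda>p. u (\<lambda>i. (p(l := p0 l)) i))" by (rule ext) (rule u'_def)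
    ultimately have u': "u' \<in> polyfuns (cds l)" by (simp only:)
    have "P p = 0" if nz: "u' p \<noteq> 0" for p
    proof -
      obtain x where x: "x \<in> Z" "\<forall>i<e. g i x = (p(l := p0 l)) i" using u(3) nz unfolding u'_def by auto
      then have "x \<in> T" using l by (auto simp: T_def)
      moreover have "P (\<lambda>i. g i x) = P p" by (rule cds_cong[OF P(1)]) (use x(2) l in auto)
      ultimately show ?thesis using P(2) by auto
    qed
    moreover have "u' p0 \<noteq> 0" using u(2) by (simp add: u'_def)
    ultimately show "\<forall>p. P p = 0" using cds_mult_zero[OF u' P(1)] by blast
  qed
  \<comment> \<open>The maximal family may be longer than \<open>Suc d\<close>; only
    \<open>d\<close> of its functions are kept.\<close>
  then have "indep g d T" by (rule indep_le) (use g(1) l in simp)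
  moreover have "g i \<in> polyfuns X" if "i < d" for i using gX that g(1) by simp
  ultimately obtain C where C: "zchain X T d C"
    using Suc.IH[OF qaffine_zclosed[OF Suc.prems(1) T]] by blast
  have "T \<noteq> Z"
  proof
    assume TZ: "T = Z"
    have "(\<lambda>p. p l - p0 l) (p0(l := p0 l + 1)) = 0"
    proof (rule indepD[OF gi, of "\<lambda>p. p l - p0 l"])
      show "(\<lambda>p. p l - p0 l) \<in> polyfuns (cds e)"
        by (rule polyfuns_diff[OF polyfuns_coord[OF cds_coord] polyfuns_const]) (simp add: l)
    qed (use TZ in \<open>auto simp: T_def\<close>)
    then show False by simp
  qed
  then have TZ: "T \<subset> Z" by (auto simp: T_def)
  have CT: "C d \<subseteq> T" using C zclosed_subset unfolding zchain_def by blast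
  have "zchain X S (Suc d) (\<lambda>i. if i \<le> d then C i else Z)"
    unfolding zchain_def
  proof (intro conjI allI impI)
    fix i assume i: "i \<le> Suc d"
    show "zclosed X S (if i \<le> d then C i else Z)"
      using C zclosed_trans[OF T] Z(1) unfolding zchain_def by auto
    show "zprime X (if i \<le> d then C i else Z)" using C Z(2) unfolding zchain_def by auto
  next
    fix i assume i: "i < Suc d"
    show "(if i \<le> d then C i else Z) \<subset> (if Suc i \<le> d then C (Suc i) else Z)"
      using i C CT TZ unfolding zchain_def by (cases "i = d") auto
  qed
  then show ?case by blast
qed

lemma krull_dim_eq:
  assumes "qaffine X V S" "S \<subseteq> V" "indep f d S" "\<And>i. i < d \<Longrightarrow> f i \<in> polyfuns X" "growth X S d"
  shows "krull_dim (subtopology (zariski X V) S) = enat d"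
proof -
  obtain Z where "zchain X S d Z" using indep_zchain[OF assms(1,3,4)] by blast
  then show ?thesis using krull_dim_eqI[OF assms(2)] zchain_le_growth[OF _ assms(5)] by blast
qed

section \<open>Families of matrices\<close>

lemma pf_entry: "i < n \<Longrightarrow> j < n \<Longrightarrow> pf (mat_coords n) S (\<lambda>A. A $$ (i, j))"
  by (rule pf_coord) (auto simp: mat_coords_def)

definition pfm :: "('a \<Rightarrow> complex) set \<Rightarrow> 'a set \<Rightarrow> nat \<Rightarrow> ('a \<Rightarrow> complex mat) \<Rightarrow> bool" where
  "pfm X S n M \<longleftrightarrow> (\<forall>x\<in>S. M x \<in> carrier_mat n n) \<and> (\<forall>i<n. \<forall>j<n. pf X S (\<lambda>x. M x $$ (i, j)))"

lemma pfm_carrier: "pfm X S n M \<Longrightarrow> x \<in> S \<Longrightarrow> M x \<in> carrier_mat n n"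
  and pfm_entry: "pfm X S n M \<Longrightarrow> i < n \<Longrightarrow> j < n \<Longrightarrow> pf X S (\<lambda>x. M x $$ (i, j))"
  by (auto simp: pfm_def)

lemma pfm_const: "A \<in> carrier_mat n n \<Longrightarrow> pfm X S n (\<lambda>_. A)"
  by (auto simp: pfm_def intro: pf_const)

lemma pfm_id: "S \<subseteq> carrier_mat n n \<Longrightarrow> pfm (mat_coords n) S n (\<lambda>A. A)"
  by (auto simp: pfm_def intro: pf_entry)

lemma pfm_mult:
  assumes "pfm X S n M" "pfm X S n N" shows "pfm X S n (\<lambda>x. M x * N x)"
  unfolding pfm_def
proof (intro conjI ballI allI impI)
  show "M x * N x \<in> carrier_mat n n" if "x \<in> S" for x using assms that by (auto simp: pfm_def)
  fix i j assume ij: "i < n" "j < n"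
  have "pf X S (\<lambda>x. \<Sum>k<n. M x $$ (i, k) * N x $$ (k, j))"
    by (intro pf_sum pf_mult) (use assms ij in \<open>auto simp: pfm_def\<close>)
  then show "pf X S (\<lambda>x. (M x * N x) $$ (i, j))"
  proof (rule pf_cong)
    fix x assume "x \<in> S"
    then have "M x \<in> carrier_mat n n" "N x \<in> carrier_mat n n" using assms by (auto simp: pfm_def)
    then show "(\<Sum>k<n. M x $$ (i, k) * N x $$ (k, j)) = (M x * N x) $$ (i, j)"
      using ij by (auto simp: scalar_prod_def lessThan_atLeast0 intro!: sum.cong)
  qed
qed

lemma pfm_add:
  assumes "pfm X S n M" "pfm X S n N" shows "pfm X S n (\<lambda>x. M x + N x)"
  unfolding pfm_def
proof (intro conjI ballI allI impI)
  show "M x + N x \<in> carrier_mat n n" if "x \<in> S" for x using assms that by (auto simp: pfm_def)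
  fix i j assume ij: "i < n" "j < n"
  show "pf X S (\<lambda>x. (M x + N x) $$ (i, j))"
    by (rule pf_cong[OF pf_add[OF pfm_entry[OF assms(1) ij] pfm_entry[OF assms(2) ij]]])
      (use ij assms in \<open>auto dest!: pfm_carrier\<close>)
qed

lemma pfm_smult:
  assumes "pf X S c" "pfm X S n M" shows "pfm X S n (\<lambda>x. c x \<cdot>\<^sub>m M x)"
  unfolding pfm_def
proof (intro conjI ballI allI impI)
  show "c x \<cdot>\<^sub>m M x \<in> carrier_mat n n" if "x \<in> S" for x using assms that by (auto simp: pfm_def)
  fix i j assume ij: "i < n" "j < n"
  show "pf X S (\<lambda>x. (c x \<cdot>\<^sub>m M x) $$ (i, j))"
    by (rule pf_cong[OF pf_mult[OF assms(1) pfm_entry[OF assms(2) ij]]])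
      (use ij assms in \<open>auto dest!: pfm_carrier\<close>)
qed

lemma pfm_cong:
  assumes "pfm X S n M" "\<And>x. x \<in> S \<Longrightarrow> M x = N x" shows "pfm X S n N"
  unfolding pfm_def
proof (intro conjI ballI allI impI)
  show "N x \<in> carrier_mat n n" if "x \<in> S" for x using assms(2)[OF that] pfm_carrier[OF assms(1) that] by simp
  fix i j assume "i < n" "j < n"
  then show "pf X S (\<lambda>x. N x $$ (i, j))"
    by (rule pf_cong[OF pfm_entry[OF assms(1)]]) (simp add: assms(2))
qed

lemma pfm_pow: "pfm X S n M \<Longrightarrow> pfm X S n (\<lambda>x. M x ^\<^sub>m k)"
proof (induction k)
  case 0
  have "pfm X S n (\<lambda>_. 1\<^sub>m n)" by (rule pfm_const) simp
  then show ?case by (rule pfm_cong) (use pfm_carrier[OF 0] in auto)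
next
  case (Suc k)
  then show ?case using pfm_mult[of X S n "\<lambda>x. M x ^\<^sub>m k" M] by simp
qed

lemma pfm_det: assumes "pfm X S n M" shows "pf X S (\<lambda>x. det (M x))"
proof -
  have "pf X S (\<lambda>x. \<Sum>p\<in>{p. p permutes {0..<n}}. signof p * (\<Prod>i\<in>{0..<n}. M x $$ (i, p i)))"
  proof (rule pf_sum, rule pf_mult[OF pf_const], rule pf_prod)
    fix p i assume "p \<in> {p. p permutes {0..<n}}" "i \<in> {0..<n}"
    then have "i < n" "p i < n" using permutes_in_image[of p "{0..<n}" i] by auto
    then show "pf X S (\<lambda>x. M x $$ (i, p i))" by (rule pfm_entry[OF assms])
  qed
  then show ?thesis
  proof (rule pf_cong)
    fix x assume "x \<in> S"
    then show "(\<Sum>p\<in>{p. p permutes {0..<n}}. signof p * (\<Prod>i\<in>{0..<n}. M x $$ (i, p i))) = det (M x)"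
      using pfm_carrier[OF assms] by (auto simp: det_def)
  qed
qed

lemma pfm_comp:
  assumes "pf (mat_coords n) S g" "pfm X T n M" "M ` T \<subseteq> S"
  shows "pf X T (\<lambda>x. g (M x))"
  by (rule pf_comp[OF assms(1,3)]) (use assms(2) in \<open>auto simp: mat_coords_def pfm_def\<close>)

lemma pfm_fst: "(\<And>z. z \<in> S \<Longrightarrow> fst z \<in> carrier_mat n n) \<Longrightarrow> pfm (pair_coords (mat_coords n) Y) S n fst"
  unfolding pfm_def
proof (intro conjI ballI allI impI)
  fix i j assume "i < n" "j < n"
  then have "(\<lambda>f. f \<circ> fst) (\<lambda>A. A $$ (i, j)) \<in> pair_coords (mat_coords n) Y"
    unfolding pair_coords_def by (intro UnI1 imageI) (auto simp: mat_coords_def)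
  then show "pf (pair_coords (mat_coords n) Y) S (\<lambda>z. fst z $$ (i, j))" by (intro pf_coord) (simp add: comp_def)
qed auto

lemma pfm_snd: "(\<And>z. z \<in> S \<Longrightarrow> snd z \<in> carrier_mat n n) \<Longrightarrow> pfm (pair_coords Y (mat_coords n)) S n snd"
  unfolding pfm_def
proof (intro conjI ballI allI impI)
  fix i j assume "i < n" "j < n"
  then have "(\<lambda>f. f \<circ> snd) (\<lambda>A. A $$ (i, j)) \<in> pair_coords Y (mat_coords n)"
    unfolding pair_coords_def by (intro UnI2 imageI) (auto simp: mat_coords_def)
  then show "pf (pair_coords Y (mat_coords n)) S (\<lambda>z. snd z $$ (i, j))" by (intro pf_coord) (simp add: comp_def)
qed auto

lemma pf_pair_coords_mat:
  assumes "pfm X S n M" "pfm X S n N" "f \<in> pair_coords (mat_coords n) (mat_coords n)"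
  shows "pf X S (\<lambda>x. f (M x, N x))"
  using assms by (auto simp: pair_coords_def mat_coords_def pfm_def)

lemma zclosed_mat_eq:
  assumes "pfm X S n M" "pfm X S n N" shows "zclosed X S {x\<in>S. M x = N x}"
proof -
  let ?F = "(\<lambda>(i, j) x. M x $$ (i, j) - N x $$ (i, j)) ` ({..<n} \<times> {..<n})"
  have "zclosed X S {x\<in>S. \<forall>f\<in>?F. f x = 0}"
    by (rule zclosed_pf) (use assms in \<open>auto simp: pfm_def intro: pf_diff\<close>)
  moreover have "M x = N x \<longleftrightarrow> (\<forall>f\<in>?F. f x = 0)" if "x \<in> S" for x
    using pfm_carrier[OF assms(1) that] pfm_carrier[OF assms(2) that] by (auto simp: mat_eq_iff)
  then have "{x\<in>S. \<forall>f\<in>?F. f x = 0} = {x\<in>S. M x = N x}" by blast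
  ultimately show ?thesis by (simp only:)
qed

lemma zclosed_preimage:
  assumes "zclosed X S Z" "\<phi> ` T \<subseteq> S" "\<And>f. f \<in> X \<Longrightarrow> pf Y T (\<lambda>t. f (\<phi> t))"
  shows "zclosed Y T {t\<in>T. \<phi> t \<in> Z}"
proof -
  obtain F where F: "F \<subseteq> polyfuns X" "Z = {x\<in>S. \<forall>f\<in>F. f x = 0}" using assms(1) by (auto simp: zclosed_def)
  have "zclosed Y T {t\<in>T. \<forall>f\<in>(\<lambda>f t. f (\<phi> t)) ` F. f t = 0}"
  proof (rule zclosed_pf)
    fix h assume "h \<in> (\<lambda>f t. f (\<phi> t)) ` F"
    then obtain f where f: "f \<in> F" "h = (\<lambda>t. f (\<phi> t))" by auto
    have "pf X S f" using f F by (auto intro: pf_polyfuns)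
    then show "pf Y T h" unfolding f(2) by (rule pf_comp[OF _ assms(2,3)])
  qed
  moreover have "{t\<in>T. \<forall>f\<in>(\<lambda>f t. f (\<phi> t)) ` F. f t = 0} = {t\<in>T. \<phi> t \<in> Z}" using F(2) assms(2) by auto
  ultimately show ?thesis by simp
qed

lemma finite_mat_coords: "finite (mat_coords n)"
proof -
  have "mat_coords n = (\<lambda>(i, j) A. A $$ (i, j)) ` ({..<n} \<times> {..<n})" by (auto simp: mat_coords_def)
  then show ?thesis by simp
qed

lemma finite_pair_coords: "finite X \<Longrightarrow> finite Y \<Longrightarrow> finite (pair_coords X Y)"
  by (simp add: pair_coords_def)

lemma mat_coords_realize: "\<exists>A\<in>carrier_mat n n. \<forall>y\<in>mat_coords n. y A = c y"
  by (rule bexI[of _ "mat n n (\<lambda>(i, j). c (\<lambda>A. A $$ (i, j)))"]) (auto simp: mat_coords_def)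

lemma qaffineI:
  assumes "finite X" "\<And>c. \<exists>x\<in>V. \<forall>y\<in>X. y x = c y" "pf X V v" "zclosed X {x\<in>V. v x \<noteq> 0} Z"
  shows "qaffine X V Z"
proof -
  obtain v' where "v' \<in> polyfuns X" "\<forall>x\<in>V. v x = v' x" using assms(3) by (auto simp: pf_def)
  moreover from this have "{x\<in>V. v x \<noteq> 0} = {x\<in>V. v' x \<noteq> 0}" by auto
  ultimately show ?thesis using assms(1,2,4) unfolding qaffine_def by auto
qed

lemma zclosed_Times:
  assumes "zclosed X S A" "zclosed Y T B"
  shows "zclosed (pair_coords X Y) (S \<times> T) (A \<times> B)"
proof -
  have "zclosed (pair_coords X Y) (S \<times> T) {z\<in>S \<times> T. fst z \<in> A}"
    by (rule zclosed_preimage[OF assms(1)]) (auto intro: pf_pair_fst pf_coord)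
  moreover have "zclosed (pair_coords X Y) (S \<times> T) {z\<in>S \<times> T. snd z \<in> B}"
    by (rule zclosed_preimage[OF assms(2)]) (auto intro: pf_pair_snd pf_coord)
  ultimately have "zclosed (pair_coords X Y) (S \<times> T) ({z\<in>S \<times> T. fst z \<in> A} \<inter> {z\<in>S \<times> T. snd z \<in> B})"
    by (rule zclosed_Inter2)
  moreover have "{z\<in>S \<times> T. fst z \<in> A} \<inter> {z\<in>S \<times> T. snd z \<in> B} = A \<times> B"
    using zclosed_subset[OF assms(1)] zclosed_subset[OF assms(2)] by auto
  ultimately show ?thesis by simp
qed

section \<open>Linear algebraic groups and commuting varieties as quasi-affine sets\<close>

abbreviation mat2_coords :: "nat \<Rightarrow> (complex mat \<times> complex mat \<Rightarrow> complex) set" where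
  "mat2_coords n \<equiv> pair_coords (mat_coords n) (mat_coords n)"

lemma zariski_mat2_eq: "zariski_mat2 n = zariski (mat2_coords n) (carrier_mat n n \<times> carrier_mat n n)"
  by (simp add: zariski_mat2_def pair_coords_def)

lemma carrier_GL: "carrier (GL n) = {A\<in>carrier_mat n n. det A \<noteq> 0}"
proof -
  have "carrier (GL n) = Units (ring_mat TYPE(complex) n ())" by (simp add: GL_def units_of_def)
  also have "\<dots> = {A\<in>carrier_mat n n. det A \<noteq> 0}"
    using unit_imp_det_non_zero det_non_zero_imp_unit[where 'a = complex and n = n] by (auto simp: Units_def ring_mat_def)
  finally show ?thesis .
qed

lemma group_GL: "group (GL n)"
  unfolding GL_def by (intro monoid.units_group ring.is_monoid ring_mat)

lemma GL_simps [simp]: "A \<otimes>\<^bsub>GL n\<^esub> B = A * B" "\<one>\<^bsub>GL n\<^esub> = 1\<^sub>m n"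
  by (simp_all add: GL_def units_of_def ring_mat_def)

lemma linear_algebraic_group_iff:
  "linear_algebraic_group n G \<longleftrightarrow> subgroup G (GL n) \<and> zclosed (mat_coords n) (carrier (GL n)) G"
proof -
  have "carrier (GL n) \<subseteq> carrier_mat n n" by (auto simp: carrier_GL)
  then show ?thesis unfolding linear_algebraic_group_def zariski_mat_def by (simp add: closedin_zariski_sub)
qed

lemma qaffine_group:
  assumes "zclosed (mat_coords n) (carrier (GL n)) G"
  shows "qaffine (mat_coords n) (carrier_mat n n) G"
  by (rule qaffineI[where v = det])
    (use assms in \<open>auto simp: finite_mat_coords mat_coords_realize carrier_GL intro!: pfm_det pfm_id\<close>)

lemma qaffine_group2:
  assumes "zclosed (mat_coords n) (carrier (GL n)) G"
  shows "qaffine (mat2_coords n) (carrier_mat n n \<times> carrier_mat n n) (G \<times> G)"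
proof (rule qaffineI[where v = "\<lambda>z. det (fst z) * det (snd z)"])
  show "finite (mat2_coords n)" by (simp add: finite_pair_coords finite_mat_coords)
  show "\<exists>z\<in>carrier_mat n n \<times> carrier_mat n n. \<forall>y\<in>mat2_coords n. y z = c y" for c
  proof -
    obtain A where A: "A \<in> carrier_mat n n" "\<forall>y\<in>mat_coords n. y A = c (y \<circ> fst)"
      using mat_coords_realize[of n "\<lambda>y. c (y \<circ> fst)"] by blast
    obtain B where B: "B \<in> carrier_mat n n" "\<forall>y\<in>mat_coords n. y B = c (y \<circ> snd)"
      using mat_coords_realize[of n "\<lambda>y. c (y \<circ> snd)"] by blast
    show ?thesis by (rule bexI[of _ "(A, B)"]) (use A B in \<open>auto simp: pair_coords_def\<close>)
  qed
  show "pf (mat2_coords n) (carrier_mat n n \<times> carrier_mat n n) (\<lambda>z. det (fst z) * det (snd z))"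
    by (intro pf_mult pfm_det[of _ _ n] pfm_fst pfm_snd) auto
  have "{z \<in> carrier_mat n n \<times> carrier_mat n n. det (fst z) * det (snd z) \<noteq> 0} = carrier (GL n) \<times> carrier (GL n)"
    by (auto simp: carrier_GL)
  then show "zclosed (mat2_coords n) {z \<in> carrier_mat n n \<times> carrier_mat n n. det (fst z) * det (snd z) \<noteq> 0} (G \<times> G)"
    using zclosed_Times[OF assms assms] by simp
qed

lemma zclosed_commuting_variety:
  assumes "G \<subseteq> carrier_mat n n"
  shows "zclosed (mat2_coords n) (G \<times> G) (commuting_variety G)"
proof -
  have "zclosed (mat2_coords n) (G \<times> G) {z\<in>G \<times> G. fst z * snd z = snd z * fst z}"
    by (intro zclosed_mat_eq[of _ _ n] pfm_mult pfm_fst pfm_snd) (use assms in auto)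
  moreover have "{z\<in>G \<times> G. fst z * snd z = snd z * fst z} = commuting_variety G"
    by (auto simp: commuting_variety_def)
  ultimately show ?thesis by simp
qed

section \<open>The lower bound\<close>

lemma indep_0: assumes "S \<noteq> {}" shows "indep f 0 S"
  unfolding indep_def
proof (intro ballI impI allI)
  fix P p assume P: "P \<in> polyfuns (cds 0)" "\<forall>x\<in>S. P (\<lambda>i. f i x) = 0"
  obtain x where x: "x \<in> S" using assms by blast
  have "P p = P (\<lambda>i. f i x)" by (rule cds_cong[OF P(1)]) simp
  then show "P p = 0" using P(2) x by simp
qed

text \<open>The induction carries a function \<open>h\<close>, the product of equations of the
  members already rejected, and requires the covering only off the zeros of \<open>h\<close>. By
  primality \<open>h\<close> never becomes zero on \<open>Z\<close>.\<close>

lemma zprime_subset_Union: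
  assumes Z: "zprime X Z" and F: "finite F" "\<And>M. M \<in> F \<Longrightarrow> zclosed X S M" and ZS: "Z \<subseteq> \<Union>F" "Z \<subseteq> S"
  shows "\<exists>M\<in>F. Z \<subseteq> M"
proof -
  have *: "\<exists>M\<in>F. Z \<subseteq> M" if "\<And>M. M \<in> F \<Longrightarrow> zclosed X S M" "h \<in> polyfuns X" "\<exists>x\<in>Z. h x \<noteq> 0" "\<forall>x\<in>Z. x \<in> \<Union>F \<or> h x = 0" for h
    using F(1) that
  proof (induction F arbitrary: h rule: finite_induct)
    case empty
    then show ?case by auto
  next
    case (insert M F)
    show ?case
    proof (cases "Z \<subseteq> M")
      case False
      obtain G where G: "G \<subseteq> polyfuns X" "M = {x\<in>S. \<forall>f\<in>G. f x = 0}" using insert.prems(1)[of M] by (auto simp: zclosed_def)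
      obtain g where g: "g \<in> G" "\<exists>x\<in>Z. g x \<noteq> 0" using False G(2) ZS(2) by auto
      have gX: "g \<in> polyfuns X" using g G by auto
      have nz: "\<exists>x\<in>Z. h x * g x \<noteq> 0"
        using zprimeD[OF Z pf_polyfuns[OF insert.prems(2)] pf_polyfuns[OF gX]] insert.prems(3) g(2) by auto
      have "\<exists>M\<in>F. Z \<subseteq> M"
        by (rule insert.IH[OF _ polyfuns_mult[OF insert.prems(2) gX] nz]) (use insert.prems G(2) g(1) in auto)
      then show ?thesis by blast
    qed auto
  qed
  show ?thesis
  proof (rule *[of "\<lambda>_. 1"])
    show "\<exists>x\<in>Z. (\<lambda>_. 1 :: complex) x \<noteq> 0" using Z by (auto simp: zprime_def)
    show "\<forall>x\<in>Z. x \<in> \<Union>F \<or> (\<lambda>_. 1 :: complex) x = 0" using ZS(1) by auto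
  qed (simp_all add: F(2) polyfuns_const)
qed

lemma krull_dim_bounded:
  assumes "S \<subseteq> V" "zchain X S d Z" "\<And>e Z. zchain X S e Z \<Longrightarrow> e \<le> B"
  obtains D Z where "krull_dim (subtopology (zariski X V) S) = enat D" "zchain X S D Z" "d \<le> D" "D \<le> B"
proof -
  let ?E = "{e. \<exists>Z. zchain X S e Z}"
  have fin: "finite ?E" by (rule finite_subset[of _ "{..B}"]) (use assms(3) in auto)
  have dE: "d \<in> ?E" using assms(2) by blast
  then have "Max ?E \<in> ?E" using fin by (intro Max_in) auto
  then obtain C where C: "zchain X S (Max ?E) C" by blast
  have "krull_dim (subtopology (zariski X V) S) = enat (Max ?E)"
  proof (rule krull_dim_eqI[OF assms(1) C])
    fix e Z assume "zchain X S e Z"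
    then have "e \<in> ?E" by blast
    then show "e \<le> Max ?E" by (rule Max_ge[OF fin])
  qed
  then show ?thesis using that C Max_ge[OF fin dE] assms(3)[OF C] by blast
qed

lemma zchain_mono:
  assumes "zchain X T d Z" "zclosed X S T" shows "zchain X S d Z"
  using assms zclosed_trans unfolding zchain_def by metis

lemma finite_values:
  assumes y: "\<not> indep (\<lambda>_. y) 1 S" shows "finite (y ` S)"
proof -
  obtain P p where P: "P \<in> polyfuns (cds 1)" "P p \<noteq> 0" "\<And>x. x \<in> S \<Longrightarrow> P (\<lambda>i. y x) = 0"
    by (rule not_indepE[OF y], rule that)
  have "\<exists>q. \<forall>t. P (\<lambda>_. t) = poly q t"
    by (rule poly_path[OF P(1)]) (auto simp: cds_def intro: exI[of _ "[:0, 1:]"])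
  then obtain q where q: "\<And>t. P (\<lambda>_. t) = poly q t" by blast
  have "P (\<lambda>_. p 0) = P p" by (rule cds_cong[OF P(1)]) simp
  then have "q \<noteq> 0" using P(2) q[of "p 0"] by auto
  have "y ` S \<subseteq> {t. poly q t = 0}" using P(3) q by auto
  then show ?thesis using poly_roots_finite[OF \<open>q \<noteq> 0\<close>] finite_subset by blast
qed

lemma finite_mat_set:
  assumes "S \<subseteq> carrier_mat n n" "\<And>y. y \<in> mat_coords n \<Longrightarrow> finite (y ` S)"
  shows "finite S"
proof -
  let ?r = "\<lambda>A. restrict (\<lambda>(i, j). A $$ (i, j)) ({..<n} \<times> {..<n})"
  have "inj_on ?r S"
  proof (rule inj_onI)
    fix A B assume A: "A \<in> S" "B \<in> S" "?r A = ?r B"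
    show "A = B"
    proof (rule eq_matI)
      fix i j assume "i < dim_row B" "j < dim_col B"
      then have "i < n" "j < n" using A assms(1) by auto
      then show "A $$ (i, j) = B $$ (i, j)" using fun_cong[OF A(3), of "(i, j)"] by simp
    qed (use A assms(1) in auto)
  qed
  moreover have "?r ` S \<subseteq> PiE ({..<n} \<times> {..<n}) (\<lambda>(i, j). (\<lambda>A. A $$ (i, j)) ` S)"
    by (intro subsetI, elim imageE, hypsubst, rule PiE_I) auto
  moreover have "finite (PiE ({..<n} \<times> {..<n}) (\<lambda>(i, j). (\<lambda>A. A $$ (i, j)) ` S))"
  proof (rule finite_PiE)
    fix x assume "x \<in> {..<n} \<times> {..<n}"
    then obtain i j where "x = (i, j)" "i < n" "j < n" by auto
    moreover from this have "(\<lambda>A. A $$ (i, j)) \<in> mat_coords n" unfolding mat_coords_def by blast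
    from assms(2)[OF this] have "finite ((\<lambda>A. A $$ (i, j)) ` S)" .
    ultimately show "finite (case x of (i, j) \<Rightarrow> (\<lambda>A. A $$ (i, j)) ` S)" by simp
  qed simp
  ultimately show ?thesis by (meson finite_imageD finite_subset)
qed

section \<open>Powers of matrices and irreducible sets of finite exponent\<close>

fun geo :: "nat \<Rightarrow> complex mat \<Rightarrow> nat \<Rightarrow> complex mat" where
  "geo n A 0 = 0\<^sub>m n n"
| "geo n A (Suc e) = geo n A e + A ^\<^sub>m e"

lemma geo_carrier [simp]: "A \<in> carrier_mat n n \<Longrightarrow> geo n A e \<in> carrier_mat n n"
  by (induction e) auto

lemma geo_mult:
  assumes A: "A \<in> carrier_mat n n"
  shows "geo n A e * (A - 1\<^sub>m n) = A ^\<^sub>m e - 1\<^sub>m n"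
proof (induction e)
  case 0
  then show ?case using A by (auto simp: minus_r_inv_mat)
next
  case (Suc e)
  have "geo n A (Suc e) * (A - 1\<^sub>m n) = (A ^\<^sub>m e - 1\<^sub>m n) + A ^\<^sub>m e * (A - 1\<^sub>m n)"
    using Suc add_mult_distrib_mat[OF geo_carrier[OF A] pow_carrier_mat[OF A] minus_carrier_mat[OF one_carrier_mat]]
    by simp
  also have "A ^\<^sub>m e * (A - 1\<^sub>m n) = A ^\<^sub>m e * A - A ^\<^sub>m e"
    using A by (simp add: mult_minus_distrib_mat[of _ n n])
  also have "(A ^\<^sub>m e - 1\<^sub>m n) + (A ^\<^sub>m e * A - A ^\<^sub>m e) = A ^\<^sub>m e * A - 1\<^sub>m n"
    using A pow_carrier_mat[OF A, of e] by (intro eq_matI) auto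
  finally show ?case by simp
qed

lemma pow_add_mat:
  assumes "(A :: complex mat) \<in> carrier_mat n n" shows "A ^\<^sub>m (k + l) = A ^\<^sub>m k * A ^\<^sub>m l"
proof (induction l)
  case 0
  then show ?case using assms right_mult_one_mat[OF pow_carrier_mat[OF assms]] by simp
next
  case (Suc l)
  then show ?case
    using assoc_mult_mat[OF pow_carrier_mat[OF assms] pow_carrier_mat[OF assms] assms] by simp
qed

lemma pow_one_mat: "(1\<^sub>m n :: complex mat) ^\<^sub>m k = 1\<^sub>m n"
  by (induction k) auto

lemma det_geo_one: "e > 0 \<Longrightarrow> det (geo n (1\<^sub>m n) e) \<noteq> 0"
proof -
  assume e: "e > 0"
  have "geo n (1\<^sub>m n) e = of_nat e \<cdot>\<^sub>m 1\<^sub>m n"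
  proof (induction e)
    case (Suc e)
    show ?case unfolding geo.simps Suc pow_one_mat by (intro eq_matI) (auto simp: distrib_right)
  qed (auto intro: eq_matI)
  then show ?thesis using e by simp
qed

lemma pfm_geo: "pfm X S n M \<Longrightarrow> pfm X S n (\<lambda>x. geo n (M x) e)"
  by (induction e) (auto intro: pfm_const pfm_add pfm_pow)

lemma mat_mult_cancel_left:
  fixes A B C :: "complex mat"
  assumes "A \<in> carrier_mat n n" "B \<in> carrier_mat n n" "C \<in> carrier_mat n n" "det A \<noteq> 0" "A * B = A * C"
  shows "B = C"
proof -
  obtain A' where A': "A' \<in> carrier_mat n n" "A' * A = 1\<^sub>m n"
    using det_non_zero_imp_unit[OF assms(1,4), of "()"] by (auto simp: Units_def ring_mat_def)
  have "A' * (A * B) = A' * (A * C)" using assms(5) by simp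
  then show ?thesis using assms(1-3) A' by (simp flip: assoc_mult_mat[of _ n n _ n _ n])
qed

text \<open>On a prime set through \<open>1\<close> of elements of exponent \<open>e\<close>, \<open>det (1 + A + \<dots> + A\<^sup>e\<^sup>-\<^sup>1)\<close> does not
  vanish at \<open>1\<close>, while its product with \<open>A - 1\<close> is \<open>0\<close>; so the set is \<open>{1}\<close>.\<close>

lemma zprime_finite_exponent:
  assumes Z: "zprime X Z" and M: "pfm X Z n M" and e: "e > 0" "\<And>x. x \<in> Z \<Longrightarrow> M x ^\<^sub>m e = 1\<^sub>m n"
    and x0: "x0 \<in> Z" "M x0 = 1\<^sub>m n" and x: "x \<in> Z"
  shows "M x = 1\<^sub>m n"
proof -
  have Mc: "M x \<in> carrier_mat n n" if "x \<in> Z" for x using pfm_carrier[OF M that] .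
  have one: "M x = 1\<^sub>m n" if "x \<in> Z" "det (geo n (M x) e) \<noteq> 0" for x
  proof -
    let ?g = "geo n (M x) e" and ?I = "1\<^sub>m n :: complex mat"
    have g: "?g \<in> carrier_mat n n" and m: "M x \<in> carrier_mat n n" using Mc[OF that(1)] by auto
    have gm: "?g * M x \<in> carrier_mat n n" by (rule mult_carrier_mat[OF g m])
    have "?g * (M x - ?I) = 0\<^sub>m n n"
      unfolding geo_mult[OF m] using e(2)[OF that(1)] minus_r_inv_mat[of ?I n n] by simp
    then have z: "?g * M x - ?g * ?I = 0\<^sub>m n n"
      using mult_minus_distrib_mat[OF g m one_carrier_mat] by simp
    have "?g * M x = (?g * M x - ?g * ?I) + ?g * ?I"
      using gm g by (intro eq_matI) (auto simp del: index_mult_mat(1))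
    also have "\<dots> = ?g * ?I" unfolding z using g by simp
    finally have "?g * M x = ?g * ?I" .
    then show ?thesis
      by (rule mat_mult_cancel_left[OF geo_carrier[OF Mc[OF that(1)]] Mc[OF that(1)] one_carrier_mat that(2)])
  qed
  have "M x $$ (i, j) = 1\<^sub>m n $$ (i, j)" if ij: "i < n" "j < n" for i j
  proof -
    have "(\<forall>x\<in>Z. det (geo n (M x) e) = 0) \<or> (\<forall>x\<in>Z. M x $$ (i, j) - 1\<^sub>m n $$ (i, j) = 0)"
    proof (rule zprimeD[OF Z])
      show "pf X Z (\<lambda>x. det (geo n (M x) e))" by (rule pfm_det[OF pfm_geo[OF M]])
      show "pf X Z (\<lambda>x. M x $$ (i, j) - 1\<^sub>m n $$ (i, j))" by (rule pf_diff[OF pfm_entry[OF M ij] pf_const])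
      show "det (geo n (M x) e) = 0 \<or> M x $$ (i, j) - 1\<^sub>m n $$ (i, j) = 0" if "x \<in> Z" for x
        by (cases "det (geo n (M x) e) = 0") (use one[OF that] in auto)
    qed
    moreover have "det (geo n (M x0) e) \<noteq> 0" using det_geo_one[OF e(1)] x0(2) by simp
    ultimately show ?thesis using x0(1) x by auto
  qed
  then show ?thesis using Mc[OF x] by (intro eq_matI) auto
qed

text \<open>\<open>d\<close> is the largest length of an independent family on \<open>G\<close>. It
  bounds the growth of every component of \<open>G\<close>, so chains in \<open>G \<times> G\<close>
  have length at most \<open>2 * d\<close>; the image of a chain of length \<open>d\<close> in
  \<open>G\<close>, continued by a component of the commuting variety, has length
  \<open>Suc d\<close>. These two inequalities give the strict bound.\<close>

lemma commuting_prob_bounds: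
  assumes G: "linear_algebraic_group n G"
  shows "commuting_prob n G \<in> \<rat> \<inter> {1/2<..1}"
proof (cases "finite G")
  case True
  then show ?thesis by (simp add: commuting_prob_def)
next
  case inf: False
  let ?X = "mat_coords n" and ?V = "carrier_mat n n"
  let ?X2 = "mat2_coords n" and ?V2 = "carrier_mat n n \<times> carrier_mat n n"
  let ?C = "commuting_variety G"
  have sub: "subgroup G (GL n)" and cl: "zclosed ?X (carrier (GL n)) G" using G by (auto simp: linear_algebraic_group_iff)
  have GV: "G \<subseteq> ?V" using subgroup.subset[OF sub] by (auto simp: carrier_GL)
  have one: "1\<^sub>m n \<in> G" using subgroup.one_closed[OF sub] by simp
  have mult: "A * B \<in> G" if "A \<in> G" "B \<in> G" for A B using subgroup.m_closed[OF sub that] by simp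
  have qG: "qaffine ?X ?V G" by (rule qaffine_group[OF cl])
  have fX: "finite ?X" by (rule finite_mat_coords)
  have fX2: "finite ?X2" by (simp add: finite_pair_coords fX)
  let ?E = "{e. \<exists>f. (\<forall>i<e. f i \<in> polyfuns ?X) \<and> indep f e G}"
  have "?E \<subseteq> {..card ?X}" using indep_le_growth[OF growth_coords[OF fX]] by auto
  then have fE: "finite ?E" by (rule finite_subset) simp
  define d where "d = Max ?E"
  have "0 \<in> ?E" using indep_0[of G] one by auto
  then have "d \<in> ?E" unfolding d_def using fE by (intro Max_in) auto
  then obtain f where f: "\<And>i. i < d \<Longrightarrow> f i \<in> polyfuns ?X" "indep f d G" by blast
  have dmax: "e \<le> d" if "\<And>i. i < e \<Longrightarrow> g i \<in> polyfuns ?X" "indep g e G" for e g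
    unfolding d_def using fE that by (intro Max_ge) auto
  have gG: "growth ?X G d"
  proof -
    obtain F where F: "finite F" "\<forall>Z\<in>F. zclosed ?X G Z \<and> zprime ?X Z" "G = \<Union>F"
      using zclosed_decomposition[OF fX zclosed_self[of ?X G]] by (elim exE conjE)
    have "growth ?X Z d" if Z: "Z \<in> F" for Z
    proof -
      have Zp: "zprime ?X Z" using F(2) Z by blast
      then have "Z \<noteq> {}" by (auto simp: zprime_def)
      from maxind_extend[OF growth_coords[OF fX] indep_0[OF this]]
      obtain e g where g: "maxind ?X g e Z" by auto
      have "indep g e G" using g F(3) Z by (auto simp: maxind_def intro: indep_mono)
      then have "e \<le> d" using dmax[of e g] g by (auto simp: maxind_def)
      with maxind_growth[OF fX Zp g] show ?thesis by (intro growth_mono[of ?X Z e Z d]) auto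
    qed
    then show ?thesis using growth_Union[OF F(1), of ?X d] F(3) by auto
  qed
  have gG2: "growth ?X2 (G \<times> G) (d + d)" by (rule growth_Times[OF gG gG])
  have d0: "d > 0"
  proof (rule ccontr)
    assume "\<not> d > 0"
    then have "finite (y ` G)" if "y \<in> ?X" for y
      using dmax[of 1 "\<lambda>_. y"] that by (intro finite_values) (auto intro: polyfuns_coord)
    then show False using inf finite_mat_set[OF GV] by blast
  qed
  obtain Z where Z: "zchain ?X G d Z" using indep_zchain[OF qG f(2,1)] by blast
  have Zs: "zclosed ?X G (Z i)" "zprime ?X (Z i)" if "i \<le> d" for i using Z that by (auto simp: zchain_def)
  have Zlt: "Z i \<subset> Z (Suc i)" if "i < d" for i using Z that by (auto simp: zchain_def)
  have Z0d: "Z 0 \<subset> Z d"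
  proof -
    have le: "Z 0 \<subseteq> Z i" if "i \<le> d" for i
      using that
    proof (induction i)
      case (Suc i)
      then have "Z 0 \<subseteq> Z i" "Z i \<subset> Z (Suc i)" using Zlt[of i] by auto
      then show ?case by simp
    qed simp
    obtain l where l: "d = Suc l" using d0 gr0_implies_Suc by blast
    then have "Z 0 \<subseteq> Z l" "Z l \<subset> Z d" using le[of l] Zlt[of l] by auto
    then show ?thesis by simp
  qed
  obtain y0 where y0: "y0 \<in> Z 0" using Zs(2)[of 0] by (auto simp: zprime_def)
  then have y0G: "y0 \<in> G" using zclosed_subset[OF Zs(1)[of 0]] by auto
  \<comment> \<open>Translation by \<open>y\<close> moves a point of \<open>Z 0\<close> to
    \<open>1\<close>, so that the translated chain passes through the identity, as
    \<open>zprime_finite_exponent\<close> requires.\<close>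
  define y where "y = inv\<^bsub>GL n\<^esub> y0"
  have y0c: "y0 \<in> carrier (GL n)" using subgroup.subset[OF sub] y0G by auto
  have yG: "y \<in> G" unfolding y_def by (rule subgroup.m_inv_closed[OF sub y0G])
  have y0V: "y0 \<in> ?V" and yV: "y \<in> ?V" using y0G yG GV by auto
  have yy: "y * y0 = 1\<^sub>m n" "y0 * y = 1\<^sub>m n"
    using group.l_inv[OF group_GL y0c] group.r_inv[OF group_GL y0c] unfolding y_def by simp_all
  have cancel: "y0 * (y * A) = A" if "A \<in> ?V" for A
    using that y0V yV yy by (simp flip: assoc_mult_mat[of _ n n _ n _ n])
  have powG: "A ^\<^sub>m k \<in> G" if "A \<in> G" for A k
    using that GV one mult by (induction k) auto
  have pow_comm: "A * A ^\<^sub>m k = A ^\<^sub>m k * A" if "A \<in> ?V" for A :: "complex mat" and k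
    using that by (induction k) (auto simp flip: assoc_mult_mat[of _ n n _ n _ n])
  define \<phi> where "\<phi> k A = (y * A, (y * A) ^\<^sub>m k)" for k A
  define W where "W k i = \<phi> k ` Z i" for k i
  have ZG: "Z i \<subseteq> G" if "i \<le> d" for i by (rule zclosed_subset[OF Zs(1)[OF that]])
  have \<phi>C: "\<phi> k A \<in> ?C" if "A \<in> G" for k A
    using mult[OF yG that] powG pow_comm GV unfolding \<phi>_def commuting_variety_def by auto
  have pm: "pfm ?X S n (\<lambda>A. y * A)" if "S \<subseteq> G" for S
    by (rule pfm_mult[OF pfm_const[OF yV] pfm_id]) (use that GV in auto)
  have Wp: "zprime ?X2 (W k i)" if i: "i \<le> d" for k i
    unfolding W_def
  proof (rule zprime_image[OF Zs(2)[OF i]])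
    fix h assume "h \<in> ?X2"
    then show "pf ?X (Z i) (\<lambda>t. h (\<phi> k t))"
      unfolding \<phi>_def by (rule pf_pair_coords_mat[OF pm[OF ZG[OF i]] pfm_pow[OF pm[OF ZG[OF i]]]])
  qed
  have CV: "?C \<subseteq> G \<times> G" by (auto simp: commuting_variety_def)
  have CV2: "?C \<subseteq> ?V2" using CV GV by auto
  have fstC: "pfm ?X2 ?C n fst" by (rule pfm_fst) (use CV2 in auto)
  have sndC: "pfm ?X2 ?C n snd" by (rule pfm_snd) (use CV2 in auto)
  \<comment> \<open>\<open>W k i\<close> is the graph of the \<open>k\<close>-th power map over the
    translate of \<open>Z i\<close>, hence closed.\<close>
  have Wc: "zclosed ?X2 ?C (W k i)" if i: "i \<le> d" for k i
  proof -
    have 1: "zclosed ?X2 ?C {z\<in>?C. snd z = fst z ^\<^sub>m k}"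
      by (rule zclosed_mat_eq[OF sndC pfm_pow[OF fstC]])
    have pm0: "pfm ?X2 ?C n (\<lambda>z. y0 * fst z)" by (rule pfm_mult[OF pfm_const[OF y0V] fstC])
    have 2: "zclosed ?X2 ?C {z\<in>?C. y0 * fst z \<in> Z i}"
    proof (rule zclosed_preimage[OF Zs(1)[OF i]])
      show "(\<lambda>z. y0 * fst z) ` ?C \<subseteq> G" using CV mult[OF y0G] by auto
      show "pf ?X2 ?C (\<lambda>t. h (y0 * fst t))" if "h \<in> ?X" for h
        using pm0 that by (auto simp: mat_coords_def pfm_def)
    qed
    have "{z\<in>?C. snd z = fst z ^\<^sub>m k} \<inter> {z\<in>?C. y0 * fst z \<in> Z i} = W k i"
    proof (intro Set.equalityI subsetI)
      fix z assume z: "z \<in> {z\<in>?C. snd z = fst z ^\<^sub>m k} \<inter> {z\<in>?C. y0 * fst z \<in> Z i}"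
      then have fz: "fst z \<in> ?V" using CV2 by auto
      have "y * (y0 * fst z) = fst z" using fz y0V yV yy by (simp flip: assoc_mult_mat[of _ n n _ n _ n])
      then have "z = \<phi> k (y0 * fst z)" using z unfolding \<phi>_def by (auto simp: prod_eq_iff)
      then show "z \<in> W k i" using z unfolding W_def by blast
    next
      fix z assume "z \<in> W k i"
      then obtain A where A: "A \<in> Z i" "z = \<phi> k A" unfolding W_def by blast
      then have AG: "A \<in> G" using ZG[OF i] by auto
      then show "z \<in> {z\<in>?C. snd z = fst z ^\<^sub>m k} \<inter> {z\<in>?C. y0 * fst z \<in> Z i}"
        using A \<phi>C[OF AG] cancel[of A] GV by (auto simp: \<phi>_def)
    qed
    then show ?thesis using zclosed_Inter2[OF 1 2] by simp
  qed
  have \<phi>inj: "A = B" if "\<phi> k A = \<phi> l B" "A \<in> G" "B \<in> G" for k l A B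
  proof -
    have "y * A = y * B" using that(1) by (simp add: \<phi>_def)
    then have "y0 * (y * A) = y0 * (y * B)" by simp
    then show ?thesis using cancel[of A] cancel[of B] that(2,3) GV by auto
  qed
  have Wlt: "W k i \<subset> W k (Suc i)" if i: "i < d" for k i
  proof -
    obtain A where A: "A \<in> Z (Suc i)" "A \<notin> Z i" using Zlt[OF i] by auto
    have "\<phi> k A \<notin> W k i"
    proof
      assume "\<phi> k A \<in> W k i"
      then obtain B where B: "B \<in> Z i" "\<phi> k A = \<phi> k B" unfolding W_def by blast
      have "A = B" by (rule \<phi>inj[OF B(2)]) (use A B ZG[of i] ZG[of "Suc i"] i in auto)
      then show False using A B by simp
    qed
    then show ?thesis using Zlt[OF i] A unfolding W_def by blast
  qed
  \<comment> \<open>If two power graphs agree, the translate of \<open>Z d\<close> has exponent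
    \<open>l - k\<close>; being irreducible and containing \<open>1\<close>, it is a point, although
    the chain is strict.\<close>
  have Winj': False if kl: "k < l" "W k d = W l d" for k l
  proof -
    have eq: "(y * A) ^\<^sub>m (l - k) = 1\<^sub>m n" if A: "A \<in> Z d" for A
    proof -
      have AG: "A \<in> G" using A ZG by blast
      let ?a = "y * A"
      have aG: "?a \<in> G" by (rule mult[OF yG AG])
      have "\<phi> k A \<in> W l d" using A kl(2) unfolding W_def by blast
      then obtain B where B: "B \<in> Z d" "\<phi> k A = \<phi> l B" unfolding W_def by blast
      have "A = B" by (rule \<phi>inj[OF B(2) AG]) (use B ZG in auto)
      then have "?a ^\<^sub>m k = ?a ^\<^sub>m l" using B(2) by (simp add: \<phi>_def)
      moreover have "?a ^\<^sub>m l = ?a ^\<^sub>m k * ?a ^\<^sub>m (l - k)"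
        using pow_add_mat[of ?a n k "l - k"] aG GV kl(1) by auto
      ultimately have "?a ^\<^sub>m k * ?a ^\<^sub>m (l - k) = ?a ^\<^sub>m k * 1\<^sub>m n"
        using right_mult_one_mat[of "?a ^\<^sub>m k" n n] powG[OF aG, of k] GV by auto
      then show ?thesis
        by (rule mat_mult_cancel_left[rotated 4])
          (use powG[OF aG] GV subgroup.subset[OF sub] in \<open>auto simp: carrier_GL\<close>)
    qed
    have y0d: "y0 \<in> Z d" using Z0d y0 by auto
    have "y * A = 1\<^sub>m n" if "A \<in> Z d" for A
      by (rule zprime_finite_exponent[OF Zs(2)[OF order.refl] pm[OF ZG[OF order.refl]] _ eq y0d yy(1) that])
        (use kl in auto)
    then have "A = y0" if "A \<in> Z d" for A
      using cancel[of A] that ZG[of d] GV y0V by auto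
    then have "Z d \<subseteq> Z 0" using y0 by auto
    then show False using Z0d by auto
  qed
  have Winj: "k = l" if "W k d = W l d" for k l
    using Winj'[of k l] Winj'[of l k] that by (metis linorder_neqE_nat)
  obtain F where F: "finite F" "\<forall>M\<in>F. zclosed ?X2 ?C M \<and> zprime ?X2 M" "?C = \<Union>F"
    using zclosed_decomposition[OF fX2 zclosed_self[of ?X2 ?C]] by (elim exE conjE)
  have WC: "W k i \<subseteq> ?C" if "i \<le> d" for k i by (rule zclosed_subset[OF Wc[OF that]])
  have "\<exists>M\<in>F. W k d \<subseteq> M" for k
    by (rule zprime_subset_Union[OF Wp[OF order.refl] F(1), of ?C]) (use F WC in auto)
  then have "\<forall>k. \<exists>M. M \<in> F \<and> W k d \<subseteq> M" by blast
  from choice[OF this] obtain M where M: "\<And>k. M k \<in> F" "\<And>k. W k d \<subseteq> M k" by blast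
  have "range M \<subseteq> F" using M(1) by auto
  then have "finite (range M)" using F(1) finite_subset by blast
  then have "\<not> inj M" using finite_imageD[of M UNIV] infinite_UNIV_nat by blast
  then obtain k l where kl: "M k = M l" "k \<noteq> l" by (auto simp: inj_on_def)
  \<comment> \<open>Of two different graphs inside one component, at most one equals the
    component.\<close>
  have "\<exists>j. W j d \<subset> M j"
  proof (cases "W k d = M k")
    case True
    have "W l d \<noteq> M l" using True kl Winj by metis
    then show ?thesis using M(2) by blast
  next
    case False
    then show ?thesis using M(2) by blast
  qed
  then obtain j where j: "W j d \<subset> M j" by blast
  have chainC: "zchain ?X2 ?C (Suc d) (\<lambda>i. if i \<le> d then W j i else M j)"
    unfolding zchain_def
  proof (intro conjI allI impI)
    fix i assume i: "i \<le> Suc d"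
    show "zclosed ?X2 ?C (if i \<le> d then W j i else M j)" using Wc F(2) M(1) by auto
    show "zprime ?X2 (if i \<le> d then W j i else M j)" using Wp F(2) M(1) by auto
  next
    fix i assume i: "i < Suc d"
    show "(if i \<le> d then W j i else M j) \<subset> (if Suc i \<le> d then W j (Suc i) else M j)"
      using i Wlt[of i j] j by (cases "i = d") auto
  qed
  have gC: "growth ?X2 ?C (d + d)" by (rule growth_mono[OF gG2 CV order.refl])
  obtain c ZC where c: "krull_dim (subtopology (zariski ?X2 ?V2) ?C) = enat c" "zchain ?X2 ?C c ZC" "Suc d \<le> c"
    by (rule krull_dim_bounded[OF CV2 chainC zchain_le_growth[OF _ gC]])
  have clC: "zclosed ?X2 (G \<times> G) ?C" by (rule zclosed_commuting_variety[OF GV])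
  have GV2: "G \<times> G \<subseteq> ?V2" using GV by auto
  obtain D where D: "krull_dim (subtopology (zariski ?X2 ?V2) (G \<times> G)) = enat D" "c \<le> D" "D \<le> d + d"
    by (rule krull_dim_bounded[OF GV2 zchain_mono[OF c(2) clC] zchain_le_growth[OF _ gG2]])
  have p: "commuting_prob n G = real c / real D"
    using inf c(1) D(1) by (simp add: commuting_prob_def zariski_mat2_eq)
  have "real c / real D \<in> \<rat>" by simp
  moreover have "1 / 2 < real c / real D" using c(3) D by (simp add: field_simps)
  moreover have "real c / real D \<le> 1" using D c(3) by (simp add: field_simps)
  ultimately show ?thesis unfolding p by simp
qed

text \<open>Excludes the branch of \<open>commuting_prob\<close> for finite groups. The polynomial
  whose roots are the finitely many values of \<open>f 0\<close> would be a relation.\<close>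

lemma polyfuns_infinite:
  assumes "finite S" "indep f d S" shows "d = 0"
proof (rule ccontr)
  assume "d \<noteq> 0"
  then have d: "0 < d" by simp
  have "(\<lambda>p. \<Prod>v\<in>f 0 ` S. (p 0 - v)) \<in> polyfuns (cds d)"
    by (rule polyfuns_prod, rule polyfuns_diff[OF polyfuns_coord[OF cds_coord[OF d]] polyfuns_const])
  then have z: "(\<Prod>v\<in>f 0 ` S. (p 0 - v)) = 0" for p :: "nat \<Rightarrow> complex"
    by (rule indepD[OF assms(2)]) (use assms(1) in auto)
  have "finite (f 0 ` S)" using assms(1) by simp
  then obtain t :: complex where t: "t \<notin> f 0 ` S" using ex_new_if_finite[OF infinite_UNIV_char_0] by metis
  from z[of "\<lambda>_. t"] show False using t assms(1) by auto
qed

lemma commuting_prob_eq: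
  assumes cl: "zclosed (mat_coords n) (carrier (GL n)) G"
    and f: "\<And>i. i < d \<Longrightarrow> f i \<in> polyfuns (mat_coords n)" "indep f d G" "growth (mat_coords n) G d" "d > 0"
    and g: "\<And>i. i < c \<Longrightarrow> g i \<in> polyfuns (mat2_coords n)" "indep g c (commuting_variety G)"
      "growth (mat2_coords n) (commuting_variety G) c"
  shows "commuting_prob n G = real c / (2 * real d)"
proof -
  let ?V2 = "carrier_mat n n \<times> carrier_mat n n" and ?X2 = "mat2_coords n"
  have GV: "G \<subseteq> carrier_mat n n" using zclosed_subset[OF cl] by (auto simp: carrier_GL)
  have inf: "infinite G" using polyfuns_infinite[of G f d] f by auto
  have q2: "qaffine ?X2 ?V2 (G \<times> G)" by (rule qaffine_group2[OF cl])
  have qC: "qaffine ?X2 ?V2 (commuting_variety G)"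
    by (rule qaffine_zclosed[OF q2 zclosed_commuting_variety[OF GV]])
  have "krull_dim (subtopology (zariski ?X2 ?V2) (commuting_variety G)) = enat c"
    by (rule krull_dim_eq[OF qC _ g(2,1,3)]) (use GV in \<open>auto simp: commuting_variety_def\<close>)
  moreover have "krull_dim (subtopology (zariski ?X2 ?V2) (G \<times> G)) = enat (d + d)"
  proof (rule krull_dim_eq[OF q2 _ indep_Times[OF f(2) f(2)] _ growth_Times[OF f(3) f(3)]])
    show "(\<lambda>z. if i < d then f i (fst z) else f (i - d) (snd z)) \<in> polyfuns ?X2" if "i < d + d" for i
      using that pf_pair_fst[of "mat_coords n" UNIV "f i" "mat_coords n" UNIV]
        pf_pair_snd[of "mat_coords n" UNIV "f (i - d)" "mat_coords n" UNIV] f(1)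
      by (cases "i < d") (auto simp: pf_UNIV)
  qed (use GV in auto)
  ultimately show ?thesis using inf by (simp add: commuting_prob_def zariski_mat2_eq)
qed

lemma polyfuns_entry: "i < n \<Longrightarrow> j < n \<Longrightarrow> (\<lambda>A. A $$ (i, j)) \<in> polyfuns (mat_coords n)"
  by (rule polyfuns_coord) (auto simp: mat_coords_def)

lemma polyfuns_fst_entry: "i < n \<Longrightarrow> j < n \<Longrightarrow> (\<lambda>z. fst z $$ (i, j)) \<in> polyfuns (pair_coords (mat_coords n) Y)"
  using pf_pair_fst[of "mat_coords n" UNIV "\<lambda>A. A $$ (i, j)" Y UNIV] polyfuns_entry[of i n j] by (auto simp: pf_UNIV)

lemma polyfuns_snd_entry: "i < n \<Longrightarrow> j < n \<Longrightarrow> (\<lambda>z. snd z $$ (i, j)) \<in> polyfuns (pair_coords Y (mat_coords n))"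
  using pf_pair_snd[of "mat_coords n" UNIV "\<lambda>A. A $$ (i, j)" Y UNIV] polyfuns_entry[of i n j] by (auto simp: pf_UNIV)

section \<open>Substitution groups\<close>

definition tangent :: "nat \<Rightarrow> complex fps set" where
  "tangent k = {f. fps_nth f 0 = 0 \<and> fps_nth f 1 = 1 \<and> (\<forall>j\<in>{2..k}. fps_nth f j = 0)}"

text \<open>The matrix of the substitution operator of \<open>f\<close> on \<open>x \<complex>[x] / x\<^sup>m\<^sup>+\<^sup>2\<close>: row \<open>i\<close> lists the
  coefficients of \<open>f\<^sup>i\<^sup>+\<^sup>1\<close>.\<close>

definition subst_mat :: "nat \<Rightarrow> complex fps \<Rightarrow> complex mat" where
  "subst_mat m f = mat (Suc m) (Suc m) (\<lambda>(i, j). fps_nth (f ^ Suc i) (Suc j))"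

lemma subst_mat_carrier [simp]: "subst_mat m f \<in> carrier_mat (Suc m) (Suc m)"
  by (simp add: subst_mat_def)

lemma subst_mat_entry: "i \<le> m \<Longrightarrow> j \<le> m \<Longrightarrow> subst_mat m f $$ (i, j) = fps_nth (f ^ Suc i) (Suc j)"
  by (simp add: subst_mat_def)

lemma subst_mat_row: "j \<le> m \<Longrightarrow> subst_mat m f $$ (0, j) = fps_nth f (Suc j)"
  by (simp add: subst_mat_entry)

text \<open>Row \<open>i\<close> of the product expands \<open>f ^ Suc i\<close> and replaces each
  power of the variable by that power of \<open>g\<close>, which gives
  \<open>(f oo g) ^ Suc i\<close>. Truncation is harmless because \<open>g ^ Suc l\<close> has no
  terms of degree at most \<open>l\<close>.\<close>

lemma subst_mat_compose:
  assumes f: "fps_nth f 0 = 0" and g: "fps_nth g 0 = 0"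
  shows "subst_mat m (f oo g) = subst_mat m f * subst_mat m g"
proof (rule eq_matI)
  fix i j assume "i < dim_row (subst_mat m f * subst_mat m g)" "j < dim_col (subst_mat m f * subst_mat m g)"
  then have ij: "i \<le> m" "j \<le> m" by (auto simp: subst_mat_def)
  have "subst_mat m (f oo g) $$ (i, j) = fps_nth (f ^ Suc i oo g) (Suc j)"
    using ij fps_compose_power[OF g, of f "Suc i"] by (simp add: subst_mat_entry)
  also have "\<dots> = (\<Sum>l\<in>{0..Suc j}. fps_nth (f ^ Suc i) l * fps_nth (g ^ l) (Suc j))"
    by (rule fps_compose_nth)
  also have "\<dots> = (\<Sum>l\<in>{0..j}. fps_nth (f ^ Suc i) (Suc l) * fps_nth (g ^ Suc l) (Suc j))"
    using f by (subst sum.atLeast0_atMost_Suc_shift) simp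
  also have "\<dots> = (\<Sum>l\<in>{0..m}. fps_nth (f ^ Suc i) (Suc l) * fps_nth (g ^ Suc l) (Suc j))"
  proof (rule sum.mono_neutral_left)
    show "\<forall>l\<in>{0..m} - {0..j}. fps_nth (f ^ Suc i) (Suc l) * fps_nth (g ^ Suc l) (Suc j) = 0"
    proof
      fix l assume "l \<in> {0..m} - {0..j}"
      then have "fps_nth (g ^ Suc l) (Suc j) = 0"
        using startsby_zero_power_prefix[OF g, of "Suc l"] by (simp del: power_Suc)
      then show "fps_nth (f ^ Suc i) (Suc l) * fps_nth (g ^ Suc l) (Suc j) = 0" by (simp only: mult_zero_right)
    qed
  qed (use ij in auto)
  also have "\<dots> = (subst_mat m f * subst_mat m g) $$ (i, j)"
    using ij by (simp add: subst_mat_def scalar_prod_def atLeastLessThanSuc_atLeastAtMost del: power_Suc)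
  finally show "subst_mat m (f oo g) $$ (i, j) = (subst_mat m f * subst_mat m g) $$ (i, j)" .
qed (auto simp: subst_mat_def)

lemma subst_mat_X: "subst_mat m fps_X = 1\<^sub>m (Suc m)"
  by (rule eq_matI) (auto simp: subst_mat_def fps_X_power_nth simp del: power_Suc)

lemma subst_mat_cong:
  assumes "\<And>j. j \<le> Suc m \<Longrightarrow> fps_nth f j = fps_nth g j"
  shows "subst_mat m f = subst_mat m g"
proof -
  have "fps_nth (f ^ i) j = fps_nth (g ^ i) j" if "j \<le> Suc m" for i j
    using that
  proof (induction i arbitrary: j)
    case (Suc i)
    have "fps_nth f l * fps_nth (f ^ i) (j - l) = fps_nth g l * fps_nth (g ^ i) (j - l)" if "l \<in> {0..j}" for l
      using Suc.IH[of "j - l"] assms[of l] Suc.prems that by simp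
    then show ?case by (simp add: fps_mult_nth)
  qed simp
  then have "fps_nth (f ^ Suc i) (Suc j) = fps_nth (g ^ Suc i) (Suc j)" if "j \<le> m" for i j using that by blast
  then show ?thesis unfolding subst_mat_def by (intro cong_mat) (simp_all only: prod.case less_Suc_eq_le)
qed

section \<open>Series tangent to the identity and their depth\<close>

lemma tangent_decompose:
  assumes "f \<in> tangent k" "k \<ge> 1"
  obtains r where "f = fps_X + fps_X ^ Suc k * r" "fps_nth r 0 = fps_nth f (Suc k)"
proof
  show "f = fps_X + fps_X ^ Suc k * Abs_fps (\<lambda>j. fps_nth f (j + Suc k))"
  proof (rule fps_ext)
    fix j
    consider "j = 0" | "j = 1" | "2 \<le> j" "j \<le> k" | "k < j" "2 \<le> j" by linarith
    then show "fps_nth f j = fps_nth (fps_X + fps_X ^ Suc k * Abs_fps (\<lambda>j. fps_nth f (j + Suc k))) j"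
      using assms unfolding tangent_def fps_add_nth fps_X_power_mult_nth by cases (auto simp: fps_X_def)
  qed
qed simp

text \<open>The binomial expansion to first order: every further term contains
  \<open>fps_X ^ (l + 2 * k)\<close>.\<close>

lemma tangent_power_decompose:
  fixes r :: "complex fps"
  shows "\<exists>s. (fps_X + fps_X ^ Suc k * r) ^ l = fps_X ^ l + of_nat l * (fps_X ^ (l + k) * r) + fps_X ^ (l + (k + k)) * s"
proof (induction l)
  case 0
  show ?case by (rule exI[of _ 0]) simp
next
  case (Suc l)
  then obtain s where s: "(fps_X + fps_X ^ Suc k * r) ^ l = fps_X ^ l + of_nat l * (fps_X ^ (l + k) * r) + fps_X ^ (l + (k + k)) * s" by blast
  show ?case
    unfolding power_Suc[of "fps_X + fps_X ^ Suc k * r"] s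
    by (rule exI[of _ "s + of_nat l * r * r + fps_X ^ k * r * s"]) (simp add: algebra_simps power_add)
qed

lemma tangent_power_nth:
  assumes "f \<in> tangent k" "k \<ge> 1"
  shows "j < l + k \<Longrightarrow> fps_nth (f ^ l) j = (if j = l then 1 else 0)"
    and "fps_nth (f ^ l) (l + k) = of_nat l * fps_nth f (Suc k)"
proof -
  obtain r where r: "f = fps_X + fps_X ^ Suc k * r" "fps_nth r 0 = fps_nth f (Suc k)"
    using tangent_decompose[OF assms] .
  obtain s where s: "f ^ l = fps_X ^ l + of_nat l * (fps_X ^ (l + k) * r) + fps_X ^ (l + (k + k)) * s"
    using tangent_power_decompose[of k r l] r(1) by auto
  have nth: "fps_nth (f ^ l) j = (if j = l then 1 else 0) + of_nat l * (if j < l + k then 0 else fps_nth r (j - (l + k)))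
     + (if j < l + 2 * k then 0 else fps_nth s (j - (l + (k + k))))" for j
    unfolding s fps_add_nth fps_X_power_mult_nth fps_mult_of_nat_nth(1) fps_X_power_nth by auto
  show "j < l + k \<Longrightarrow> fps_nth (f ^ l) j = (if j = l then 1 else 0)" unfolding nth by auto
  show "fps_nth (f ^ l) (l + k) = of_nat l * fps_nth f (Suc k)" unfolding nth using assms(2) r(2) by auto
qed

lemma tangentD: "f \<in> tangent k \<Longrightarrow> fps_nth f 0 = 0" "f \<in> tangent k \<Longrightarrow> fps_nth f 1 = 1"
  "f \<in> tangent k \<Longrightarrow> 2 \<le> j \<Longrightarrow> j \<le> k \<Longrightarrow> fps_nth f j = 0"
  by (auto simp: tangent_def)

lemma tangent_mono: "k \<le> l \<Longrightarrow> tangent l \<subseteq> tangent k"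
  by (auto simp: tangent_def)

lemma tangent_Suc: "f \<in> tangent k \<Longrightarrow> fps_nth f (Suc k) = 0 \<Longrightarrow> f \<in> tangent (Suc k)"
  by (auto simp: tangent_def le_Suc_eq)

lemma X_tangent: "fps_X \<in> tangent k"
  by (auto simp: tangent_def fps_X_def)

lemma compose_nth_low:
  assumes "f \<in> tangent k" "k \<ge> 1" "j \<le> k"
  shows "fps_nth (h oo f) j = fps_nth h j"
proof -
  have "fps_nth (h oo f) j = (\<Sum>l\<in>{0..j}. fps_nth h l * fps_nth (f ^ l) j)" by (rule fps_compose_nth)
  also have "\<dots> = (\<Sum>l\<in>{0..j}. if l = j then fps_nth h l else 0)"
  proof (rule sum.cong[OF refl])
    fix l assume l: "l \<in> {0..j}"
    show "fps_nth h l * fps_nth (f ^ l) j = (if l = j then fps_nth h l else 0)"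
    proof (cases "l = 0")
      case False
      then show ?thesis using tangent_power_nth(1)[OF assms(1,2), of j l] l assms(3) by auto
    next
      case True
      then show ?thesis by auto
    qed
  qed
  also have "\<dots> = fps_nth h j" by simp
  finally show ?thesis .
qed

lemma tangent_compose:
  assumes "f \<in> tangent k" "g \<in> tangent k" "k \<ge> 1" shows "f oo g \<in> tangent k"
  unfolding tangent_def using compose_nth_low[OF assms(2,3), of _ f] tangentD[OF assms(1)] assms(3) by auto

lemma tangent_inv:
  assumes "f \<in> tangent k" "k \<ge> 1"
  shows "fps_inv f \<in> tangent k" "fps_inv f oo f = fps_X" "f oo fps_inv f = fps_X"
proof -
  have f: "fps_nth f 0 = 0" "fps_nth f 1 \<noteq> 0" using assms by (auto simp: tangent_def)
  show 1: "fps_inv f oo f = fps_X" by (rule fps_inv[OF f])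
  show "f oo fps_inv f = fps_X" by (rule fps_inv_right[OF f])
  have "fps_nth (fps_inv f) j = fps_nth fps_X j" if "j \<le> k" for j
    using compose_nth_low[OF assms that, of "fps_inv f"] 1 by simp
  then show "fps_inv f \<in> tangent k" using assms(2) unfolding tangent_def by (auto simp: fps_X_def)
qed

text \<open>Only three powers of \<open>g\<close> contribute. For \<open>2 \<le> l \<le> i\<close>
  the coefficient of \<open>f\<close> vanishes, and for \<open>Suc i < l < Suc (i + j)\<close> the
  power \<open>g ^ l\<close> agrees with \<open>fps_X ^ l\<close> in all degrees up to
  \<open>Suc (i + j)\<close>.\<close>

lemma compose_nth_depth:
  assumes f: "f \<in> tangent i" "i \<ge> 1" and g: "g \<in> tangent j" "j \<ge> 1"
  shows "fps_nth (f oo g) (Suc (i + j)) = fps_nth g (Suc (i + j)) + of_nat (Suc i) * fps_nth f (Suc i) * fps_nth g (Suc j)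
    + fps_nth f (Suc (i + j))"
proof -
  let ?N = "Suc (i + j)"
  have "fps_nth (f oo g) ?N = (\<Sum>l\<in>{0..?N}. fps_nth f l * fps_nth (g ^ l) ?N)" by (rule fps_compose_nth)
  also have "\<dots> = (\<Sum>l\<in>{1, Suc i, ?N}. fps_nth f l * fps_nth (g ^ l) ?N)"
  proof (rule sum.mono_neutral_right)
    show "\<forall>l\<in>{0..?N} - {1, Suc i, ?N}. fps_nth f l * fps_nth (g ^ l) ?N = 0"
    proof
      fix l assume l: "l \<in> {0..?N} - {1, Suc i, ?N}"
      consider "l = 0" | "2 \<le> l" "l \<le> i" | "Suc i < l" "l < ?N" using l by force
      then show "fps_nth f l * fps_nth (g ^ l) ?N = 0"
      proof cases
        case 3
        then show ?thesis using tangent_power_nth(1)[OF g, of ?N l] by simp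
      qed (use tangentD[OF f(1)] in auto)
    qed
  qed (use f(2) in auto)
  also have "\<dots> = fps_nth f 1 * fps_nth (g ^ 1) ?N + fps_nth f (Suc i) * fps_nth (g ^ Suc i) (Suc i + j)
     + fps_nth f ?N * fps_nth (g ^ ?N) ?N"
    using f(2) g(2) by (simp del: power_Suc)
  also have "\<dots> = fps_nth g ?N + fps_nth f (Suc i) * (of_nat (Suc i) * fps_nth g (Suc j)) + fps_nth f ?N"
    using tangent_power_nth(2)[OF g, of "Suc i"] tangent_power_nth(1)[OF g, of ?N ?N] tangentD(2)[OF f(1)] g(2)
    by (simp del: power_Suc of_nat_Suc)
  finally show ?thesis by (simp only: ac_simps)
qed

text \<open>Cross terms start in degree \<open>a + b + 1\<close>. Up to degree \<open>a + b\<close>,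
  composition is therefore addition of the deviations from \<open>fps_X\<close>, and in particular
  symmetric in \<open>f\<close> and \<open>g\<close>.\<close>

lemma compose_nth_high:
  assumes f: "f \<in> tangent a" "a \<ge> 1" and g: "g \<in> tangent b" "b \<ge> 1" and j: "j \<le> a + b"
  shows "fps_nth (f oo g) j = fps_nth f j + fps_nth g j - fps_nth fps_X j"
proof (cases "j = 0")
  case True
  then show ?thesis using tangentD(1)[OF f(1)] tangentD(1)[OF g(1)] by simp
next
  case False
  have "fps_nth (f oo g) j = (\<Sum>l\<in>{0..j}. fps_nth f l * fps_nth (g ^ l) j)" by (rule fps_compose_nth)
  also have "\<dots> = (\<Sum>l\<in>{0..j}. (if l = 1 then fps_nth g j else 0) + (if l = j then fps_nth f j - fps_nth fps_X j else 0))"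
  proof (rule sum.cong[OF refl])
    fix l assume l: "l \<in> {0..j}"
    consider "l = 0" | "l = 1" "j = 1" | "l = 1" "j \<noteq> 1" | "2 \<le> l" "l \<le> a" | "a < l" "2 \<le> l" by linarith
    then show "fps_nth f l * fps_nth (g ^ l) j
      = (if l = 1 then fps_nth g j else 0) + (if l = j then fps_nth f j - fps_nth fps_X j else 0)"
    proof cases
      case 5
      then have "fps_nth (g ^ l) j = (if j = l then 1 else 0)" using j by (intro tangent_power_nth(1)[OF g]) auto
      then show ?thesis using 5 by auto
    qed (use tangentD[OF f(1)] tangentD[OF g(1)] False in auto)
  qed
  also have "\<dots> = fps_nth g j + (fps_nth f j - fps_nth fps_X j)"
    using False by (simp add: sum.distrib)
  finally show ?thesis by simp
qed

lemma compose_nth_first: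
  assumes "f \<in> tangent k" "g \<in> tangent k" "k \<ge> 1"
  shows "fps_nth (f oo g) (Suc k) = fps_nth f (Suc k) + fps_nth g (Suc k)"
  using compose_nth_high[OF assms(1,3) assms(2,3), of "Suc k"] assms(3) by (simp add: fps_X_def)

lemma depth_cases:
  assumes "f \<in> tangent a"
  shows "f \<in> tangent b \<or> (\<exists>j. a \<le> j \<and> j < b \<and> f \<in> tangent j \<and> fps_nth f (Suc j) \<noteq> 0)"
proof (induction b)
  case 0
  then show ?case using tangent_mono[of 0 a] assms by auto
next
  case (Suc b)
  show ?case
  proof (cases "f \<in> tangent b")
    case True
    show ?thesis
    proof (cases "a \<le> b")
      case False
      then show ?thesis using assms tangent_mono[of "Suc b" a] by auto
    qed (use True tangent_Suc in auto)
  next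
    case False
    then show ?thesis using Suc less_Suc_eq by blast
  qed
qed

text \<open>In degree \<open>Suc (i + j)\<close> the two compositions differ by \<open>i - j\<close>
  times the product of the leading coefficients; \<open>i + j \<le> m\<close> means that this degree
  survives the truncation.\<close>

lemma commuting_depth:
  assumes f: "f \<in> tangent i" "i \<ge> 1" "fps_nth f (Suc i) \<noteq> 0" and g: "g \<in> tangent j" "j \<ge> 1" "fps_nth g (Suc j) \<noteq> 0"
    and m: "i + j \<le> m" and comm: "subst_mat m f * subst_mat m g = subst_mat m g * subst_mat m f"
  shows "i = j"
proof -
  have "subst_mat m (f oo g) = subst_mat m (g oo f)"
    using comm subst_mat_compose[of f g m] subst_mat_compose[of g f m] tangentD(1)[OF f(1)] tangentD(1)[OF g(1)] by simp
  then have "fps_nth (f oo g) (Suc (i + j)) = fps_nth (g oo f) (Suc (j + i))"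
    using subst_mat_row[OF m, of "f oo g"] subst_mat_row[OF m, of "g oo f"] by (simp add: add.commute)
  then have "of_nat (Suc i) * (fps_nth f (Suc i) * fps_nth g (Suc j)) = of_nat (Suc j) * (fps_nth f (Suc i) * fps_nth g (Suc j))"
    unfolding compose_nth_depth[OF f(1,2) g(1,2)] compose_nth_depth[OF g(1,2) f(1,2)]
    by (simp add: add.commute[of j i] mult_ac del: of_nat_Suc)
  then have "(of_nat (Suc i) :: complex) = of_nat (Suc j)" using f(3) g(3) by (simp del: of_nat_Suc)
  then show ?thesis by (simp only: of_nat_eq_iff)
qed

section \<open>Filtration of matrices by superdiagonals\<close>

definition upr :: "nat \<Rightarrow> nat \<Rightarrow> complex mat \<Rightarrow> bool" where
  "upr n s A \<longleftrightarrow> A \<in> carrier_mat n n \<and> (\<forall>i<n. \<forall>j<n. j < i + s \<longrightarrow> A $$ (i, j) = 0)"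

lemma upr_mult:
  assumes "upr n s A" "upr n t B" shows "upr n (s + t) (A * B)"
  unfolding upr_def
proof (intro conjI allI impI)
  show "A * B \<in> carrier_mat n n" using assms by (auto simp: upr_def)
  fix i j assume ij: "i < n" "j < n" "j < i + (s + t)"
  have "(A * B) $$ (i, j) = (\<Sum>l\<in>{0..<n}. A $$ (i, l) * B $$ (l, j))"
    using assms ij by (auto simp: upr_def scalar_prod_def)
  also have "\<dots> = 0"
  proof (rule sum.neutral, rule ballI)
    fix l assume l: "l \<in> {0..<n}"
    have "l < i + s \<or> j < l + t" using ij(3) by linarith
    then show "A $$ (i, l) * B $$ (l, j) = 0" using assms ij l by (auto simp: upr_def)
  qed
  finally show "(A * B) $$ (i, j) = 0" .
qed

lemma upr_add: "upr n s A \<Longrightarrow> upr n s B \<Longrightarrow> upr n s (A + B)"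
  by (auto simp: upr_def)

lemma upr_minus: "upr n s A \<Longrightarrow> upr n s B \<Longrightarrow> upr n s (A - B)"
  by (auto simp: upr_def)

lemma upr_mono: "upr n s A \<Longrightarrow> t \<le> s \<Longrightarrow> upr n t A"
  by (auto simp: upr_def)

lemma upr_one: "upr n 0 (1\<^sub>m n)"
  by (auto simp: upr_def)

lemma upr_zero: "upr n n A \<Longrightarrow> A = 0\<^sub>m n n"
  by (auto simp: upr_def)

lemma upr_pow: "upr n s A \<Longrightarrow> upr n (k * s) (A ^\<^sub>m k)"
proof (induction k)
  case 0
  then have "A \<in> carrier_mat n n" by (simp add: upr_def)
  then show ?case using upr_one by auto
next
  case (Suc k)
  then show ?case using upr_mult[of n "k * s" "A ^\<^sub>m k" s A] by (simp add: add.commute)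
qed

lemma subst_mat_upr:
  assumes "f \<in> tangent k" "k \<ge> 1" shows "upr (Suc m) 1 (subst_mat m f - 1\<^sub>m (Suc m))"
  unfolding upr_def
proof (intro conjI allI impI)
  fix i j assume ij: "i < Suc m" "j < Suc m" "j < i + 1"
  then show "(subst_mat m f - 1\<^sub>m (Suc m)) $$ (i, j) = 0"
    using tangent_power_nth(1)[OF assms, of "Suc j" "Suc i"] assms(2) by (auto simp: subst_mat_entry simp del: power_Suc)
qed (simp add: minus_carrier_mat)

section \<open>The substitution group: closedness, irreducibility and dimension\<close>

definition tangent_group :: "nat \<Rightarrow> nat \<Rightarrow> complex mat set" where
  "tangent_group m k = subst_mat m ` tangent k"

lemma tangent_group_carrier: "tangent_group m k \<subseteq> carrier_mat (Suc m) (Suc m)"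
  by (auto simp: tangent_group_def)

lemma tangent_group_mult:
  assumes "A \<in> tangent_group m k" "B \<in> tangent_group m k" "k \<ge> 1" shows "A * B \<in> tangent_group m k"
proof -
  obtain f g where "f \<in> tangent k" "A = subst_mat m f" "g \<in> tangent k" "B = subst_mat m g"
    using assms by (auto simp: tangent_group_def)
  then show ?thesis using subst_mat_compose[of f g m] tangent_compose[of f k g] tangentD(1)[of f k] tangentD(1)[of g k] assms(3)
    unfolding tangent_group_def by (metis image_eqI)
qed

lemma tangent_group_inv:
  assumes "A \<in> tangent_group m k" "k \<ge> 1"
  shows "\<exists>B\<in>tangent_group m k. A * B = 1\<^sub>m (Suc m) \<and> B * A = 1\<^sub>m (Suc m)"
proof -
  obtain f where f: "f \<in> tangent k" "A = subst_mat m f" using assms by (auto simp: tangent_group_def)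
  note i = tangent_inv[OF f(1) assms(2)]
  show ?thesis
  proof (rule bexI[of _ "subst_mat m (fps_inv f)"], rule conjI)
    show "A * subst_mat m (fps_inv f) = 1\<^sub>m (Suc m)"
      unfolding f(2) using subst_mat_compose[of f "fps_inv f" m] i(3) subst_mat_X tangentD(1)[OF f(1)] tangentD(1)[OF i(1)] by simp
    show "subst_mat m (fps_inv f) * A = 1\<^sub>m (Suc m)"
      unfolding f(2) using subst_mat_compose[of "fps_inv f" f m] i(2) subst_mat_X tangentD(1)[OF f(1)] tangentD(1)[OF i(1)] by simp
  qed (use i(1) in \<open>simp add: tangent_group_def\<close>)
qed

lemma tangent_group_one: "1\<^sub>m (Suc m) \<in> tangent_group m k"
  unfolding tangent_group_def using X_tangent subst_mat_X by (metis image_eqI)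

lemma GL_inverse:
  assumes "A \<in> carrier_mat n n" "B \<in> carrier_mat n n" "A * B = 1\<^sub>m n" "B * A = 1\<^sub>m n"
  shows "A \<in> carrier (GL n)" "inv\<^bsub>GL n\<^esub> A = B"
proof -
  have "det A * det B = 1" using det_mult[OF assms(1,2)] assms(3) by simp
  then have "det A \<noteq> 0" "det B \<noteq> 0" by auto
  then show A: "A \<in> carrier (GL n)" using assms by (simp add: carrier_GL)
  have "B \<in> carrier (GL n)" using \<open>det B \<noteq> 0\<close> assms by (simp add: carrier_GL)
  then show "inv\<^bsub>GL n\<^esub> A = B"
    by (intro group.inv_equality[OF group_GL]) (use A assms(4) in simp_all)
qed

lemma tangent_group_subgroup:
  assumes "k \<ge> 1" shows "subgroup (tangent_group m k) (GL (Suc m))"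
proof (rule group.subgroupI[OF group_GL])
  have *: "A \<in> carrier (GL (Suc m)) \<and> inv\<^bsub>GL (Suc m)\<^esub> A \<in> tangent_group m k" if A: "A \<in> tangent_group m k" for A
  proof -
    obtain B where B: "B \<in> tangent_group m k" "A * B = 1\<^sub>m (Suc m)" "B * A = 1\<^sub>m (Suc m)"
      using tangent_group_inv[OF A assms] by blast
    have "A \<in> carrier_mat (Suc m) (Suc m)" "B \<in> carrier_mat (Suc m) (Suc m)" using A B tangent_group_carrier by auto
    then show ?thesis using GL_inverse[of A "Suc m" B] B by simp
  qed
  show "tangent_group m k \<subseteq> carrier (GL (Suc m))" using * by auto
  show "tangent_group m k \<noteq> {}" using tangent_group_one by blast
  show "\<And>A. A \<in> tangent_group m k \<Longrightarrow> inv\<^bsub>GL (Suc m)\<^esub> A \<in> tangent_group m k" using * by auto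
  show "\<And>A B. A \<in> tangent_group m k \<Longrightarrow> B \<in> tangent_group m k \<Longrightarrow> A \<otimes>\<^bsub>GL (Suc m)\<^esub> B \<in> tangent_group m k"
    using tangent_group_mult[OF _ _ assms] by simp
qed

text \<open>\<open>t l\<close> is the coefficient of \<open>x ^ (l + k + 1)\<close>. Exactly the
  \<open>Suc m - k\<close> coefficients that survive truncation are parameters, which gives a
  polynomial parametrisation of \<open>tangent_group m k\<close> by affine space.\<close>

definition pser :: "nat \<Rightarrow> nat \<Rightarrow> (nat \<Rightarrow> complex) \<Rightarrow> complex fps" where
  "pser m k t = Abs_fps (\<lambda>j. if j = 1 then 1 else if k < j \<and> j \<le> Suc m then t (j - Suc k) else 0)"

lemma pser_tangent: "k \<ge> 1 \<Longrightarrow> pser m k t \<in> tangent k"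
  by (auto simp: pser_def tangent_def)

lemma pser_nth: "k < j \<Longrightarrow> j \<le> Suc m \<Longrightarrow> k \<ge> 1 \<Longrightarrow> fps_nth (pser m k t) j = t (j - Suc k)"
  by (auto simp: pser_def)

lemma subst_mat_pser:
  assumes "f \<in> tangent k" "k \<ge> 1" "\<And>j. k \<le> j \<Longrightarrow> j \<le> m \<Longrightarrow> t (j - k) = fps_nth f (Suc j)"
  shows "subst_mat m (pser m k t) = subst_mat m f"
proof (rule subst_mat_cong)
  fix j assume j: "j \<le> Suc m"
  consider "j = 0" | "j = 1" | "2 \<le> j" "j \<le> k" | "k < j" "2 \<le> j" by linarith
  then show "fps_nth (pser m k t) j = fps_nth f j"
  proof cases
    case 4
    then obtain l where "j = Suc l" "k \<le> l" by (cases j) auto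
    then show ?thesis using assms(3)[of l] j 4 by (simp add: pser_def)
  qed (use tangentD[OF assms(1)] assms(2) in \<open>auto simp: pser_def\<close>)
qed

lemma pf_fps_power:
  assumes "\<And>j. pf X S (\<lambda>x. fps_nth (F x) j)" shows "pf X S (\<lambda>x. fps_nth (F x ^ i) j)"
proof (induction i arbitrary: j)
  case 0
  show ?case by (auto intro: pf_const)
next
  case (Suc i)
  have "pf X S (\<lambda>x. \<Sum>l=0..j. fps_nth (F x) l * fps_nth (F x ^ i) (j - l))"
    by (rule pf_sum, rule pf_mult[OF assms Suc])
  then show ?case by (simp add: fps_mult_nth)
qed

lemma pfm_subst_mat:
  assumes "\<And>j. pf X S (\<lambda>x. fps_nth (F x) j)" shows "pfm X S (Suc m) (\<lambda>x. subst_mat m (F x))"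
  unfolding pfm_def
proof (intro conjI ballI allI impI)
  fix i j assume "i < Suc m" "j < Suc m"
  then show "pf X S (\<lambda>x. subst_mat m (F x) $$ (i, j))"
    using pf_fps_power[OF assms, of "Suc i" "Suc j"] by (simp add: subst_mat_def del: power_Suc)
qed simp

lemma pfm_pser:
  assumes "\<And>j. k \<le> j \<Longrightarrow> j \<le> m \<Longrightarrow> pf X S (\<lambda>x. t x (j - k))"
  shows "pfm X S (Suc m) (\<lambda>x. subst_mat m (pser m k (t x)))"
proof (rule pfm_subst_mat)
  fix j
  show "pf X S (\<lambda>x. fps_nth (pser m k (t x)) j)"
  proof (cases "j \<noteq> 1 \<and> k < j \<and> j \<le> Suc m")
    case True
    then obtain l where "j = Suc l" "k \<le> l" "l \<le> m" by (cases j) auto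
    then show ?thesis using assms[of l] True by (simp add: pser_def)
  next
    case False
    then have "fps_nth (pser m k (t x)) j = (if j = 1 then 1 else 0)" for x by (auto simp: pser_def)
    then show ?thesis using pf_const[of X S 1] pf_const[of X S 0] by (cases "j = 1") simp_all
  qed
qed

lemma tangent_group_range:
  assumes "k \<ge> 1" shows "tangent_group m k = range (\<lambda>t. subst_mat m (pser m k t))"
proof (intro Set.equalityI subsetI)
  fix A assume "A \<in> tangent_group m k"
  then obtain f where f: "f \<in> tangent k" "A = subst_mat m f" by (auto simp: tangent_group_def)
  then have "A = subst_mat m (pser m k (\<lambda>l. fps_nth f (Suc (l + k))))"
    using subst_mat_pser[OF f(1) assms, of m "\<lambda>l. fps_nth f (Suc (l + k))"] by simp
  then show "A \<in> range (\<lambda>t. subst_mat m (pser m k t))" by blast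
qed (use pser_tangent[OF assms] in \<open>auto simp: tangent_group_def\<close>)

definition row_series :: "nat \<Rightarrow> complex mat \<Rightarrow> complex fps" where
  "row_series m A = Abs_fps (\<lambda>j. if j = 0 \<or> j > Suc m then 0 else A $$ (0, j - 1))"

text \<open>A substitution matrix is determined by its first row, and its other rows are polynomials
  in that row. Membership thus becomes a system of polynomial equations in the entries, whence
  closedness.\<close>

lemma tangent_group_iff:
  assumes "k \<ge> 1" "k \<le> m"
  shows "A \<in> tangent_group m k \<longleftrightarrow> A = subst_mat m (row_series m A) \<and> A $$ (0, 0) = 1 \<and> (\<forall>l\<in>{1..<k}. A $$ (0, l) = 0)"
proof
  assume "A \<in> tangent_group m k"
  then obtain f where f: "f \<in> tangent k" "A = subst_mat m f" by (auto simp: tangent_group_def)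
  have "subst_mat m (row_series m A) = subst_mat m f"
  proof (rule subst_mat_cong)
    fix j assume "j \<le> Suc m"
    then show "fps_nth (row_series m A) j = fps_nth f j"
      using subst_mat_row[of "j - 1" m f] tangentD(1)[OF f(1)] by (cases j) (auto simp: row_series_def f(2))
  qed
  moreover have "A $$ (0, 0) = 1" using subst_mat_row[of 0 m f] f tangentD(2)[OF f(1)] by simp
  moreover have "\<forall>l\<in>{1..<k}. A $$ (0, l) = 0"
    using subst_mat_row[of _ m f] f tangentD(3)[OF f(1)] assms by auto
  ultimately show "A = subst_mat m (row_series m A) \<and> A $$ (0, 0) = 1 \<and> (\<forall>l\<in>{1..<k}. A $$ (0, l) = 0)" using f(2) by simp
next
  assume A: "A = subst_mat m (row_series m A) \<and> A $$ (0, 0) = 1 \<and> (\<forall>l\<in>{1..<k}. A $$ (0, l) = 0)"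
  have "fps_nth (row_series m A) j = 0" if "j \<in> {2..k}" for j
  proof -
    have "j - 1 \<in> {1..<k}" using that by auto
    then show ?thesis using A that assms(2) by (auto simp: row_series_def)
  qed
  then have "row_series m A \<in> tangent k"
    unfolding tangent_def using A by (auto simp: row_series_def)
  then show "A \<in> tangent_group m k" using A unfolding tangent_group_def by blast
qed

lemma tangent_group_zclosed:
  assumes "k \<ge> 1" "k \<le> m"
  shows "zclosed (mat_coords (Suc m)) (carrier_mat (Suc m) (Suc m)) (tangent_group m k)"
proof -
  let ?X = "mat_coords (Suc m)" and ?V = "carrier_mat (Suc m) (Suc m) :: complex mat set"
  have "pf ?X ?V (\<lambda>A. fps_nth (row_series m A) j)" for j
    by (cases "j = 0 \<or> j > Suc m") (auto simp: row_series_def intro: pf_const pf_entry)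
  then have "pfm ?X ?V (Suc m) (\<lambda>A. subst_mat m (row_series m A))" by (rule pfm_subst_mat)
  then have 1: "zclosed ?X ?V {A\<in>?V. A = subst_mat m (row_series m A)}"
    by (rule zclosed_mat_eq[OF pfm_id[OF order.refl]])
  let ?F = "insert (\<lambda>A. A $$ (0, 0) - 1) ((\<lambda>l A. A $$ (0, l)) ` {1..<k})"
  have 2: "zclosed ?X ?V {A\<in>?V. \<forall>f\<in>?F. f A = 0}"
    by (rule zclosed_pf) (use assms in \<open>auto intro!: pf_diff pf_entry pf_const\<close>)
  have "{A\<in>?V. A = subst_mat m (row_series m A)} \<inter> {A\<in>?V. \<forall>f\<in>?F. f A = 0} = tangent_group m k"
    using tangent_group_iff[OF assms] tangent_group_carrier[of m k] by auto
  then show ?thesis using zclosed_Inter2[OF 1 2] by simp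
qed

lemma tangent_group_GL:
  assumes "k \<ge> 1" "k \<le> m"
  shows "zclosed (mat_coords (Suc m)) (carrier (GL (Suc m))) (tangent_group m k)"
  by (rule zclosed_mono[OF tangent_group_zclosed[OF assms]])
    (use subgroup.subset[OF tangent_group_subgroup[OF assms(1)]] in \<open>auto simp: carrier_GL\<close>)

lemma pfm_tangent_param:
  assumes "k \<ge> 1" "Suc m - k \<le> D"
  shows "pfm (cds D) UNIV (Suc m) (\<lambda>t. subst_mat m (pser m k t))"
  by (rule pfm_pser) (use assms in \<open>auto intro!: pf_coord cds_coord\<close>)

lemma tangent_group_dim:
  assumes "k \<ge> 1" "k \<le> m"
  shows "zprime (mat_coords (Suc m)) (tangent_group m k)"
    and "growth (mat_coords (Suc m)) (tangent_group m k) (Suc m - k)"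
    and "indep (\<lambda>l A. A $$ (0, l + k)) (Suc m - k) (tangent_group m k)"
proof -
  have co: "pf (cds (Suc m - k)) UNIV (\<lambda>t. f (subst_mat m (pser m k t)))" if "f \<in> mat_coords (Suc m)" for f
    using pfm_tangent_param[OF assms(1) order.refl, of m] that by (auto simp: mat_coords_def pfm_def)
  show "zprime (mat_coords (Suc m)) (tangent_group m k)"
    unfolding tangent_group_range[OF assms(1)] by (rule zprime_image[OF zprime_affine co])
  show "growth (mat_coords (Suc m)) (tangent_group m k) (Suc m - k)"
    unfolding tangent_group_range[OF assms(1)] by (rule growth_affine_image[OF finite_mat_coords co])
  show "indep (\<lambda>l A. A $$ (0, l + k)) (Suc m - k) (tangent_group m k)"
    unfolding indep_def
  proof (intro ballI impI allI)
    fix P p assume P: "P \<in> polyfuns (cds (Suc m - k))" "\<forall>A\<in>tangent_group m k. P (\<lambda>l. A $$ (0, l + k)) = 0"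
    let ?A = "subst_mat m (pser m k p)"
    have "P (\<lambda>l. ?A $$ (0, l + k)) = P p"
      by (rule cds_cong[OF P(1)]) (use assms in \<open>auto simp: subst_mat_row pser_nth\<close>)
    moreover have "?A \<in> tangent_group m k" unfolding tangent_group_range[OF assms(1)] by blast
    ultimately show "P p = 0" using P(2) by metis
  qed
qed

section \<open>Nilpotency and solvability of the substitution group\<close>

lemma upr_inverse:
  assumes A: "upr n s (A - 1\<^sub>m n)" and B: "upr n 0 B" and AB: "A * B = 1\<^sub>m n" "A \<in> carrier_mat n n"
  shows "upr n s (B - 1\<^sub>m n)"
proof -
  have Bc: "B \<in> carrier_mat n n" using B by (simp add: upr_def)
  have "(A - 1\<^sub>m n) * B = 1\<^sub>m n - B" using AB Bc by (simp add: minus_mult_distrib_mat[of _ n n])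
  then have u: "upr n s (1\<^sub>m n - B)" using upr_mult[OF A B] by simp
  show ?thesis unfolding upr_def
  proof (intro conjI allI impI)
    fix i j assume ij: "i < n" "j < n" "j < i + s"
    then have "(1\<^sub>m n - B) $$ (i, j) = 0" using u by (simp add: upr_def)
    then show "(B - 1\<^sub>m n) $$ (i, j) = 0" using ij Bc by (auto split: if_splits)
  qed (use Bc in \<open>simp add: minus_carrier_mat\<close>)
qed

text \<open>With \<open>C\<close> and \<open>D\<close> inverse to \<open>A\<close> and
  \<open>B\<close>, the commutator minus \<open>1\<close> is \<open>(A * B - B * A) * C * D\<close>,
  and \<open>A * B - B * A\<close> does not change when \<open>1\<close> is subtracted from both
  matrices. So the indices of \<open>A - 1\<close> and \<open>B - 1\<close> add up.\<close>

lemma upr_commutator: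
  assumes A: "upr n 1 (A - 1\<^sub>m n)" "A \<in> carrier_mat n n" and B: "upr n s (B - 1\<^sub>m n)" "B \<in> carrier_mat n n"
    and C: "upr n 0 C" "upr n 0 D" "A * C = 1\<^sub>m n" "B * D = 1\<^sub>m n"
  shows "upr n (Suc s) (A * B * C * D - 1\<^sub>m n)"
proof -
  have Cc: "C \<in> carrier_mat n n" "D \<in> carrier_mat n n" using C by (auto simp: upr_def)
  have "upr n (Suc s) ((A - 1\<^sub>m n) * (B - 1\<^sub>m n) - (B - 1\<^sub>m n) * (A - 1\<^sub>m n))"
    using upr_minus[OF upr_mult[OF A(1) B(1)] upr_mono[OF upr_mult[OF B(1) A(1)]]] by simp
  moreover have "(A - 1\<^sub>m n) * (B - 1\<^sub>m n) - (B - 1\<^sub>m n) * (A - 1\<^sub>m n) = A * B - B * A"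
  proof -
    have 1: "(X - 1\<^sub>m n) * (Y - 1\<^sub>m n) = X * Y - X - (Y - 1\<^sub>m n)" if XY: "X \<in> carrier_mat n n" "Y \<in> carrier_mat n n" for X Y :: "complex mat"
      using minus_mult_distrib_mat[OF XY(1) one_carrier_mat minus_carrier_mat[OF one_carrier_mat], of Y]
        mult_minus_distrib_mat[OF XY(1) XY(2) one_carrier_mat] XY
      by (simp add: minus_carrier_mat)
    show ?thesis unfolding 1[OF A(2) B(2)] 1[OF B(2) A(2)]
      using A(2) B(2) by (intro eq_matI) (auto simp del: index_mult_mat(1))
  qed
  ultimately have "upr n (Suc s) ((A * B - B * A) * C * D)"
    using upr_mult[OF upr_mult[of n "Suc s" _ 0 C] C(2)] C(1) by simp
  moreover have "(A * B - B * A) * C * D = A * B * C * D - 1\<^sub>m n"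
  proof -
    have "(A * B - B * A) * C = A * B * C - B * A * C"
      by (rule minus_mult_distrib_mat[of _ n n _ _ n]) (use A B Cc in auto)
    also have "B * A * C = B" using A(2) B(2) Cc C(3) assoc_mult_mat[of B n n A n C n] by simp
    also have "(A * B * C - B) * D = A * B * C * D - B * D"
      by (rule minus_mult_distrib_mat[of _ n n _ _ n]) (use A B Cc in auto)
    finally show ?thesis using C(4) by simp
  qed
  ultimately show ?thesis by simp
qed

text \<open>A descending filtration by subgroups that contains the terms of both the lower central
  and the derived series: a commutator with any group element raises \<open>s\<close> by
  one.\<close>

definition upr_part :: "nat \<Rightarrow> nat \<Rightarrow> nat \<Rightarrow> complex mat set" where
  "upr_part m k s = {A\<in>tangent_group m k. upr (Suc m) s (A - 1\<^sub>m (Suc m))}"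

lemma inv_as_group:
  assumes "k \<ge> 1" "A \<in> tangent_group m k"
  shows "inv\<^bsub>as_group (Suc m) (tangent_group m k)\<^esub> A = inv\<^bsub>GL (Suc m)\<^esub> A"
  using group.m_inv_consistent[OF group_GL tangent_group_subgroup[OF assms(1)] assms(2)] .

lemma tangent_group_inv':
  assumes "k \<ge> 1" "A \<in> tangent_group m k"
  shows "inv\<^bsub>GL (Suc m)\<^esub> A \<in> tangent_group m k" "A * inv\<^bsub>GL (Suc m)\<^esub> A = 1\<^sub>m (Suc m)"
    "upr (Suc m) 0 (inv\<^bsub>GL (Suc m)\<^esub> A)"
proof -
  have sub: "subgroup (tangent_group m k) (GL (Suc m))" by (rule tangent_group_subgroup[OF assms(1)])
  show i: "inv\<^bsub>GL (Suc m)\<^esub> A \<in> tangent_group m k" by (rule subgroup.m_inv_closed[OF sub assms(2)])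
  show "A * inv\<^bsub>GL (Suc m)\<^esub> A = 1\<^sub>m (Suc m)"
    using group.r_inv[OF group_GL, of A "Suc m"] subgroup.subset[OF sub] assms(2) by auto
  obtain f where f: "f \<in> tangent k" "inv\<^bsub>GL (Suc m)\<^esub> A = subst_mat m f" using i by (auto simp: tangent_group_def)
  have "upr (Suc m) 0 (subst_mat m f - 1\<^sub>m (Suc m))"
    using subst_mat_upr[OF f(1) assms(1), of m] upr_mono by blast
  from upr_add[OF this upr_one] show "upr (Suc m) 0 (inv\<^bsub>GL (Suc m)\<^esub> A)"
    unfolding f(2) by (simp add: upr_def)
qed

lemma generate_upr_part:
  assumes k: "k \<ge> 1" and S: "S \<subseteq> upr_part m k s"
  shows "generate (as_group (Suc m) (tangent_group m k)) S \<subseteq> upr_part m k s"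
proof
  let ?G = "as_group (Suc m) (tangent_group m k)"
  have inv: "inv\<^bsub>?G\<^esub> A \<in> upr_part m k s" if "A \<in> upr_part m k s" for A
    using that inv_as_group[OF k, of A m] tangent_group_inv'[OF k, of A m]
      upr_inverse[of "Suc m" s A "inv\<^bsub>GL (Suc m)\<^esub> A"] tangent_group_carrier[of m k]
    by (auto simp: upr_part_def)
  fix A assume "A \<in> generate ?G S"
  then show "A \<in> upr_part m k s"
  proof induction
    case one
    show ?case using tangent_group_one[of m k] by (auto simp: upr_part_def upr_def)
  next
    case (incl h)
    then show ?case using S by blast
  next
    case (inv h)
    then show ?case using S \<open>\<And>A. A \<in> upr_part m k s \<Longrightarrow> inv\<^bsub>?G\<^esub> A \<in> upr_part m k s\<close> by blast
  next
    case (eng A B)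
    let ?I = "1\<^sub>m (Suc m) :: complex mat"
    have A: "A \<in> tangent_group m k" "upr (Suc m) s (A - ?I)" and B: "B \<in> tangent_group m k" "upr (Suc m) s (B - ?I)"
      using eng by (auto simp: upr_part_def)
    then have c: "A \<in> carrier_mat (Suc m) (Suc m)" "B \<in> carrier_mat (Suc m) (Suc m)" using tangent_group_carrier by auto
    obtain f where f: "f \<in> tangent k" "B = subst_mat m f" using B by (auto simp: tangent_group_def)
    have "upr (Suc m) 0 (B - ?I)" using subst_mat_upr[OF f(1) k, of m] f(2) upr_mono by blast
    from upr_add[OF this upr_one] have B0: "upr (Suc m) 0 B" using c by (simp add: upr_def)
    have "upr (Suc m) s ((A - ?I) * B + (B - ?I))" using upr_add[OF _ B(2)] upr_mult[OF A(2) B0] by simp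
    moreover have "(A - ?I) * B + (B - ?I) = A * B - ?I"
      using c minus_mult_distrib_mat[OF c(1) one_carrier_mat c(2)] by (intro eq_matI) (auto simp del: index_mult_mat(1))
    ultimately show ?case using tangent_group_mult[OF A(1) B(1) k] by (simp add: upr_part_def)
  qed
qed

lemma commutator_upr_part:
  assumes k: "k \<ge> 1" and A: "A \<in> tangent_group m k" and B: "B \<in> upr_part m k s"
  defines "G \<equiv> as_group (Suc m) (tangent_group m k)"
  shows "A \<otimes>\<^bsub>G\<^esub> B \<otimes>\<^bsub>G\<^esub> inv\<^bsub>G\<^esub> A \<otimes>\<^bsub>G\<^esub> inv\<^bsub>G\<^esub> B \<in> upr_part m k (Suc s)"
proof -
  have B': "B \<in> tangent_group m k" "upr (Suc m) s (B - 1\<^sub>m (Suc m))" using B by (auto simp: upr_part_def)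
  obtain f where f: "f \<in> tangent k" "A = subst_mat m f" using A by (auto simp: tangent_group_def)
  note iA = tangent_group_inv'[OF k A] and iB = tangent_group_inv'[OF k B'(1)]
  have "upr (Suc m) (Suc s) (A * B * inv\<^bsub>GL (Suc m)\<^esub> A * inv\<^bsub>GL (Suc m)\<^esub> B - 1\<^sub>m (Suc m))"
    by (rule upr_commutator[OF _ _ B'(2) _ iA(3) iB(3) iA(2) iB(2)])
      (use subst_mat_upr[OF f(1) k, of m] f(2) A B' tangent_group_carrier in auto)
  moreover have "A * B * inv\<^bsub>GL (Suc m)\<^esub> A * inv\<^bsub>GL (Suc m)\<^esub> B \<in> tangent_group m k"
    by (intro tangent_group_mult A B'(1) iA(1) iB(1) k)
  ultimately show ?thesis unfolding G_def upr_part_def using inv_as_group[OF k A] inv_as_group[OF k B'(1)] by simp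
qed

lemma upr_part_1: "k \<ge> 1 \<Longrightarrow> upr_part m k 1 = tangent_group m k"
  using subst_mat_upr by (auto simp: upr_part_def tangent_group_def)

lemma upr_part_trivial: "upr_part m k (Suc m) \<subseteq> {1\<^sub>m (Suc m)}"
proof
  fix A assume A: "A \<in> upr_part m k (Suc m)"
  then have "A - 1\<^sub>m (Suc m) = 0\<^sub>m (Suc m) (Suc m)" by (intro upr_zero) (simp add: upr_part_def)
  moreover have c: "A \<in> carrier_mat (Suc m) (Suc m)" using A tangent_group_carrier by (auto simp: upr_part_def)
  ultimately have "(A - 1\<^sub>m (Suc m)) + 1\<^sub>m (Suc m) = 1\<^sub>m (Suc m)" by simp
  moreover have "(A - 1\<^sub>m (Suc m)) + 1\<^sub>m (Suc m) = A" using c by (intro eq_matI) auto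
  ultimately show "A \<in> {1\<^sub>m (Suc m)}" by simp
qed

lemma tangent_group_nilpotent:
  assumes k: "k \<ge> 1" shows "nilpotent_group (as_group (Suc m) (tangent_group m k))"
proof -
  let ?G = "as_group (Suc m) (tangent_group m k)"
  have lcs: "lower_central_series ?G i \<subseteq> upr_part m k (Suc i)" for i
  proof (induction i)
    case 0
    show ?case using upr_part_1[OF k, of m] by simp
  next
    case (Suc i)
    show ?case unfolding lower_central_series.simps
      by (rule generate_upr_part[OF k]) (use Suc commutator_upr_part[OF k, of _ m] in fastforce)
  qed
  have one: "1\<^sub>m (Suc m) \<in> lower_central_series ?G i" for i
    using tangent_group_one[of m k] generate.one[of ?G] by (cases i) auto
  have "lower_central_series ?G m = {1\<^sub>m (Suc m)}"
    using lcs[of m] upr_part_trivial[of m k] one[of m] by blast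
  then show ?thesis unfolding nilpotent_group_def by (intro exI[of _ m]) simp
qed

lemma tangent_group_solvable:
  assumes k: "k \<ge> 1" shows "solvable (as_group (Suc m) (tangent_group m k))"
proof -
  let ?G = "as_group (Suc m) (tangent_group m k)"
  have gr: "group ?G" by (rule subgroup.subgroup_is_group[OF tangent_group_subgroup[OF k] group_GL])
  have der: "(derived ?G ^^ i) (carrier ?G) \<subseteq> upr_part m k (Suc i)" for i
  proof (induction i)
    case 0
    show ?case using upr_part_1[OF k, of m] by simp
  next
    case (Suc i)
    have "derived ?G H \<subseteq> upr_part m k (Suc (Suc i))" if H: "H \<subseteq> upr_part m k (Suc i)" for H
    proof -
      have "H \<subseteq> tangent_group m k" using H by (auto simp: upr_part_def)
      then show ?thesis unfolding derived_def
        by (intro generate_upr_part[OF k]) (use H commutator_upr_part[OF k, of _ m] in fastforce)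
    qed
    from this[OF Suc] show ?case by simp
  qed
  have one: "1\<^sub>m (Suc m) \<in> (derived ?G ^^ i) (carrier ?G)" for i
    using tangent_group_one[of m k] generate.one[of ?G] by (cases i) (auto simp: derived_def)
  have "(derived ?G ^^ m) (carrier ?G) = {1\<^sub>m (Suc m)}"
    using der[of m] upr_part_trivial[of m k] one[of m] by blast
  then show ?thesis unfolding group.solvable_iff_trivial_derived_seq[OF gr] by (intro exI[of _ m]) simp
qed

section \<open>Complex powers of unipotent matrices by the binomial series\<close>

fun bpow :: "nat \<Rightarrow> complex \<Rightarrow> complex mat \<Rightarrow> nat \<Rightarrow> complex mat" where
  "bpow n c A 0 = 0\<^sub>m n n"
| "bpow n c A (Suc l) = bpow n c A l + (c gchoose l) \<cdot>\<^sub>m (A - 1\<^sub>m n) ^\<^sub>m l"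

lemma bpow_carrier [simp]: "A \<in> carrier_mat n n \<Longrightarrow> bpow n c A l \<in> carrier_mat n n"
  by (induction l) (auto intro: minus_carrier_mat)

lemma bpow_rec:
  assumes A: "A \<in> carrier_mat n n"
  shows "bpow n (c + 1) A (Suc l) = bpow n c A (Suc l) + bpow n c A l * (A - 1\<^sub>m n)"
proof (induction l)
  case 0
  have N: "A - 1\<^sub>m n \<in> carrier_mat n n" using A by (simp add: minus_carrier_mat)
  then show ?case by simp
next
  case (Suc l)
  let ?N = "A - 1\<^sub>m n"
  have N: "?N \<in> carrier_mat n n" using A by (simp add: minus_carrier_mat)
  have Nl: "?N ^\<^sub>m l \<in> carrier_mat n n" "?N ^\<^sub>m l * ?N \<in> carrier_mat n n" using N by auto
  have b: "bpow n c A l \<in> carrier_mat n n" "bpow n c A l * ?N \<in> carrier_mat n n" "bpow n c A (Suc l) \<in> carrier_mat n n"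
    by (rule bpow_carrier[OF A], rule mult_carrier_mat[OF bpow_carrier[OF A] N], rule bpow_carrier[OF A])
  have "bpow n (c + 1) A (Suc (Suc l)) = (bpow n c A (Suc l) + bpow n c A l * ?N) + ((c gchoose l) + (c gchoose Suc l)) \<cdot>\<^sub>m (?N ^\<^sub>m l * ?N)"
    unfolding bpow.simps(2)[of n "c + 1" A "Suc l"] Suc gbinomial_Suc_Suc by simp
  moreover have "bpow n c A (Suc l) * ?N = bpow n c A l * ?N + (c gchoose l) \<cdot>\<^sub>m (?N ^\<^sub>m l * ?N)"
    using add_mult_distrib_mat[OF b(1) smult_carrier_mat[OF Nl(1)] N, of "c gchoose l"]
      mult_smult_assoc_mat[OF Nl(1) N, of "c gchoose l"] by simp
  moreover have "bpow n c A (Suc (Suc l)) = bpow n c A (Suc l) + (c gchoose Suc l) \<cdot>\<^sub>m (?N ^\<^sub>m l * ?N)" by simp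
  ultimately show ?case
    using b Nl by (intro eq_matI) (auto simp del: index_mult_mat(1) bpow.simps simp: algebra_simps)
qed

text \<open>By Pascal's rule in \<open>bpow_rec\<close>, raising the exponent by \<open>1\<close>
  adds the product of the shorter sum with \<open>A - 1\<close>. Since
  \<open>(A - 1) ^ n = 0\<close>, this product is the same for the full sum, so the full sum gets
  multiplied by \<open>A\<close>.\<close>

lemma bpow_nat:
  assumes A: "A \<in> carrier_mat n n" and u: "upr n 1 (A - 1\<^sub>m n)" and n: "n = Suc l"
  shows "bpow n (of_nat k) A n = A ^\<^sub>m k"
proof (induction k)
  case 0
  have "bpow n 0 A (Suc j) = 1\<^sub>m n" for j
  proof (induction j)
    case 0
    have "(1::complex) \<cdot>\<^sub>m 1\<^sub>m n = 1\<^sub>m n" by (intro eq_matI) auto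
    then show ?case using A by (simp add: minus_carrier_mat)
  next
    case (Suc j)
    have "(A - 1\<^sub>m n) ^\<^sub>m Suc j \<in> carrier_mat n n" using A by (intro pow_carrier_mat minus_carrier_mat) auto
    then have "0 \<cdot>\<^sub>m (A - 1\<^sub>m n) ^\<^sub>m Suc j = 0\<^sub>m n n" by (intro eq_matI) auto
    moreover have "((0::complex) gchoose Suc j) = 0" by (simp add: gbinomial_0(2))
    ultimately have "bpow n 0 A (Suc (Suc j)) = bpow n 0 A (Suc j) + 0\<^sub>m n n"
      unfolding bpow.simps(2)[of n 0 A "Suc j"] by simp
    then show ?case using Suc by simp
  qed
  then show ?case using A by (simp add: n)
next
  case (Suc k)
  let ?N = "A - 1\<^sub>m n" and ?c = "of_nat k :: complex"
  have N: "?N \<in> carrier_mat n n" using A by (simp add: minus_carrier_mat)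
  have Nl: "?N ^\<^sub>m l \<in> carrier_mat n n" using N by simp
  have b: "bpow n ?c A l \<in> carrier_mat n n" "bpow n ?c A n \<in> carrier_mat n n" "bpow n ?c A l * ?N \<in> carrier_mat n n"
    by (rule bpow_carrier[OF A], rule bpow_carrier[OF A], rule mult_carrier_mat[OF bpow_carrier[OF A] N])
  have "upr n n (?N ^\<^sub>m n)" using upr_pow[OF u, of n] by simp
  then have "?N ^\<^sub>m l * ?N = 0\<^sub>m n n" using upr_zero[of n "?N ^\<^sub>m n"] n by simp
  then have z: "((?c gchoose l) \<cdot>\<^sub>m ?N ^\<^sub>m l) * ?N = 0\<^sub>m n n"
    using mult_smult_assoc_mat[OF Nl N, of "?c gchoose l"] by simp
  have "bpow n ?c A n * ?N = bpow n ?c A l * ?N"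
    using add_mult_distrib_mat[OF b(1) smult_carrier_mat[OF Nl] N, of "?c gchoose l"] z b(3) n by simp
  moreover have "bpow n ?c A n * ?N = bpow n ?c A n * A - bpow n ?c A n"
    using mult_minus_distrib_mat[OF b(2) A one_carrier_mat] right_mult_one_mat[OF b(2)] by simp
  ultimately have "bpow n ?c A l * ?N = bpow n ?c A n * A - bpow n ?c A n" by simp
  then have "bpow n (?c + 1) A n = bpow n ?c A n + (bpow n ?c A n * A - bpow n ?c A n)"
    using bpow_rec[OF A, of ?c l] n by simp
  also have "\<dots> = bpow n ?c A n * A"
    using carrier_matD[OF b(2)] carrier_matD[OF mult_carrier_mat[OF b(2) A]]
    by (intro eq_matI) (simp_all del: index_mult_mat bpow.simps)
  finally show ?case using Suc by (simp add: add.commute)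
qed

lemma pf_gchoose: "pf X S c \<Longrightarrow> pf X S (\<lambda>x. c x gchoose l)"
  unfolding gbinomial_prod_rev by (intro pf_divide_const pf_prod pf_diff pf_const)

lemma pfm_bpow:
  assumes "pf X S c" "pfm X S n A" shows "pfm X S n (\<lambda>x. bpow n (c x) (A x) l)"
proof (induction l)
  case 0
  then show ?case by (simp add: pfm_const)
next
  case (Suc l)
  have "pfm X S n (\<lambda>x. A x + (-1) \<cdot>\<^sub>m 1\<^sub>m n)" by (rule pfm_add[OF assms(2) pfm_const]) simp
  then have "pfm X S n (\<lambda>x. A x - 1\<^sub>m n)"
    by (rule pfm_cong) (use pfm_carrier[OF assms(2)] in \<open>intro eq_matI, auto\<close>)
  then show ?case unfolding bpow.simps by (intro pfm_add Suc pfm_smult pf_gchoose assms(1) pfm_pow)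
qed

lemma nat_dense:
  assumes "pf {\<lambda>t. t} UNIV g" "\<And>k. g (of_nat k) = 0" shows "g (t::complex) = 0"
proof -
  have "\<exists>q. \<forall>t. g t = poly q t"
    by (rule poly_path[of g "{\<lambda>t. t}" "\<lambda>t. t"]) (use assms(1) in \<open>auto simp: pf_UNIV intro: exI[of _ "[:0, 1:]"]\<close>)
  then obtain q where q: "\<And>t. g t = poly q t" by blast
  have "q = 0"
  proof (rule ccontr)
    assume "q \<noteq> 0"
    then have "finite {t. poly q t = 0}" by (rule poly_roots_finite)
    moreover have "range (of_nat :: nat \<Rightarrow> complex) \<subseteq> {t. poly q t = 0}" using assms(2) q by auto
    ultimately have "finite (range (of_nat :: nat \<Rightarrow> complex))" by (rule finite_subset[rotated])
    then have "finite (UNIV :: nat set)" by (rule finite_imageD) (simp add: inj_on_def)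
    then show False by simp
  qed
  then show ?thesis using q by simp
qed

text \<open>Statements about the complex powers \<open>bpow\<close> of a unipotent \<open>A\<close> are polynomial in the
  exponent, hence follow from the case of natural exponents.\<close>

lemma bpow_in_zclosed:
  assumes A: "A \<in> carrier_mat n n" and Z: "zclosed (mat_coords n) (carrier_mat n n) Z"
    and nat: "\<And>k. bpow n (of_nat k) A l \<in> Z"
  shows "bpow n c A l \<in> Z"
proof -
  obtain F where F: "F \<subseteq> polyfuns (mat_coords n)" "Z = {x\<in>carrier_mat n n. \<forall>f\<in>F. f x = 0}"
    using Z by (auto simp: zclosed_def)
  have pm: "pfm {\<lambda>t. t} UNIV n (\<lambda>c. bpow n c A l)" by (intro pfm_bpow pf_coord pfm_const A) simp
  have "f (bpow n c A l) = 0" if f: "f \<in> F" for f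
  proof (rule nat_dense[of "\<lambda>c. f (bpow n c A l)"])
    have "pf (mat_coords n) (carrier_mat n n) f" using f F(1) by (auto intro: pf_polyfuns)
    then show "pf {\<lambda>t. t} UNIV (\<lambda>c. f (bpow n c A l))" by (rule pfm_comp[OF _ pm]) (use A in auto)
    show "f (bpow n (of_nat k) A l) = 0" for k using nat[of k] f F(2) by auto
  qed
  then show ?thesis using A F(2) by simp
qed

section \<open>Commuting pairs of substitutions\<close>

lemma tangent_group_upr: "A \<in> tangent_group m i \<Longrightarrow> i \<ge> 1 \<Longrightarrow> upr (Suc m) 1 (A - 1\<^sub>m (Suc m))"
  using subst_mat_upr by (auto simp: tangent_group_def)

lemma tangent_group_additive:
  assumes "A \<in> tangent_group m i" "B \<in> tangent_group m i" "1 \<le> i" "i \<le> m"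
  shows "(A * B) $$ (0, i) = A $$ (0, i) + B $$ (0, i)"
proof -
  obtain f g where f: "f \<in> tangent i" "A = subst_mat m f" and g: "g \<in> tangent i" "B = subst_mat m g"
    using assms by (auto simp: tangent_group_def)
  have "A * B = subst_mat m (f oo g)" using subst_mat_compose[of f g m] f g tangentD(1) by simp
  then show ?thesis using compose_nth_first[OF f(1) g(1) assms(3)] assms(4) by (simp add: f g subst_mat_row)
qed

lemma bpow_tangent_group:
  assumes A: "A \<in> tangent_group m i" and i: "1 \<le> i" "i \<le> m"
  defines "Q \<equiv> \<lambda>c. bpow (Suc m) c A (Suc m)"
  shows "Q c \<in> tangent_group m i" "Q c $$ (0, i) = c * A $$ (0, i)" "Q 0 = 1\<^sub>m (Suc m)"
    "\<And>B. B \<in> carrier_mat (Suc m) (Suc m) \<Longrightarrow> A * B = B * A \<Longrightarrow> Q c * B = B * Q c"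
proof -
  let ?V = "carrier_mat (Suc m) (Suc m) :: complex mat set"
  have Ac: "A \<in> ?V" using A tangent_group_carrier by auto
  have nat: "Q (of_nat k) = A ^\<^sub>m k" for k
    unfolding Q_def by (rule bpow_nat[OF Ac tangent_group_upr[OF A i(1)] refl])
  have pw: "A ^\<^sub>m k \<in> tangent_group m i \<and> (A ^\<^sub>m k) $$ (0, i) = of_nat k * A $$ (0, i)" for k
  proof (induction k)
    case 0
    then show ?case using tangent_group_one[of m i] i Ac by simp
  next
    case (Suc k)
    then show ?case using tangent_group_mult[OF _ A i(1)] tangent_group_additive[OF _ A i] by (simp add: algebra_simps)
  qed
  show "Q c \<in> tangent_group m i"
    unfolding Q_def by (rule bpow_in_zclosed[OF Ac tangent_group_zclosed[OF i]]) (use nat pw in \<open>simp add: Q_def\<close>)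
  show "Q c $$ (0, i) = c * A $$ (0, i)"
  proof -
    have "Q c $$ (0, i) - c * A $$ (0, i) = 0"
    proof (rule nat_dense[of "\<lambda>c. Q c $$ (0, i) - c * A $$ (0, i)"])
      have "pfm {\<lambda>t. t} UNIV (Suc m) Q" unfolding Q_def by (intro pfm_bpow pf_coord pfm_const Ac) simp
      then show "pf {\<lambda>t. t} UNIV (\<lambda>c. Q c $$ (0, i) - c * A $$ (0, i))"
        by (intro pf_diff pf_mult pf_const pf_coord pfm_entry) (use i in auto)
    qed (simp add: nat pw)
    then show ?thesis by simp
  qed
  show "Q 0 = 1\<^sub>m (Suc m)" using nat[of 0] Ac by simp
  fix B assume B: "B \<in> ?V" "A * B = B * A"
  have cl: "zclosed (mat_coords (Suc m)) ?V {C\<in>?V. C * B = B * C}"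
    by (rule zclosed_mat_eq[OF pfm_mult[OF pfm_id pfm_const] pfm_mult[OF pfm_const pfm_id]]) (use B in auto)
  have comm: "A ^\<^sub>m k * B = B * A ^\<^sub>m k" for k
  proof (induction k)
    case (Suc k)
    have p: "A ^\<^sub>m k \<in> ?V" using Ac by simp
    have "A ^\<^sub>m Suc k * B = A ^\<^sub>m k * (A * B)" using assoc_mult_mat[OF p Ac B(1)] by simp
    also have "\<dots> = (A ^\<^sub>m k * B) * A" unfolding B(2) by (rule assoc_mult_mat[OF p B(1) Ac, symmetric])
    also have "\<dots> = B * A ^\<^sub>m Suc k" unfolding Suc using assoc_mult_mat[OF B(1) p Ac] by simp
    finally show ?case .
  qed (use Ac B(1) in simp)
  have "Q (of_nat k) \<in> {C\<in>?V. C * B = B * C}" for k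
    unfolding nat using comm[of k] pow_carrier_mat[OF Ac, of k] by blast
  then have "Q c \<in> {C\<in>?V. C * B = B * C}" unfolding Q_def by (rule bpow_in_zclosed[OF Ac cl])
  then show "Q c * B = B * Q c" by simp
qed

text \<open>Let \<open>B\<close> have depth \<open>j\<close>. If \<open>i + j \<le> m\<close>, then
  \<open>commuting_depth\<close> forces \<open>j = i\<close>; otherwise
  \<open>j \<ge> Suc m - i\<close>, and at such a depth commutation is automatic up to
  truncation.\<close>

lemma commuting_dichotomy:
  assumes A: "A \<in> tangent_group m i" "1 \<le> i" "i \<le> m" "A $$ (0, i) \<noteq> 0"
    and B: "B \<in> tangent_group m a" "1 \<le> a" and comm: "A * B = B * A"
  shows "B \<in> tangent_group m (Suc m - i) \<or> B \<in> tangent_group m i \<and> B $$ (0, i) \<noteq> 0"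
proof -
  obtain f g where f: "f \<in> tangent i" "A = subst_mat m f" and g: "g \<in> tangent a" "B = subst_mat m g"
    using A B by (auto simp: tangent_group_def)
  consider "g \<in> tangent (Suc m - i)" | j where "a \<le> j" "j < Suc m - i" "g \<in> tangent j" "fps_nth g (Suc j) \<noteq> 0"
    using depth_cases[OF g(1), of "Suc m - i"] by blast
  then show ?thesis
  proof cases
    case 1
    then show ?thesis using g(2) by (auto simp: tangent_group_def)
  next
    case 2
    have "i = j"
      by (rule commuting_depth[OF f(1) A(2) _ 2(3) _ 2(4), of m]) (use 2 B(2) A f g comm in \<open>auto simp: subst_mat_row\<close>)
    then show ?thesis using 2 g(2) A(3) by (auto simp: tangent_group_def subst_mat_row)
  qed
qed

text \<open>If \<open>B\<close> has the depth of \<open>A\<close>, the power of \<open>A\<close>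
  whose exponent is the quotient of the leading coefficients has the same leading coefficient as
  \<open>B\<close>. Dividing by it leaves a \<open>Z\<close> that still commutes with
  \<open>A\<close> but has lost this coefficient, so the dichotomy sends \<open>Z\<close> to depth
  \<open>Suc m - i\<close>.\<close>

lemma commuting_structure:
  assumes A: "A \<in> tangent_group m i" "1 \<le> i" "i \<le> m" "A $$ (0, i) \<noteq> 0"
    and B: "B \<in> tangent_group m 1" and comm: "A * B = B * A"
  shows "\<exists>c. \<exists>Z\<in>tangent_group m (Suc m - i). B = bpow (Suc m) c A (Suc m) * Z"
proof -
  let ?V = "carrier_mat (Suc m) (Suc m) :: complex mat set"
  let ?Q = "\<lambda>c. bpow (Suc m) c A (Suc m)"
  note Q = bpow_tangent_group[OF A(1-3)]
  have Ac: "A \<in> ?V" and Bc: "B \<in> ?V" using A B tangent_group_carrier by blast+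
  from commuting_dichotomy[OF A B order.refl comm] show ?thesis
  proof
    assume "B \<in> tangent_group m (Suc m - i)"
    moreover have "B = ?Q 0 * B" unfolding Q(3) using Bc by simp
    ultimately show ?thesis by blast
  next
    assume Bi: "B \<in> tangent_group m i \<and> B $$ (0, i) \<noteq> 0"
    define c where "c = B $$ (0, i) / A $$ (0, i)"
    have Qc: "?Q c \<in> ?V" using Ac by (simp del: bpow.simps)
    obtain R where R: "R \<in> tangent_group m i" "?Q c * R = 1\<^sub>m (Suc m)" "R * ?Q c = 1\<^sub>m (Suc m)"
      using tangent_group_inv[OF Q(1) A(2)] by blast
    have Rc: "R \<in> ?V" using R tangent_group_carrier by blast
    define Z where "Z = R * B"
    have Zi: "Z \<in> tangent_group m i" unfolding Z_def by (rule tangent_group_mult[OF R(1) _ A(2)]) (use Bi in blast)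
    have "?Q c * Z = (?Q c * R) * B" unfolding Z_def using Qc Rc Bc by (simp del: bpow.simps)
    then have BZ: "B = ?Q c * Z" unfolding R(2) using Bc by simp
    have QA: "?Q c * A = A * ?Q c" by (rule Q(4)[OF Ac refl])
    have "R * A = R * A * (?Q c * R)" unfolding R(2) using Rc Ac by simp
    also have "\<dots> = (R * A * ?Q c) * R" by (rule assoc_mult_mat[OF mult_carrier_mat[OF Rc Ac] Qc Rc, symmetric])
    also have "\<dots> = R * (?Q c * A) * R" unfolding QA by (simp only: assoc_mult_mat[OF Rc Ac Qc])
    also have "\<dots> = (R * ?Q c) * A * R" by (simp only: assoc_mult_mat[OF Rc Qc Ac])
    also have "\<dots> = A * R" unfolding R(3) using Rc Ac by simp
    finally have RA: "R * A = A * R" .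
    have "A * Z = (A * R) * B" unfolding Z_def using Ac Rc Bc by simp
    also have "\<dots> = R * (A * B)" unfolding RA[symmetric] using Ac Rc Bc by simp
    also have "\<dots> = Z * A" unfolding comm Z_def using Ac Rc Bc by simp
    finally have AZ: "A * Z = Z * A" .
    have "B $$ (0, i) = ?Q c $$ (0, i) + Z $$ (0, i)"
      using tangent_group_additive[OF Q(1)[of c] Zi A(2,3)] BZ by simp
    then have "Z $$ (0, i) = 0" unfolding Q(2) c_def using A(4) by simp
    then have "Z \<in> tangent_group m (Suc m - i)" using commuting_dichotomy[OF A Zi A(2) AZ] by blast
    then show ?thesis using BZ by blast
  qed
qed

text \<open>Parameters \<open>0\<close> to \<open>m - i\<close> are the coefficients of the first
  entry, number \<open>Suc m - i\<close> is the exponent, and the last \<open>i\<close> ones are the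
  coefficients of the factor of depth \<open>Suc m - i\<close>; together \<open>m + 2\<close> for
  every \<open>i\<close>.\<close>

definition pair_param :: "nat \<Rightarrow> nat \<Rightarrow> (nat \<Rightarrow> complex) \<Rightarrow> complex mat \<times> complex mat" where
  "pair_param m i t = (subst_mat m (pser m i t),
     bpow (Suc m) (t (Suc m - i)) (subst_mat m (pser m i t)) (Suc m) *
     subst_mat m (pser m (Suc m - i) (\<lambda>l. t (l + Suc (Suc m - i)))))"

lemma pair_param_surj:
  assumes A: "A \<in> tangent_group m i" and i: "1 \<le> i" "i \<le> m" and Z: "Z \<in> tangent_group m (Suc m - i)"
  shows "(A, bpow (Suc m) c A (Suc m) * Z) \<in> range (pair_param m i)"
proof -
  obtain a where a: "A = subst_mat m (pser m i a)" using A tangent_group_range[OF i(1), of m] by blast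
  have "1 \<le> Suc m - i" using i by simp
  then obtain z where z: "Z = subst_mat m (pser m (Suc m - i) z)" using Z tangent_group_range[of "Suc m - i" m] by blast
  define t where "t l = (if l < Suc m - i then a l else if l = Suc m - i then c else z (l - Suc (Suc m - i)))" for l
  have "subst_mat m (pser m i t) = A"
    unfolding a by (rule subst_mat_pser[OF pser_tangent[OF i(1)] i(1)]) (use i in \<open>auto simp: t_def pser_nth\<close>)
  moreover have "t (Suc m - i) = c" by (simp add: t_def)
  moreover have "(\<lambda>l. t (l + Suc (Suc m - i))) = z" by (auto simp: t_def)
  ultimately have "pair_param m i t = (A, bpow (Suc m) c A (Suc m) * Z)" unfolding pair_param_def z by simp
  then show ?thesis by (metis rangeI)
qed

text \<open>Stratify by the depth \<open>i\<close> of the first entry. By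
  \<open>commuting_structure\<close> each stratum lies in an image of affine space of dimension
  \<open>m + 2\<close>, and growth bounds survive finite unions.\<close>

lemma commuting_variety_tangent_growth:
  assumes k: "1 \<le> k" "k \<le> m"
  shows "growth (mat2_coords (Suc m)) (commuting_variety (tangent_group m k)) (m + 2)"
proof -
  let ?V = "carrier_mat (Suc m) (Suc m) :: complex mat set"
  have "growth (mat2_coords (Suc m)) (range (pair_param m i)) (m + 2)" if i: "i \<in> {k..m}" for i
  proof (rule growth_affine_image)
    show "finite (mat2_coords (Suc m))" by (simp add: finite_pair_coords finite_mat_coords)
    have 1: "pfm (cds (m + 2)) UNIV (Suc m) (\<lambda>t. subst_mat m (pser m i t))"
      by (rule pfm_tangent_param) (use i k in auto)
    have 2: "pfm (cds (m + 2)) UNIV (Suc m) (\<lambda>t. subst_mat m (pser m (Suc m - i) (\<lambda>l. t (l + Suc (Suc m - i)))))"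
      by (rule pfm_pser) (use i k in \<open>auto intro!: pf_coord cds_coord\<close>)
    have 3: "pf (cds (m + 2)) UNIV (\<lambda>t. t (Suc m - i))" by (rule pf_coord[OF cds_coord]) simp
    fix f assume "f \<in> mat2_coords (Suc m)"
    then show "pf (cds (m + 2)) UNIV (\<lambda>t. f (pair_param m i t))"
      unfolding pair_param_def by (rule pf_pair_coords_mat[OF 1 pfm_mult[OF pfm_bpow[OF 3 1] 2]])
  qed
  then have "growth (mat2_coords (Suc m)) (\<Union>((\<lambda>i. range (pair_param m i)) ` {k..m})) (m + 2)"
    by (intro growth_Union) auto
  then show ?thesis
  proof (rule growth_mono)
    show "commuting_variety (tangent_group m k) \<subseteq> \<Union>((\<lambda>i. range (pair_param m i)) ` {k..m})"
    proof
      fix z assume "z \<in> commuting_variety (tangent_group m k)"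
      then obtain A B where z: "z = (A, B)" "A \<in> tangent_group m k" "B \<in> tangent_group m k" "A * B = B * A"
        by (auto simp: commuting_variety_def)
      obtain f where f: "f \<in> tangent k" "A = subst_mat m f" using z(2) by (auto simp: tangent_group_def)
      have B1: "B \<in> tangent_group m 1" using z(3) tangent_mono[OF k(1)] by (auto simp: tangent_group_def)
      consider "f \<in> tangent (Suc m)" | i where "k \<le> i" "i < Suc m" "f \<in> tangent i" "fps_nth f (Suc i) \<noteq> 0"
        using depth_cases[OF f(1), of "Suc m"] by blast
      then have "\<exists>i\<in>{k..m}. z \<in> range (pair_param m i)"
      proof cases
        case 1
        \<comment> \<open>Here \<open>A\<close> is the identity. It is put into the stratum
          \<open>i = m\<close>, where the second factor has depth \<open>Suc m - m = 1\<close> and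
          so may be any \<open>B\<close>.\<close>
        have "A \<in> tangent_group m m" using 1 f(2) tangent_mono[of m "Suc m"] by (auto simp: tangent_group_def)
        moreover have m1: "1 \<le> m" using k by simp
        ultimately have "(A, bpow (Suc m) 0 A (Suc m) * B) \<in> range (pair_param m m)"
          by (intro pair_param_surj) (use B1 in auto)
        moreover have "bpow (Suc m) 0 A (Suc m) * B = B"
          unfolding bpow_tangent_group(3)[OF \<open>A \<in> tangent_group m m\<close> m1 order.refl]
          using z(3) tangent_group_carrier[of m k] by auto
        ultimately show ?thesis using z(1) k by auto
      next
        case 2
        have A: "A \<in> tangent_group m i" using 2 f(2) by (auto simp: tangent_group_def)
        have i: "1 \<le> i" "i \<le> m" using 2 k by auto
        have "A $$ (0, i) \<noteq> 0" using 2 f(2) i by (simp add: subst_mat_row)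
        from commuting_structure[OF A i this B1 z(4)] obtain c Z where
          Z: "Z \<in> tangent_group m (Suc m - i)" "B = bpow (Suc m) c A (Suc m) * Z" by blast
        have "z \<in> range (pair_param m i)" using pair_param_surj[OF A i Z(1), of c] z(1) Z(2) by simp
        then show ?thesis using 2 by auto
      qed
      then show "z \<in> \<Union>((\<lambda>i. range (pair_param m i)) ` {k..m})" by blast
    qed
  qed simp
qed

text \<open>Only pairs with \<open>A\<close> of exact depth \<open>k\<close> are used. The
  coordinates are the \<open>d\<close> coefficients of \<open>A\<close>, the leading coefficient of
  \<open>B\<close>, and the coefficients of \<open>B\<close> from index \<open>d\<close> on. From
  \<open>2 * k \<le> m\<close> follows \<open>k < d\<close>: the last group is disjoint from the
  leading coefficient and can be adjusted by a factor of depth \<open>d\<close>, which lies in the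
  group and commutes with \<open>A\<close>.\<close>

lemma commuting_variety_tangent_indep:
  fixes m k :: nat
  assumes k: "1 \<le> k" "2 * k \<le> m"
  defines "d \<equiv> Suc m - k"
  defines "h \<equiv> \<lambda>l z. if l < d then fst z $$ (0, l + k) else if l = d then snd z $$ (0, k) else snd z $$ (0, l - Suc d + d)"
  shows "indep h (m + 2) (commuting_variety (tangent_group m k))"
    and "\<And>l. l < m + 2 \<Longrightarrow> h l \<in> polyfuns (mat2_coords (Suc m))"
proof -
  show "h l \<in> polyfuns (mat2_coords (Suc m))" if "l < m + 2" for l
  proof -
    consider "l < d" | "l = d" | "l > d" by linarith
    then show ?thesis
    proof cases
      case 3
      then have "l - Suc d + d < Suc m" using that k by (simp add: d_def)
      then show ?thesis using 3 polyfuns_snd_entry[of 0 "Suc m" "l - Suc d + d"] by (simp add: h_def)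
    next
      case 1
      then have "l + k < Suc m" by (simp add: d_def)
      then show ?thesis using 1 polyfuns_fst_entry[of 0 "Suc m" "l + k"] by (simp add: h_def)
    next
      case 2
      then show ?thesis using polyfuns_snd_entry[of 0 "Suc m" k] k by (simp add: h_def)
    qed
  qed
  have d: "k < d" "d \<le> m" "1 \<le> d" using k by (auto simp: d_def)
  show "indep h (m + 2) (commuting_variety (tangent_group m k))"
    unfolding indep_def
  proof (intro ballI impI)
    fix P assume P: "P \<in> polyfuns (cds (m + 2))" "\<forall>z\<in>commuting_variety (tangent_group m k). P (\<lambda>l. h l z) = 0"
    have "P p = 0" if p0: "p 0 \<noteq> 0" for p
    proof -
      \<comment> \<open>\<open>p 0\<close> is the leading coefficient of \<open>?A\<close>, so the
        power with this exponent has leading coefficient \<open>p d\<close>.\<close>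
      let ?A = "subst_mat m (pser m k p)" and ?c = "p d / p 0"
      have A: "?A \<in> tangent_group m k" using pser_tangent[OF k(1)] by (auto simp: tangent_group_def)
      have km: "k \<le> m" using k by simp
      note Q = bpow_tangent_group[OF A k(1) km]
      obtain q where q: "q \<in> tangent k" "bpow (Suc m) ?c ?A (Suc m) = subst_mat m q"
        using Q(1)[of ?c] by (auto simp: tangent_group_def)
      \<comment> \<open>Corrects the high coefficients: by \<open>compose_nth_high\<close> those of
        \<open>q\<close> and \<open>z\<close> add up.\<close>
      define z where "z = pser m d (\<lambda>l. p (l + Suc d) - fps_nth q (Suc (l + d)))"
      have z: "z \<in> tangent d" unfolding z_def by (rule pser_tangent[OF d(3)])
      let ?B = "subst_mat m (q oo z)"
      have zk: "z \<in> tangent k" using z tangent_mono[of k d] d by auto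
      have B: "?B \<in> tangent_group m k" using tangent_compose[OF q(1) zk k(1)] by (auto simp: tangent_group_def)
      have AQ: "?A * subst_mat m q = subst_mat m q * ?A"
        using Q(4)[of ?A ?c] q(2) by simp
      \<comment> \<open>The depths add up to \<open>k + d = Suc m\<close>, the last degree seen by
        the truncation; up to there composition is symmetric.\<close>
      have Az: "?A * subst_mat m z = subst_mat m z * ?A"
      proof -
        have "subst_mat m (pser m k p oo z) = subst_mat m (z oo pser m k p)"
          by (rule subst_mat_cong)
            (use compose_nth_high[OF pser_tangent[OF k(1)] k(1) z d(3), of _ m p]
              compose_nth_high[OF z d(3) pser_tangent[OF k(1)] k(1), of _ m p] k in \<open>simp add: d_def\<close>)
        then show ?thesis
          using subst_mat_compose[of "pser m k p" z m] subst_mat_compose[of z "pser m k p" m]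
            tangentD(1)[OF z] tangentD(1)[OF pser_tangent[OF k(1), of m p]] by simp
      qed
      have Bm: "?B = subst_mat m q * subst_mat m z"
        by (rule subst_mat_compose[OF tangentD(1)[OF q(1)] tangentD(1)[OF z]])
      let ?V = "carrier_mat (Suc m) (Suc m) :: complex mat set"
      have c: "?A \<in> ?V" "subst_mat m q \<in> ?V" "subst_mat m z \<in> ?V" by simp_all
      have "?A * ?B = (?A * subst_mat m q) * subst_mat m z" unfolding Bm by (rule assoc_mult_mat[OF c, symmetric])
      also have "\<dots> = subst_mat m q * (?A * subst_mat m z)" unfolding AQ by (rule assoc_mult_mat[OF c(2,1,3)])
      also have "\<dots> = ?B * ?A" unfolding Az Bm by (rule assoc_mult_mat[OF c(2,3,1), symmetric])
      finally have AB: "(?A, ?B) \<in> commuting_variety (tangent_group m k)" using A B by (simp add: commuting_variety_def)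
      have Bn: "?B $$ (0, j) = fps_nth q (Suc j) + fps_nth z (Suc j)" if "1 \<le> j" "j \<le> m" for j
        using compose_nth_high[OF q(1) k(1) z d(3), of "Suc j"] that k by (simp add: subst_mat_row d_def fps_X_def)
      have "P (\<lambda>l. h l (?A, ?B)) = P p"
      proof (rule cds_cong[OF P(1)])
        fix l assume l: "l < m + 2"
        consider "l < d" | "l = d" | "l > d" by linarith
        then show "h l (?A, ?B) = p l"
        proof cases
          case 1
          then show ?thesis using k by (simp add: h_def d_def subst_mat_row pser_nth)
        next
          case 2
          have "fps_nth z (Suc k) = 0" using tangentD(3)[OF z, of "Suc k"] d k by simp
          moreover have "fps_nth q (Suc k) = ?c * p 0"
            using Q(2)[of ?c] pser_nth[of k "Suc k" m p] k unfolding q(2) by (simp add: subst_mat_row)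
          ultimately show ?thesis using 2 Bn[of k] k p0 by (simp add: h_def)
        next
          case 3
          define s where "s = l - Suc d"
          have s: "l = s + Suc d" "s + d \<le> m" using 3 l by (auto simp: s_def d_def)
          have "fps_nth z (Suc (s + d)) = p (s + Suc d) - fps_nth q (Suc (s + d))"
            unfolding z_def using s d by (subst pser_nth) auto
          then show ?thesis using s d Bn[of "s + d"] by (simp add: h_def)
        qed
      qed
      then show ?thesis using P(2) AB by metis
    qed
    moreover have "(\<lambda>p. p 0) \<in> polyfuns (cds (m + 2))" by (rule polyfuns_coord[OF cds_coord]) simp
    ultimately have "(\<forall>p::nat \<Rightarrow> complex. p 0 = 0) \<or> (\<forall>p. P p = 0)" using cds_mult_zero[of "\<lambda>p. p 0" "m + 2" P] P(1) by blast
    moreover have "\<not> (\<forall>p::nat \<Rightarrow> complex. p 0 = 0)" by (auto intro: exI[of _ "\<lambda>_. 1"])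
    ultimately show "\<forall>p. P p = 0" by blast
  qed
qed

lemma tangent_group_prob:
  assumes k: "1 \<le> k" "2 * k \<le> m"
  shows "commuting_prob (Suc m) (tangent_group m k) = real (m + 2) / (2 * real (Suc m - k))"
proof (rule commuting_prob_eq)
  have km: "k \<le> m" using k by simp
  show "zclosed (mat_coords (Suc m)) (carrier (GL (Suc m))) (tangent_group m k)" by (rule tangent_group_GL[OF k(1) km])
  show "indep (\<lambda>l A. A $$ (0, l + k)) (Suc m - k) (tangent_group m k)"
    "growth (mat_coords (Suc m)) (tangent_group m k) (Suc m - k)" using tangent_group_dim[OF k(1) km] by auto
  show "(\<lambda>A. A $$ (0, i + k)) \<in> polyfuns (mat_coords (Suc m))" if "i < Suc m - k" for i
    by (rule polyfuns_entry) (use that in auto)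
  show "growth (mat2_coords (Suc m)) (commuting_variety (tangent_group m k)) (m + 2)"
    by (rule commuting_variety_tangent_growth[OF k(1) km])
qed (use k commuting_variety_tangent_indep[OF k] in auto)

section \<open>Realisation of the rational values by nilpotent groups\<close>

lemma rational_half:
  assumes "r \<in> \<rat> \<inter> {1/2<..1::real}"
  obtains s t :: nat where "0 < s" "s \<le> t" "r = 1/2 + real s / (2 * real t)"
proof -
  have "2 * r - 1 \<in> \<rat>" "0 < 2 * r - 1" "2 * r - 1 \<le> 1" using assms by auto
  then obtain s t :: nat where st: "t \<noteq> 0" "\<bar>2 * r - 1\<bar> = real s / real t"
    by (elim Rats_abs_nat_div_natE) blast
  then have eq: "2 * r - 1 = real s / real t" using \<open>0 < 2 * r - 1\<close> by simp
  show ?thesis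
  proof (rule that[of s t])
    show "0 < s" using eq \<open>0 < 2 * r - 1\<close> by (cases s) auto
    have "real s / real t \<le> 1" using eq \<open>2 * r - 1 \<le> 1\<close> by simp
    then show "s \<le> t" using st(1) by (simp add: divide_le_eq_1_pos)
    show "r = 1/2 + real s / (2 * real t)" using eq st(1) by (simp add: field_simps)
  qed
qed

lemma nilpotent_realization:
  assumes "r \<in> \<rat> \<inter> {1/2<..1}"
  shows "\<exists>n G. linear_algebraic_group n G \<and> zariski_connected n G \<and> nilpotent_group (as_group n G) \<and>
    solvable (as_group n G) \<and> commuting_prob n G = r"
proof -
  obtain s t :: nat where st: "0 < s" "s \<le> t" "r = 1/2 + real s / (2 * real t)" using rational_half[OF assms] .
  \<comment> \<open>Chosen so that \<open>m + 2 = 2 * (t + s)\<close> and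
    \<open>Suc m - k = 2 * t\<close>. The factor 2 keeps \<open>k\<close> positive for
    \<open>s = 1\<close>, and \<open>2 * k \<le> m\<close> amounts to
    \<open>s \<le> t\<close>.\<close>
  define k m where "k = 2 * s - 1" and "m = 2 * t + 2 * s - 2"
  have k: "1 \<le> k" "2 * k \<le> m" "k \<le> m" using st by (auto simp: k_def m_def)
  have "Suc m - k = 2 * t" "m + 2 = 2 * t + 2 * s" using st by (auto simp: k_def m_def)
  then have "commuting_prob (Suc m) (tangent_group m k) = real (2 * t + 2 * s) / (2 * real (2 * t))"
    using tangent_group_prob[OF k(1,2)] by simp
  also have "\<dots> = r" using st by (simp add: field_simps)
  finally have "commuting_prob (Suc m) (tangent_group m k) = r" .
  moreover have "linear_algebraic_group (Suc m) (tangent_group m k)"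
    unfolding linear_algebraic_group_iff using tangent_group_subgroup[OF k(1)] tangent_group_GL[OF k(1,3)] by blast
  moreover have "zariski_connected (Suc m) (tangent_group m k)"
    unfolding zariski_mat_def by (rule connectedin_zprime[OF tangent_group_dim(1)[OF k(1,3)] tangent_group_carrier])
  ultimately show ?thesis using tangent_group_nilpotent[OF k(1)] tangent_group_solvable[OF k(1)] by blast
qed

section \<open>The theorem of Motzkin and Taussky\<close>

definition krylov :: "nat \<Rightarrow> complex mat \<Rightarrow> complex mat \<Rightarrow> complex mat" where
  "krylov n R v = mat n n (\<lambda>(i, j). (R ^\<^sub>m j * v) $$ (i, 0))"

lemma krylov_carrier [simp]: "krylov n R v \<in> carrier_mat n n"
  by (simp add: krylov_def)

fun matpoly :: "nat \<Rightarrow> (nat \<Rightarrow> complex) \<Rightarrow> complex mat \<Rightarrow> nat \<Rightarrow> complex mat" where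
  "matpoly n c R 0 = 0\<^sub>m n n"
| "matpoly n c R (Suc l) = matpoly n c R l + c l \<cdot>\<^sub>m R ^\<^sub>m l"

lemma matpoly_carrier [simp]: "R \<in> carrier_mat n n \<Longrightarrow> matpoly n c R l \<in> carrier_mat n n"
  by (induction l) auto

lemma mat_mult_entry:
  "A \<in> carrier_mat n k \<Longrightarrow> B \<in> carrier_mat k m \<Longrightarrow> i < n \<Longrightarrow> j < m \<Longrightarrow>
    (A * B) $$ (i, j) = (\<Sum>l<k. A $$ (i, l) * B $$ (l, j))"
  by (auto simp: scalar_prod_def lessThan_atLeast0)

lemma mult_krylov:
  assumes "A \<in> carrier_mat n n" "R \<in> carrier_mat n n" "v \<in> carrier_mat n 1" "i < n" "j < n"
  shows "(A * krylov n R v) $$ (i, j) = (A * (R ^\<^sub>m j * v)) $$ (i, 0)"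
proof -
  have "R ^\<^sub>m j * v \<in> carrier_mat n 1" using assms by (intro mult_carrier_mat[of _ n n] pow_carrier_mat)
  then show ?thesis
    using assms by (subst (1 2) mat_mult_entry[of _ n n _ ]) (auto simp: krylov_def)
qed

lemma matpoly_commute:
  assumes "R \<in> carrier_mat n n" "A \<in> carrier_mat n n" "A * R = R * A"
  shows "A * matpoly n c R l = matpoly n c R l * A"
proof (induction l)
  case 0
  then show ?case using assms by simp
next
  case (Suc l)
  have p: "R ^\<^sub>m l \<in> carrier_mat n n" "matpoly n c R l \<in> carrier_mat n n" using assms by auto
  have pw: "A * R ^\<^sub>m j = R ^\<^sub>m j * A" for j
  proof (induction j)
    case (Suc j)
    have pj: "R ^\<^sub>m j \<in> carrier_mat n n" using assms by simp
    have "A * R ^\<^sub>m Suc j = (A * R ^\<^sub>m j) * R" using assoc_mult_mat[OF assms(2) pj assms(1)] by simp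
    also have "\<dots> = R ^\<^sub>m j * (R * A)" unfolding Suc assms(3)[symmetric] by (rule assoc_mult_mat[OF pj assms(2,1)])
    also have "\<dots> = R ^\<^sub>m Suc j * A" using assoc_mult_mat[OF pj assms(1,2)] by simp
    finally show ?case .
  qed (use assms in simp)
  have "A * matpoly n c R (Suc l) = A * matpoly n c R l + A * (c l \<cdot>\<^sub>m R ^\<^sub>m l)"
    unfolding matpoly.simps by (rule mult_add_distrib_mat[OF assms(2) p(2) smult_carrier_mat[OF p(1)]])
  also have "A * (c l \<cdot>\<^sub>m R ^\<^sub>m l) = (c l \<cdot>\<^sub>m R ^\<^sub>m l) * A"
    using mult_smult_distrib[OF assms(2) p(1)] mult_smult_assoc_mat[OF p(1) assms(2)] pw[of l] by simp
  also have "A * matpoly n c R l + (c l \<cdot>\<^sub>m R ^\<^sub>m l) * A = matpoly n c R (Suc l) * A"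
    unfolding Suc matpoly.simps by (rule add_mult_distrib_mat[OF p(2) smult_carrier_mat[OF p(1)] assms(2), symmetric])
  finally show ?case .
qed

lemma matpoly_vec:
  assumes "R \<in> carrier_mat n n" "v \<in> carrier_mat n 1" "i < n"
  shows "(matpoly n c R l * v) $$ (i, 0) = (\<Sum>j<l. c j * (R ^\<^sub>m j * v) $$ (i, 0))"
proof (induction l)
  case 0
  then show ?case using assms by simp
next
  case (Suc l)
  have p: "R ^\<^sub>m l \<in> carrier_mat n n" "matpoly n c R l \<in> carrier_mat n n" using assms by auto
  have "matpoly n c R (Suc l) * v = matpoly n c R l * v + c l \<cdot>\<^sub>m (R ^\<^sub>m l * v)"
    using add_mult_distrib_mat[OF p(2) smult_carrier_mat[OF p(1)] assms(2)] mult_smult_assoc_mat[OF p(1) assms(2)] by simp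
  moreover have "matpoly n c R l * v \<in> carrier_mat n 1" "R ^\<^sub>m l * v \<in> carrier_mat n 1"
    by (rule mult_carrier_mat[OF p(2) assms(2)], rule mult_carrier_mat[OF p(1) assms(2)])
  ultimately have "(matpoly n c R (Suc l) * v) $$ (i, 0) = (matpoly n c R l * v) $$ (i, 0) + c l * (R ^\<^sub>m l * v) $$ (i, 0)"
    using assms(3) by (simp del: matpoly.simps index_mult_mat)
  then show ?case using Suc by simp
qed

lemma det_inverse:
  assumes "(K :: complex mat) \<in> carrier_mat n n" "det K \<noteq> 0"
  obtains L where "L \<in> carrier_mat n n" "K * L = 1\<^sub>m n" "L * K = 1\<^sub>m n"
  using det_non_zero_imp_unit[OF assms, of "()"] by (auto simp: Units_def ring_mat_def)

lemma krylov_solve: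
  assumes R: "R \<in> carrier_mat n n" "v \<in> carrier_mat n 1" "det (krylov n R v) \<noteq> 0" and w: "w \<in> carrier_mat n 1"
  shows "\<exists>c. matpoly n c R n * v = w"
proof -
  let ?K = "krylov n R v"
  obtain L where L: "L \<in> carrier_mat n n" "?K * L = 1\<^sub>m n" using det_inverse[OF krylov_carrier R(3)] by metis
  define c where "c l = (L * w) $$ (l, 0)" for l
  have Lw: "L * w \<in> carrier_mat n 1" using L(1) w by simp
  have "?K * (L * w) = w" using assoc_mult_mat[OF krylov_carrier L(1) w, of R v] L(2) w by simp
  moreover have "matpoly n c R n * v = ?K * (L * w)"
  proof (rule eq_matI)
    fix i j assume "i < dim_row (?K * (L * w))" "j < dim_col (?K * (L * w))"
    then have ij: "i < n" "j = 0" using w by (auto simp: krylov_def)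
    have "(?K * (L * w)) $$ (i, 0) = (\<Sum>l<n. ?K $$ (i, l) * (L * w) $$ (l, 0))"
      by (rule mat_mult_entry[OF krylov_carrier Lw ij(1)]) simp
    then show "(matpoly n c R n * v) $$ (i, j) = (?K * (L * w)) $$ (i, j)"
      using matpoly_vec[OF R(1,2) ij(1), of c n] ij by (simp add: c_def krylov_def mult.commute del: index_mult_mat)
  qed (use R w in \<open>auto simp: krylov_def carrier_matD[OF matpoly_carrier[OF R(1)]]\<close>)
  ultimately show ?thesis by metis
qed

text \<open>A matrix commuting with \<open>R\<close> is determined by its value on the cyclic vector
  \<open>v\<close>, since this fixes its values on all \<open>R ^ j v\<close>; and some polynomial
  in \<open>R\<close> takes the same value on \<open>v\<close>.\<close>

lemma commutant_of_cyclic: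
  assumes R: "R \<in> carrier_mat n n" "v \<in> carrier_mat n 1" "det (krylov n R v) \<noteq> 0"
    and A: "A \<in> carrier_mat n n" "A * R = R * A"
  shows "\<exists>c. A = matpoly n c R n"
proof -
  let ?K = "krylov n R v"
  obtain c where c: "matpoly n c R n * v = A * v" using krylov_solve[OF R mult_carrier_mat[OF A(1) R(2)]] by blast
  let ?P = "matpoly n c R n"
  have P: "?P \<in> carrier_mat n n" using R by simp
  have pw: "X * (R ^\<^sub>m j * v) = R ^\<^sub>m j * (X * v)" if X: "X \<in> carrier_mat n n" "X * R = R * X" for X j
  proof -
    have p: "R ^\<^sub>m j \<in> carrier_mat n n" using R by simp
    have com: "X * R ^\<^sub>m j = R ^\<^sub>m j * X"
    proof (induction j)
      case (Suc j)
      have pj: "R ^\<^sub>m j \<in> carrier_mat n n" using R by simp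
      have "X * R ^\<^sub>m Suc j = (X * R ^\<^sub>m j) * R" using assoc_mult_mat[OF X(1) pj R(1)] by simp
      also have "\<dots> = R ^\<^sub>m j * (R * X)" unfolding Suc X(2)[symmetric] by (rule assoc_mult_mat[OF pj X(1) R(1)])
      also have "\<dots> = R ^\<^sub>m Suc j * X" using assoc_mult_mat[OF pj R(1) X(1)] by simp
      finally show ?case .
    qed (use X R in simp)
    have "X * (R ^\<^sub>m j * v) = (X * R ^\<^sub>m j) * v" by (rule assoc_mult_mat[OF X(1) p R(2), symmetric])
    also have "\<dots> = R ^\<^sub>m j * (X * v)" unfolding com by (rule assoc_mult_mat[OF p X(1) R(2)])
    finally show ?thesis .
  qed
  have PR: "?P * R = R * ?P" by (rule matpoly_commute[OF R(1) R(1) refl, symmetric])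
  have "A * ?K = ?P * ?K"
  proof (rule eq_matI)
    fix i j assume "i < dim_row (?P * ?K)" "j < dim_col (?P * ?K)"
    then have ij: "i < n" "j < n" using carrier_matD[OF mult_carrier_mat[OF P krylov_carrier]] by auto
    show "(A * ?K) $$ (i, j) = (?P * ?K) $$ (i, j)"
      unfolding mult_krylov[OF A(1) R(1,2) ij] mult_krylov[OF P R(1,2) ij] pw[OF A] pw[OF P PR] c ..
  qed (use A carrier_matD[OF P] in auto)
  moreover obtain L where L: "L \<in> carrier_mat n n" "?K * L = 1\<^sub>m n" using det_inverse[OF krylov_carrier R(3)] by metis
  ultimately have "A * (?K * L) = ?P * (?K * L)"
    using assoc_mult_mat[OF A(1) krylov_carrier L(1), of R v] assoc_mult_mat[OF P krylov_carrier L(1), of R v] by simp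
  then have "A = ?P" unfolding L(2) using A(1) right_mult_one_mat[OF P] by simp
  then show ?thesis by blast
qed

text \<open>A Jordan matrix in which \<open>\<beta> i\<close> numbers the block containing
  \<open>i\<close> and \<open>a\<close> lists the eigenvalues by block. Keeping
  \<open>\<beta>\<close> and changing \<open>a\<close> gives commuting matrices. Monotone
  \<open>\<beta>\<close>, as provided by \<open>jordan_matrix_bidiag\<close>, makes the blocks
  consecutive intervals, and \<open>a = of_nat\<close> then gives different blocks different
  eigenvalues.\<close>

definition bidiag :: "nat \<Rightarrow> (nat \<Rightarrow> nat) \<Rightarrow> (nat \<Rightarrow> complex) \<Rightarrow> complex mat" where
  "bidiag n \<beta> a = mat n n (\<lambda>(i, j). if i = j then a (\<beta> i) else if j = Suc i \<and> \<beta> i = \<beta> j then 1 else 0)"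

lemma bidiag_carrier [simp]: "bidiag n \<beta> a \<in> carrier_mat n n"
  by (simp add: bidiag_def)

lemma jordan_matrix_bidiag:
  "\<exists>\<beta> a. mono \<beta> \<and> jordan_matrix n_as = bidiag (sum_list (map fst n_as)) \<beta> a"
proof (induction n_as)
  case Nil
  have "jordan_matrix [] = bidiag 0 (\<lambda>_. 0) (\<lambda>_. 0)"
    by (rule eq_matI) (simp_all add: jordan_matrix_def bidiag_def)
  moreover have "mono (\<lambda>_::nat. 0::nat)" by (rule monoI) simp
  ultimately show ?case by (intro exI[of _ "\<lambda>_. 0"]) simp
next
  case (Cons na n_as)
  obtain n x where na: "na = (n, x)" by force
  let ?N = "sum_list (map fst n_as)"
  obtain \<beta> a where \<beta>: "mono \<beta>" "jordan_matrix n_as = bidiag ?N \<beta> a" using Cons by blast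
  let ?\<beta> = "\<lambda>i. if i < n then 0 else Suc (\<beta> (i - n))" and ?a = "\<lambda>k. case k of 0 \<Rightarrow> x | Suc k \<Rightarrow> a k"
  have "mono ?\<beta>" using \<beta>(1) by (auto simp: mono_def)
  moreover have "jordan_matrix (na # n_as) = bidiag (n + ?N) ?\<beta> ?a"
    unfolding na jordan_matrix_Cons \<beta>(2)
  proof (rule eq_matI)
    fix i j assume "i < dim_row (bidiag (n + ?N) ?\<beta> ?a)" "j < dim_col (bidiag (n + ?N) ?\<beta> ?a)"
    then have ij: "i < n + ?N" "j < n + ?N" by (auto simp: bidiag_def)
    have e: "four_block_mat (jordan_block n x) (0\<^sub>m n ?N) (0\<^sub>m ?N n) (bidiag ?N \<beta> a) $$ (i, j) =
      (if i < n then if j < n then jordan_block n x $$ (i, j) else 0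
       else if j < n then 0 else bidiag ?N \<beta> a $$ (i - n, j - n))"
      using ij by (simp add: bidiag_def)
    have shift: "i - n = j - n \<longleftrightarrow> i = j" "j - n = Suc (i - n) \<longleftrightarrow> j = Suc i" if "n \<le> i" "n \<le> j"
      using that by arith+
    show "four_block_mat (jordan_block n x) (0\<^sub>m n ?N) (0\<^sub>m ?N n) (bidiag ?N \<beta> a) $$ (i, j) = bidiag (n + ?N) ?\<beta> ?a $$ (i, j)"
      unfolding e
    proof (cases "n \<le> i \<and> n \<le> j")
      case True
      then have "i - n < ?N" "j - n < ?N" using ij by auto
      then show "(if i < n then if j < n then jordan_block n x $$ (i, j) else 0
       else if j < n then 0 else bidiag ?N \<beta> a $$ (i - n, j - n)) = bidiag (n + ?N) ?\<beta> ?a $$ (i, j)"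
        using True ij shift by (simp add: bidiag_def)
    next
      case False
      then show "(if i < n then if j < n then jordan_block n x $$ (i, j) else 0
       else if j < n then 0 else bidiag ?N \<beta> a $$ (i - n, j - n)) = bidiag (n + ?N) ?\<beta> ?a $$ (i, j)"
        using ij by (cases "i < n"; cases "j < n") (simp_all add: bidiag_def)
    qed
  qed (simp_all add: bidiag_def)
  ultimately show ?case unfolding na by (intro exI[of _ ?\<beta>] exI[of _ ?a]) simp
qed

lemma similar_bidiag:
  assumes A: "(A :: complex mat) \<in> carrier_mat n n"
  obtains \<beta> a P Q where "mono \<beta>" "similar_mat_wit A (bidiag n \<beta> a) P Q"
proof -
  obtain as where "char_poly A = (\<Prod>a\<leftarrow>as. [:- a, 1:])" using char_poly_factorized[OF A] by blast
  then obtain n_as where "jordan_nf A n_as" using jordan_nf_exists[OF A] by blast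
  then have sim: "similar_mat A (jordan_matrix n_as)" by (simp add: jordan_nf_def)
  obtain \<beta> a where \<beta>: "mono \<beta>" "jordan_matrix n_as = bidiag (sum_list (map fst n_as)) \<beta> a"
    using jordan_matrix_bidiag by blast
  obtain P Q where w: "similar_mat_wit A (jordan_matrix n_as) P Q" using sim unfolding similar_mat_def by blast
  have "sum_list (map fst n_as) = n" using similar_mat_witD2(5)[OF A w] \<beta>(2) by (auto simp: bidiag_def)
  then have "jordan_matrix n_as = bidiag n \<beta> a" using \<beta>(2) by simp
  with that[OF \<beta>(1)] w show thesis by simp
qed

text \<open>The two matrices differ by a matrix that is scalar on each block. The scalar may be read
  off at the row or at the column of an entry, because entries between different blocks
  vanish.\<close>

lemma bidiag_commute: "bidiag n \<beta> a * bidiag n \<beta> b = bidiag n \<beta> b * bidiag n \<beta> a"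
proof (rule eq_matI)
  fix i j assume "i < dim_row (bidiag n \<beta> b * bidiag n \<beta> a)" "j < dim_col (bidiag n \<beta> b * bidiag n \<beta> a)"
  then have ij: "i < n" "j < n" by (auto simp: bidiag_def)
  have e: "(bidiag n \<beta> a * bidiag n \<beta> b) $$ (i, j) = (\<Sum>l<n. bidiag n \<beta> a $$ (i, l) * bidiag n \<beta> a $$ (l, j)
      + (if l = j then (b (\<beta> i) - a (\<beta> i)) * bidiag n \<beta> a $$ (i, j) else 0))" for a b :: "nat \<Rightarrow> complex"
    unfolding mat_mult_entry[OF bidiag_carrier bidiag_carrier ij]
    by (rule sum.cong) (use ij in \<open>auto simp: bidiag_def algebra_simps\<close>)
  have e': "(bidiag n \<beta> b * bidiag n \<beta> a) $$ (i, j) = (\<Sum>l<n. bidiag n \<beta> a $$ (i, l) * bidiag n \<beta> a $$ (l, j)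
      + (if l = i then (b (\<beta> i) - a (\<beta> i)) * bidiag n \<beta> a $$ (i, j) else 0))" for a b :: "nat \<Rightarrow> complex"
    unfolding mat_mult_entry[OF bidiag_carrier bidiag_carrier ij]
    by (rule sum.cong) (use ij in \<open>auto simp: bidiag_def algebra_simps\<close>)
  show "(bidiag n \<beta> a * bidiag n \<beta> b) $$ (i, j) = (bidiag n \<beta> b * bidiag n \<beta> a) $$ (i, j)"
    unfolding e[of a b] e'[of b a] using ij by (simp add: sum.distrib)
qed (auto simp: bidiag_def)

text \<open>The Newton vectors \<open>(R - d\<^sub>i) \<dots> (R - d\<^sub>n\<^sub>-\<^sub>1) v\<close> lie in the Krylov space of \<open>v\<close> and form a
  triangular matrix; its diagonal does not vanish because the blocks of \<open>R\<close> have distinct eigenvalues.\<close>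

lemma bidiag_cyclic:
  fixes n :: nat
  assumes \<beta>: "mono \<beta>"
  defines "R \<equiv> bidiag n \<beta> of_nat"
  defines "v \<equiv> mat n 1 (\<lambda>_. 1 :: complex)"
  shows "det (krylov n R v) \<noteq> 0"
proof -
  let ?d = "\<lambda>i. of_nat (\<beta> i) :: complex"
  let ?\<epsilon> = "\<lambda>i. if Suc i < n \<and> \<beta> i = \<beta> (Suc i) then 1 else 0 :: complex"
  have R: "R \<in> carrier_mat n n" and v: "v \<in> carrier_mat n 1" by (auto simp: R_def v_def)
  define \<kappa> where "\<kappa> l i = (R ^\<^sub>m l * v) $$ (i, 0)" for l i
  have \<kappa>0: "\<kappa> 0 i = 1" if "i < n" for i using that R unfolding \<kappa>_def by (simp add: v_def)
  have \<kappa>S: "\<kappa> (Suc l) i = ?d i * \<kappa> l i + ?\<epsilon> i * \<kappa> l (Suc i)" if i: "i < n" for l i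
  proof -
    have pl: "R ^\<^sub>m l \<in> carrier_mat n n" using R by simp
    have com: "R ^\<^sub>m l * R = R * R ^\<^sub>m l"
    proof (induction l)
      case (Suc l)
      have pl: "R ^\<^sub>m l \<in> carrier_mat n n" using R by simp
      show ?case using Suc assoc_mult_mat[OF R pl R] by simp
    qed (use R in simp)
    have "R ^\<^sub>m Suc l * v = R * (R ^\<^sub>m l * v)" using com assoc_mult_mat[OF R pl v] by simp
    then have "\<kappa> (Suc l) i = (\<Sum>s<n. R $$ (i, s) * \<kappa> l s)"
      unfolding \<kappa>_def using mat_mult_entry[OF R mult_carrier_mat[OF pl v] i, of 0] by simp
    also have "\<dots> = (\<Sum>s<n. (if s = i then ?d i * \<kappa> l i else 0) + (if s = Suc i then ?\<epsilon> i * \<kappa> l (Suc i) else 0))"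
      by (rule sum.cong) (use i in \<open>auto simp: R_def bidiag_def\<close>)
    also have "\<dots> = ?d i * \<kappa> l i + ?\<epsilon> i * \<kappa> l (Suc i)" using i by (auto simp: sum.distrib)
    finally show ?thesis .
  qed
  \<comment> \<open>\<open>x j\<close> arises from the all-ones vector by applying
    \<open>R - d\<close> for the last \<open>j\<close> diagonal entries \<open>d\<close>, in
    descending order of index.\<close>
  define x where "x = rec_nat (\<lambda>_. 1) (\<lambda>j y i. (?d i - ?d (n - Suc j)) * y i + ?\<epsilon> i * y (Suc i))"
  have x0: "x 0 i = 1" and xS: "x (Suc j) i = (?d i - ?d (n - Suc j)) * x j i + ?\<epsilon> i * x j (Suc i)" for j i
    by (simp_all add: x_def)
  have span: "\<exists>u. \<forall>i<n. x j i = (\<Sum>l\<le>j. u l * \<kappa> l i)" for j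
  proof (induction j)
    case 0
    show ?case by (rule exI[of _ "\<lambda>_. 1"]) (simp add: x0 \<kappa>0)
  next
    case (Suc j)
    then obtain u where u: "\<And>i. i < n \<Longrightarrow> x j i = (\<Sum>l\<le>j. u l * \<kappa> l i)" by blast
    let ?e = "?d (n - Suc j)"
    let ?u = "\<lambda>l. (case l of 0 \<Rightarrow> 0 | Suc k \<Rightarrow> u k) - ?e * (if l \<le> j then u l else 0)"
    have "x (Suc j) i = (\<Sum>l\<le>Suc j. ?u l * \<kappa> l i)" if i: "i < n" for i
    proof -
      have "?\<epsilon> i * x j (Suc i) = (\<Sum>l\<le>j. u l * (?\<epsilon> i * \<kappa> l (Suc i)))"
        using u[of "Suc i"] by (simp add: sum_distrib_left)
      moreover have "?d i * x j i = (\<Sum>l\<le>j. u l * (?d i * \<kappa> l i))"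
        using u[OF i] by (simp add: sum_distrib_left mult.left_commute)
      ultimately have "?d i * x j i + ?\<epsilon> i * x j (Suc i) = (\<Sum>l\<le>j. u l * \<kappa> (Suc l) i)"
        unfolding \<kappa>S[OF i] by (simp only: distrib_left sum.distrib)
      also have "\<dots> = (\<Sum>l\<le>Suc j. (case l of 0 \<Rightarrow> 0 | Suc k \<Rightarrow> u k) * \<kappa> l i)"
        by (simp add: sum.atMost_Suc_shift del: sum.atMost_Suc)
      finally have 1: "?d i * x j i + ?\<epsilon> i * x j (Suc i) = (\<Sum>l\<le>Suc j. (case l of 0 \<Rightarrow> 0 | Suc k \<Rightarrow> u k) * \<kappa> l i)" .
      have 2: "?e * x j i = (\<Sum>l\<le>Suc j. ?e * (if l \<le> j then u l else 0) * \<kappa> l i)"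
        using u[OF i] by (simp add: sum_distrib_left mult.assoc)
      have "x (Suc j) i = (?d i * x j i + ?\<epsilon> i * x j (Suc i)) - ?e * x j i" by (simp add: xS algebra_simps)
      also have "\<dots> = (\<Sum>l\<le>Suc j. ?u l * \<kappa> l i)" unfolding 1 2 by (simp only: left_diff_distrib sum_subtractf)
      finally show ?thesis .
    qed
    then show ?case by (intro exI[of _ ?u] allI impI)
  qed
  \<comment> \<open>Each application clears one more entry from below. The entry just above the
    cleared part is nonzero: inside a block it is inherited from the next row through the
    \<open>1\<close> of \<open>R\<close>, and at the end of a block it is an earlier entry times
    differences of distinct eigenvalues, which is what the second clause records.\<close>
  have tri: "(\<forall>i<n. n - j \<le> i \<longrightarrow> x j i = 0) \<and> (\<forall>i<n - j. (Suc i < n \<longrightarrow> \<beta> i \<noteq> \<beta> (Suc i)) \<longrightarrow> x j i \<noteq> 0)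
      \<and> (j < n \<longrightarrow> x j (n - Suc j) \<noteq> 0)" if "j \<le> n" for j
    using that
  proof (induction j)
    case 0
    then show ?case by (auto simp: x0)
  next
    case (Suc j)
    define m where "m = n - Suc j"
    have m: "n - j = Suc m" "m < n" using Suc.prems by (auto simp: m_def)
    have IH: "\<And>i. i < n \<Longrightarrow> Suc m \<le> i \<Longrightarrow> x j i = 0" "\<And>i. i < Suc m \<Longrightarrow> (Suc i < n \<longrightarrow> \<beta> i \<noteq> \<beta> (Suc i)) \<Longrightarrow> x j i \<noteq> 0"
      "x j m \<noteq> 0" using Suc m by (auto simp: m_def)
    have xm: "x (Suc j) i = (?d i - ?d m) * x j i + ?\<epsilon> i * x j (Suc i)" for i by (simp add: xS m_def)
    have A: "x (Suc j) i = 0" if i: "i < n" "m \<le> i" for i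
    proof (cases "i = m")
      case True
      then show ?thesis unfolding xm using IH(1)[of "Suc i"] by auto
    next
      case False
      then show ?thesis unfolding xm using IH(1)[of i] IH(1)[of "Suc i"] i by auto
    qed
    have B: "x (Suc j) i \<noteq> 0" if i: "i < m" "Suc i < n \<longrightarrow> \<beta> i \<noteq> \<beta> (Suc i)" for i
    proof -
      have "\<beta> i \<noteq> \<beta> (Suc i)" using i m by auto
      then have "\<beta> i < \<beta> (Suc i)" using monoD[OF \<beta>, of i "Suc i"] by simp
      also have "\<beta> (Suc i) \<le> \<beta> m" using monoD[OF \<beta>, of "Suc i" m] i by simp
      finally have "?d i - ?d m \<noteq> 0" by simp
      moreover have "x j i \<noteq> 0" using IH(2)[of i] i by simp
      moreover have "?\<epsilon> i = 0" using i by auto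
      ultimately show ?thesis unfolding xm by simp
    qed
    have C: "x (Suc j) (n - Suc (Suc j)) \<noteq> 0" if jn: "Suc j < n"
    proof -
      obtain p where p: "m = Suc p" using jn by (cases m) (auto simp: m_def)
      have np: "n - Suc (Suc j) = p" using p by (simp add: m_def)
      show ?thesis
      proof (cases "\<beta> p = \<beta> (Suc p)")
        case True
        then show ?thesis unfolding np xm using p m IH(3) by auto
      next
        case False
        then show ?thesis unfolding np using B[of p] p by auto
      qed
    qed
    show ?case
      by (intro conjI allI impI) (use A B C in \<open>simp_all add: m_def\<close>)
  qed
  \<comment> \<open>Column \<open>j\<close> is \<open>x (n - Suc j)\<close>, whose entries below row
    \<open>j\<close> vanish and whose entry in row \<open>j\<close> does not.\<close>
  define T where "T = mat n n (\<lambda>(i, j). x (n - Suc j) i)"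
  have "upper_triangular T"
    unfolding upper_triangular_def T_def using tri by (auto simp: Suc_diff_Suc)
  then have "det T = prod_list (diag_mat T)" by (rule det_upper_triangular[of _ n]) (simp add: T_def)
  moreover have "0 \<notin> set (diag_mat T)"
  proof
    assume "0 \<in> set (diag_mat T)"
    then obtain i where "i < n" "x (n - Suc i) i = 0" by (auto simp: diag_mat_def T_def)
    then show False using tri[of "n - Suc i"] by (auto simp: Suc_diff_Suc)
  qed
  ultimately have dT: "det T \<noteq> 0" by (simp add: prod_list_zero_iff)
  have "\<forall>j. \<exists>u. \<forall>i<n. x j i = (\<Sum>l\<le>j. u l * \<kappa> l i)" using span by blast
  from choice[OF this] obtain u where u: "\<And>j i. i < n \<Longrightarrow> x j i = (\<Sum>l\<le>j. u j l * \<kappa> l i)" by blast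
  define U where "U = mat n n (\<lambda>(l, j). if l \<le> n - Suc j then u (n - Suc j) l else 0)"
  have U: "U \<in> carrier_mat n n" by (simp add: U_def)
  have "T = krylov n R v * U"
  proof (rule eq_matI)
    fix i j assume "i < dim_row (krylov n R v * U)" "j < dim_col (krylov n R v * U)"
    then have ij: "i < n" "j < n" by (auto simp: krylov_def U_def)
    have "(krylov n R v * U) $$ (i, j) = (\<Sum>l<n. \<kappa> l i * (if l \<le> n - Suc j then u (n - Suc j) l else 0))"
      unfolding mat_mult_entry[OF krylov_carrier U ij]
      by (rule sum.cong) (use ij in \<open>auto simp: krylov_def U_def \<kappa>_def simp del: index_mult_mat\<close>)
    also have "\<dots> = (\<Sum>l\<le>n - Suc j. \<kappa> l i * (if l \<le> n - Suc j then u (n - Suc j) l else 0))"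
      by (rule sum.mono_neutral_right) (use ij in auto)
    also have "\<dots> = x (n - Suc j) i" using u[OF ij(1)] by (simp add: mult.commute)
    finally show "T $$ (i, j) = (krylov n R v * U) $$ (i, j)" using ij by (simp add: T_def)
  qed (auto simp: T_def krylov_def U_def)
  then have "det T = det (krylov n R v) * det U" using det_mult[OF krylov_carrier U] by simp
  then show ?thesis using dT by auto
qed

text \<open>In a Jordan basis of \<open>A\<close>, give the blocks pairwise different eigenvalues.
  The new matrix still commutes with \<open>A\<close> and is cyclic, with the all-ones vector
  transported by \<open>P\<close>.\<close>

lemma commuting_cyclic_exists:
  assumes A: "A \<in> carrier_mat n n"
  obtains R v where "R \<in> carrier_mat n n" "v \<in> carrier_mat n 1" "A * R = R * A" "det (krylov n R v) \<noteq> 0"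
proof -
  obtain \<beta> a P Q where \<beta>: "mono \<beta>" and wit: "similar_mat_wit A (bidiag n \<beta> a) P Q" using similar_bidiag[OF A] .
  note w = similar_mat_witD2[OF A wit]
  have P: "P \<in> carrier_mat n n" and Q: "Q \<in> carrier_mat n n" and PQ: "P * Q = 1\<^sub>m n" "Q * P = 1\<^sub>m n"
    and AJ: "A = P * bidiag n \<beta> a * Q" by (rule w)+
  let ?J = "bidiag n \<beta> a" and ?R = "bidiag n \<beta> of_nat" and ?v = "mat n 1 (\<lambda>_. 1 :: complex)"
  have conj: "(P * X * Q) * (P * Y * Q) = P * (X * Y) * Q" if "X \<in> carrier_mat n n" "Y \<in> carrier_mat n n" for X Y
  proof -
    have PX: "P * X \<in> carrier_mat n n" and YQ: "Y * Q \<in> carrier_mat n n" and PYQ: "P * Y * Q \<in> carrier_mat n n" using P Q that by auto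
    have "(P * X * Q) * (P * Y * Q) = (P * X) * (Q * (P * Y * Q))" by (rule assoc_mult_mat[OF PX Q PYQ])
    also have "Q * (P * Y * Q) = (Q * P) * (Y * Q)"
      unfolding assoc_mult_mat[OF P that(2) Q] by (rule assoc_mult_mat[OF Q P YQ, symmetric])
    also have "\<dots> = Y * Q" unfolding PQ by (rule left_mult_one_mat[OF YQ])
    also have "(P * X) * (Y * Q) = P * (X * Y) * Q"
      using assoc_mult_mat[OF PX that(2) Q] assoc_mult_mat[OF P that] by simp
    finally show ?thesis .
  qed
  let ?S = "P * ?R * Q"
  have S: "?S \<in> carrier_mat n n" by (rule mult_carrier_mat[OF mult_carrier_mat[OF P bidiag_carrier] Q])
  have Pv: "P * ?v \<in> carrier_mat n 1" using P by simp
  have "?S ^\<^sub>m j * (P * ?v) = P * (?R ^\<^sub>m j * ?v)" for j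
  proof -
    have pj: "?R ^\<^sub>m j \<in> carrier_mat n n" by simp
    have "?S ^\<^sub>m j = P * ?R ^\<^sub>m j * Q"
    proof (induction j)
      case 0
      have "dim_row ?S = n" "dim_row ?R = n" using carrier_matD[OF S] by (auto simp: bidiag_def)
      then show ?case using right_mult_one_mat[OF P] PQ by (simp del: index_mult_mat)
    next
      case (Suc j)
      then show ?case using conj[of "?R ^\<^sub>m j" ?R] by simp
    qed
    then have "?S ^\<^sub>m j * (P * ?v) = (P * ?R ^\<^sub>m j) * (Q * (P * ?v))"
      using assoc_mult_mat[OF mult_carrier_mat[OF P pj] Q Pv] by simp
    also have "Q * (P * ?v) = ?v" using assoc_mult_mat[OF Q P, of ?v 1] PQ by simp
    also have "(P * ?R ^\<^sub>m j) * ?v = P * (?R ^\<^sub>m j * ?v)" by (rule assoc_mult_mat[OF P pj, of ?v 1]) simp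
    finally show ?thesis .
  qed
  then have "krylov n ?S (P * ?v) = P * krylov n ?R ?v"
    using mult_krylov[OF P bidiag_carrier, of ?v] carrier_matD[OF P]
    by (intro eq_matI) (auto simp: krylov_def simp del: index_mult_mat(1))
  then have "det (krylov n ?S (P * ?v)) = det P * det (krylov n ?R ?v)"
    using det_mult[OF P krylov_carrier] by simp
  moreover have "det P * det Q = 1" using det_mult[OF P Q] PQ by simp
  ultimately have "det (krylov n ?S (P * ?v)) \<noteq> 0" using bidiag_cyclic[OF \<beta>, of n] by auto
  moreover have "A * ?S = ?S * A" unfolding AJ conj[OF bidiag_carrier bidiag_carrier] bidiag_commute[of n \<beta> a] ..
  ultimately show ?thesis using that S Pv by blast
qed

lemma pfm_matpoly:
  assumes "pfm X S n R" "\<And>j. j < l \<Longrightarrow> pf X S (\<lambda>x. c x j)"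
  shows "pfm X S n (\<lambda>x. matpoly n (c x) (R x) l)"
  using assms(2) by (induction l) (auto intro!: pfm_const pfm_add pfm_smult pfm_pow assms(1))

lemma pf_det_krylov:
  assumes "pfm X S n R" "v \<in> carrier_mat n 1" shows "pf X S (\<lambda>x. det (krylov n (R x) v))"
proof (rule pfm_det[of _ _ n], unfold pfm_def, intro conjI ballI allI impI)
  fix i j assume ij: "i < n" "j < n"
  have p: "pfm X S n (\<lambda>x. R x ^\<^sub>m j)" by (rule pfm_pow[OF assms(1)])
  have "pf X S (\<lambda>x. \<Sum>l<n. (R x ^\<^sub>m j) $$ (i, l) * v $$ (l, 0))"
    by (intro pf_sum pf_mult pf_const pfm_entry[OF p]) (use ij in auto)
  then show "pf X S (\<lambda>x. krylov n (R x) v $$ (i, j))"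
    by (rule pf_cong) (use ij mat_mult_entry[OF pfm_carrier[OF p] assms(2) ij(1), of _ 0] in \<open>simp add: krylov_def\<close>)
qed simp

text \<open>Motzkin--Taussky: the pairs \<open>(p(B), B)\<close> are dense in the commuting pairs. On the line from \<open>B\<close>
  to a cyclic matrix commuting with \<open>A\<close> almost all matrices are cyclic.\<close>

lemma commuting_pairs_dense:
  assumes g: "g \<in> polyfuns (mat2_coords n)" "\<And>c B. B \<in> carrier_mat n n \<Longrightarrow> g (matpoly n c B n, B) = 0"
    and AB: "A \<in> carrier_mat n n" "B \<in> carrier_mat n n" "A * B = B * A"
  shows "g (A, B) = 0"
proof -
  obtain R v where R: "R \<in> carrier_mat n n" "v \<in> carrier_mat n 1" "A * R = R * A" "det (krylov n R v) \<noteq> 0"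
    using commuting_cyclic_exists[OF AB(1)] by metis
  let ?X = "cds 1"
  define L where "L t = (1 - t 0) \<cdot>\<^sub>m B + t 0 \<cdot>\<^sub>m R" for t :: "nat \<Rightarrow> complex"
  have t0: "pf ?X UNIV (\<lambda>t. t 0)" by (rule pf_coord[OF cds_coord]) simp
  have L: "pfm ?X UNIV n L"
    unfolding L_def by (intro pfm_add pfm_smult pf_diff pf_const t0 pfm_const AB R)
  have Lc: "L t \<in> carrier_mat n n" for t using pfm_carrier[OF L] by simp
  have com: "A * L t = L t * A" for t
    unfolding L_def
    using mult_add_distrib_mat[OF AB(1) smult_carrier_mat[OF AB(2)] smult_carrier_mat[OF R(1)], of "1 - t 0" "t 0"]
      add_mult_distrib_mat[OF smult_carrier_mat[OF AB(2)] smult_carrier_mat[OF R(1)] AB(1), of "1 - t 0" "t 0"]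
      mult_smult_distrib[OF AB(1,2)] mult_smult_distrib[OF AB(1) R(1)]
      mult_smult_assoc_mat[OF AB(2,1)] mult_smult_assoc_mat[OF R(1) AB(1)] AB(3) R(3) by simp
  have d: "(\<lambda>t. det (krylov n (L t) v)) \<in> polyfuns ?X" using pf_det_krylov[OF L R(2)] by (simp add: pf_UNIV)
  have "pf ?X UNIV (\<lambda>t. g (A, L t))"
    by (rule pf_comp[of "mat2_coords n" UNIV]) (use g(1) pf_pair_coords_mat[OF pfm_const[OF AB(1)] L] in \<open>auto simp: pf_UNIV\<close>)
  then have h: "(\<lambda>t. g (A, L t)) \<in> polyfuns ?X" by (simp add: pf_UNIV)
  have "g (A, L t) = 0" if "det (krylov n (L t) v) \<noteq> 0" for t
    using commutant_of_cyclic[OF Lc R(2) that AB(1) com] g(2)[OF Lc] by metis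
  then have "(\<forall>t. det (krylov n (L t) v) = 0) \<or> (\<forall>t. g (A, L t) = 0)" by (rule cds_mult_zero[OF d h])
  moreover have "L (\<lambda>_. 1) = R" unfolding L_def using AB R by (intro eq_matI) auto
  moreover have "L (\<lambda>_. 0) = B" unfolding L_def using AB R by (intro eq_matI) auto
  ultimately show ?thesis using R(4) by metis
qed

section \<open>Products of a general linear group with a torus\<close>

definition blk :: "nat \<Rightarrow> nat \<Rightarrow> complex mat \<Rightarrow> (nat \<Rightarrow> complex) \<Rightarrow> complex mat" where
  "blk n b A \<alpha> = mat (n + b) (n + b) (\<lambda>(i, j). if i < n \<and> j < n then A $$ (i, j) else if i = j then \<alpha> (i - n) else 0)"

lemma blk_carrier [simp]: "blk n b A \<alpha> \<in> carrier_mat (n + b) (n + b)"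
  by (simp add: blk_def)

lemma blk_entry: "i < n + b \<Longrightarrow> j < n + b \<Longrightarrow>
    blk n b A \<alpha> $$ (i, j) = (if i < n \<and> j < n then A $$ (i, j) else if i = j then \<alpha> (i - n) else 0)"
  by (simp add: blk_def)

lemma blk_mult:
  assumes "A \<in> carrier_mat n n" "B \<in> carrier_mat n n"
  shows "blk n b A \<alpha> * blk n b B \<beta> = blk n b (A * B) (\<lambda>s. \<alpha> s * \<beta> s)"
proof (rule eq_matI)
  fix i j assume "i < dim_row (blk n b (A * B) (\<lambda>s. \<alpha> s * \<beta> s))" "j < dim_col (blk n b (A * B) (\<lambda>s. \<alpha> s * \<beta> s))"
  then have ij: "i < n + b" "j < n + b" by (auto simp: blk_def)
  have e: "(blk n b A \<alpha> * blk n b B \<beta>) $$ (i, j) = (\<Sum>l<n + b. blk n b A \<alpha> $$ (i, l) * blk n b B \<beta> $$ (l, j))"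
    by (rule mat_mult_entry[OF blk_carrier blk_carrier ij])
  show "(blk n b A \<alpha> * blk n b B \<beta>) $$ (i, j) = blk n b (A * B) (\<lambda>s. \<alpha> s * \<beta> s) $$ (i, j)"
  proof (cases "i < n")
    case True
    have "(\<Sum>l<n + b. blk n b A \<alpha> $$ (i, l) * blk n b B \<beta> $$ (l, j)) = (\<Sum>l<n. blk n b A \<alpha> $$ (i, l) * blk n b B \<beta> $$ (l, j))"
      by (rule sum.mono_neutral_right) (use True in \<open>auto simp: blk_entry\<close>)
    also have "\<dots> = (\<Sum>l<n. if j < n then A $$ (i, l) * B $$ (l, j) else 0)"
      by (rule sum.cong) (use True ij in \<open>auto simp: blk_entry\<close>)
    also have "\<dots> = blk n b (A * B) (\<lambda>s. \<alpha> s * \<beta> s) $$ (i, j)"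
      using True ij mat_mult_entry[OF assms True, of j] by (simp add: blk_entry del: index_mult_mat)
    finally show ?thesis unfolding e .
  next
    case False
    have "(\<Sum>l<n + b. blk n b A \<alpha> $$ (i, l) * blk n b B \<beta> $$ (l, j)) = (\<Sum>l<n + b. if l = i then \<alpha> (i - n) * blk n b B \<beta> $$ (i, j) else 0)"
      by (rule sum.cong) (use False ij in \<open>auto simp: blk_entry\<close>)
    then show ?thesis unfolding e using False ij by (auto simp: blk_entry)
  qed
qed (auto simp: blk_def)

lemma blk_commute_iff:
  assumes "A \<in> carrier_mat n n" "B \<in> carrier_mat n n"
  shows "blk n b A \<alpha> * blk n b B \<beta> = blk n b B \<beta> * blk n b A \<alpha> \<longleftrightarrow> A * B = B * A"
proof
  assume "blk n b A \<alpha> * blk n b B \<beta> = blk n b B \<beta> * blk n b A \<alpha>"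
  then have e: "blk n b (A * B) (\<lambda>s. \<alpha> s * \<beta> s) = blk n b (B * A) (\<lambda>s. \<beta> s * \<alpha> s)"
    unfolding blk_mult[OF assms] blk_mult[OF assms(2,1)] .
  show "A * B = B * A"
  proof (rule eq_matI)
    fix i j assume "i < dim_row (B * A)" "j < dim_col (B * A)"
    then have "i < n" "j < n" using assms by auto
    then show "(A * B) $$ (i, j) = (B * A) $$ (i, j)"
      using arg_cong[OF e, of "\<lambda>M. M $$ (i, j)"] by (simp add: blk_entry del: index_mult_mat)
  qed (use assms in auto)
next
  assume "A * B = B * A"
  then show "blk n b A \<alpha> * blk n b B \<beta> = blk n b B \<beta> * blk n b A \<alpha>"
    unfolding blk_mult[OF assms] blk_mult[OF assms(2,1)] by (simp add: mult.commute)
qed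

lemma pfm_blk:
  assumes "pfm X S n M" "\<And>s. s < b \<Longrightarrow> pf X S (\<lambda>x. \<alpha> x s)"
  shows "pfm X S (n + b) (\<lambda>x. blk n b (M x) (\<alpha> x))"
  unfolding pfm_def
proof (intro conjI ballI allI impI)
  fix i j assume ij: "i < n + b" "j < n + b"
  consider "i < n" "j < n" | "\<not> (i < n \<and> j < n)" "i = j" | "\<not> (i < n \<and> j < n)" "i \<noteq> j" by blast
  then show "pf X S (\<lambda>x. blk n b (M x) (\<alpha> x) $$ (i, j))"
  proof cases
    case 1
    then show ?thesis using pfm_entry[OF assms(1)] ij by (simp add: blk_entry)
  next
    case 2
    then show ?thesis using assms(2)[of "i - n"] ij by (simp add: blk_entry)
  next
    case 3
    then show ?thesis using ij by (simp add: blk_entry pf_const del: de_Morgan_conj)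
  qed
qed simp

text \<open>The group \<open>GL n \<times> (\<complex>\<^sup>\<times>)\<^sup>b\<close> is the centraliser in \<open>GL (n + b)\<close> of \<open>diag (0, \<dots>, 0, 1, \<dots>, b)\<close>; the
  truncated subtraction \<open>Suc i - n\<close> is \<open>0\<close> for \<open>i < n\<close>.\<close>

definition levi_diag :: "nat \<Rightarrow> nat \<Rightarrow> complex mat" where
  "levi_diag n b = mat (n + b) (n + b) (\<lambda>(i, j). if i = j then of_nat (Suc i - n) else 0)"

definition levi :: "nat \<Rightarrow> nat \<Rightarrow> complex mat set" where
  "levi n b = {A\<in>carrier (GL (n + b)). A * levi_diag n b = levi_diag n b * A}"

lemma levi_diag_carrier [simp]: "levi_diag n b \<in> carrier_mat (n + b) (n + b)"
  by (simp add: levi_diag_def)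

lemma levi_iff:
  "A \<in> levi n b \<longleftrightarrow> A \<in> carrier (GL (n + b)) \<and>
    (\<forall>i<n + b. \<forall>j<n + b. i \<noteq> j \<longrightarrow> \<not> (i < n \<and> j < n) \<longrightarrow> A $$ (i, j) = 0)"
proof (cases "A \<in> carrier (GL (n + b))")
  case True
  let ?D = "levi_diag n b"
  have A: "A \<in> carrier_mat (n + b) (n + b)" using True by (simp add: carrier_GL)
  have "(A * ?D) $$ (i, j) = A $$ (i, j) * of_nat (Suc j - n)"
    "(?D * A) $$ (i, j) = of_nat (Suc i - n) * A $$ (i, j)" if ij: "i < n + b" "j < n + b" for i j
  proof -
    have "(\<Sum>l<n + b. A $$ (i, l) * ?D $$ (l, j)) = (\<Sum>l<n + b. if l = j then A $$ (i, j) * of_nat (Suc j - n) else 0)"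
      by (rule sum.cong) (use ij in \<open>auto simp: levi_diag_def\<close>)
    then show "(A * ?D) $$ (i, j) = A $$ (i, j) * of_nat (Suc j - n)"
      unfolding mat_mult_entry[OF A levi_diag_carrier ij] using ij by simp
    have "(\<Sum>l<n + b. ?D $$ (i, l) * A $$ (l, j)) = (\<Sum>l<n + b. if l = i then of_nat (Suc i - n) * A $$ (i, j) else 0)"
      by (rule sum.cong) (use ij in \<open>auto simp: levi_diag_def\<close>)
    then show "(?D * A) $$ (i, j) = of_nat (Suc i - n) * A $$ (i, j)"
      unfolding mat_mult_entry[OF levi_diag_carrier A ij] using ij by simp
  qed
  then have "A * ?D = ?D * A \<longleftrightarrow> (\<forall>i<n + b. \<forall>j<n + b. A $$ (i, j) * of_nat (Suc j - n) = of_nat (Suc i - n) * A $$ (i, j))"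
    using A carrier_matD[OF levi_diag_carrier[of n b]] by (auto simp: mat_eq_iff simp del: index_mult_mat(1))
  also have "\<dots> \<longleftrightarrow> (\<forall>i<n + b. \<forall>j<n + b. A $$ (i, j) = 0 \<or> Suc i - n = Suc j - n)"
  proof -
    have "a * of_nat q = of_nat p * a \<longleftrightarrow> a = 0 \<or> p = q" for a :: complex and p q
      by (auto simp: mult.commute[of a])
    then show ?thesis by simp
  qed
  also have "\<dots> \<longleftrightarrow> (\<forall>i<n + b. \<forall>j<n + b. i \<noteq> j \<longrightarrow> \<not> (i < n \<and> j < n) \<longrightarrow> A $$ (i, j) = 0)"
  proof -
    have "Suc i - n = Suc j - n \<longleftrightarrow> i = j \<or> (i < n \<and> j < n)" for i j by linarith
    then show ?thesis by (simp only:) blast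
  qed
  finally show ?thesis using True by (simp add: levi_def)
qed (simp add: levi_def)

lemma levi_carrier: "levi n b \<subseteq> carrier_mat (n + b) (n + b)"
  by (auto simp: levi_def carrier_GL)

lemma levi_blk:
  assumes "A \<in> levi n b"
  shows "A = blk n b (mat n n (\<lambda>ij. A $$ ij)) (\<lambda>s. A $$ (n + s, n + s))"
proof -
  have "A \<in> carrier_mat (n + b) (n + b)" using assms levi_carrier by blast
  then show ?thesis using assms by (intro eq_matI) (auto simp: levi_iff blk_def)
qed

lemma blk_levi: "det (blk n b A \<alpha>) \<noteq> 0 \<Longrightarrow> blk n b A \<alpha> \<in> levi n b"
  by (auto simp: levi_iff carrier_GL blk_entry)

lemma levi_subgroup: "subgroup (levi n b) (GL (n + b))"
proof (rule group.subgroupI[OF group_GL])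
  let ?D = "levi_diag n b" and ?N = "n + b"
  show "levi n b \<subseteq> carrier (GL ?N)" by (auto simp: levi_def)
  have "1\<^sub>m ?N \<in> levi n b"
    unfolding levi_iff carrier_GL by simp
  then show "levi n b \<noteq> {}" by blast
  fix A assume "A \<in> levi n b"
  then have A: "A \<in> carrier (GL ?N)" "A \<in> carrier_mat ?N ?N" "A * ?D = ?D * A" by (auto simp: levi_def carrier_GL)
  show "inv\<^bsub>GL ?N\<^esub> A \<in> levi n b"
  proof -
    let ?B = "inv\<^bsub>GL ?N\<^esub> A"
    have Bg: "?B \<in> carrier (GL ?N)" by (rule group.inv_closed[OF group_GL A(1)])
    then have B: "?B \<in> carrier_mat ?N ?N" by (simp add: carrier_GL)
    have AB: "A * ?B = 1\<^sub>m ?N" "?B * A = 1\<^sub>m ?N"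
      using group.r_inv[OF group_GL A(1)] group.l_inv[OF group_GL A(1)] by simp_all
    have D: "?D \<in> carrier_mat ?N ?N" by simp
    have "?B * ?D = ?B * (?D * (A * ?B))" unfolding AB right_mult_one_mat[OF D] ..
    also have "?D * (A * ?B) = (A * ?D) * ?B" unfolding A(3) by (rule assoc_mult_mat[OF D A(2) B, symmetric])
    also have "\<dots> = A * (?D * ?B)" by (rule assoc_mult_mat[OF A(2) D B])
    also have "?B * (A * (?D * ?B)) = (?B * A) * (?D * ?B)"
      by (rule assoc_mult_mat[OF B A(2) mult_carrier_mat[OF D B], symmetric])
    also have "\<dots> = ?D * ?B" unfolding AB by (rule left_mult_one_mat[OF mult_carrier_mat[OF D B]])
    finally show ?thesis using Bg by (simp add: levi_def)
  qed
  fix B assume "B \<in> levi n b"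
  then have B: "B \<in> carrier (GL ?N)" "B \<in> carrier_mat ?N ?N" "B * ?D = ?D * B" by (auto simp: levi_def carrier_GL)
  have D: "?D \<in> carrier_mat ?N ?N" by simp
  have "(A * B) * ?D = A * (B * ?D)" by (rule assoc_mult_mat[OF A(2) B(2) D])
  also have "\<dots> = (A * ?D) * B" unfolding B(3) by (rule assoc_mult_mat[OF A(2) D B(2), symmetric])
  also have "\<dots> = ?D * (A * B)" unfolding A(3) by (rule assoc_mult_mat[OF D A(2) B(2)])
  finally have "(A * B) * ?D = ?D * (A * B)" .
  moreover have "A * B \<in> carrier (GL ?N)" using A B det_mult[OF A(2) B(2)] by (auto simp: carrier_GL)
  ultimately show "A \<otimes>\<^bsub>GL ?N\<^esub> B \<in> levi n b" by (simp add: levi_def)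
qed

lemma levi_zclosed: "zclosed (mat_coords (n + b)) (carrier (GL (n + b))) (levi n b)"
  unfolding levi_def
  by (intro zclosed_mat_eq[of _ _ "n + b"] pfm_mult pfm_id pfm_const) (auto simp: carrier_GL)

section \<open>Coordinates on the group and on its commuting variety\<close>

abbreviation pmat :: "nat \<Rightarrow> (nat \<Rightarrow> complex) \<Rightarrow> complex mat" where
  "pmat n t \<equiv> mat n n (\<lambda>(i, j). t (i * n + j))"

lemma index_less: "i < n \<Longrightarrow> j < n \<Longrightarrow> i * n + j < n * (n::nat)"
  using mult_le_mono1[of "Suc i" n n] by simp

lemma pfm_pmat: "n * n \<le> D \<Longrightarrow> pfm (cds D) UNIV n (pmat n)"
  unfolding pfm_def
  by (auto intro!: pf_coord cds_coord less_le_trans[OF index_less])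

lemma pmat_surj: "A \<in> carrier_mat n n \<Longrightarrow> (\<And>l. l < n * n \<Longrightarrow> t l = A $$ (l div n, l mod n)) \<Longrightarrow> pmat n t = A"
  by (intro eq_matI) (auto simp: index_less)

lemma square_index: "l < n * n \<Longrightarrow> l div n < n \<and> l mod n < (n::nat)"
  by (cases "n = 0") (auto simp: less_mult_imp_div_less)

abbreviation levi_param :: "nat \<Rightarrow> nat \<Rightarrow> (nat \<Rightarrow> complex) \<Rightarrow> complex mat" where
  "levi_param n b t \<equiv> blk n b (pmat n t) (\<lambda>s. t (n * n + s))"

abbreviation levi_coord :: "nat \<Rightarrow> nat \<Rightarrow> complex mat \<Rightarrow> complex" where
  "levi_coord n l A \<equiv> (if l < n * n then A $$ (l div n, l mod n) else A $$ (n + (l - n * n), n + (l - n * n)))"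

lemma levi_image: "levi n b = levi_param n b ` {t. det (levi_param n b t) \<noteq> 0}"
proof (intro subset_antisym subsetI)
  fix A assume A: "A \<in> levi n b"
  have "A = levi_param n b (\<lambda>l. levi_coord n l A)"
  proof -
    have "pmat n (\<lambda>l. levi_coord n l A) = mat n n (\<lambda>ij. A $$ ij)"
      by (rule pmat_surj) (use square_index in auto)
    then show ?thesis using levi_blk[OF A] by simp
  qed
  moreover have "det A \<noteq> 0" using A by (simp add: levi_def carrier_GL)
  ultimately show "A \<in> levi_param n b ` {t. det (levi_param n b t) \<noteq> 0}"
    by (intro image_eqI[where x = "\<lambda>l. levi_coord n l A"]) auto
qed (auto intro: blk_levi)

lemma pfm_levi_param: "pfm (cds (n * n + b)) UNIV (n + b) (levi_param n b)"
  by (intro pfm_blk pfm_pmat pf_coord cds_coord) auto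

lemma levi_one: "1\<^sub>m (n + b) \<in> levi n b"
  using subgroup.one_closed[OF levi_subgroup] by simp

text \<open>The group is the image of the principal open subset of affine space on which the
  determinant is nonzero, and \<open>levi_coord\<close> inverts this parametrisation.\<close>

lemma levi_dim:
  shows "zprime (mat_coords (n + b)) (levi n b)"
    and "growth (mat_coords (n + b)) (levi n b) (n * n + b)"
    and "indep (levi_coord n) (n * n + b) (levi n b)"
proof -
  let ?d = "n * n + b"
  have co: "pf (cds ?d) S (\<lambda>t. f (levi_param n b t))" if "f \<in> mat_coords (n + b)" for f S
    by (rule pf_subset[OF _ subset_UNIV]) (use pfm_levi_param[of n b] that in \<open>auto simp: mat_coords_def pfm_def\<close>)
  have d: "pf (cds ?d) UNIV (\<lambda>t. det (levi_param n b t))" by (rule pfm_det[OF pfm_levi_param])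
  obtain t where t: "det (levi_param n b t) \<noteq> 0" using levi_one[of n b] unfolding levi_image by (elim imageE CollectE)
  have "zprime (cds ?d) {t\<in>UNIV. det (levi_param n b t) \<noteq> 0}"
    by (rule zprime_open(1)[OF zprime_affine d, of t]) (use t in auto)
  then show "zprime (mat_coords (n + b)) (levi n b)"
    unfolding levi_image by (intro zprime_image[OF _ co]) simp_all
  show "growth (mat_coords (n + b)) (levi n b) ?d"
    by (rule growth_mono[OF growth_affine_image[OF finite_mat_coords co]]) (auto simp: levi_image)
  show "indep (levi_coord n) ?d (levi n b)"
    unfolding indep_def
  proof (intro ballI impI)
    fix P assume P: "P \<in> polyfuns (cds ?d)" "\<forall>A\<in>levi n b. P (\<lambda>l. levi_coord n l A) = 0"
    have "P p = 0" if "det (levi_param n b p) \<noteq> 0" for p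
    proof -
      have "P (\<lambda>l. levi_coord n l (levi_param n b p)) = P p"
      proof (rule cds_cong[OF P(1)])
        fix l assume l: "l < ?d"
        show "levi_coord n l (levi_param n b p) = p l"
        proof (cases "l < n * n")
          case True
          then show ?thesis using square_index[OF True] by (simp add: blk_entry)
        qed (use l in \<open>auto simp: blk_entry\<close>)
      qed
      then show ?thesis using bspec[OF P(2) blk_levi[OF that]] by (simp only:)
    qed
    then have "(\<forall>p. det (levi_param n b p) = 0) \<or> (\<forall>p. P p = 0)"
      using cds_mult_zero[of "\<lambda>p. det (levi_param n b p)" ?d P] d P(1) by (simp add: pf_UNIV)
    then show "\<forall>p. P p = 0"
    proof
      assume "\<forall>p. det (levi_param n b p) = 0"
      from spec[OF this, of t] t show ?thesis by contradiction
    qed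
  qed
qed

text \<open>The parameters are, in order, the \<open>n * n\<close> entries of a matrix
  \<open>B\<close>, the \<open>n\<close> coefficients of a polynomial \<open>p\<close> for the first
  block \<open>p(B)\<close>, the torus part of the second entry, and that of the first.
  Invertibility is not imposed, which keeps the parameter space affine.\<close>

abbreviation cv_param :: "nat \<Rightarrow> nat \<Rightarrow> (nat \<Rightarrow> complex) \<Rightarrow> complex mat \<times> complex mat" where
  "cv_param n b t \<equiv> (blk n b (matpoly n (\<lambda>l. t (n * n + l)) (pmat n t) n) (\<lambda>s. t (n * n + n + b + s)),
     blk n b (pmat n t) (\<lambda>s. t (n * n + n + s)))"

text \<open>The coefficients of \<open>p\<close> need not be determined by the pair, as
  \<open>B\<close> may satisfy an equation of degree below \<open>n\<close>. They are replaced by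
  the row sums of the first block, which are the entries of \<open>p(B) v\<close> for the all-ones
  vector \<open>v\<close>.\<close>

abbreviation cv_coord :: "nat \<Rightarrow> nat \<Rightarrow> nat \<Rightarrow> complex mat \<times> complex mat \<Rightarrow> complex" where
  "cv_coord n b l z \<equiv>
     (if l < n * n then snd z $$ (l div n, l mod n)
      else if l < n * n + n then \<Sum>j<n. fst z $$ (l - n * n, j)
      else if l < n * n + n + b then snd z $$ (n + (l - (n * n + n)), n + (l - (n * n + n)))
      else fst z $$ (n + (l - (n * n + n + b)), n + (l - (n * n + n + b))))"

lemma pfm_cv_param:
  shows "pfm (cds (n * n + n + 2 * b)) UNIV (n + b) (\<lambda>t. fst (cv_param n b t))"
    and "pfm (cds (n * n + n + 2 * b)) UNIV (n + b) (\<lambda>t. snd (cv_param n b t))"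
proof -
  have p: "pf (cds (n * n + n + 2 * b)) UNIV (\<lambda>t. t l)" if "l < n * n + n + 2 * b" for l
    by (rule pf_coord[OF cds_coord[OF that]])
  have m: "pfm (cds (n * n + n + 2 * b)) UNIV n (pmat n)" by (rule pfm_pmat) simp
  show "pfm (cds (n * n + n + 2 * b)) UNIV (n + b) (\<lambda>t. fst (cv_param n b t))"
    unfolding fst_conv by (rule pfm_blk[OF pfm_matpoly[OF m]]) (rule p, simp)+
  show "pfm (cds (n * n + n + 2 * b)) UNIV (n + b) (\<lambda>t. snd (cv_param n b t))"
    unfolding snd_conv by (rule pfm_blk[OF m]) (rule p, simp)
qed

text \<open>With the torus parts held fixed, a function of the pair becomes a function of the two
  blocks of size \<open>n\<close>, to which \<open>commuting_pairs_dense\<close> applies.\<close>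

lemma cv_param_zdense:
  "zdense (mat2_coords (n + b)) (range (cv_param n b)) (commuting_variety (levi n b))"
  unfolding zdense_def
proof (intro ballI impI)
  fix g z assume g: "g \<in> polyfuns (mat2_coords (n + b))" "\<forall>z\<in>range (cv_param n b). g z = 0"
    and z: "z \<in> commuting_variety (levi n b)"
  obtain A B where AB: "z = (A, B)" "A \<in> levi n b" "B \<in> levi n b" "A * B = B * A"
    using z by (auto simp: commuting_variety_def)
  define A0 B0 where "A0 = mat n n (\<lambda>ij. A $$ ij)" and "B0 = mat n n (\<lambda>ij. B $$ ij)"
  define \<alpha> \<beta> where "\<alpha> s = A $$ (n + s, n + s)" and "\<beta> s = B $$ (n + s, n + s)" for s
  have eq: "A = blk n b A0 \<alpha>" "B = blk n b B0 \<beta>"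
    unfolding A0_def B0_def \<alpha>_def \<beta>_def by (rule levi_blk[OF AB(2)], rule levi_blk[OF AB(3)])
  have c: "A0 \<in> carrier_mat n n" "B0 \<in> carrier_mat n n" by (simp_all add: A0_def B0_def)
  have com: "A0 * B0 = B0 * A0" using AB(4) blk_commute_iff[OF c] unfolding eq by blast
  let ?h = "\<lambda>z. g (blk n b (fst z) \<alpha>, blk n b (snd z) \<beta>)"
  let ?V = "carrier_mat n n \<times> carrier_mat n n :: (complex mat \<times> complex mat) set"
  have "pf (mat2_coords n) ?V ?h"
  proof (rule pf_comp[of "mat2_coords (n + b)" UNIV])
    have f: "pfm (mat2_coords n) ?V n fst" "pfm (mat2_coords n) ?V n snd" by (auto intro!: pfm_fst pfm_snd)
    show "pf (mat2_coords n) ?V (\<lambda>z. f (blk n b (fst z) \<alpha>, blk n b (snd z) \<beta>))" if "f \<in> mat2_coords (n + b)" for f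
      by (rule pf_pair_coords_mat[OF pfm_blk[OF f(1) pf_const] pfm_blk[OF f(2) pf_const] that])
  qed (simp_all add: pf_UNIV g(1))
  then obtain h where h: "h \<in> polyfuns (mat2_coords n)" "\<forall>z\<in>?V. ?h z = h z" unfolding pf_def by blast
  have "h (A0, B0) = 0"
  proof (rule commuting_pairs_dense[OF h(1) _ c com])
    fix u and Y :: "complex mat" assume Y: "Y \<in> carrier_mat n n"
    define t where "t l = (if l < n * n then Y $$ (l div n, l mod n) else if l < n * n + n then u (l - n * n)
      else if l < n * n + n + b then \<beta> (l - (n * n + n)) else \<alpha> (l - (n * n + n + b)))" for l
    have Yt: "pmat n t = Y" by (rule pmat_surj[OF Y]) (simp add: t_def)
    have m: "matpoly n (\<lambda>l. t (n * n + l)) Y l = matpoly n u Y l" if "l \<le> n" for l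
      using that by (induction l) (simp_all add: t_def)
    have e: "matpoly n (\<lambda>l. t (n * n + l)) (pmat n t) n = matpoly n u Y n" unfolding Yt by (rule m[OF order.refl])
    have "blk n b X (\<lambda>s. t (n * n + n + b + s)) = blk n b X \<alpha>" "blk n b X (\<lambda>s. t (n * n + n + s)) = blk n b X \<beta>" for X
      by (rule eq_matI; auto simp: blk_def t_def)+
    then have "cv_param n b t = (blk n b (matpoly n u Y n) \<alpha>, blk n b Y \<beta>)" by (simp only: Yt m[OF order.refl])
    moreover have "g (cv_param n b t) = 0" using g(2) by blast
    ultimately have "?h (matpoly n u Y n, Y) = 0" by simp
    then show "h (matpoly n u Y n, Y) = 0" using h(2) Y by simp
  qed
  then show "g z = 0" using h(2) c unfolding AB(1) eq by simp
qed

lemma cv_growth: "growth (mat2_coords (n + b)) (commuting_variety (levi n b)) (n * n + n + 2 * b)"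
  unfolding growth_def
proof (intro exI conjI)
  show "zdense (mat2_coords (n + b)) (range (cv_param n b)) (commuting_variety (levi n b))"
    by (rule cv_param_zdense)
  show "growth0 (mat2_coords (n + b)) (range (cv_param n b)) (n * n + n + 2 * b)"
  proof (rule growth0_image[OF finite_pair_coords[OF finite_mat_coords finite_mat_coords] _ growth0_affine])
    fix f assume "f \<in> mat2_coords (n + b)"
    then show "pf (cds (n * n + n + 2 * b)) UNIV (\<lambda>t. f (cv_param n b t))"
      using pf_pair_coords_mat[OF pfm_cv_param] by simp
  qed
qed

lemma det_krylov_bidiag: "det (krylov n (bidiag n (\<lambda>_. 0) of_nat) (mat n 1 (\<lambda>_. 1))) \<noteq> 0"
  by (rule bidiag_cyclic) (simp add: mono_def)

text \<open>Pulled back to the parameters, a relation \<open>P\<close> vanishes where both matrices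
  are invertible, hence everywhere. If \<open>B\<close> is cyclic for the all-ones vector,
  \<open>krylov_solve\<close> finds coefficients for any prescribed row sums, so the coordinates
  take every value \<open>p\<close> in a nonempty open set.\<close>

lemma cv_indep: "indep (cv_coord n b) (n * n + n + 2 * b) (commuting_variety (levi n b))"
  unfolding indep_def
proof (intro ballI impI)
  let ?c = "n * n + n + 2 * b" and ?v = "mat n 1 (\<lambda>_. 1) :: complex mat"
  let ?U = "\<lambda>t. det (fst (cv_param n b t)) * det (snd (cv_param n b t))"
  fix P assume P: "P \<in> polyfuns (cds ?c)" "\<forall>z\<in>commuting_variety (levi n b). P (\<lambda>l. cv_coord n b l z) = 0"
  have U: "?U \<in> polyfuns (cds ?c)"
    using pf_mult[OF pfm_det pfm_det, OF pfm_cv_param] by (simp add: pf_UNIV)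
  \<comment> \<open>Were the product of determinants zero on all parameters, density would make it
    zero at the pair of identity matrices, which lies in the commuting variety.\<close>
  have U0: "\<not> (\<forall>t. ?U t = 0)"
  proof
    assume *: "\<forall>t. ?U t = 0"
    let ?V = "carrier_mat (n + b) (n + b) \<times> carrier_mat (n + b) (n + b) :: (complex mat \<times> complex mat) set"
    have "pf (mat2_coords (n + b)) ?V (\<lambda>z. det (fst z) * det (snd z))"
      by (intro pf_mult pfm_det[of _ _ "n + b"] pfm_fst pfm_snd) auto
    then obtain g where g: "g \<in> polyfuns (mat2_coords (n + b))" "\<And>z. z \<in> ?V \<Longrightarrow> det (fst z) * det (snd z) = g z"
      unfolding pf_def by blast
    have "g (cv_param n b t) = 0" for t using g(2)[of "cv_param n b t"] spec[OF *, of t] by simp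
    then have "\<forall>z\<in>commuting_variety (levi n b). g z = 0"
      using cv_param_zdense[of n b] g(1) unfolding zdense_def by blast
    moreover have "(1\<^sub>m (n + b), 1\<^sub>m (n + b)) \<in> commuting_variety (levi n b)"
      using levi_one by (simp add: commuting_variety_def)
    ultimately have "g (1\<^sub>m (n + b), 1\<^sub>m (n + b)) = 0" by blast
    then show False using g(2)[of "(1\<^sub>m (n + b), 1\<^sub>m (n + b))"] by simp
  qed
  have cf: "cv_coord n b l (cv_param n b t) =
      (if n * n \<le> l \<and> l < n * n + n then (matpoly n (\<lambda>l. t (n * n + l)) (pmat n t) n * ?v) $$ (l - n * n, 0) else t l)"
    if l: "l < ?c" for l t
  proof -
    let ?M = "matpoly n (\<lambda>l. t (n * n + l)) (pmat n t) n"
    consider "l < n * n" | "n * n \<le> l" "l < n * n + n" | "n * n + n \<le> l" "l < n * n + n + b" | "n * n + n + b \<le> l" by linarith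
    then show ?thesis
    proof cases
      case 1
      then show ?thesis using square_index[OF 1] by (simp add: blk_entry)
    next
      case 2
      have M: "?M \<in> carrier_mat n n" by simp
      have "(?M * ?v) $$ (l - n * n, 0) = (\<Sum>j<n. ?M $$ (l - n * n, j) * ?v $$ (j, 0))"
        by (rule mat_mult_entry[OF M]) (use 2 in auto)
      also have "\<dots> = (\<Sum>j<n. blk n b ?M (\<lambda>s. t (n * n + n + b + s)) $$ (l - n * n, j))"
        by (rule sum.cong) (use 2 in \<open>auto simp: blk_entry\<close>)
      finally show ?thesis using 2 by (simp del: index_mult_mat)
    next
      case 3
      then obtain s where "l = n * n + n + s" "s < b" by (metis add_less_cancel_left le_Suc_ex)
      then show ?thesis by (simp add: blk_entry)
    next
      case 4
      then obtain s where s: "l = n * n + n + b + s" using le_Suc_ex by blast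
      then have "s < b" using l by simp
      then show ?thesis using s by (simp add: blk_entry)
    qed
  qed
  have co: "(\<lambda>t. cv_coord n b l (cv_param n b t)) \<in> polyfuns (cds ?c)" if l: "l < ?c" for l
  proof -
    have ent: "pf (cds ?c) UNIV (\<lambda>t. fst (cv_param n b t) $$ (i, j))"
      "pf (cds ?c) UNIV (\<lambda>t. snd (cv_param n b t) $$ (i, j))" if "i < n + b" "j < n + b" for i j
      by (rule pfm_entry[OF pfm_cv_param(1) that], rule pfm_entry[OF pfm_cv_param(2) that])
    consider "l < n * n" | "n * n \<le> l" "l < n * n + n" | "n * n + n \<le> l" "l < n * n + n + b" | "n * n + n + b \<le> l" by linarith
    then have "pf (cds ?c) UNIV (\<lambda>t. cv_coord n b l (cv_param n b t))"
    proof cases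
      case 1
      then show ?thesis using ent(2)[of "l div n" "l mod n"] square_index[OF 1] by simp
    next
      case 2
      then have "pf (cds ?c) UNIV (\<lambda>t. \<Sum>j<n. fst (cv_param n b t) $$ (l - n * n, j))"
        by (intro pf_sum ent) auto
      then show ?thesis using 2 by simp
    next
      case 3
      then show ?thesis using ent(2)[of "n + (l - (n * n + n))" "n + (l - (n * n + n))"] by simp
    next
      case 4
      then show ?thesis using l ent(1)[of "n + (l - (n * n + n + b))" "n + (l - (n * n + n + b))"] by simp
    qed
    then show ?thesis by (simp only: pf_UNIV)
  qed
  have "P (\<lambda>l. cv_coord n b l (cv_param n b t)) = 0" if t: "?U t \<noteq> 0" for t
  proof -
    have "fst (cv_param n b t) \<in> levi n b" "snd (cv_param n b t) \<in> levi n b" using t by (simp_all add: blk_levi)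
    moreover have "fst (cv_param n b t) * snd (cv_param n b t) = snd (cv_param n b t) * fst (cv_param n b t)"
      unfolding fst_conv snd_conv
      by (subst blk_commute_iff) (simp_all add: matpoly_commute[symmetric])
    ultimately have "cv_param n b t \<in> commuting_variety (levi n b)" by (simp add: commuting_variety_def)
    then show ?thesis by (rule bspec[OF P(2)])
  qed
  then have "(\<forall>t. ?U t = 0) \<or> (\<forall>t. P (\<lambda>l. cv_coord n b l (cv_param n b t)) = 0)"
    by (intro cds_mult_zero[OF U polyfuns_cds_comp[OF P(1) co]])
  then have Q: "\<forall>t. P (\<lambda>l. cv_coord n b l (cv_param n b t)) = 0"
  proof
    assume "\<forall>t. ?U t = 0"
    with U0 show ?thesis by contradiction
  qed
  have "P p = 0" if p: "det (krylov n (pmat n p) ?v) \<noteq> 0" for p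
  proof -
    obtain u where u: "matpoly n u (pmat n p) n * ?v = mat n 1 (\<lambda>(i, _). p (n * n + i))"
      using krylov_solve[OF mat_carrier mat_carrier p mat_carrier] ..
    define t where "t l = (if n * n \<le> l \<and> l < n * n + n then u (l - n * n) else p l)" for l
    have Bt: "pmat n t = pmat n p" by (rule eq_matI) (auto simp: t_def dest: index_less)
    have "matpoly n (\<lambda>l. t (n * n + l)) (pmat n p) l = matpoly n u (pmat n p) l" if "l \<le> n" for l
      using that by (induction l) (simp_all add: t_def)
    then have M: "matpoly n (\<lambda>l. t (n * n + l)) (pmat n t) n = matpoly n u (pmat n p) n" unfolding Bt by simp
    have "P (\<lambda>l. cv_coord n b l (cv_param n b t)) = P p"
    proof (rule cds_cong[OF P(1)])
      fix l assume l: "l < ?c"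
      show "cv_coord n b l (cv_param n b t) = p l"
        by (rule trans[OF cf[OF l, of t]], unfold M u) (auto simp: t_def)
    qed
    then show ?thesis using spec[OF Q, of t] by (simp only:)
  qed
  moreover have k: "(\<lambda>p. det (krylov n (pmat n p) ?v)) \<in> polyfuns (cds ?c)"
    using pf_det_krylov[OF pfm_pmat, of n ?c ?v] by (simp add: pf_UNIV)
  ultimately have "(\<forall>p. det (krylov n (pmat n p) ?v) = 0) \<or> (\<forall>p. P p = 0)"
    by (intro cds_mult_zero[OF k P(1)])
  then show "\<forall>p. P p = 0"
  proof
    assume *: "\<forall>p. det (krylov n (pmat n p) ?v) = 0"
    have "pmat n (\<lambda>l. bidiag n (\<lambda>_. 0) of_nat $$ (l div n, l mod n)) = bidiag n (\<lambda>_. 0) of_nat"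
      by (rule pmat_surj) simp_all
    with spec[OF *, of "\<lambda>l. bidiag n (\<lambda>_. 0) of_nat $$ (l div n, l mod n)"]
    have "det (krylov n (bidiag n (\<lambda>_. 0) of_nat) ?v) = 0" by (simp only:)
    with det_krylov_bidiag[of n] show ?thesis by contradiction
  qed
qed

lemma levi_prob:
  assumes n: "n \<ge> 1"
  shows "commuting_prob (n + b) (levi n b) = real (n * n + n + 2 * b) / (2 * real (n * n + b))"
proof (rule commuting_prob_eq)
  show "zclosed (mat_coords (n + b)) (carrier (GL (n + b))) (levi n b)" by (rule levi_zclosed)
  show "growth (mat_coords (n + b)) (levi n b) (n * n + b)" by (rule levi_dim)
  show "indep (levi_coord n) (n * n + b) (levi n b)" by (rule levi_dim)
  show "levi_coord n l \<in> polyfuns (mat_coords (n + b))" if "l < n * n + b" for l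
  proof (cases "l < n * n")
    case True
    then show ?thesis using square_index[OF True] by (auto intro!: polyfuns_entry trans_less_add1)
  next
    case False
    then show ?thesis using that by (auto intro!: polyfuns_entry)
  qed
  show "growth (mat2_coords (n + b)) (commuting_variety (levi n b)) (n * n + n + 2 * b)" by (rule cv_growth)
  show "indep (cv_coord n b) (n * n + n + 2 * b) (commuting_variety (levi n b))" by (rule cv_indep)
  show "cv_coord n b l \<in> polyfuns (mat2_coords (n + b))" if l: "l < n * n + n + 2 * b" for l
  proof -
    consider "l < n * n" | "n * n \<le> l" "l < n * n + n" | "n * n + n \<le> l" "l < n * n + n + b" | "n * n + n + b \<le> l" by linarith
    then show ?thesis
    proof cases
      case 1
      then show ?thesis using square_index[OF 1] by (auto intro!: polyfuns_snd_entry trans_less_add1)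
    next
      case 2
      then show ?thesis by (auto intro!: polyfuns_sum polyfuns_fst_entry)
    next
      case 3
      then show ?thesis by (auto intro!: polyfuns_snd_entry)
    next
      case 4
      then show ?thesis using l by (auto intro!: polyfuns_fst_entry)
    qed
  qed
qed (use n in auto)

section \<open>Traces of unipotent matrices and reductivity\<close>

definition tr :: "nat \<Rightarrow> complex mat \<Rightarrow> complex" where
  "tr n A = (\<Sum>i<n. A $$ (i, i))"

lemma tr_mult: "A \<in> carrier_mat n n \<Longrightarrow> B \<in> carrier_mat n n \<Longrightarrow> tr n (A * B) = (\<Sum>i<n. \<Sum>l<n. A $$ (i, l) * B $$ (l, i))"
  unfolding tr_def by (intro sum.cong refl mat_mult_entry) auto

lemma tr_comm: "A \<in> carrier_mat n n \<Longrightarrow> B \<in> carrier_mat n n \<Longrightarrow> tr n (A * B) = tr n (B * A)"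
  unfolding tr_mult by (subst sum.swap) (simp add: mult.commute)

lemma tr_add: "A \<in> carrier_mat n n \<Longrightarrow> B \<in> carrier_mat n n \<Longrightarrow> tr n (A + B) = tr n A + tr n B"
  unfolding tr_def by (subst sum.distrib[symmetric], rule sum.cong) auto

lemma tr_minus: "A \<in> carrier_mat n n \<Longrightarrow> B \<in> carrier_mat n n \<Longrightarrow> tr n (A - B) = tr n A - tr n B"
  unfolding tr_def by (subst sum_subtractf[symmetric], rule sum.cong) auto

lemma upr_pow_diag:
  assumes A: "upr n 0 A" and i: "i < n"
  shows "(A ^\<^sub>m k) $$ (i, i) = A $$ (i, i) ^ k"
proof (induction k)
  case 0
  then show ?case using A i by (auto simp: upr_def)
next
  case (Suc k)
  have c: "A \<in> carrier_mat n n" "A ^\<^sub>m k \<in> carrier_mat n n" using A by (auto simp: upr_def)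
  have u: "upr n 0 (A ^\<^sub>m k)" using upr_pow[OF A, of k] by simp
  have "(A ^\<^sub>m k * A) $$ (i, i) = (\<Sum>l<n. (A ^\<^sub>m k) $$ (i, l) * A $$ (l, i))" by (rule mat_mult_entry[OF c(2,1) i i])
  also have "\<dots> = (\<Sum>l<n. if l = i then A $$ (i, i) ^ k * A $$ (i, i) else 0)"
  proof (rule sum.cong)
    fix l assume l: "l \<in> {..<n}"
    have "A $$ (l, i) = 0" if "i < l" using A l i that by (simp add: upr_def)
    moreover have "(A ^\<^sub>m k) $$ (i, l) = 0" if "l < i" using u l i that by (simp add: upr_def)
    ultimately show "(A ^\<^sub>m k) $$ (i, l) * A $$ (l, i) = (if l = i then A $$ (i, i) ^ k * A $$ (i, i) else 0)"
      using Suc by (cases l i rule: linorder_cases) simp_all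
  qed simp
  also have "\<dots> = A $$ (i, i) ^ Suc k" using i by simp
  finally show ?case by simp
qed

text \<open>The trace is invariant under conjugation, and a nilpotent Jordan matrix has zero
  diagonal.\<close>

lemma nilpotent_tr:
  assumes A: "A \<in> carrier_mat n n" and k: "A ^\<^sub>m k = 0\<^sub>m n n"
  shows "tr n A = 0"
proof -
  obtain \<beta> a P Q where wit: "similar_mat_wit A (bidiag n \<beta> a) P Q" using similar_bidiag[OF A] .
  note w = similar_mat_witD2[OF A wit]
  let ?J = "bidiag n \<beta> a"
  have "?J ^\<^sub>m k = Q * A ^\<^sub>m k * P"
    using similar_mat_wit_pow_id[OF similar_mat_wit_sym[OF wit], of k] .
  then have Jk: "?J ^\<^sub>m k = 0\<^sub>m n n" using k w(6,7) by simp
  have "upr n 0 ?J" by (auto simp: upr_def bidiag_def)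
  then have "?J $$ (i, i) = 0" if "i < n" for i
    using upr_pow_diag[of n ?J i k] that unfolding Jk by simp
  then have "tr n ?J = 0" by (simp add: tr_def)
  moreover have "tr n A = tr n ?J"
  proof -
    have "A = P * (?J * Q)" using w(3) assoc_mult_mat[OF w(6) bidiag_carrier w(7)] by simp
    then have "tr n A = tr n ((?J * Q) * P)" using tr_comm[OF w(6) mult_carrier_mat[OF bidiag_carrier w(7)]] by simp
    also have "(?J * Q) * P = ?J"
      unfolding assoc_mult_mat[OF bidiag_carrier w(7,6)] w(2) by (rule right_mult_one_mat[OF bidiag_carrier])
    finally show ?thesis .
  qed
  ultimately show ?thesis by simp
qed

lemma unipotent_tr:
  assumes A: "A \<in> carrier_mat n n" and "unipotent_mat n A"
  shows "tr n A = of_nat n"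
proof -
  have c: "A - 1\<^sub>m n \<in> carrier_mat n n" using A by (simp add: minus_carrier_mat)
  have "tr n (A - 1\<^sub>m n) = 0" using assms nilpotent_tr[OF c] by (auto simp: unipotent_mat_def)
  moreover have "tr n (1\<^sub>m n) = of_nat n" by (simp add: tr_def)
  ultimately show ?thesis using tr_minus[OF A one_carrier_mat] by simp
qed

text \<open>For an elementary matrix \<open>E\<close> with \<open>E\<^sup>2 = 0\<close>, \<open>u\<cdot>(1 + E)u(1 - E)\<close> and \<open>u\<^sup>2\<close> have trace \<open>n\<close>, and
  the traces differ by \<open>tr (uE)\<^sup>2\<close>, the square of an entry of \<open>u\<close>.\<close>

lemma levi_reductive: "reductive (n + b) (levi n b)"
  unfolding reductive_def
proof (intro allI impI, elim conjE)
  let ?N = "n + b" and ?G = "as_group (n + b) (levi n b)"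
  fix H assume H: "H \<lhd> ?G" and uni: "\<forall>A\<in>H. unipotent_mat ?N A"
  have sub: "subgroup H ?G" by (rule normal_imp_subgroup[OF H])
  have HL: "H \<subseteq> levi n b" using subgroup.subset[OF sub] by simp
  have mult: "A * B \<in> H" if "A \<in> H" "B \<in> H" for A B using subgroup.m_closed[OF sub that] by simp
  have tr1: "tr ?N A = of_nat ?N" if "A \<in> H" for A
    by (rule unipotent_tr) (use uni that HL levi_carrier[of n b] in auto)
  have u0: "u $$ (j, i) = 0" if u: "u \<in> H" and ij: "i < n" "j < n" "i \<noteq> j" for u i j
  proof -
    \<comment> \<open>\<open>1 + E\<close> has inverse \<open>1 - E\<close> and lies in the group
      because \<open>i\<close> and \<open>j\<close> are indices of the \<open>GL n\<close> block;
      conjugation by it preserves the normal subgroup.\<close>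
    define E :: "complex mat" where "E = mat ?N ?N (\<lambda>(a, c). if a = i \<and> c = j then 1 else 0)"
    have E: "E \<in> carrier_mat ?N ?N" by (simp add: E_def)
    have uc: "u \<in> carrier_mat ?N ?N" using u HL levi_carrier by blast
    let ?X = "1\<^sub>m ?N + E" and ?Y = "1\<^sub>m ?N - E"
    have X: "?X \<in> carrier_mat ?N ?N" and Y: "?Y \<in> carrier_mat ?N ?N" using E by (auto intro: minus_carrier_mat)
    have EE: "E * E = 0\<^sub>m ?N ?N"
    proof (rule eq_matI)
      fix a c assume "a < dim_row (0\<^sub>m ?N ?N :: complex mat)" "c < dim_col (0\<^sub>m ?N ?N :: complex mat)"
      then have ac: "a < ?N" "c < ?N" by auto
      show "(E * E) $$ (a, c) = 0\<^sub>m ?N ?N $$ (a, c)"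
        unfolding mat_mult_entry[OF E E ac] using ac ij by (auto simp: E_def intro!: sum.neutral)
    qed (use E in auto)
    have XY: "?X * ?Y = 1\<^sub>m ?N"
      unfolding add_mult_distrib_mat[OF one_carrier_mat E Y] mult_minus_distrib_mat[OF E one_carrier_mat E]
        left_mult_one_mat[OF Y] right_mult_one_mat[OF E] EE using E by (intro eq_matI) auto
    have YX: "?Y * ?X = 1\<^sub>m ?N"
      unfolding minus_mult_distrib_mat[OF one_carrier_mat E X] mult_add_distrib_mat[OF E one_carrier_mat E]
        left_mult_one_mat[OF X] right_mult_one_mat[OF E] EE using E by (intro eq_matI) auto
    note inv = GL_inverse[OF X Y XY YX]
    have XL: "?X \<in> levi n b" unfolding levi_iff using inv(1) ij by (auto simp: E_def)
    have "inv\<^bsub>?G\<^esub> ?X = ?Y" using group.m_inv_consistent[OF group_GL levi_subgroup XL] inv(2) by simp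
    moreover have "?X \<otimes>\<^bsub>?G\<^esub> u \<otimes>\<^bsub>?G\<^esub> inv\<^bsub>?G\<^esub> ?X \<in> H"
      by (rule normal.inv_op_closed2[OF H _ u]) (use XL in simp)
    ultimately have "?X * u * ?Y \<in> H" by simp
    then have w: "u * (?X * u * ?Y) \<in> H" by (rule mult[OF u])
    define F where "F = u * E"
    have F: "F \<in> carrier_mat ?N ?N" unfolding F_def by (rule mult_carrier_mat[OF uc E])
    have "u * (?X * u * ?Y) = (u * ?X) * (u * ?Y)"
      unfolding assoc_mult_mat[OF X uc Y] by (rule assoc_mult_mat[OF uc X mult_carrier_mat[OF uc Y], symmetric])
    also have "u * ?X = u + F"
      unfolding F_def mult_add_distrib_mat[OF uc one_carrier_mat E] right_mult_one_mat[OF uc] ..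
    also have "u * ?Y = u - F"
      unfolding F_def mult_minus_distrib_mat[OF uc one_carrier_mat E] right_mult_one_mat[OF uc] ..
    also have "(u + F) * (u - F) = (u * u - u * F) + (F * u - F * F)"
      unfolding add_mult_distrib_mat[OF uc F minus_carrier_mat[OF F]] mult_minus_distrib_mat[OF uc uc F] mult_minus_distrib_mat[OF F uc F] ..
    finally have eq: "u * (?X * u * ?Y) = (u * u - u * F) + (F * u - F * F)" .
    have c: "u * u \<in> carrier_mat ?N ?N" "u * F \<in> carrier_mat ?N ?N" "F * u \<in> carrier_mat ?N ?N" "F * F \<in> carrier_mat ?N ?N"
      by (rule mult_carrier_mat[OF uc uc] mult_carrier_mat[OF uc F] mult_carrier_mat[OF F uc] mult_carrier_mat[OF F F])+
    have "tr ?N (u * (?X * u * ?Y)) = tr ?N (u * u) - tr ?N (F * F)"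
      unfolding eq tr_add[OF minus_carrier_mat[OF c(2)] minus_carrier_mat[OF c(4)]] tr_minus[OF c(1,2)] tr_minus[OF c(3,4)]
        tr_comm[OF F uc] by simp
    then have FF: "tr ?N (F * F) = 0" using tr1[OF w] tr1[OF mult[OF u u]] by simp
    \<comment> \<open>\<open>F = u * E\<close> is column \<open>i\<close> of \<open>u\<close> moved
      to position \<open>j\<close>, so the trace of its square is the square of the entry of
      \<open>u\<close> at \<open>(j, i)\<close>.\<close>
    have Fe: "F $$ (a, c) = (if c = j then u $$ (a, i) else 0)" if ac: "a < ?N" "c < ?N" for a c
    proof -
      have "F $$ (a, c) = (\<Sum>l<?N. if l = i then (if c = j then u $$ (a, i) else 0) else 0)"
        unfolding F_def mat_mult_entry[OF uc E ac] by (rule sum.cong) (use ac in \<open>auto simp: E_def\<close>)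
      then show ?thesis using ij by simp
    qed
    have "(\<Sum>l<?N. F $$ (a, l) * F $$ (l, a)) = (if a = j then u $$ (j, i) * u $$ (j, i) else 0)" if a: "a < ?N" for a
    proof -
      have "(\<Sum>l<?N. F $$ (a, l) * F $$ (l, a)) = (\<Sum>l<?N. if l = j then (if a = j then u $$ (j, i) * u $$ (j, i) else 0) else 0)"
        by (rule sum.cong) (use a Fe in auto)
      then show ?thesis using ij by simp
    qed
    then have "tr ?N (F * F) = (\<Sum>a<?N. if a = j then u $$ (j, i) * u $$ (j, i) else 0)"
      unfolding tr_mult[OF F F] by (intro sum.cong) auto
    then show ?thesis using FF ij by simp
  qed
  show "H = {1\<^sub>m ?N}"
  proof (intro subset_antisym subsetI)
    fix u assume u: "u \<in> H"
    have uc: "u \<in> carrier_mat ?N ?N" using u HL levi_carrier by blast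
    let ?\<nu> = "u - 1\<^sub>m ?N"
    have off: "u $$ (i, j) = 0" if "i < ?N" "j < ?N" "i \<noteq> j" for i j
      using u0[OF u, of j i] u HL that by (cases "i < n \<and> j < n") (auto simp: levi_iff)
    obtain k where k: "?\<nu> ^\<^sub>m k = 0\<^sub>m ?N ?N" using uni u by (auto simp: unipotent_mat_def)
    \<comment> \<open>Once \<open>u\<close> is diagonal, the diagonal entries of
      \<open>u - 1\<close> are nilpotent numbers, hence zero.\<close>
    have "upr ?N 0 ?\<nu>" unfolding upr_def using off uc by (auto intro: minus_carrier_mat)
    then have "u $$ (i, i) = 1" if "i < ?N" for i
      using upr_pow_diag[of ?N ?\<nu> i k] that uc unfolding k by auto
    then have "u = 1\<^sub>m ?N" using off uc by (intro eq_matI) auto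
    then show "u \<in> {1\<^sub>m ?N}" by simp
  qed (use subgroup.one_closed[OF sub] in simp)
qed

lemma reductive_realization:
  assumes "r \<in> \<rat> \<inter> {1/2<..1}"
  shows "\<exists>n G. linear_algebraic_group n G \<and> zariski_connected n G \<and> reductive n G \<and> commuting_prob n G = r"
proof -
  obtain s t :: nat where st: "0 < s" "s \<le> t" "r = 1/2 + real s / (2 * real t)" using rational_half[OF assms] .
  have "\<exists>n b. n \<ge> 1 \<and> real (n * n + n + 2 * b) / (2 * real (n * n + b)) = r"
  proof (cases "s = t")
    case True
    then have "r = 1" using st by simp
    then show ?thesis by (intro exI[of _ 1] exI[of _ 0]) simp
  next
    case False
    define q where "q = t - s"
    have q: "q \<ge> 1" "t = s + q" using st False by (auto simp: q_def)
    \<comment> \<open>The equation to solve is \<open>(n + b) / (n * n + b) = s / t\<close>. Taking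
      \<open>n + b = 2 * s * (n - 1)\<close> makes the denominator
      \<open>(n - 1) * (n + 2 * s)\<close>, which is \<open>2 * t * (n - 1)\<close> for
      \<open>n = 2 * (t - s)\<close>. The factor 2 gives \<open>n \<ge> 2\<close>, so that the
      truncated subtraction in \<open>b\<close> is exact.\<close>
    define n where "n = 2 * q"
    have le: "n \<le> 2 * s * (n - 1)" using q st by (cases s) (auto simp: n_def)
    define b where "b = 2 * s * (n - 1) - n"
    have "real b = 2 * real s * (real n - 1) - real n"
      using le q by (simp add: b_def of_nat_diff n_def)
    then have b: "real b = 2 * real s * (2 * real q - 1) - 2 * real q" by (simp add: n_def)
    have n: "real n = 2 * real q" by (simp add: n_def)
    have d: "real (n * n + b) = 2 * real t * (2 * real q - 1)" "real (n * n + n + 2 * b) = 2 * (real t + real s) * (2 * real q - 1)"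
      using b n q(2) by (simp_all add: algebra_simps)
    have "2 * real q - 1 > 0" using q by simp
    then have "real (n * n + n + 2 * b) / (2 * real (n * n + b)) = r"
      unfolding d st(3) using st by (simp add: field_simps)
    then show ?thesis using q by (intro exI[of _ n] exI[of _ b]) (auto simp: n_def)
  qed
  then obtain n b where nb: "n \<ge> 1" "real (n * n + n + 2 * b) / (2 * real (n * n + b)) = r" by blast
  have "linear_algebraic_group (n + b) (levi n b)"
    unfolding linear_algebraic_group_iff using levi_subgroup levi_zclosed by blast
  moreover have "zariski_connected (n + b) (levi n b)"
    unfolding zariski_mat_def by (rule connectedin_zprime[OF levi_dim(1) levi_carrier])
  moreover have "commuting_prob (n + b) (levi n b) = r" using levi_prob[OF nb(1)] nb(2) by simp
  ultimately show ?thesis using levi_reductive by blast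
qed

section \<open>The four sets of values and their limit points\<close>

lemma commuting_probs_eq:
  assumes "\<And>r. r \<in> \<rat> \<inter> {1/2<..1} \<Longrightarrow>
    \<exists>n G. linear_algebraic_group n G \<and> zariski_connected n G \<and> P n G \<and> commuting_prob n G = r"
  shows "commuting_probs P = \<rat> \<inter> {1/2<..1}"
proof
  show "commuting_probs P \<subseteq> \<rat> \<inter> {1/2<..1}"
    unfolding commuting_probs_def using commuting_prob_bounds by blast
  show "\<rat> \<inter> {1/2<..1} \<subseteq> commuting_probs P"
    unfolding commuting_probs_def using assms by blast
qed

lemma islimpt_rationals:
  assumes "\<alpha> \<in> {1/2..1::real}"
  shows "\<alpha> islimpt \<rat> \<inter> {1/2<..1}"
proof (rule islimptI)
  fix T assume "\<alpha> \<in> T" "open T"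
  then obtain e where e: "0 < e" "\<And>q. dist q \<alpha> < e \<Longrightarrow> q \<in> T" unfolding open_dist by blast
  have "\<exists>q\<in>\<rat>. 1/2 < q \<and> q \<le> 1 \<and> q \<noteq> \<alpha> \<and> \<bar>q - \<alpha>\<bar> < e"
  proof (cases "\<alpha> < 1")
    case True
    then obtain q where "q \<in> \<rat>" "\<alpha> < q" "q < min 1 (\<alpha> + e)" using Rats_dense_in_real[of \<alpha> "min 1 (\<alpha> + e)"] e by auto
    then show ?thesis using assms by (intro bexI[of _ q]) auto
  next
    case False
    then have a: "\<alpha> = 1" using assms by simp
    obtain q where "q \<in> \<rat>" "max (1/2) (1 - e) < q" "q < 1" using Rats_dense_in_real[of "max (1/2) (1 - e)" 1] e by auto
    then show ?thesis using a by (intro bexI[of _ q]) auto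
  qed
  then show "\<exists>q\<in>\<rat> \<inter> {1/2<..1}. q \<in> T \<and> q \<noteq> \<alpha>" using e(2) unfolding dist_real_def by force
qed

theorem corollary5p4:
  shows "(commuting_probs reductive = commuting_probs (\<lambda>n G. nilpotent_group (as_group n G)) \<and>
     commuting_probs (\<lambda>n G. nilpotent_group (as_group n G)) =
       commuting_probs (\<lambda>n G. solvable (as_group n G)) \<and>
     commuting_probs (\<lambda>n G. solvable (as_group n G)) = commuting_probs (\<lambda>n G. True) \<and>
     commuting_probs (\<lambda>n G. True) = \<rat> \<inter> {1/2<..1}) \<and>
    (\<forall>\<alpha>\<in>{1/2..1::real}.
     \<alpha> islimpt commuting_probs reductive \<and>
     \<alpha> islimpt commuting_probs (\<lambda>n G. nilpotent_group (as_group n G)) \<and>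
     \<alpha> islimpt commuting_probs (\<lambda>n G. solvable (as_group n G)) \<and>
     \<alpha> islimpt commuting_probs (\<lambda>n G. True))"
proof -
  have "commuting_probs reductive = \<rat> \<inter> {1/2<..1}"
    by (rule commuting_probs_eq[OF reductive_realization])
  moreover have "commuting_probs (\<lambda>n G. nilpotent_group (as_group n G)) = \<rat> \<inter> {1/2<..1}"
    by (rule commuting_probs_eq) (use nilpotent_realization in blast)
  moreover have "commuting_probs (\<lambda>n G. solvable (as_group n G)) = \<rat> \<inter> {1/2<..1}"
    by (rule commuting_probs_eq) (use nilpotent_realization in blast)
  moreover have "commuting_probs (\<lambda>n G. True) = \<rat> \<inter> {1/2<..1}"
    by (rule commuting_probs_eq) (use nilpotent_realization in blast)
  ultimately show ?thesis using islimpt_rationals by simp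
qed

end
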